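(* Let $\lambda\neq0$ be a complex number and let $f(x,y,z):=xy^3+yz^3+zx^3+\lambda xyz$. Consider the holomorphic forms $$\omega_1:=dx\wedge dy\wedge dz,\quad \omega_2:=y^3z^2\,\omega_1,\quad \omega_3:=y^7\,\omega_1,\quad \omega_4:=xy^3\,\omega_1 .$$ Then for each $i\in\{1,2,3,4\}$ the fresco $\mathcal F_{f,\omega_i}$ is a rank $2$ theme, and its second Bernstein polynomial is equal respectively to $x+1$, $x+3$, $x+5$ and $x+3$ for $i=1,2,3,4$. Moreover, for $i=3,4$ the (full) Bernstein polynomial of $\mathcal F_{f,\omega_i}$ has only simple roots.
   Context: **(a,b)-modules, frescos, themes.** $\tilde{\mathcal A}$ is the algebra of series $\sum_{\nu\ge0}P_\nu(a)b^\nu$, $P_\nu\in\mathbb{C}[a]$, with the relation $ab-ba=b^2$; it contains $\mathbb{C}[[b]]$. An (a,b)-module is a free $\mathbb{C}[[b]]$-module of finite rank with a $\mathbb{C}$-linear endomorphism $a$ satisfying $ab-ba=b^2$ (so it is a left $\tilde{\mathcal A}$-module); its rank is its rank over $\mathbb{C}[[b]]$. For $\alpha\in\,]0,1]\cap\mathbb{Q}$ and $N\ge0$ let $\Xi^{(N)}_\alpha=\bigoplus_{j=0}^N\mathbb{C}[[s]]\,s^{\alpha-1}(\mathrm{Log}\,s)^j$, where $a$ is multiplication by $s$ and $b$ is termwise integration from $0$. For a finite dimensional complex vector space $V$, $\tilde{\mathcal A}$ acts on $\Xi_\alpha^{(N)}\otimes V$ through the first factor. A fresco is an (a,b)-module generated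 by one element over $\tilde{\mathcal A}$ which is isomorphic to an $\tilde{\mathcal A}$-submodule of some finite direct sum of modules $\Xi^{(N)}_{\alpha}\otimes V$. It is $[\alpha]$-primitive if it embeds in some $\Xi^{(N)}_\alpha\otimes V$; an $[\alpha]$-primitive theme is a fresco which embeds in some $\Xi^{(N)}_\alpha$ (i.e. with $\dim V=1$). For $\lambda$ a positive rational number, $\mathcal{E}_\lambda=\tilde{\mathcal A}/\tilde{\mathcal A}(a-\lambda b)$. **Bernstein polynomials.** The (full) Bernstein polynomial $B_{\mathcal F}$ of a fresco is the minimal polynomial of $-b^{-1}a$ acting on $\mathcal{F}^\sharp/b\mathcal{F}^\sharp$, where $\mathcal{F}^\sharp=\sum_{j\ge0}(b^{-1}a)^j\mathcal{F}\subset\mathcal{F}[b^{-1}]$; its degree is the rank of $\mathcal F$. An (a,b)-module is semi-simple if it embeds in a finite direct sum of modules $\mathcal{E}_\lambda$. For a fresco $\mathcal F$, $S_0(\mathcal F)=0$, $S_1(\mathcal F)$ is its largest semi-simple submodule and $S_j(\mathcal F)$ is the preimage in $\mathcal F$ of $S_1(\mathcal F/S_{j-1}(\mathcal F))$. If $\mathcal F$ is $[\alpha]$-primitive, its $j$-th Bernstein polynomial is $B^j_{\mathcal F}(x):=B_{S_j(\mathcal F)/S_{j-1}(\mathcal F)}(x-r_j)$ with $r_j=\mathrm{rank}(\mathcal F/S_j(\mathcal F))$ (equal to $1$ if $S_j(\mathcal F)=S_{j-1}(\mathcal F)$), so that $\prod_jB^j_{\mathcal F}=B_{\mathcal F}$.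 **The fresco $\mathcal F_{f,\omega}$.** Let $n=2$, let $\Omega^q_0$ be the space of germs at $0\in\mathbb{C}^{3}$ of holomorphic $q$-forms and let $\mathrm{Ker}\,df^{n}$ be the kernel of $df\wedge:\Omega^n_0\to\Omega^{n+1}_0$. The (a,b)-module $H^{n+1}_0$ associated to $f$ is the ($f$-adically completed) quotient $\Omega^{n+1}_0/d(\mathrm{Ker}\,df^n)$ modulo its $b$-torsion, where $a$ is multiplication by $f$ and $b[d\eta]=[df\wedge\eta]$. (Here $f$ has an isolated singularity at $0$, so $\mathrm{Ker}\,df^n=df\wedge\Omega_0^{n-1}$.) For $\omega\in\Omega^{n+1}_0$, $\mathcal F_{f,\omega}:=\tilde{\mathcal A}[\omega]\subset H^{n+1}_0$, which is a fresco. *)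

theory Defs
  imports
    "HOL-Analysis.Analysis"
    "HOL-Algebra.Algebra"
    "HOL-Algebra.Algebraic_Closure_Type"
    "HOL-Computational_Algebra.Computational_Algebra"
begin

section \<open>(a,b)-modules\<close>

text \<open>
  The ring \<open>C[[b]]\<close> is \<^typ>\<open>complex fps\<close>, with \<open>b\<close> = \<^term>\<open>fps_X\<close>.  A structure of type
  \<open>'m abmod\<close> carries an action of \<open>C[[b]]\<close> and an operator \<open>a\<close>.  The fields \<open>mult\<close> and \<open>one\<close>,
  inherited from the record of modules, play no role.
\<close>

abbreviation fps_ring :: "complex fps ring" where
  "fps_ring \<equiv> ring_of_type_algebra"

record 'm abmod = "(complex fps, 'm) module" +
  aop :: "'m \<Rightarrow> 'm"

definition bop :: "'m abmod \<Rightarrow> 'm \<Rightarrow> 'm" where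
  "bop M x = fps_X \<odot>\<^bsub>M\<^esub> x"

definition csmult :: "'m abmod \<Rightarrow> complex \<Rightarrow> 'm \<Rightarrow> 'm" where
  "csmult M c x = fps_const c \<odot>\<^bsub>M\<^esub> x"

definition is_basis :: "'m abmod \<Rightarrow> 'm list \<Rightarrow> bool" where
  "is_basis M es \<longleftrightarrow> set es \<subseteq> carrier M \<and>
     (\<forall>x\<in>carrier M. \<exists>!cs. length cs = length es \<and>
        x = finsum M (\<lambda>i. (cs ! i) \<odot>\<^bsub>M\<^esub> (es ! i)) {..<length es})"

definition ab_module :: "'m abmod \<Rightarrow> bool" where
  "ab_module M \<longleftrightarrow> Module.module fps_ring M \<and>
     (\<exists>es. is_basis M es) \<and>
     aop M \<in> carrier M \<rightarrow> carrier M \<and>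
     (\<forall>x\<in>carrier M. \<forall>y\<in>carrier M. aop M (x \<oplus>\<^bsub>M\<^esub> y) = aop M x \<oplus>\<^bsub>M\<^esub> aop M y) \<and>
     (\<forall>c. \<forall>x\<in>carrier M. aop M (csmult M c x) = csmult M c (aop M x)) \<and>
     (\<forall>x\<in>carrier M. aop M (bop M x) \<ominus>\<^bsub>M\<^esub> bop M (aop M x) = bop M (bop M x))"

definition ab_rank :: "'m abmod \<Rightarrow> nat" where
  "ab_rank M = (THE k. \<exists>es. is_basis M es \<and> length es = k)"

definition ab_submodule :: "'m abmod \<Rightarrow> 'm set \<Rightarrow> bool" where
  "ab_submodule M S \<longleftrightarrow> submodule S fps_ring M \<and> aop M ` S \<subseteq> S"

definition ab_sub :: "'m abmod \<Rightarrow> 'm set \<Rightarrow> 'm abmod" where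
  "ab_sub M S = M\<lparr>carrier := S\<rparr>"

definition ab_quot :: "'m abmod \<Rightarrow> 'm set \<Rightarrow> 'm set abmod" where
  "ab_quot M N =
     \<lparr>carrier = a_rcosets\<^bsub>M\<^esub> N, monoid.mult = undefined, monoid.one = undefined, ring.zero = N,
      ring.add = (\<lambda>C D. C <+>\<^bsub>M\<^esub> D),
      module.smult = (\<lambda>S C. \<Union>x\<in>C. N +>\<^bsub>M\<^esub> (S \<odot>\<^bsub>M\<^esub> x)),
      aop = (\<lambda>C. \<Union>x\<in>C. N +>\<^bsub>M\<^esub> aop M x)\<rparr>"

definition ab_dsum :: "'m abmod list \<Rightarrow> 'm list abmod" where
  "ab_dsum Ms =
     \<lparr>carrier = {xs. length xs = length Ms \<and> (\<forall>i<length Ms. xs ! i \<in> carrier (Ms ! i))},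
      monoid.mult = undefined, monoid.one = undefined, ring.zero = map ring.zero Ms,
      ring.add = (\<lambda>xs ys. map (\<lambda>i. (xs ! i) \<oplus>\<^bsub>Ms ! i\<^esub> (ys ! i)) [0..<length Ms]),
      module.smult = (\<lambda>S xs. map (\<lambda>i. S \<odot>\<^bsub>Ms ! i\<^esub> (xs ! i)) [0..<length Ms]),
      aop = (\<lambda>xs. map (\<lambda>i. aop (Ms ! i) (xs ! i)) [0..<length Ms])\<rparr>"

definition ab_hom :: "'m abmod \<Rightarrow> 'n abmod \<Rightarrow> ('m \<Rightarrow> 'n) set" where
  "ab_hom M N = {\<phi>. \<phi> \<in> carrier M \<rightarrow> carrier N \<and>
     (\<forall>x\<in>carrier M. \<forall>y\<in>carrier M. \<phi> (x \<oplus>\<^bsub>M\<^esub> y) = \<phi> x \<oplus>\<^bsub>N\<^esub> \<phi> y) \<and>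
     (\<forall>S. \<forall>x\<in>carrier M. \<phi> (S \<odot>\<^bsub>M\<^esub> x) = S \<odot>\<^bsub>N\<^esub> \<phi> x) \<and>
     (\<forall>x\<in>carrier M. \<phi> (aop M x) = aop N (\<phi> x))}"

definition embeds :: "'m abmod \<Rightarrow> 'n abmod \<Rightarrow> bool" where
  "embeds M N \<longleftrightarrow> (\<exists>\<phi>\<in>ab_hom M N. inj_on \<phi> (carrier M))"

definition poly_op :: "'m abmod \<Rightarrow> ('m \<Rightarrow> 'm) \<Rightarrow> complex poly \<Rightarrow> 'm \<Rightarrow> 'm" where
  "poly_op M T p x = finsum M (\<lambda>i. csmult M (Polynomial.coeff p i) ((T ^^ i) x)) {..Polynomial.degree p}"


section \<open>The algebra of series in a and b\<close>

text \<open>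
  The sequence \<open>u\<close> stands for the series \<open>\<Sum>\<nu>. u \<nu> (a) b\<^sup>\<nu>\<close>.  From \<open>ab - ba = b\<^sup>2\<close> one gets
  \<open>b\<^sup>\<nu> Q(a) = \<Sum>j. binom(-\<nu>, j) Q\<^sup>(\<^sup>j\<^sup>)(a) b\<^sup>\<nu>\<^sup>+\<^sup>j\<close>, whence the formula for the product.
\<close>

type_synonym atilde = "nat \<Rightarrow> complex poly"

definition at_mult :: "atilde \<Rightarrow> atilde \<Rightarrow> atilde" where
  "at_mult u v = (\<lambda>n. \<Sum>\<nu>\<le>n. \<Sum>j\<le>n - \<nu>.
     Polynomial.smult ((- of_nat \<nu>) gchoose j) (u \<nu> * (pderiv ^^ j) (v (n - \<nu> - j))))"

definition at_one :: atilde where "at_one = (\<lambda>n. if n = 0 then 1 else 0)"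
definition at_a :: atilde where "at_a = (\<lambda>n. if n = 0 then [:0, 1:] else 0)"
definition at_b :: atilde where "at_b = (\<lambda>n. if n = 1 then 1 else 0)"
definition at_fps :: "complex fps \<Rightarrow> atilde" where "at_fps S = (\<lambda>n. [:fps_nth S n:])"

lemma at_commutator:
  "at_mult at_a at_b n - at_mult at_b at_a n = at_mult at_b at_b n"
proof -
  have der: "(pderiv ^^ j) (0 :: complex poly) = 0" for j
    by (induction j) auto
  have der1: "(pderiv ^^ j) (1 :: complex poly) = (if j = 0 then 1 else 0)" for j
  proof (cases j)
    case (Suc k)
    then show ?thesis by (simp add: funpow_Suc_right der del: funpow.simps)
  qed simp
  have derX: "(pderiv ^^ j) [:0, 1 :: complex:] = (if j = 0 then [:0, 1:] else if j = 1 then 1 else 0)" for j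
  proof (cases j)
    case (Suc k)
    then show ?thesis
      by (cases k) (simp_all add: funpow_Suc_right der der1 pderiv_pCons del: funpow.simps)
  qed simp
  have only: "(\<Sum>\<nu>\<le>n. f \<nu>) = (if k \<le> n then f k else 0)"
    if "\<And>\<nu>. \<nu> \<noteq> k \<Longrightarrow> f \<nu> = 0" for f :: "nat \<Rightarrow> complex poly" and k n
  proof (cases "k \<le> n")
    case True
    then have "(\<Sum>\<nu>\<le>n. f \<nu>) = f k"
      using sum.mono_neutral_right[of "{..n}" "{k}" f] that by auto
    then show ?thesis using True by simp
  qed (use that in \<open>auto intro!: sum.neutral\<close>)
  have row: "at_mult u v n = (if \<mu> \<le> n then (\<Sum>j\<le>n - \<mu>. Polynomial.smult ((- of_nat \<mu>) gchoose j)
        (u \<mu> * (pderiv ^^ j) (v (n - \<mu> - j)))) else 0)" if "\<And>\<nu>. \<nu> \<noteq> \<mu> \<Longrightarrow> u \<nu> = 0" for u v \<mu>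
    unfolding at_mult_def by (rule only) (simp add: that)
  have ab: "at_mult at_a at_b n = (if n = 1 then [:0, 1:] else 0)"
  proof -
    have "at_mult at_a at_b n = (\<Sum>j\<le>n. Polynomial.smult (0 gchoose j)
        ([:0, 1:] * (pderiv ^^ j) (at_b (n - j))))"
      by (subst row[where \<mu> = 0]) (auto simp: at_a_def)
    also have "\<dots> = [:0, 1:] * at_b n"
      by (subst only[where k = 0]) (auto simp: gbinomial_0 at_b_def der der1 gr0_conv_Suc)
    finally show ?thesis by (simp add: at_b_def)
  qed
  have bb: "at_mult at_b at_b n = (if n = 2 then 1 else 0)"
  proof (cases n)
    case (Suc m)
    have "at_mult at_b at_b n = (\<Sum>j\<le>m. Polynomial.smult (- 1 gchoose j) ((pderiv ^^ j) (at_b (m - j))))"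
      using Suc by (subst row[where \<mu> = 1]) (auto simp: at_b_def)
    also have "\<dots> = at_b m"
      by (subst only[where k = 0]) (auto simp: at_b_def der der1)
    finally show ?thesis using Suc by (simp add: at_b_def)
  qed (simp add: at_mult_def at_b_def)
  have ba: "at_mult at_b at_a n = (if n = 1 then [:0, 1:] else if n = 2 then - 1 else 0)"
  proof (cases n)
    case (Suc m)
    have "at_mult at_b at_a n = (\<Sum>j\<le>m. Polynomial.smult (- 1 gchoose j) ((pderiv ^^ j) (at_a (m - j))))"
      using Suc by (subst row[where \<mu> = 1]) (auto simp: at_b_def)
    also have "\<dots> = (\<Sum>j\<le>m. if j = m then Polynomial.smult (- 1 gchoose m) ((pderiv ^^ m) [:0, 1:]) else 0)"
      by (rule sum.cong) (auto simp: at_a_def der)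
    also have "\<dots> = Polynomial.smult (- 1 gchoose m) ((pderiv ^^ m) [:0, 1:])"
      by simp
    finally show ?thesis using Suc by (simp add: derX one_pCons)
  qed (simp add: at_mult_def at_b_def)
  show ?thesis by (simp add: ab bb ba)
qed

definition at_module :: "atilde abmod" where
  "at_module =
     \<lparr>carrier = UNIV, monoid.mult = at_mult, monoid.one = at_one, ring.zero = (\<lambda>n. 0), ring.add = (\<lambda>u v n. u n + v n),
      module.smult = (\<lambda>S. at_mult (at_fps S)), aop = at_mult at_a\<rparr>"

definition E_mod :: "complex \<Rightarrow> atilde set abmod" where
  "E_mod l = ab_quot at_module
     {at_mult u (\<lambda>n. at_a n - Polynomial.smult l (at_b n)) | u. True}"

text \<open>
  The action of a series on an (a,b)-module is the limit of the partial sums for the \<open>b\<close>-adic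
  topology, for which a free \<open>C[[b]]\<close>-module of finite rank is complete.
\<close>

definition at_act :: "'m abmod \<Rightarrow> atilde \<Rightarrow> 'm \<Rightarrow> 'm" where
  "at_act M u x = (THE y. y \<in> carrier M \<and>
     (\<forall>N. \<exists>z\<in>carrier M.
        y = finsum M (\<lambda>\<nu>. poly_op M (aop M) (u \<nu>) ((bop M ^^ \<nu>) x)) {..<N} \<oplus>\<^bsub>M\<^esub> (bop M ^^ N) z))"

definition at_span :: "'m abmod \<Rightarrow> 'm \<Rightarrow> 'm set" where
  "at_span M x = {at_act M u x | u. True}"


section \<open>Asymptotic expansions, frescos and themes\<close>

text \<open>
  An element \<open>x\<close> of \<open>\<Xi>\<close> is \<open>\<Sum>j\<le>N. x j (s) s\<^sup>\<alpha>\<^sup>-\<^sup>1 (Log s)\<^sup>j\<close>.  The operator \<open>b\<close> is given by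
  \<open>\<integral>\<^sub>0\<^sup>s t\<^sup>\<mu> (Log t)\<^sup>l dt = \<Sum>j\<le>l. (-1)\<^sup>l\<^sup>-\<^sup>j (l!/j!) (\<mu>+1)\<^sup>-\<^sup>(\<^sup>l\<^sup>-\<^sup>j\<^sup>+\<^sup>1\<^sup>) s\<^sup>\<mu>\<^sup>+\<^sup>1 (Log s)\<^sup>j\<close>
  with \<open>\<mu> = \<alpha> - 1 + m\<close>.
\<close>

definition xi_b :: "rat \<Rightarrow> nat \<Rightarrow> (nat \<Rightarrow> complex fps) \<Rightarrow> (nat \<Rightarrow> complex fps)" where
  "xi_b \<alpha> N x = (\<lambda>j. Abs_fps (\<lambda>k. case k of 0 \<Rightarrow> 0 | Suc m \<Rightarrow>
     (\<Sum>l=j..N. (- 1) ^ (l - j) * (fact l / fact j) / (of_rat \<alpha> + of_nat m) ^ (l - j + 1)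
        * fps_nth (x l) m)))"

text \<open>
  Since \<open>b\<^sup>n\<close> raises the order in \<open>s\<close> by \<open>n\<close>, only \<open>n \<le> m\<close> contributes to the coefficient of
  \<open>s\<^sup>\<alpha>\<^sup>-\<^sup>1\<^sup>+\<^sup>m\<close> in \<open>S(b) x\<close>.
\<close>

definition Xi :: "rat \<Rightarrow> nat \<Rightarrow> (nat \<Rightarrow> complex fps) abmod" where
  "Xi \<alpha> N =
     \<lparr>carrier = {x. \<forall>j>N. x j = 0}, monoid.mult = undefined, monoid.one = undefined,
      ring.zero = (\<lambda>j. 0), ring.add = (\<lambda>x y j. x j + y j),
      module.smult = (\<lambda>S x j. Abs_fps (\<lambda>m. \<Sum>n\<le>m. fps_nth S n * fps_nth ((xi_b \<alpha> N ^^ n) x j) m)),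
      aop = (\<lambda>x j. fps_X * x j)\<rparr>"

text \<open>The tensor product with a vector space of dimension \<open>d\<close>, in coordinates.\<close>

definition Xi_tensor :: "rat \<Rightarrow> nat \<Rightarrow> nat \<Rightarrow> (nat \<Rightarrow> complex fps) list abmod" where
  "Xi_tensor \<alpha> N d = ab_dsum (replicate d (Xi \<alpha> N))"

definition fresco :: "'m abmod \<Rightarrow> bool" where
  "fresco M \<longleftrightarrow> ab_module M \<and>
     (\<exists>x\<in>carrier M. carrier M = at_span M x) \<and>
     (\<exists>ps :: (rat \<times> nat \<times> nat) list.
        (\<forall>(\<alpha>, N, d)\<in>set ps. 0 < \<alpha> \<and> \<alpha> \<le> 1) \<and>
        embeds M (ab_dsum (map (\<lambda>(\<alpha>, N, d). Xi_tensor \<alpha> N d) ps)))"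

definition primitive_theme :: "rat \<Rightarrow> 'm abmod \<Rightarrow> bool" where
  "primitive_theme \<alpha> M \<longleftrightarrow> fresco M \<and> (\<exists>N. embeds M (Xi \<alpha> N))"

definition theme :: "'m abmod \<Rightarrow> bool" where
  "theme M \<longleftrightarrow> (\<exists>\<alpha>. 0 < \<alpha> \<and> \<alpha> \<le> 1 \<and> primitive_theme \<alpha> M)"


section \<open>Bernstein polynomials\<close>

text \<open>
  In \<open>M[b\<^sup>-\<^sup>1]\<close> the fraction \<open>b\<^sup>-\<^sup>n x\<close> is the class of the pair \<open>(x, n)\<close>; the relation
  \<open>ab - ba = b\<^sup>2\<close> forces \<open>a b\<^sup>-\<^sup>n x = b\<^sup>-\<^sup>n (a x - n b x)\<close>.
\<close>

definition bfrac :: "'m abmod \<Rightarrow> 'm \<Rightarrow> nat \<Rightarrow> ('m \<times> nat) set" where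
  "bfrac M x n = {(y, m). y \<in> carrier M \<and> (bop M ^^ m) x = (bop M ^^ n) y}"

definition ab_loc :: "'m abmod \<Rightarrow> ('m \<times> nat) set abmod" where
  "ab_loc M =
     \<lparr>carrier = {bfrac M x n | x n. x \<in> carrier M}, monoid.mult = undefined, monoid.one = undefined,
      ring.zero = bfrac M \<zero>\<^bsub>M\<^esub> 0,
      ring.add = (\<lambda>C D. \<Union>(x, n)\<in>C. \<Union>(y, m)\<in>D.
               bfrac M ((bop M ^^ m) x \<oplus>\<^bsub>M\<^esub> (bop M ^^ n) y) (n + m)),
      module.smult = (\<lambda>S C. \<Union>(x, n)\<in>C. bfrac M (S \<odot>\<^bsub>M\<^esub> x) n),
      aop = (\<lambda>C. \<Union>(x, n)\<in>C. bfrac M (aop M x \<ominus>\<^bsub>M\<^esub> csmult M (of_nat n) (bop M x)) n)\<rparr>"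

definition binv :: "'m abmod \<Rightarrow> ('m \<times> nat) set \<Rightarrow> ('m \<times> nat) set" where
  "binv M C = (\<Union>(x, n)\<in>C. bfrac M x (Suc n))"

definition binv_a :: "'m abmod \<Rightarrow> ('m \<times> nat) set \<Rightarrow> ('m \<times> nat) set" where
  "binv_a M C = binv M (aop (ab_loc M) C)"

definition sharp :: "'m abmod \<Rightarrow> ('m \<times> nat) set abmod" where
  "sharp M = ab_sub (ab_loc M)
     {finsum (ab_loc M) (\<lambda>j. (binv_a M ^^ j) (bfrac M (x j) 0)) {..<k} | x k.
        \<forall>j. x j \<in> carrier M}"

definition is_min_poly :: "'m abmod \<Rightarrow> ('m \<Rightarrow> 'm) \<Rightarrow> complex poly \<Rightarrow> bool" where
  "is_min_poly M T p \<longleftrightarrow> Polynomial.coeff p (Polynomial.degree p) = 1 \<and> (\<forall>x\<in>carrier M. poly_op M T p x = \<zero>\<^bsub>M\<^esub>) \<and>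
     (\<forall>q. q \<noteq> 0 \<and> (\<forall>x\<in>carrier M. poly_op M T q x = \<zero>\<^bsub>M\<^esub>) \<longrightarrow> Polynomial.degree p \<le> Polynomial.degree q)"

definition bernstein :: "'m abmod \<Rightarrow> complex poly" where
  "bernstein M =
     (let F = sharp M; bF = bop F ` carrier F in
      THE p. is_min_poly (ab_quot F bF)
        (\<lambda>C. \<Union>w\<in>C. bF +>\<^bsub>F\<^esub> csmult F (- 1) (binv_a M w)) p)"

definition semi_simple :: "'m abmod \<Rightarrow> bool" where
  "semi_simple M \<longleftrightarrow> ab_module M \<and>
     (\<exists>ls :: rat list. (\<forall>l\<in>set ls. 0 < l) \<and> embeds M (ab_dsum (map (\<lambda>l. E_mod (of_rat l)) ls)))"

definition ss_part :: "'m abmod \<Rightarrow> 'm set" where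
  "ss_part M = (THE S. ab_submodule M S \<and> semi_simple (ab_sub M S) \<and>
     (\<forall>S'. ab_submodule M S' \<and> semi_simple (ab_sub M S') \<longrightarrow> S' \<subseteq> S))"

primrec ss_filt :: "'m abmod \<Rightarrow> nat \<Rightarrow> 'm set" where
  "ss_filt M 0 = {\<zero>\<^bsub>M\<^esub>}"
| "ss_filt M (Suc j) =
     {x \<in> carrier M. ss_filt M j +>\<^bsub>M\<^esub> x \<in> ss_part (ab_quot M (ss_filt M j))}"

text \<open>Meaningful for \<open>j \<ge> 1\<close> and \<open>M\<close> a primitive fresco.\<close>

definition bernstein_j :: "'m abmod \<Rightarrow> nat \<Rightarrow> complex poly" where
  "bernstein_j M j =
     (if ss_filt M j = ss_filt M (j - 1) then 1
      else pcompose (bernstein (ab_quot (ab_sub M (ss_filt M j)) (ss_filt M (j - 1))))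
             [:- of_nat (ab_rank (ab_quot M (ss_filt M j))), 1:])"


section \<open>The (a,b)-module of a germ in three variables\<close>

text \<open>
  Germs are represented by functions that are holomorphic near \<open>0\<close>; functions with the same germ
  are identified in the quotients below.  A germ of 3-form \<open>g dx\<and>dy\<and>dz\<close> is given by \<open>g\<close>, and a
  germ of 2-form \<open>\<eta>\<^sub>1 dy\<and>dz + \<eta>\<^sub>2 dz\<and>dx + \<eta>\<^sub>3 dx\<and>dy\<close> by the family \<open>\<eta>\<close>, so that \<open>d\<eta>\<close> is the
  divergence of \<open>\<eta>\<close> and \<open>df \<and> \<eta>\<close> is \<open>\<Sum>i. (\<partial>\<^sub>i f) \<eta>\<^sub>i\<close>.
\<close>

type_synonym fun3 = "complex ^ 3 \<Rightarrow> complex"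

definition holo_germ :: "fun3 \<Rightarrow> bool" where
  "holo_germ g \<longleftrightarrow> (\<exists>U. open U \<and> 0 \<in> U \<and>
     (\<forall>p\<in>U. \<exists>D. Vector_Spaces.linear (*s) (*) D \<and> (g has_derivative D) (at p)))"

definition pd :: "3 \<Rightarrow> fun3 \<Rightarrow> fun3" where
  "pd i g p = frechet_derivative g (at p) (axis i 1)"

definition Omega3 :: "fun3 ring" where
  "Omega3 = \<lparr>carrier = {g. holo_germ g}, monoid.mult = (\<lambda>g h p. g p * h p), monoid.one = (\<lambda>p. 1),
     ring.zero = (\<lambda>p. 0), ring.add = (\<lambda>g h p. g p + h p)\<rparr>"

definition Omega2 :: "(3 \<Rightarrow> fun3) set" where
  "Omega2 = {\<eta>. \<forall>i. holo_germ (\<eta> i)}"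

definition ext_d :: "(3 \<Rightarrow> fun3) \<Rightarrow> fun3" where
  "ext_d \<eta> p = (\<Sum>i\<in>UNIV. pd i (\<eta> i) p)"

definition df_wedge :: "fun3 \<Rightarrow> (3 \<Rightarrow> fun3) \<Rightarrow> fun3" where
  "df_wedge f \<eta> p = (\<Sum>i\<in>UNIV. pd i f p * \<eta> i p)"

definition Ker_df :: "fun3 \<Rightarrow> (3 \<Rightarrow> fun3) set" where
  "Ker_df f = {\<eta>\<in>Omega2. \<forall>\<^sub>F p in nhds 0. df_wedge f \<eta> p = 0}"

definition D_sub :: "fun3 \<Rightarrow> nat \<Rightarrow> fun3 set" where
  "D_sub f k = {g \<in> carrier Omega3. \<exists>\<eta>\<in>Ker_df f. \<exists>h\<in>carrier Omega3.
     \<forall>\<^sub>F p in nhds 0. g p = ext_d \<eta> p + f p ^ k * h p}"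

text \<open>
  The \<open>f\<close>-adic completion of \<open>Q = \<Omega>\<^sup>3/d(Ker df)\<close> is the inverse limit of the spaces
  \<open>Q/f\<^sup>kQ = \<Omega>\<^sup>3/(d(Ker df) + f\<^sup>k\<Omega>\<^sup>3)\<close>; a coset modulo the \<open>(k+1)\<close>-st subspace maps to the coset
  modulo the \<open>k\<close>-th one that contains it.
\<close>

type_synonym compl = "nat \<Rightarrow> fun3 set"

definition compl_group :: "fun3 \<Rightarrow> compl ring" where
  "compl_group f =
     \<lparr>carrier = {h. \<forall>k. h k \<in> a_rcosets\<^bsub>Omega3\<^esub> (D_sub f k) \<and> h (Suc k) \<subseteq> h k},
      monoid.mult = undefined, monoid.one = undefined, ring.zero = D_sub f,
      ring.add = (\<lambda>h h' k. h k <+>\<^bsub>Omega3\<^esub> h' k)\<rparr>"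

definition compl_scale :: "fun3 \<Rightarrow> complex \<Rightarrow> compl \<Rightarrow> compl" where
  "compl_scale f c h = (\<lambda>k. \<Union>g\<in>h k. D_sub f k +>\<^bsub>Omega3\<^esub> (\<lambda>p. c * g p))"

definition compl_a :: "fun3 \<Rightarrow> compl \<Rightarrow> compl" where
  "compl_a f h = (\<lambda>k. \<Union>g\<in>h k. D_sub f k +>\<^bsub>Omega3\<^esub> (\<lambda>p. f p * g p))"

text \<open>The extension by continuity of \<open>b[d\<eta>] = [df \<and> \<eta>]\<close> to the completion.\<close>

definition compl_b :: "fun3 \<Rightarrow> compl \<Rightarrow> compl" where
  "compl_b f h = (THE h'. h' \<in> carrier (compl_group f) \<and>
     (\<forall>m. \<exists>K. \<forall>k\<ge>K. \<forall>\<eta>\<in>Omega2. ext_d \<eta> \<in> h k \<longrightarrow> df_wedge f \<eta> \<in> h' m))"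

text \<open>\<open>S(b) h\<close> is the limit of the partial sums of \<open>\<Sum>n. S\<^sub>n b\<^sup>n h\<close> in the completion.\<close>

definition compl_smult :: "fun3 \<Rightarrow> complex fps \<Rightarrow> compl \<Rightarrow> compl" where
  "compl_smult f S h = (THE h'. h' \<in> carrier (compl_group f) \<and>
     (\<forall>m. \<exists>K. \<forall>k\<ge>K.
        finsum (compl_group f) (\<lambda>n. compl_scale f (fps_nth S n) ((compl_b f ^^ n) h)) {..<k} m
          = h' m))"

definition compl_mod :: "fun3 \<Rightarrow> compl abmod" where
  "compl_mod f =
     \<lparr>carrier = carrier (compl_group f), monoid.mult = undefined, monoid.one = undefined,
      ring.zero = ring.zero (compl_group f), ring.add = ring.add (compl_group f),
      module.smult = compl_smult f, aop = compl_a f\<rparr>"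

definition b_torsion :: "'m abmod \<Rightarrow> 'm set" where
  "b_torsion M = {x \<in> carrier M. \<exists>n. (bop M ^^ n) x = \<zero>\<^bsub>M\<^esub>}"

definition H_mod :: "fun3 \<Rightarrow> compl set abmod" where
  "H_mod f = ab_quot (compl_mod f) (b_torsion (compl_mod f))"

definition H_class :: "fun3 \<Rightarrow> fun3 \<Rightarrow> compl set" where
  "H_class f g = b_torsion (compl_mod f) +>\<^bsub>compl_mod f\<^esub> (\<lambda>k. D_sub f k +>\<^bsub>Omega3\<^esub> g)"

definition F_fresco :: "fun3 \<Rightarrow> fun3 \<Rightarrow> compl set abmod" where
  "F_fresco f g = ab_sub (H_mod f) (at_span (H_mod f) (H_class f g))"

end

theory Submission
  imports Defs "HOL-Complex_Analysis.Complex_Analysis"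
begin

text \<open>
  By Euler's formula a germ of 3-form is the divergence of a radial field, so \<open>b\<close> lifts to an explicit operator on power
  series.  The forms \<open>\<omega>\<^sub>i\<close> are invariant under the cyclic group of order 7 acting with weights (1, 2, 4), and modulo the
  relations the invariant series are generated over \<open>C[[b]]\<close> by 1 and \<open>x y\<^sup>3\<close>.  In the other direction, a generating
  function of products of reciprocal Gamma factors satisfies the recursions dual to the gradient of \<open>f\<close>; the coefficients of
  its expansion in a parameter give functionals that identify the invariant part of the module with a submodule of the rank
  two module generated by \<open>1\<close> and \<open>Log s\<close>.  The leading exponents \<open>(q, r)\<close> of the images of the four forms are
  (0, 0), (2, 1), (4, 1), (2, 1), and they determine the socle, its quotient and the Bernstein polynomials.
\<close>

text \<open>Germs converge and the module is completed f-adically, while the computation is formal.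
  The bridge is that a convergent series of order at least 20 m lies in d(Ker df) + (f^m): gradient
  relations are chained in a cycle that returns to the same multiple of xyz up to xyz times a
  bounded diagonal operator, and the resulting equation has convergent solutions. The functionals
  imitate integrals of exp(-f) times a monomial, expanded in the four monomials of f. These have the
  single relation (x y^3)(y z^3)(z x^3) = (xyz)^4, so their exponents may be moved along (1, 1, 1,
  -4), whose sum -1 makes the parameter act as a logarithm. Each negative Gamma argument gives a
  zero in the parameter. One argument at least is negative, and three are for monomials of high
  degree; the orders 1 and 2 in between form the Jordan block. Order 1 is first reached when k + 1
  is the largest of the weights (2a + 4b + c)/7, (a + 2b + 4c)/7, (4a + b + 2c)/7, where a, b, c are
  the exponents plus one: 1, 3, 5, 3 for the four forms, the constants of the statement.\<close>

type_synonym jordan2 = "complex fps \<times> complex fps"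

section \<open>Power series in three variables\<close>

type_synonym ps3 = "complex fps fps fps"

definition cf :: "ps3 => nat => nat => nat => complex" where
 "cf P i j k = fps_nth (fps_nth (fps_nth P i) j) k"

definition mk :: "(nat => nat => nat => complex) => ps3" where
 "mk g = Abs_fps (%i. Abs_fps (%j. Abs_fps (%k. g i j k)))"

definition cX :: ps3 where "cX = fps_X"
definition cY :: ps3 where "cY = fps_const fps_X"
definition cZ :: ps3 where "cZ = fps_const (fps_const fps_X)"
definition cc :: "complex => ps3" where "cc c = fps_const (fps_const (fps_const c))"

lemma cf_mk [simp]: "cf (mk g) i j k = g i j k"
 by (simp add: cf_def mk_def)

lemma ps3_eqI: "(!!i j k. cf P i j k = cf Q i j k) ==> P = Q"
 by (auto simp: cf_def fps_eq_iff)

lemma cf_cX [simp]: "cf (cX * P) i j k = (if i = 0 then 0 else cf P (i - 1) j k)"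
 by (simp add: cf_def cX_def)
lemma cf_cY [simp]: "cf (cY * P) i j k = (if j = 0 then 0 else cf P i (j - 1) k)"
 by (simp add: cf_def cY_def)
lemma cf_cZ [simp]: "cf (cZ * P) i j k = (if k = 0 then 0 else cf P i j (k - 1))"
 by (simp add: cf_def cZ_def)
lemma cf_cc [simp]: "cf (cc c * P) i j k = c * cf P i j k"
 by (simp add: cf_def cc_def)
lemma cf_add [simp]: "cf (P + Q) i j k = cf P i j k + cf Q i j k"
 by (simp add: cf_def)
lemma cf_diff [simp]: "cf (P - Q) i j k = cf P i j k - cf Q i j k"
 by (simp add: cf_def)
lemma cf_uminus [simp]: "cf (- P) i j k = - cf P i j k"
 by (simp add: cf_def)
lemma cf_zero [simp]: "cf 0 i j k = 0"
 by (simp add: cf_def)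
lemma cf_one: "cf 1 i j k = (if i = 0 & j = 0 & k = 0 then 1 else 0)"
 by (simp add: cf_def)
lemma cf_sum: "cf (sum F A) i j k = (\<Sum>a\<in>A. cf (F a) i j k)"
 by (simp add: cf_def fps_sum_nth)

lemma cc_numeral: "cc (numeral n) = numeral n"
 by (simp add: cc_def numeral_fps_const)
lemma cc_0 [simp]: "cc 0 = 0" and cc_1 [simp]: "cc 1 = 1"
 by (simp_all add: cc_def)
lemma cc_add: "cc (a + b) = cc a + cc b" and cc_mult: "cc (a * b) = cc a * cc b"
 and cc_uminus: "cc (- a) = - cc a" and cc_diff: "cc (a - b) = cc a - cc b"
 by (simp_all add: cc_def flip: fps_const_neg)
lemma cf_numeral [simp]: "cf (numeral n * P) i j k = numeral n * cf P i j k"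
 using cf_cc[of "numeral n" P] by (simp add: cc_numeral)

section \<open>Diagonal operators on coefficients\<close>

definition dg :: "(nat => nat => nat => complex) => ps3 => ps3" where
 "dg ka P = mk (%i j k. ka i j k * cf P i j k)"

lemma cf_dg [simp]: "cf (dg ka P) i j k = ka i j k * cf P i j k"
 by (simp add: dg_def)

lemma dg_add: "dg ka (P + Q) = dg ka P + dg ka Q"
 by (rule ps3_eqI) (simp add: algebra_simps)
lemma dg_diff: "dg ka (P - Q) = dg ka P - dg ka Q"
 by (rule ps3_eqI) (simp add: algebra_simps)
lemma dg_cc: "dg ka (cc c * P) = cc c * dg ka P"
 by (rule ps3_eqI) simp
lemma dg_dg: "dg ka (dg mu P) = dg (%i j k. ka i j k * mu i j k) P"
 by (rule ps3_eqI) (simp add: algebra_simps)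
lemma dg_cX: "dg ka (cX * P) = cX * dg (%i. ka (Suc i)) P"
 by (rule ps3_eqI) (auto simp: gr0_conv_Suc)
lemma dg_cY: "dg ka (cY * P) = cY * dg (%i j. ka i (Suc j)) P"
 by (rule ps3_eqI) (auto simp: gr0_conv_Suc)
lemma dg_cZ: "dg ka (cZ * P) = cZ * dg (%i j k. ka i j (Suc k)) P"
 by (rule ps3_eqI) (auto simp: gr0_conv_Suc)
lemma dg_1: "(!!i j k. ka i j k = 1) ==> dg ka P = P"
 by (rule ps3_eqI) simp
lemma dg_const: "dg (%i j k. c) P = cc c * P"
 by (rule ps3_eqI) simp

definition bdd3 :: "(nat => nat => nat => complex) => bool" where
 "bdd3 ka \<longleftrightarrow> (\<exists>B. \<forall>i j k. cmod (ka i j k) \<le> B)"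

lemma bdd3I: "(!!i j k. cmod (ka i j k) \<le> B) ==> bdd3 ka"
 by (auto simp: bdd3_def)

lemma bdd3_mult: assumes "bdd3 ka" "bdd3 mu" shows "bdd3 (%i j k. ka i j k * mu i j k)"
proof -
 obtain B1 B2 where B: "!!i j k. cmod (ka i j k) \<le> B1" "!!i j k. cmod (mu i j k) \<le> B2"
  using assms by (auto simp: bdd3_def)
 have "0 \<le> B1" using B(1)[of 0 0 0] norm_ge_zero order_trans by blast
 then show ?thesis by (intro bdd3I[of _ "B1 * B2"]) (auto simp: norm_mult intro!: mult_mono B)
qed

text \<open>Moving a diagonal operator across a monomial replaces its multiplier by a shifted copy.
  The bounds depend only on the set of values, so the shift itself is forgotten.\<close>

definition in_range3 :: "(nat => nat => nat => complex) => (nat => nat => nat => complex) => bool" where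
 "in_range3 ka' ka \<longleftrightarrow> (\<forall>i j k. \<exists>i' j' k'. ka' i j k = ka i' j' k')"

lemma in_range3_trans: "in_range3 a b ==> in_range3 b c ==> in_range3 a c"
 unfolding in_range3_def by metis

lemma bdd3_in_range: "in_range3 ka' ka ==> bdd3 ka ==> bdd3 ka'"
 unfolding in_range3_def bdd3_def by metis

definition dgc :: "ps3 => bool" where
 "dgc u \<longleftrightarrow> (\<forall>ka. \<exists>ka'. in_range3 ka' ka & (\<forall>w. dg ka (u * w) = u * dg ka' w))"

lemma dgc_X: "dgc cX" and dgc_Y: "dgc cY" and dgc_Z: "dgc cZ"
 unfolding dgc_def in_range3_def using dg_cX dg_cY dg_cZ by metis+

lemma dgc_mult: assumes "dgc u" "dgc v" shows "dgc (u * v)"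
 unfolding dgc_def
proof
 fix ka
 obtain ka1 where 1: "in_range3 ka1 ka" "!!w. dg ka (u * w) = u * dg ka1 w" using assms(1) unfolding dgc_def by metis
 obtain ka2 where 2: "in_range3 ka2 ka1" "!!w. dg ka1 (v * w) = v * dg ka2 w" using assms(2) unfolding dgc_def by metis
 show "\<exists>ka'. in_range3 ka' ka & (\<forall>w. dg ka (u * v * w) = u * v * dg ka' w)"
  using in_range3_trans[OF 2(1) 1(1)] 1(2) 2(2) by (auto simp: mult.assoc)
qed

definition sub3 :: "ps3 set => bool" where
 "sub3 S \<longleftrightarrow> 0 \<in> S & (\<forall>P\<in>S. \<forall>Q\<in>S. P + Q \<in> S) & (\<forall>c. \<forall>P\<in>S. cc c * P \<in> S)"

lemma sub3_0: "sub3 S ==> 0 \<in> S" and sub3_add: "sub3 S ==> P \<in> S ==> Q \<in> S ==> P + Q \<in> S"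
 and sub3_cc: "sub3 S ==> P \<in> S ==> cc c * P \<in> S"
 by (auto simp: sub3_def)
lemma sub3_uminus: "sub3 S ==> P \<in> S ==> - P \<in> S"
 using sub3_cc[of S P "-1"] by (simp add: cc_uminus)
lemma sub3_diff: "sub3 S ==> P \<in> S ==> Q \<in> S ==> P - Q \<in> S"
 using sub3_add[of S P "-Q"] sub3_uminus by simp
lemma sub3_sum: "sub3 S ==> (!!a. a \<in> A ==> F a \<in> S) ==> sum F A \<in> S"
 by (induction A rule: infinite_finite_induct) (auto simp: sub3_0 sub3_add)
lemma sub3_numeral: "sub3 S ==> P \<in> S ==> numeral n * P \<in> S"
 using sub3_cc[of S P "numeral n"] by (simp add: cc_numeral)
lemma sub3_cancel: "sub3 S ==> cc c * P \<in> S ==> c ~= 0 ==> P \<in> S"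
 using sub3_cc[of S "cc c * P" "1/c"] by (simp flip: mult.assoc cc_mult)

section \<open>Reductions along the cyclic symmetry\<close>

definition closed3 :: "ps3 set => bool" where
 "closed3 C \<longleftrightarrow> sub3 C & (\<forall>P\<in>C. cX * P \<in> C & cY * P \<in> C & cZ * P \<in> C) & (\<forall>ka. \<forall>P\<in>C. bdd3 ka \<longrightarrow> dg ka P \<in> C)"

text \<open>The equation that remains when a chain of relations has returned to its starting
  monomial. The class \<open>C\<close> is kept abstract so that the same reductions serve convergent
  series of a given order and all formal series.\<close>

definition solvable3 :: "ps3 set => bool" where
 "solvable3 C \<longleftrightarrow> (\<forall>ka. \<forall>g\<in>C. bdd3 ka \<longrightarrow> (\<exists>w\<in>C. w - cX * cY * cZ * dg ka w = g))"

definition multc :: "ps3 set => ps3 => bool" where "multc C u \<longleftrightarrow> dgc u & (\<forall>w\<in>C. u * w \<in> C)"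

lemma closed3_multc: "closed3 C ==> multc C cX" "closed3 C ==> multc C cY" "closed3 C ==> multc C cZ"
 by (auto simp: closed3_def multc_def dgc_X dgc_Y dgc_Z)

lemma multc_mult: "multc C u ==> multc C v ==> multc C (u * v)"
 by (auto simp: multc_def dgc_mult mult.assoc)

lemma closed3_dg: "closed3 C ==> P \<in> C ==> bdd3 ka ==> dg ka P \<in> C"
 by (auto simp: closed3_def)

text \<open>Modulo \<open>S\<close> the three relations chain up: u m w becomes t m (t w1), then v m
  (v t w2), then u m (u v t \<open>dg k w\<close>). So u m times (w - xyz \<open>dg k w\<close>)
  lies in \<open>S\<close>, and by solvability the bracket can be any given
  \<open>g\<close>.\<close>

lemma cycle_reduction:
 assumes C: "closed3 C" "solvable3 C" and S: "sub3 S"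
  and u: "multc C u" and v: "multc C v" and t: "multc C t" and m: "m = u * v * t" "m = cX * cY * cZ"
  and h1: "\<exists>ka. bdd3 ka & (\<forall>w\<in>C. u * (m * w) - t * (t * (m * dg ka w)) \<in> S)"
  and h2: "\<exists>ka. bdd3 ka & (\<forall>w\<in>C. t * (m * w) - v * (v * (m * dg ka w)) \<in> S)"
  and h3: "\<exists>ka. bdd3 ka & (\<forall>w\<in>C. v * (m * w) - u * (u * (m * dg ka w)) \<in> S)"
  and g: "g \<in> C"
 shows "u * (m * g) \<in> S"
proof -
 obtain k1 where k1: "bdd3 k1" "!!w. w \<in> C ==> u * (m * w) - t * (t * (m * dg k1 w)) \<in> S" using h1 by blast
 obtain k2 where k2: "bdd3 k2" "!!w. w \<in> C ==> t * (m * w) - v * (v * (m * dg k2 w)) \<in> S" using h2 by blast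
 obtain k3 where k3: "bdd3 k3" "!!w. w \<in> C ==> v * (m * w) - u * (u * (m * dg k3 w)) \<in> S" using h3 by blast
 obtain k2' where k2': "in_range3 k2' k2" "!!w. dg k2 (t * w) = t * dg k2' w"
  using t unfolding multc_def dgc_def by metis
 obtain k3' where k3': "in_range3 k3' k3" "!!w. dg k3 (v * t * w) = v * t * dg k3' w"
  using multc_mult[OF v t] unfolding multc_def dgc_def by metis
 have b2: "bdd3 k2'" and b3: "bdd3 k3'" using bdd3_in_range k2' k3' k2 k3 by blast+
 \<comment> \<open>The product of the three multipliers, the second one pulled back across
   \<open>t\<close> and the third across \<open>v * t\<close>.\<close>
 define k where "k = (%i j l. k3' i j l * (k2' i j l * k1 i j l))"
 have bk: "bdd3 k" unfolding k_def by (intro bdd3_mult b2 b3 k1)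
 obtain w where w: "w \<in> C" "w - cX * cY * cZ * dg k w = g"
  using C(2) g bk unfolding solvable3_def by blast
 define w1 where "w1 = dg k1 w"
 define w2 where "w2 = dg k2' w1"
 have w1: "w1 \<in> C" unfolding w1_def using closed3_dg C(1) w(1) k1(1) by blast
 then have w2: "w2 \<in> C" unfolding w2_def using closed3_dg C(1) b2 by blast
 have tw1: "t * w1 \<in> C" and vtw2: "v * t * w2 \<in> C" using w1 w2 t multc_mult[OF v t] by (auto simp: multc_def)
 have kw: "dg k3' w2 = dg k w" by (simp add: w2_def w1_def dg_dg k_def)
 have "u * (m * w) - t * (t * (m * w1)) \<in> S" using k1(2)[OF w(1)] by (simp add: w1_def)
 moreover have "t * (m * (t * w1)) - v * (v * (m * (t * w2))) \<in> S"
  using k2(2)[OF tw1] by (simp add: w2_def k2')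
 moreover have "v * (m * (v * t * w2)) - u * (u * (m * (v * t * dg k w))) \<in> S"
  using k3(2)[OF vtw2] by (simp add: k3' kw)
 ultimately have "(u * (m * w) - t * (t * (m * w1))) + (t * (m * (t * w1)) - v * (v * (m * (t * w2))))
  + (v * (m * (v * t * w2)) - u * (u * (m * (v * t * dg k w)))) \<in> S"
  using S sub3_add by blast
 also have "(u * (m * w) - t * (t * (m * w1))) + (t * (m * (t * w1)) - v * (v * (m * (t * w2))))
  + (v * (m * (v * t * w2)) - u * (u * (m * (v * t * dg k w)))) = u * (m * (w - u * v * t * dg k w))"
  by (simp add: algebra_simps)
 also have "w - u * v * t * dg k w = g" using w(2) m by simp
 finally show ?thesis .
qed

text \<open>Both relations produce the term u^4 t: the first at u t w, the second at u w. In their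
  difference only u m and t^2 m remain, and u m carries the multiplier mu - nu. This is invertible
  with bounded inverse, because the real parts stay at least 1 - 4/7 = 3/7 apart.\<close>

lemma cycle_step:
 assumes C: "closed3 C" and S: "sub3 S" and lam: "lam ~= 0"
  and u: "multc C u" and v: "multc C v" and t: "multc C t" and m: "m = u * v * t"
  and mu: "bdd3 mu" "!!i j k. Re (mu i j k) \<ge> 1" and nu: "bdd3 nu" "!!i j k. Re (nu i j k) \<le> 4/7"
  and r: "!!w. w \<in> C ==> u ^ 3 * w + 3 * (v * (t\<^sup>2 * w)) + cc lam * (u * (v * dg mu w)) \<in> S"
  and n: "!!w. w \<in> C ==> t * (u ^ 3 * w) + cc lam * (m * dg nu w) \<in> S"
 shows "\<exists>ka. bdd3 ka & (\<forall>w\<in>C. u * (m * w) - t * (t * (m * dg ka w)) \<in> S)"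
proof -
 obtain mu' where mu': "in_range3 mu' mu" "!!w. dg mu (u * t * w) = u * t * dg mu' w"
  using multc_mult[OF u t] unfolding multc_def dgc_def by metis
 obtain nu' where nu': "in_range3 nu' nu" "!!w. dg nu (u * w) = u * dg nu' w"
  using u unfolding multc_def dgc_def by metis
 have *: "Re (mu' i j k - nu' i j k) \<ge> 3/7" for i j k
 proof -
  obtain i1 j1 k1 where "mu' i j k = mu i1 j1 k1" using mu'(1) unfolding in_range3_def by metis
  moreover obtain i2 j2 k2 where "nu' i j k = nu i2 j2 k2" using nu'(1) unfolding in_range3_def by metis
  ultimately show ?thesis using mu(2)[of i1 j1 k1] nu(2)[of i2 j2 k2] by simp
 qed
 define d where "d = (%i j k. 1 / (mu' i j k - nu' i j k))"
 have "cmod (d i j k) \<le> 7/3" for i j k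
 proof -
  have "3/7 \<le> cmod (mu' i j k - nu' i j k)" using * complex_Re_le_cmod order_trans by blast
  then have "1 / cmod (mu' i j k - nu' i j k) \<le> 1 / (3/7)" by (intro divide_left_mono) auto
  then show ?thesis by (simp add: d_def norm_divide)
 qed
 then have bd: "bdd3 d" by (rule bdd3I)
 have dd: "dg mu' (dg d w) - dg nu' (dg d w) = w" for w
 proof (rule ps3_eqI)
  fix i j k
  have "mu' i j k - nu' i j k ~= 0" using *[of i j k] by force
  then have "(mu' i j k - nu' i j k) * d i j k = 1" by (simp add: d_def)
  then have "(mu' i j k - nu' i j k) * d i j k * cf w i j k = cf w i j k" by simp
  then show "cf (dg mu' (dg d w) - dg nu' (dg d w)) i j k = cf w i j k"
   by (simp add: left_diff_distrib mult.assoc)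
 qed
 \<comment> \<open>Read off from lam u m w + 3 t^2 m \<open>dg d w\<close> = 0 modulo
   \<open>S\<close>, solved for the first term.\<close>
 define ka where "ka = (%i j k. (- 3 / lam) * d i j k)"
 have "bdd3 ka" unfolding ka_def by (intro bdd3_mult bd) (auto simp: bdd3_def)
 moreover have "u * (m * w) - t * (t * (m * dg ka w)) \<in> S" if w: "w \<in> C" for w
 proof -
  define v1 where "v1 = dg d w"
  have v1: "v1 \<in> C" unfolding v1_def using C w bd closed3_dg by blast
  have k: "cc lam * dg ka w = - (3 * v1)"
   by (rule ps3_eqI) (use lam in \<open>simp add: ka_def v1_def\<close>)
  have "u * t * v1 \<in> C" "u * v1 \<in> C" using v1 multc_mult[OF u t] u by (auto simp: multc_def)
  from sub3_diff[OF S r[OF this(1), unfolded mu'(2)] n[OF this(2), unfolded nu'(2)]]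
  have "cc lam * (u * (m * (dg mu' v1 - dg nu' v1))) + 3 * (t * (t * (m * v1))) \<in> S"
   by (simp add: m algebra_simps power2_eq_square power3_eq_cube)
  then have "cc lam * (u * (m * w)) - t * (t * (m * (- (3 * v1)))) \<in> S"
   using dd[of w] by (simp add: v1_def algebra_simps)
  then have "cc lam * (u * (m * w) - t * (t * (m * dg ka w))) \<in> S"
   unfolding k[symmetric] by (simp add: algebra_simps)
  then show ?thesis using sub3_cancel[OF S _ lam] by blast
 qed
 ultimately show ?thesis by blast
qed

lemma multc_power: "multc C u ==> multc C (u ^ n)"
proof (induction n)
 case 0
 have "dgc 1" unfolding dgc_def in_range3_def by (metis mult_1)
 then show ?case by (simp add: multc_def)
qed (simp add: multc_mult)

text \<open>Multiplied by v^2, the first relation links u^3 v^2 to its cyclic image v^3 t^2, since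
  the third term falls into the known multiples of u v^3. Three such links close up to a multiple of
  u^3 v^2. Multiplying the first relation by u^2 v and by u^4 then reaches u^5 v and u^7.\<close>

lemma pure_powers:
 assumes C: "closed3 C" and S: "sub3 S"
  and u: "multc C u" and v: "multc C v" and t: "multc C t"
  and r1: "\<exists>ka. bdd3 ka & (\<forall>w\<in>C. u ^ 3 * w + 3 * (v * (t\<^sup>2 * w)) + u * (v * dg ka w) \<in> S)"
  and r2: "\<exists>ka. bdd3 ka & (\<forall>w\<in>C. v ^ 3 * w + 3 * (t * (u\<^sup>2 * w)) + v * (t * dg ka w) \<in> S)"
  and r3: "\<exists>ka. bdd3 ka & (\<forall>w\<in>C. t ^ 3 * w + 3 * (u * (v\<^sup>2 * w)) + t * (u * dg ka w) \<in> S)"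
  and m: "!!w. w \<in> C ==> u * v * t * w \<in> S"
  and n: "!!w. w \<in> C ==> u * v ^ 3 * w \<in> S" "!!w. w \<in> C ==> v * t ^ 3 * w \<in> S" "!!w. w \<in> C ==> t * u ^ 3 * w \<in> S"
  and w: "w \<in> C"
 shows "u ^ 3 * v\<^sup>2 * w \<in> S" "u ^ 5 * v * w \<in> S" "u ^ 7 * w \<in> S"
proof -
 have mc: "p \<in> C ==> multc C q ==> q * p \<in> C" for p q by (auto simp: multc_def)
 have factor: "\<exists>w'\<in>C. dg ka (q * w) = q * w'" if "bdd3 ka" "multc C q" "w \<in> C" for ka q w
  using that C bdd3_in_range unfolding multc_def dgc_def by (metis closed3_dg)
 have *: "u ^ 3 * v\<^sup>2 * w + 3 * (v ^ 3 * t\<^sup>2 * w) \<in> S"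
  if uvt: "multc C u" "multc C v" and w: "w \<in> C" and n1: "!!w. w \<in> C ==> u * v ^ 3 * w \<in> S"
  and r: "\<exists>ka. bdd3 ka & (\<forall>w\<in>C. u ^ 3 * w + 3 * (v * (t\<^sup>2 * w)) + u * (v * dg ka w) \<in> S)" for u v t w
 proof -
  obtain ka where ka: "bdd3 ka" "!!w. w \<in> C ==> u ^ 3 * w + 3 * (v * (t\<^sup>2 * w)) + u * (v * dg ka w) \<in> S"
   using r by blast
  obtain w' where w': "w' \<in> C" "dg ka (v\<^sup>2 * w) = v\<^sup>2 * w'" using factor[OF ka(1) multc_power[OF uvt(2)] w] by blast
  have "u ^ 3 * (v\<^sup>2 * w) + 3 * (v * (t\<^sup>2 * (v\<^sup>2 * w))) + u * (v * dg ka (v\<^sup>2 * w)) - u * v ^ 3 * w' \<in> S"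
   by (intro sub3_diff[OF S] ka n1 w' mc w multc_power uvt)
  then show ?thesis unfolding w' by (simp add: algebra_simps power2_eq_square power3_eq_cube)
 qed
 have A: "u ^ 3 * v\<^sup>2 * w \<in> S" if w: "w \<in> C" for w
 proof -
  \<comment> \<open>The factors 1, -3, 9 cancel the two other cyclic images and leave 1 + 27 = 28
    times the wanted term.\<close>
  have "(u ^ 3 * v\<^sup>2 * w + 3 * (v ^ 3 * t\<^sup>2 * w)) - 3 * (v ^ 3 * t\<^sup>2 * w + 3 * (t ^ 3 * u\<^sup>2 * w))
     + 9 * (t ^ 3 * u\<^sup>2 * w + 3 * (u ^ 3 * v\<^sup>2 * w)) \<in> S"
   by (intro sub3_add[OF S] sub3_diff[OF S] sub3_numeral[OF S] *[OF u v w n(1) r1] *[OF v t w n(2) r2] *[OF t u w n(3) r3])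
  then have "cc 28 * (u ^ 3 * v\<^sup>2 * w) \<in> S" by (simp add: algebra_simps cc_numeral)
  then show ?thesis using sub3_cancel[OF S] by (metis zero_neq_numeral)
 qed
 then show "u ^ 3 * v\<^sup>2 * w \<in> S" using w by blast
 obtain ka where ka: "bdd3 ka" "!!w. w \<in> C ==> u ^ 3 * w + 3 * (v * (t\<^sup>2 * w)) + u * (v * dg ka w) \<in> S"
   using r1 by blast
 have B: "u ^ 5 * v * w \<in> S" if w: "w \<in> C" for w
 proof -
  have mq: "multc C (u\<^sup>2 * v)" by (intro multc_mult multc_power u v)
  obtain w' where w': "w' \<in> C" "dg ka (u\<^sup>2 * v * w) = u\<^sup>2 * v * w'" using factor[OF ka(1) mq w] by blast
  have "u ^ 3 * (u\<^sup>2 * v * w) + 3 * (v * (t\<^sup>2 * (u\<^sup>2 * v * w))) + u * (v * dg ka (u\<^sup>2 * v * w))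
    - u ^ 3 * v\<^sup>2 * w' - 3 * (u * v * t * (u * (v * (t * w)))) \<in> S"
   by (intro sub3_diff[OF S] sub3_numeral[OF S] ka A w' mc mq w m u v t)
  then show ?thesis unfolding w' by (simp add: algebra_simps power_numeral_reduce)
 qed
 then show "u ^ 5 * v * w \<in> S" using w by blast
 obtain w' where w': "w' \<in> C" "dg ka (u^4 * w) = u^4 * w'" using factor[OF ka(1) multc_power[OF u] w] by blast
 have "u ^ 3 * (u^4 * w) + 3 * (v * (t\<^sup>2 * (u^4 * w))) + u * (v * dg ka (u^4 * w))
   - u ^ 5 * v * w' - 3 * (u * v * t * (u^3 * (t * w))) \<in> S"
  by (intro sub3_diff[OF S] sub3_numeral[OF S] ka B w' mc w m u v t multc_power)
 then show "u ^ 7 * w \<in> S" unfolding w' by (simp add: algebra_simps power_numeral_reduce)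
qed

section \<open>Differential operators and radial primitives\<close>

definition lift_fps :: "('a::comm_ring_1 => 'a) => 'a fps => 'a fps" where
 "lift_fps D P = Abs_fps (%i. D (fps_nth P i))"

definition derivation :: "('a::comm_ring_1 => 'a) => bool" where
 "derivation D \<longleftrightarrow> (\<forall>x y. D (x + y) = D x + D y) & (\<forall>x y. D (x * y) = D x * y + x * D y)"

lemma derivation_0: "derivation D ==> D 0 = 0"
 unfolding derivation_def by (metis add_cancel_right_left)

lemma derivation_fps_deriv: "derivation fps_deriv"
 by (simp add: derivation_def algebra_simps)

lemma derivation_lift: assumes "derivation D" shows "derivation (lift_fps D)"
proof -
 have sum: "D (sum g A) = (\<Sum>a\<in>A. D (g a))" for g and A :: "nat set"
  by (induction A rule: infinite_finite_induct) (use assms derivation_0[OF assms] in \<open>auto simp: derivation_def\<close>)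
 have "D (x * y) = D x * y + x * D y" "D (x + y) = D x + D y" for x y using assms by (auto simp: derivation_def)
 then show ?thesis
  unfolding derivation_def lift_fps_def by (auto simp: fps_eq_iff fps_mult_nth sum sum.distrib)
qed

definition dX :: "ps3 => ps3" where "dX = fps_deriv"
definition dY :: "ps3 => ps3" where "dY = lift_fps fps_deriv"
definition dZ :: "ps3 => ps3" where "dZ = lift_fps (lift_fps fps_deriv)"

lemma derivation_dX: "derivation dX" and derivation_dY: "derivation dY" and derivation_dZ: "derivation dZ"
 by (simp_all add: dX_def dY_def dZ_def derivation_lift derivation_fps_deriv)

lemma derivation_rules:
 assumes "derivation D"
 shows "D (x + y) = D x + D y" "D (x * y) = D x * y + x * D y" "D 0 = 0" "D 1 = 0" "D (- x) = - D x" "D (x - y) = D x - D y"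
  "D (numeral n) = 0" "D (x ^ m) = of_nat m * x ^ (m - 1) * D x"
proof -
 show 1: "D (x + y) = D x + D y" and 2: "D (x * y) = D x * y + x * D y" for x y
  using assms by (auto simp: derivation_def)
 show 0: "D 0 = 0" by (rule derivation_0[OF assms])
 show 3: "D 1 = 0" using 2[of 1 1] by simp
 show 4: "D (- x) = - D x" for x using 1[of x "-x"] 0 by (simp add: add_eq_0_iff)
 show "D (x - y) = D x - D y" using 1[of x "-y"] 4[of y] by simp
 have nat: "D (of_nat n) = 0" for n by (induction n) (simp_all add: 0 1 3)
 show "D (numeral n) = 0" using nat[of "numeral n"] by simp
 show "D (x ^ m) = of_nat m * x ^ (m - 1) * D x"
 proof (induction m)
  case (Suc m)
  then show ?case by (cases m) (simp_all add: 2 algebra_simps)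
 qed (simp add: 3)
qed

lemmas dX_rules [simp] = derivation_rules[OF derivation_dX]
lemmas dY_rules [simp] = derivation_rules[OF derivation_dY]
lemmas dZ_rules [simp] = derivation_rules[OF derivation_dZ]

lemma cf_dX [simp]: "cf (dX P) i j k = of_nat (Suc i) * cf P (Suc i) j k"
 by (simp add: cf_def dX_def flip: fps_of_nat del: of_nat_Suc)
lemma cf_dY [simp]: "cf (dY P) i j k = of_nat (Suc j) * cf P i (Suc j) k"
 by (simp add: cf_def dY_def lift_fps_def flip: fps_of_nat del: of_nat_Suc)
lemma cf_dZ [simp]: "cf (dZ P) i j k = of_nat (Suc k) * cf P i j (Suc k)"
 by (simp add: cf_def dZ_def lift_fps_def)

lemma d_vars [simp]: "dX cX = 1" "dX cY = 0" "dX cZ = 0" "dY cX = 0" "dY cY = 1" "dY cZ = 0"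
 "dZ cX = 0" "dZ cY = 0" "dZ cZ = 1" "dX (cc c) = 0" "dY (cc c) = 0" "dZ (cc c) = 0"
 by (simp_all add: dX_def dY_def dZ_def lift_fps_def cX_def cY_def cZ_def cc_def fps_eq_iff)

definition div3 :: "ps3 => ps3 => ps3 => ps3" where "div3 a b c = dX a + dY b + dZ c"

text \<open>\<open>Einv\<close> and \<open>E2inv\<close> invert the Lie derivative along the Euler
  field on 3-forms and on 2-forms; the differentials add 3 or 2 to the degree of a monomial.\<close>

definition Einv :: "ps3 => ps3" where "Einv = dg (%i j k. 1 / of_nat (i + j + k + 3))"
definition E2inv :: "ps3 => ps3" where "E2inv = dg (%i j k. 1 / of_nat (i + j + k + 2))"

lemma div3_E2inv: "div3 (E2inv a) (E2inv b) (E2inv c) = Einv (div3 a b c)"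
proof (rule ps3_eqI)
 fix i j k
 have *: "Suc i + j + k + 2 = i + j + k + 3" "i + Suc j + k + 2 = i + j + k + 3" "i + j + Suc k + 2 = i + j + k + 3" by simp_all
 show "cf (div3 (E2inv a) (E2inv b) (E2inv c)) i j k = cf (Einv (div3 a b c)) i j k"
  by (simp only: div3_def E2inv_def Einv_def cf_dg cf_dX cf_dY cf_dZ cf_add * ) (simp add: algebra_simps add_divide_distrib)
qed

lemma euler_E2inv: "cX * dX (E2inv a) + cY * dY (E2inv a) + cZ * dZ (E2inv a) + 2 * E2inv a = a"
proof (rule ps3_eqI)
 fix i j k
 have *: "cf (cX * dX P) i j k = of_nat i * cf P i j k" "cf (cY * dY P) i j k = of_nat j * cf P i j k"
   "cf (cZ * dZ P) i j k = of_nat k * cf P i j k" for P by auto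
 have n: "of_nat i + of_nat j + of_nat k + 2 ~= (0::complex)"
  by (metis add_2_eq_Suc' nat.distinct(1) of_nat_add of_nat_eq_0_iff of_nat_numeral)
 have "cf (cX * dX (E2inv a) + cY * dY (E2inv a) + cZ * dZ (E2inv a) + 2 * E2inv a) i j k
  = (of_nat i + of_nat j + of_nat k + 2) * cf (E2inv a) i j k"
  by (simp only: cf_add * cf_numeral) (simp add: algebra_simps)
 also have "\<dots> = cf a i j k" using n by (simp add: E2inv_def del: add_2_eq_Suc add_2_eq_Suc')
 finally show "cf (cX * dX (E2inv a) + cY * dY (E2inv a) + cZ * dZ (E2inv a) + 2 * E2inv a) i j k = cf a i j k" .
qed

lemma div3_radial: "div3 (cX * Einv a) (cY * Einv a) (cZ * Einv a) = a"
proof (rule ps3_eqI)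
 fix i j k
 have *: "cf (dX (cX * P)) i j k = of_nat (i + 1) * cf P i j k" "cf (dY (cY * P)) i j k = of_nat (j + 1) * cf P i j k"
   "cf (dZ (cZ * P)) i j k = of_nat (k + 1) * cf P i j k" for P by (simp_all only: cf_dX cf_dY cf_dZ cf_cX cf_cY cf_cZ) auto
 have n: "of_nat i + of_nat j + of_nat k + 3 ~= (0::complex)"
  by (metis add_eq_0_iff_both_eq_0 of_nat_add of_nat_eq_0_iff of_nat_numeral zero_neq_numeral)
 have "cf (div3 (cX * Einv a) (cY * Einv a) (cZ * Einv a)) i j k = (of_nat i + of_nat j + of_nat k + 3) * cf (Einv a) i j k"
  by (simp only: div3_def cf_add *) (simp add: algebra_simps)
 also have "\<dots> = cf a i j k" using n by (simp add: Einv_def)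
 finally show "cf (div3 (cX * Einv a) (cY * Einv a) (cZ * Einv a)) i j k = cf a i j k" .
qed

section \<open>Order of vanishing and convergence\<close>

definition ordge :: "nat => ps3 => bool" where "ordge p P \<longleftrightarrow> (\<forall>i j k. i + j + k < p \<longrightarrow> cf P i j k = 0)"

lemma ordge_0 [simp]: "ordge 0 P" and ordge_zero [simp]: "ordge p 0" by (simp_all add: ordge_def)
lemma ordge_add: "ordge p P ==> ordge p Q ==> ordge p (P + Q)"
 and ordge_diff: "ordge p P ==> ordge p Q ==> ordge p (P - Q)"
 and ordge_uminus: "ordge p P ==> ordge p (- P)"
 and ordge_cc: "ordge p P ==> ordge p (cc c * P)"
 and ordge_numeral: "ordge p P ==> ordge p (numeral n * P)"
 and ordge_dg: "ordge p P ==> ordge p (dg ka P)"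
 and ordge_mono: "ordge p P ==> q \<le> p ==> ordge q P"
 by (auto simp: ordge_def)
lemma ordge_sum: "(!!a. a \<in> A ==> ordge p (F a)) ==> ordge p (sum F A)"
 by (simp add: ordge_def cf_sum)
lemma ordge_var: "ordge p P ==> ordge (Suc p) (cX * P)" "ordge p P ==> ordge (Suc p) (cY * P)" "ordge p P ==> ordge (Suc p) (cZ * P)"
 by (auto simp: ordge_def)
lemma ordge_d: "ordge p P ==> ordge (p - 1) (dX P)" "ordge p P ==> ordge (p - 1) (dY P)" "ordge p P ==> ordge (p - 1) (dZ P)"
 by (auto simp: ordge_def)
lemma ordge_eqI: "(!!N. ordge N (P - Q)) ==> P = Q"
 by (rule ps3_eqI) (metis (no_types, lifting) ordge_def cf_diff lessI eq_iff_diff_eq_0)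

definition conv3 :: "ps3 => bool" where
 "conv3 P \<longleftrightarrow> (\<exists>C R. \<forall>i j k. cmod (cf P i j k) \<le> C * R ^ (i + j + k))"

lemma conv3I: "(!!i j k. cmod (cf P i j k) \<le> C * R ^ (i + j + k)) ==> conv3 P" by (auto simp: conv3_def)

text \<open>The rate may be enlarged beyond any given \<open>R0\<close>, so that two series can
  share one geometric majorant or the rate can beat a constant.\<close>

lemma conv3E:
 assumes "conv3 P"
 obtains C R where "C \<ge> 0" "R \<ge> R0" "R \<ge> 1" "!!i j k. cmod (cf P i j k) \<le> C * R ^ (i + j + k)"
proof -
 obtain C R where CR: "!!i j k. cmod (cf P i j k) \<le> C * R ^ (i + j + k)" using assms by (auto simp: conv3_def)
 have C: "C \<ge> 0" using CR[of 0 0 0] norm_ge_zero[of "cf P 0 0 0"] by (simp del: norm_ge_zero)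
 let ?R = "max \<bar>R\<bar> (max 1 R0)"
 have "cmod (cf P i j k) \<le> C * ?R ^ (i + j + k)" for i j k
 proof -
  have "R ^ n \<le> \<bar>R\<bar> ^ n" for n by (metis abs_ge_self power_abs)
  moreover have "\<bar>R\<bar> ^ n \<le> ?R ^ n" for n by (intro power_mono) auto
  ultimately have "R ^ (i+j+k) \<le> ?R ^ (i+j+k)" using order_trans by blast
  then show ?thesis using CR[of i j k] C mult_left_mono order_trans by blast
 qed
 then show ?thesis using that[of C ?R] C by auto
qed

lemma conv3_add: assumes "conv3 P" "conv3 Q" shows "conv3 (P + Q)"
proof -
 obtain C R where 1: "C \<ge> 0" "R \<ge> 1" "!!i j k. cmod (cf P i j k) \<le> C * R ^ (i + j + k)" using conv3E[OF assms(1)] by metis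
 obtain C' R' where 2: "C' \<ge> 0" "R' \<ge> R" "!!i j k. cmod (cf Q i j k) \<le> C' * R' ^ (i + j + k)" using conv3E[OF assms(2), of R] by metis
 show ?thesis
 proof (rule conv3I)
  fix i j k
  have "C * R ^ (i + j + k) \<le> C * R' ^ (i + j + k)" using 1 2 by (intro mult_left_mono power_mono) auto
  then have "cmod (cf P i j k) + cmod (cf Q i j k) \<le> (C + C') * R' ^ (i + j + k)"
   using 1(3)[of i j k] 2(3)[of i j k] by (simp add: algebra_simps)
  then show "cmod (cf (P + Q) i j k) \<le> (C + C') * R' ^ (i + j + k)"
   using norm_triangle_ineq[of "cf P i j k"] order_trans by (metis cf_add)
 qed
qed

lemma conv3_dg: assumes "conv3 P" "bdd3 ka" shows "conv3 (dg ka P)"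
proof -
 obtain C R where 1: "C \<ge> 0" "R \<ge> 1" "!!i j k. cmod (cf P i j k) \<le> C * R ^ (i + j + k)" using conv3E[OF assms(1)] by metis
 obtain B where B: "!!i j k. cmod (ka i j k) \<le> B" using assms(2) by (auto simp: bdd3_def)
 have "B \<ge> 0" using B[of 0 0 0] norm_ge_zero order_trans by blast
 show ?thesis
  by (rule conv3I[of _ "B * C" R]) (use B 1 \<open>B \<ge> 0\<close> in \<open>auto simp: norm_mult mult.assoc intro!: mult_mono\<close>)
qed

lemma conv3_0: "conv3 0" by (rule conv3I[of _ 0 0]) simp
lemma conv3_cc: "conv3 P ==> conv3 (cc c * P)"
 using conv3_dg[of P "%i j k. c"] by (auto simp: dg_const bdd3_def)
lemma conv3_numeral: "conv3 P ==> conv3 (numeral n * P)"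
 using conv3_cc[of P "numeral n"] by (simp add: cc_numeral)
lemma conv3_uminus: "conv3 P ==> conv3 (- P)"
 using conv3_cc[of P "-1"] by (simp add: cc_uminus)
lemma conv3_diff: "conv3 P ==> conv3 Q ==> conv3 (P - Q)"
 using conv3_add[of P "-Q"] conv3_uminus[of Q] by simp

lemma conv3_var: assumes "conv3 P" shows "conv3 (cX * P)" "conv3 (cY * P)" "conv3 (cZ * P)"
proof -
 obtain C R where 1: "C \<ge> 0" "R \<ge> 1" "!!i j k. cmod (cf P i j k) \<le> C * R ^ (i + j + k)" using conv3E[OF assms(1)] by metis
 have *: "C * R ^ m \<le> C * R ^ n" if "m \<le> n" for m n using that 1 by (intro mult_left_mono power_increasing) auto
 show "conv3 (cX * P)" by (rule conv3I[of _ C R]) (use 1(1,2) order_trans[OF 1(3) *] in auto)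
 show "conv3 (cY * P)" by (rule conv3I[of _ C R]) (use 1(1,2) order_trans[OF 1(3) *] in auto)
 show "conv3 (cZ * P)" by (rule conv3I[of _ C R]) (use 1(1,2) order_trans[OF 1(3) *] in auto)
qed

lemma conv3_mk_shift:
 assumes "conv3 P" "!!i j k. g i j k = 0 \<or> (\<exists>i' j' k'. g i j k = cf P i' j' k' & i' + j' + k' \<le> i + j + k + n)"
 shows "conv3 (mk g)"
proof -
 obtain C R where 1: "C \<ge> 0" "R \<ge> 1" "!!i j k. cmod (cf P i j k) \<le> C * R ^ (i + j + k)" using conv3E[OF assms(1)] by metis
 have *: "C * R ^ m \<le> C * R ^ n" if "m \<le> n" for m n using that 1 by (intro mult_left_mono power_increasing) auto
 show ?thesis
 proof (rule conv3I[of _ "C * R ^ n" R])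
  fix i j k
  have "cmod (g i j k) \<le> C * R ^ (i + j + k + n)"
   using assms(2)[of i j k] 1 order_trans[OF 1(3) *] by fastforce
  then show "cmod (cf (mk g) i j k) \<le> C * R ^ n * R ^ (i + j + k)" by (simp add: power_add mult_ac)
 qed
qed

lemma conv3_d: assumes "conv3 P" shows "conv3 (dX P)" "conv3 (dY P)" "conv3 (dZ P)"
proof -
 obtain C R where 1: "C \<ge> 0" "R \<ge> 1" "!!i j k. cmod (cf P i j k) \<le> C * R ^ (i + j + k)" using conv3E[OF assms(1)] by metis
 have *: "of_nat (Suc a) * cmod (cf P i j k) \<le> (C * R * 2) * (2 * R) ^ n"
  if "a \<le> n" "i + j + k = Suc n" for a i j k n
 proof -
  have "a < 2 ^ n" using that(1) less_exp[of n] by linarith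
  then have "Suc a \<le> 2 ^ n" by simp
  then have "real (Suc a) \<le> 2 ^ n" by (metis of_nat_le_iff of_nat_numeral of_nat_power)
  then have "of_nat (Suc a) * cmod (cf P i j k) \<le> 2 ^ n * (C * R ^ (Suc n))"
   using 1(3)[of i j k] that 1 by (intro mult_mono) auto
  also have "\<dots> \<le> (C * R * 2) * (2 * R) ^ n" using 1 by (simp add: power_mult_distrib)
  finally show ?thesis .
 qed
 show "conv3 (dX P)" by (rule conv3I[of _ "C * R * 2" "2 * R"]) (simp only: cf_dX norm_mult norm_of_nat, rule *, auto)
 show "conv3 (dY P)" by (rule conv3I[of _ "C * R * 2" "2 * R"]) (simp only: cf_dY norm_mult norm_of_nat, rule *, auto)
 show "conv3 (dZ P)" by (rule conv3I[of _ "C * R * 2" "2 * R"]) (simp only: cf_dZ norm_mult norm_of_nat, rule *, auto)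
qed

lemma conv3_var_power: "conv3 P ==> conv3 (cX ^ n * P)" "conv3 P ==> conv3 (cY ^ n * P)" "conv3 P ==> conv3 (cZ ^ n * P)"
 by (induction n) (simp_all add: mult.assoc conv3_var)

section \<open>A recursion along the diagonal\<close>

fun solve3 :: "(nat => nat => nat => complex) => ps3 => nat => nat => nat => complex" where
 "solve3 ka g (Suc i) (Suc j) (Suc k) = cf g (Suc i) (Suc j) (Suc k) + ka i j k * solve3 ka g i j k"
| "solve3 ka g i j k = cf g i j k"

lemma solve3: "mk (solve3 ka g) - cX * cY * cZ * dg ka (mk (solve3 ka g)) = g"
proof (rule ps3_eqI)
 fix i j k
 show "cf (mk (solve3 ka g) - cX * cY * cZ * dg ka (mk (solve3 ka g))) i j k = cf g i j k"
  by (cases i; cases j; cases k) (simp_all add: mult.assoc)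
qed

definition C3 :: "nat => ps3 set" where "C3 p = {P. conv3 P & ordge p P}"

text \<open>Each step of the recursion lowers all three exponents by one, hence leaves a factor R^3
  to spare. With R at least 1 and 2 B the bound 2 C R^n reproduces itself: B times 2 C R^n is at
  most C R^(n+3), and the new coefficient of \<open>g\<close> adds at most as much.\<close>

lemma solvable_C3: "solvable3 (C3 p)"
 unfolding solvable3_def
proof (intro allI ballI impI)
 fix ka g assume g: "g \<in> C3 p" and ka: "bdd3 ka"
 obtain B where B: "!!i j k. cmod (ka i j k) \<le> B" using ka by (auto simp: bdd3_def)
 have B0: "B \<ge> 0" using B[of 0 0 0] norm_ge_zero order_trans by blast
 obtain C R where CR: "C \<ge> 0" "R \<ge> 1" "R \<ge> 2 * B" "!!i j k. cmod (cf g i j k) \<le> C * R ^ (i + j + k)"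
  using g conv3E[of g "2 * B"] unfolding C3_def by (metis (no_types, lifting) mem_Collect_eq)
 have "cmod (solve3 ka g i j k) \<le> 2 * C * R ^ (i + j + k)" for i j k
 proof (induction ka g i j k rule: solve3.induct[where P="%ka' g' i j k. ka' = ka \<longrightarrow> g' = g \<longrightarrow> cmod (solve3 ka' g' i j k) \<le> 2 * C * R ^ (i + j + k)", simplified atomize_imp, rule_format])
  case (1 ka' g' i j k)
  have "cmod (ka i j k * solve3 ka g i j k) \<le> B * (2 * C * R ^ (i + j + k))"
   unfolding norm_mult using 1 B B0 CR by (intro mult_mono) auto
  also have "\<dots> = (2 * B) * (C * R ^ (i + j + k))" by simp
  also have "\<dots> \<le> R ^ 3 * (C * R ^ (i + j + k))"
  proof (intro mult_right_mono)
   have "R ^ 1 \<le> R ^ 3" using CR by (intro power_increasing) auto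
   then show "2 * B \<le> R ^ 3" using CR by simp
  qed (use CR in auto)
  finally have "cmod (ka i j k * solve3 ka g i j k) \<le> C * R ^ (Suc i + Suc j + Suc k)"
   by (simp add: power3_eq_cube mult_ac)
  then have "cmod (cf g (Suc i) (Suc j) (Suc k) + ka i j k * solve3 ka g i j k) \<le> 2 * C * R ^ (Suc i + Suc j + Suc k)"
   using CR(4)[of "Suc i" "Suc j" "Suc k"] norm_triangle_ineq[of "cf g (Suc i) (Suc j) (Suc k)" "ka i j k * solve3 ka g i j k"] by linarith
  then show ?case using 1 by simp
 qed (use CR in \<open>auto intro!: order_trans[OF CR(4)] mult_right_mono\<close>)
 then have "conv3 (mk (solve3 ka g))" by (intro conv3I) simp
 moreover have "solve3 ka g i j k = 0" if "i + j + k < p" for i j k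
  using that g by (induction ka g i j k rule: solve3.induct) (auto simp: C3_def ordge_def)
 ultimately have "mk (solve3 ka g) \<in> C3 p" by (simp add: C3_def ordge_def)
 then show "\<exists>w\<in>C3 p. w - cX * cY * cZ * dg ka w = g" using solve3 by blast
qed

lemma closed_C3: "closed3 (C3 p)"
 unfolding closed3_def sub3_def C3_def
 by (auto simp: conv3_0 conv3_add conv3_cc conv3_var conv3_dg ordge_add ordge_cc ordge_dg intro: ordge_var[THEN ordge_mono])

lemma closed_UNIV: "closed3 UNIV" and solvable_UNIV: "solvable3 UNIV"
 unfolding closed3_def sub3_def solvable3_def using solve3 by auto
lemma closed_ordge: "closed3 {P. ordge p P}"
 unfolding closed3_def sub3_def
 by (auto simp: ordge_add ordge_cc ordge_dg intro: ordge_var[THEN ordge_mono])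

lemma cf_var_power: "cf (cX ^ n * P) i j k = (if i < n then 0 else cf P (i - n) j k)"
 "cf (cY ^ n * P) i j k = (if j < n then 0 else cf P i (j - n) k)"
 "cf (cZ ^ n * P) i j k = (if k < n then 0 else cf P i j (k - n))"
 by (induction n arbitrary: i j k) (auto simp: mult.assoc)

text \<open>A monomial with all exponents below n has degree at most 3 n - 3. The three parts are
  cut out disjointly, by the first variable whose exponent reaches n, so orders drop by exactly n
  and convergence is inherited.\<close>

lemma decompose_powers:
 assumes "ordge (3 * n - 2) P" "n \<ge> 1"
 obtains A B C where "P = cX ^ n * A + cY ^ n * B + cZ ^ n * C"
  "!!q. ordge q P ==> ordge (q - n) A & ordge (q - n) B & ordge (q - n) C"
  "conv3 P ==> conv3 A & conv3 B & conv3 C"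
proof
 define a where "a = (%i j k. cf P (i + n) j k)"
 define b where "b = (%i j k. if i < n then cf P i (j + n) k else 0)"
 define c where "c = (%i j k. if i < n & j < n then cf P i j (k + n) else 0)"
 show "P = cX ^ n * mk a + cY ^ n * mk b + cZ ^ n * mk c"
 proof (rule ps3_eqI)
  fix i j k
  have "cf P i j k = 0" if "i < n" "j < n" "k < n"
  proof -
   have "i + j + k < 3 * n - 2" using that assms(2) by linarith
   then show ?thesis using assms(1) by (auto simp: ordge_def)
  qed
  then show "cf P i j k = cf (cX ^ n * mk a + cY ^ n * mk b + cZ ^ n * mk c) i j k"
   by (auto simp: cf_var_power a_def b_def c_def)
 qed
 show "ordge (q - n) (mk a) & ordge (q - n) (mk b) & ordge (q - n) (mk c)" if "ordge q P" for q
  using that by (auto simp: ordge_def a_def b_def c_def)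
 assume P: "conv3 P"
 show "conv3 (mk a) & conv3 (mk b) & conv3 (mk c)"
 proof (intro conjI conv3_mk_shift[OF P, where n=n])
  fix i j k
  show "a i j k = 0 \<or> (\<exists>i' j' k'. a i j k = cf P i' j' k' & i' + j' + k' \<le> i + j + k + n)"
   by (intro disjI2 exI[of _ "i + n"] exI[of _ j] exI[of _ k]) (simp add: a_def)
  show "b i j k = 0 \<or> (\<exists>i' j' k'. b i j k = cf P i' j' k' & i' + j' + k' \<le> i + j + k + n)"
   by (cases "i < n", intro disjI2 exI[of _ i] exI[of _ "j + n"] exI[of _ k]) (simp_all add: b_def)
  show "c i j k = 0 \<or> (\<exists>i' j' k'. c i j k = cf P i' j' k' & i' + j' + k' \<le> i + j + k + n)"
   by (cases "i < n & j < n", intro disjI2 exI[of _ i] exI[of _ j] exI[of _ "k + n"]) (auto simp: c_def)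
 qed
qed

section \<open>The Jacobian ideal and the operator b on convergent series\<close>

locale klein =
 fixes lam :: complex
 assumes lam: "lam ~= 0"
begin

definition fp :: ps3 where "fp = cX * cY ^ 3 + cY * cZ ^ 3 + cZ * cX ^ 3 + cc lam * (cX * cY * cZ)"
definition fx :: ps3 where "fx = cY ^ 3 + 3 * (cZ * cX\<^sup>2) + cc lam * (cY * cZ)"
definition fy :: ps3 where "fy = cZ ^ 3 + 3 * (cX * cY\<^sup>2) + cc lam * (cZ * cX)"
definition fz :: ps3 where "fz = cX ^ 3 + 3 * (cY * cZ\<^sup>2) + cc lam * (cX * cY)"

lemma d_fp: "dX fp = fx" "dY fp = fy" "dZ fp = fz"
 by (simp_all add: fp_def fx_def fy_def fz_def algebra_simps power2_eq_square power3_eq_cube)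

lemma d_fxyz: "dY fx = dX fy" "dZ fx = dX fz" "dZ fy = dY fz"
 by (simp_all add: fx_def fy_def fz_def algebra_simps power2_eq_square power3_eq_cube)

definition dfw :: "ps3 => ps3 => ps3 => ps3" where "dfw a b c = fx * a + fy * b + fz * c"

text \<open>The Euler field sends f to 4 f - lam xyz, because three monomials of f have degree 4 and
  xyz has degree 3. So this is df wedge the radial primitive of \<open>v\<close>.\<close>

definition beta :: "ps3 => ps3" where "beta v = (4 * fp - cc lam * (cX * cY * cZ)) * Einv v"

lemma dfw_radial: "dfw (cX * u) (cY * u) (cZ * u) = (4 * fp - cc lam * (cX * cY * cZ)) * u"
 by (simp add: dfw_def fp_def fx_def fy_def fz_def algebra_simps power2_eq_square power3_eq_cube)

text \<open>The Taylor series of the elements of d(Ker df).\<close>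

definition Dc :: "ps3 set" where
 "Dc = {div3 a b c | a b c. conv3 a & conv3 b & conv3 c & dfw a b c = 0}"

lemma dfw_add: "dfw (a + a') (b + b') (c + c') = dfw a b c + dfw a' b' c'" by (simp add: dfw_def algebra_simps)
lemma dfw_cc: "dfw (cc d * a) (cc d * b) (cc d * c) = cc d * dfw a b c" by (simp add: dfw_def algebra_simps)
lemma div3_add: "div3 (a + a') (b + b') (c + c') = div3 a b c + div3 a' b' c'" by (simp add: div3_def algebra_simps)
lemma div3_cc: "div3 (cc d * a) (cc d * b) (cc d * c) = cc d * div3 a b c" by (simp add: div3_def algebra_simps)
lemma dfw_diff: "dfw (a - a') (b - b') (c - c') = dfw a b c - dfw a' b' c'" by (simp add: dfw_def algebra_simps)
lemma div3_diff: "div3 (a - a') (b - b') (c - c') = div3 a b c - div3 a' b' c'" by (simp add: div3_def algebra_simps)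

lemma sub3_Dc: "sub3 Dc"
 unfolding sub3_def
proof (intro conjI ballI allI)
 have "(0::ps3) = div3 0 0 0" "dfw 0 0 0 = 0" by (simp_all add: div3_def dfw_def)
 then show "0 \<in> Dc" unfolding Dc_def using conv3_0 by blast
 fix P assume "P \<in> Dc"
 then obtain a b c where P: "P = div3 a b c" "conv3 a" "conv3 b" "conv3 c" "dfw a b c = 0" by (auto simp: Dc_def)
 show "cc d * P \<in> Dc" for d
  unfolding Dc_def P(1) div3_cc[symmetric] using P by (auto simp: dfw_cc intro!: exI conv3_cc)
 fix Q assume "Q \<in> Dc"
 then obtain a' b' c' where Q: "Q = div3 a' b' c'" "conv3 a'" "conv3 b'" "conv3 c'" "dfw a' b' c' = 0" by (auto simp: Dc_def)
 show "P + Q \<in> Dc"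
  unfolding Dc_def P(1) Q(1) div3_add[symmetric] using P Q
  by (intro CollectI exI conjI) (rule refl, auto simp: dfw_add conv3_add)
qed

lemma conv3_gradient: "conv3 P ==> conv3 (fx * P)" "conv3 P ==> conv3 (fy * P)" "conv3 P ==> conv3 (fz * P)"
 and conv3_fp: "conv3 P ==> conv3 (fp * P)"
 unfolding fx_def fy_def fz_def fp_def distrib_right mult.assoc
 by (intro conv3_add conv3_numeral conv3_cc conv3_var conv3_var_power | assumption)+

lemma conv3_Einv: "conv3 P ==> conv3 (Einv P)" and conv3_E2inv: "conv3 P ==> conv3 (E2inv P)"
 unfolding Einv_def E2inv_def
 by (intro conv3_dg bdd3I[of _ 1]; simp only: norm_divide norm_of_nat norm_one; simp add: divide_simps)+

text \<open>A divergence-free field is a curl, and the divergence of a cross product with the gradient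
 of \<open>f\<close> is minus the pairing of that gradient with the curl.\<close>

lemma dfw_closed_in_Dc:
 assumes c: "conv3 a" "conv3 b" "conv3 c" and 0: "div3 a b c = 0"
 shows "dfw a b c \<in> Dc"
proof -
 define a' b' c' where "a' = E2inv a" and "b' = E2inv b" and "c' = E2inv c"
 have c': "conv3 a'" "conv3 b'" "conv3 c'" using c by (simp_all add: a'_def b'_def c'_def conv3_E2inv)
 have "div3 a' b' c' = Einv 0" by (simp add: a'_def b'_def c'_def div3_E2inv 0)
 then have z0: "dX a' + dY b' + dZ c' = 0" by (simp add: div3_def Einv_def ps3_eqI)
 define x1 x2 x3 where "x1 = cZ * b' - cY * c'" and "x2 = cX * c' - cZ * a'" and "x3 = cY * a' - cX * b'"
 have cx: "conv3 x1" "conv3 x2" "conv3 x3" unfolding x1_def x2_def x3_def by (intro conv3_diff conv3_var c')+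
 have curl: "dY x3 - dZ x2 = a" "dZ x1 - dX x3 = b" "dX x2 - dY x1 = c"
 proof -
  have dc: "dZ c' = - dX a' - dY b'" using z0 by (simp add: algebra_simps eq_neg_iff_add_eq_0)
  have e: "cX * dX a' + cY * dY a' + cZ * dZ a' + 2 * a' = a"
   "cX * dX b' + cY * dY b' + cZ * dZ b' + 2 * b' = b"
   "cX * dX c' + cY * dY c' + cZ * dZ c' + 2 * c' = c"
   by (simp_all only: a'_def b'_def c'_def euler_E2inv)
  show "dY x3 - dZ x2 = a" unfolding e(1)[symmetric] by (simp add: x3_def x2_def dc algebra_simps)
  show "dZ x1 - dX x3 = b" unfolding e(2)[symmetric] by (simp add: x3_def x1_def dc algebra_simps)
  show "dX x2 - dY x1 = c" unfolding e(3)[symmetric] by (simp add: x2_def x1_def dc algebra_simps)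
 qed
 define y1 y2 y3 where "y1 = fz * x2 - fy * x3" and "y2 = fx * x3 - fz * x1" and "y3 = fy * x1 - fx * x2"
 have "dfw y1 y2 y3 = 0" by (simp add: dfw_def y1_def y2_def y3_def algebra_simps)
 moreover have "conv3 y1" "conv3 y2" "conv3 y3" unfolding y1_def y2_def y3_def by (intro conv3_diff conv3_gradient cx)+
 moreover have "div3 y1 y2 y3 = dfw a b c"
  unfolding dfw_def curl[symmetric] by (simp add: div3_def y1_def y2_def y3_def d_fxyz algebra_simps)
 ultimately show ?thesis unfolding Dc_def by (metis (mono_tags, lifting) mem_Collect_eq)
qed

text \<open>Subtracting the radial field with the same divergence leaves a divergence-free field, to
  which \<open>dfw_closed_in_Dc\<close> applies. Hence \<open>beta\<close> realises b[d eta] =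
  [df wedge eta] for every eta, independently of the primitive.\<close>

lemma dfw_beta_div:
 assumes c: "conv3 a" "conv3 b" "conv3 c"
 shows "dfw a b c - beta (div3 a b c) \<in> Dc"
proof -
 define u where "u = Einv (div3 a b c)"
 have cu: "conv3 u" unfolding u_def div3_def by (intro conv3_Einv conv3_add conv3_d c)
 have "dfw (a - cX * u) (b - cY * u) (c - cZ * u) \<in> Dc"
  by (rule dfw_closed_in_Dc) (intro conv3_diff c conv3_var cu, simp_all add: div3_diff div3_radial u_def conv3_diff c conv3_var cu[unfolded u_def])
 then show ?thesis by (simp add: dfw_diff dfw_radial beta_def u_def)
qed

text \<open>The divergence of f eta is f div(eta) plus df wedge eta, and the second term vanishes on
  Ker df.\<close>

lemma fp_Dc: "d \<in> Dc ==> fp * d \<in> Dc"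
proof -
 assume "d \<in> Dc"
 then obtain a b c where P: "d = div3 a b c" "conv3 a" "conv3 b" "conv3 c" "dfw a b c = 0" by (auto simp: Dc_def)
 have "div3 (fp * a) (fp * b) (fp * c) = fp * div3 a b c + dfw a b c"
  by (simp add: div3_def dfw_def d_fp algebra_simps)
 moreover have "dfw (fp * a) (fp * b) (fp * c) = fp * dfw a b c" by (simp add: dfw_def algebra_simps)
 ultimately show ?thesis unfolding Dc_def using P conv3_fp by (metis (mono_tags, lifting) add.right_neutral mem_Collect_eq mult_zero_right)
qed

lemma beta_add: "beta (P + Q) = beta P + beta Q" and beta_diff: "beta (P - Q) = beta P - beta Q"
 and beta_cc: "beta (cc c * P) = cc c * beta P"
 by (simp_all only: beta_def Einv_def dg_add dg_diff dg_cc) (simp_all add: algebra_simps)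
lemma beta_0 [simp]: "beta 0 = 0" using beta_diff[of 0 0] by simp
lemma beta_Dc: "d \<in> Dc ==> beta d \<in> Dc"
proof -
 assume "d \<in> Dc"
 then obtain a b c where P: "d = div3 a b c" "conv3 a" "conv3 b" "conv3 c" "dfw a b c = 0" by (auto simp: Dc_def)
 have "- beta d \<in> Dc" using dfw_beta_div[OF P(2-4)] P by simp
 then show "beta d \<in> Dc" using sub3_uminus[OF sub3_Dc] by fastforce
qed

lemma ordge_m4: "ordge p P ==> ordge (p + 3) (cX * cY * cZ * P)"
 using ordge_var(1)[OF ordge_var(2)[OF ordge_var(3)]] by (simp add: mult.assoc numeral_eq_Suc)

lemma ordge_var_power: "ordge p P ==> ordge (p + n) (cX ^ n * P)" "ordge p P ==> ordge (p + n) (cY ^ n * P)" "ordge p P ==> ordge (p + n) (cZ ^ n * P)"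
 by (induction n) (simp_all add: mult.assoc ordge_var)

lemma ordge_fp: assumes "ordge p P" shows "ordge (p + 3) (fp * P)"
proof -
 have "ordge (p + 4) (cX * (cY ^ 3 * P))" "ordge (p + 4) (cY * (cZ ^ 3 * P))" "ordge (p + 4) (cZ * (cX ^ 3 * P))"
  using ordge_var(1)[OF ordge_var_power(2)[OF assms, of 3]] ordge_var(2)[OF ordge_var_power(3)[OF assms, of 3]]
   ordge_var(3)[OF ordge_var_power(1)[OF assms, of 3]] by (simp_all add: numeral_eq_Suc)
 then have "ordge (p + 3) (cX * (cY ^ 3 * P))" "ordge (p + 3) (cY * (cZ ^ 3 * P))" "ordge (p + 3) (cZ * (cX ^ 3 * P))"
  by (auto intro: ordge_mono)
 then show ?thesis using ordge_m4[OF assms]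
  unfolding fp_def distrib_right mult.assoc by (intro ordge_add ordge_cc) auto
qed

lemma ordge_fp_power: "ordge p P ==> ordge (p + 3 * m) (fp ^ m * P)"
proof (induction m)
 case (Suc m)
 then show ?case using ordge_fp[of "p + 3 * m" "fp ^ m * P"] by (simp add: mult.assoc add.commute add.left_commute)
qed simp

lemma ordge_beta: assumes "ordge p P" shows "ordge (p + 3) (beta P)"
proof -
 have "ordge p (Einv P)" using assms by (simp add: Einv_def ordge_dg)
 then show ?thesis unfolding beta_def left_diff_distrib mult.assoc
  using ordge_fp ordge_m4 by (intro ordge_diff ordge_cc ordge_numeral) (auto simp: mult.assoc)
qed

lemma ordge_beta_power: "ordge p P ==> ordge (p + 3 * n) ((beta ^^ n) P)"
proof (induction n)
 case (Suc n)
 then have "ordge (p + 3 * n + 3) (beta ((beta ^^ n) P))" by (intro ordge_beta) simp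
 then show ?case by (simp add: add_ac)
qed simp

section \<open>Series of high order lie in d(Ker df) + (f^m)\<close>

definition Zs :: "nat => ps3 set" where "Zs q = {d + fp * h | d h. d \<in> Dc & h \<in> C3 q}"

lemma sub3_C3: "sub3 (C3 q)" using closed_C3 by (simp add: closed3_def)

lemma sub3_Zs: "sub3 (Zs q)"
 unfolding sub3_def
proof (intro conjI ballI allI)
 have "(0::ps3) = 0 + fp * 0" by simp
 then show "0 \<in> Zs q" unfolding Zs_def using sub3_0[OF sub3_Dc] sub3_0[OF sub3_C3] by blast
 fix P assume "P \<in> Zs q"
 then obtain d h where P: "P = d + fp * h" "d \<in> Dc" "h \<in> C3 q" by (auto simp: Zs_def)
 show "cc c * P \<in> Zs q" for c
  unfolding Zs_def P(1) using P sub3_cc[OF sub3_Dc, of d c] sub3_cc[OF sub3_C3, of h q c]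
  by (intro CollectI exI[of _ "cc c * d"] exI[of _ "cc c * h"]) (auto simp: algebra_simps)
 fix Q assume "Q \<in> Zs q"
 then obtain d' h' where Q: "Q = d' + fp * h'" "d' \<in> Dc" "h' \<in> C3 q" by (auto simp: Zs_def)
 show "P + Q \<in> Zs q"
  unfolding Zs_def P(1) Q(1) using P Q sub3_add[OF sub3_Dc, of d d'] sub3_add[OF sub3_C3, of h q h']
  by (intro CollectI exI[of _ "d + d'"] exI[of _ "h + h'"]) (auto simp: algebra_simps)
qed

lemma Einv_C3: "P \<in> C3 q ==> Einv P \<in> C3 q"
 using conv3_Einv[of P] ordge_dg[of q P] unfolding C3_def by (simp add: Einv_def)

text \<open>Modulo multiples of f only the part -lam xyz \<open>Einv\<close> of \<open>beta\<close>
  survives. So df wedge eta is small up to lam xyz times a diagonal operator applied to the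
  divergence.\<close>

lemma dfw_Zs:
 assumes "conv3 a" "conv3 b" "conv3 c" "div3 a b c \<in> C3 q"
 shows "dfw a b c + cc lam * (cX * cY * cZ * Einv (div3 a b c)) \<in> Zs q"
proof -
 have "dfw a b c + cc lam * (cX * cY * cZ * Einv (div3 a b c))
  = (dfw a b c - beta (div3 a b c)) + fp * (4 * Einv (div3 a b c))"
  by (simp add: beta_def algebra_simps)
 moreover have "4 * Einv (div3 a b c) \<in> C3 q"
  using sub3_numeral[OF sub3_C3 Einv_C3[OF assms(4)]] by blast
 ultimately show ?thesis unfolding Zs_def using dfw_beta_div[OF assms(1-3)] by blast
qed

text \<open>Fields with a single component w. For the third one the correction lam xyz
  \<open>Einv (dZ w)\<close> is lam xy times the diagonal operator with entries k/(i + j + k + 2);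
  it joins the term lam xy w of \<open>fz * w\<close> and yields the multiplier. Differentiation
  costs one order.\<close>

lemma Zs_gradient:
 assumes w: "w \<in> C3 p"
 shows "cX ^ 3 * w + 3 * (cY * (cZ\<^sup>2 * w)) + cc lam * (cX * (cY * dg (%i j k. 1 + of_nat k / of_nat (i + j + k + 2)) w)) \<in> Zs (p - 1)"
  "cY ^ 3 * w + 3 * (cZ * (cX\<^sup>2 * w)) + cc lam * (cY * (cZ * dg (%i j k. 1 + of_nat i / of_nat (i + j + k + 2)) w)) \<in> Zs (p - 1)"
  "cZ ^ 3 * w + 3 * (cX * (cY\<^sup>2 * w)) + cc lam * (cZ * (cX * dg (%i j k. 1 + of_nat j / of_nat (i + j + k + 2)) w)) \<in> Zs (p - 1)"
proof -
 have cw: "conv3 w" "ordge p w" using w by (auto simp: C3_def)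
 have k: "dg (%i j k. 1 + of_nat k / of_nat (i + j + k + 2)) w = w + cZ * Einv (dZ w)"
  "dg (%i j k. 1 + of_nat i / of_nat (i + j + k + 2)) w = w + cX * Einv (dX w)"
  "dg (%i j k. 1 + of_nat j / of_nat (i + j + k + 2)) w = w + cY * Einv (dY w)"
  by (rule ps3_eqI; auto simp: Einv_def gr0_conv_Suc algebra_simps)+
 have "dfw 0 0 w + cc lam * (cX * cY * cZ * Einv (div3 0 0 w)) \<in> Zs (p - 1)"
  by (rule dfw_Zs) (use cw in \<open>auto simp: conv3_0 div3_def C3_def conv3_d ordge_d[simplified]\<close>)
 then show "cX ^ 3 * w + 3 * (cY * (cZ\<^sup>2 * w)) + cc lam * (cX * (cY * dg (%i j k. 1 + of_nat k / of_nat (i + j + k + 2)) w)) \<in> Zs (p - 1)"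
  unfolding k by (simp add: dfw_def div3_def fz_def algebra_simps)
 have "dfw w 0 0 + cc lam * (cX * cY * cZ * Einv (div3 w 0 0)) \<in> Zs (p - 1)"
  by (rule dfw_Zs) (use cw in \<open>auto simp: conv3_0 div3_def C3_def conv3_d ordge_d[simplified]\<close>)
 then show "cY ^ 3 * w + 3 * (cZ * (cX\<^sup>2 * w)) + cc lam * (cY * (cZ * dg (%i j k. 1 + of_nat i / of_nat (i + j + k + 2)) w)) \<in> Zs (p - 1)"
  unfolding k by (simp add: dfw_def div3_def fx_def algebra_simps)
 have "dfw 0 w 0 + cc lam * (cX * cY * cZ * Einv (div3 0 w 0)) \<in> Zs (p - 1)"
  by (rule dfw_Zs) (use cw in \<open>auto simp: conv3_0 div3_def C3_def conv3_d ordge_d[simplified]\<close>)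
 then show "cZ ^ 3 * w + 3 * (cX * (cY\<^sup>2 * w)) + cc lam * (cZ * (cX * dg (%i j k. 1 + of_nat j / of_nat (i + j + k + 2)) w)) \<in> Zs (p - 1)"
  unfolding k by (simp add: dfw_def div3_def fy_def algebra_simps)
qed

text \<open>Eigenvalues of the Lie derivative along the field (p x, q y, r z)/7 on x^i y^j z^k dx dy
  dz, divided by those of the Euler field.\<close>

definition wt :: "nat => nat => nat => nat => nat => nat => complex" where
 "wt p q r i j k = of_nat (p * (i + 1) + q * (j + 1) + r * (k + 1)) / of_nat (7 * (i + j + k + 3))"

lemma wt_bounds: assumes "p \<le> 4" "q \<le> 4" "r \<le> 4" shows "bdd3 (wt p q r)" "Re (wt p q r i j k) \<le> 4/7"
proof -
 have *: "wt p q r i j k = of_real (real (p * (i + 1) + q * (j + 1) + r * (k + 1)) / real (7 * (i + j + k + 3)))" for i j k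
  by (simp add: wt_def)
 have le: "real (p * (i + 1) + q * (j + 1) + r * (k + 1)) / real (7 * (i + j + k + 3)) \<le> 4/7" for i j k
 proof -
  have "p * (i + 1) + q * (j + 1) + r * (k + 1) \<le> 4 * (i + 1) + 4 * (j + 1) + 4 * (k + 1)"
   by (intro add_mono mult_right_mono assms) auto
  then have "p * (i + 1) + q * (j + 1) + r * (k + 1) \<le> 4 * (i + j + k + 3)" by simp
  moreover have "real a / real (7 * n) \<le> 4/7" if "a \<le> 4 * n" "0 < n" for a n
   using of_nat_mono[OF that(1), where 'a=real] that(2) by (simp add: divide_simps)
  ultimately show ?thesis by (metis add_gr_0 zero_less_numeral)
 qed
 show "Re (wt p q r i j k) \<le> 4/7" using le unfolding * Re_complex_of_real .
 show "bdd3 (wt p q r)"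
 proof (rule bdd3I)
  fix i j k
  show "cmod (wt p q r i j k) \<le> 4/7" unfolding * norm_of_real using le[of i j k] by simp
 qed
qed

text \<open>The linear field (a x, b y, c z)/7 sends f to f + m: it fixes all monomials of f except
  one, which it doubles. Subtracting f w isolates that monomial, and no order is lost because the
  divergence of such a field is diagonal.\<close>

lemma Zs_weighted:
 assumes w: "w \<in> C3 p"
  and m: "7 * (m + fp) = of_nat a * (cX * fx) + of_nat b * (cY * fy) + of_nat c * (cZ * fz)"
 shows "m * w + cc lam * (cX * cY * cZ * dg (wt a b c) w) \<in> Zs p"
proof -
 have cw: "conv3 w" "ordge p w" using w by (auto simp: C3_def)
 define A B C where "A = cc (of_nat a / 7)" and "B = cc (of_nat b / 7)" and "C = cc (of_nat c / 7)"
 have cc_nat: "cc (of_nat n) = of_nat n" for n by (induction n) (simp_all add: cc_add)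
 have A7: "7 * A = of_nat a" "7 * B = of_nat b" "7 * C = of_nat c"
  unfolding A_def B_def C_def by (simp_all add: cc_nat flip: cc_mult cc_numeral)
 have d: "div3 (A * (cX * w)) (B * (cY * w)) (C * (cZ * w)) = dg (%i j k. of_nat (a * (i + 1) + b * (j + 1) + c * (k + 1)) / 7) w"
 proof (rule ps3_eqI)
  fix i j k
  have "cf (dX (A * (cX * w))) i j k = of_nat a / 7 * of_nat (i + 1) * cf w i j k"
   "cf (dY (B * (cY * w))) i j k = of_nat b / 7 * of_nat (j + 1) * cf w i j k"
   "cf (dZ (C * (cZ * w))) i j k = of_nat c / 7 * of_nat (k + 1) * cf w i j k"
   by (simp_all only: cf_dX cf_dY cf_dZ A_def B_def C_def cf_cc cf_cX cf_cY cf_cZ) (simp_all add: algebra_simps)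
  then show "cf (div3 (A * (cX * w)) (B * (cY * w)) (C * (cZ * w))) i j k = cf (dg (%i j k. of_nat (a * (i + 1) + b * (j + 1) + c * (k + 1)) / 7) w) i j k"
   by (simp only: div3_def cf_add cf_dg) (simp add: field_simps)
 qed
 have cv: "conv3 (A * (cX * w))" "conv3 (B * (cY * w))" "conv3 (C * (cZ * w))"
  unfolding A_def B_def C_def by (intro conv3_cc conv3_var cw)+
 have "div3 (A * (cX * w)) (B * (cY * w)) (C * (cZ * w)) \<in> C3 p"
 proof -
  have "conv3 (div3 (A * (cX * w)) (B * (cY * w)) (C * (cZ * w)))"
   unfolding div3_def by (intro conv3_add conv3_d cv)
  moreover have "ordge p (div3 (A * (cX * w)) (B * (cY * w)) (C * (cZ * w)))" unfolding d using cw by (rule_tac ordge_dg)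
  ultimately show ?thesis by (simp add: C3_def)
 qed
 from dfw_Zs[OF cv this] have 1: "dfw (A * (cX * w)) (B * (cY * w)) (C * (cZ * w))
  + cc lam * (cX * cY * cZ * Einv (div3 (A * (cX * w)) (B * (cY * w)) (C * (cZ * w)))) \<in> Zs p" .
 have 2: "Einv (div3 (A * (cX * w)) (B * (cY * w)) (C * (cZ * w))) = dg (wt a b c) w"
  unfolding d Einv_def dg_dg wt_def by (rule ps3_eqI) (simp add: field_simps)
 have 3: "dfw (A * (cX * w)) (B * (cY * w)) (C * (cZ * w)) = m * w + fp * w"
 proof -
  have "7 * dfw (A * (cX * w)) (B * (cY * w)) (C * (cZ * w)) = (7 * A * (cX * fx) + 7 * B * (cY * fy) + 7 * C * (cZ * fz)) * w"
   by (simp add: dfw_def algebra_simps)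
  also have "\<dots> = 7 * (m * w + fp * w)" unfolding A7 m[symmetric] by (simp add: algebra_simps)
  finally have "cc (1/7) * (cc 7 * dfw (A * (cX * w)) (B * (cY * w)) (C * (cZ * w))) = cc (1/7) * (cc 7 * (m * w + fp * w))"
   by (simp only: cc_numeral)
  then show ?thesis unfolding mult.assoc[symmetric] cc_mult[symmetric] by simp
 qed
 have "0 + fp * w \<in> Zs p" unfolding Zs_def using w sub3_0[OF sub3_Dc] by blast
 from sub3_diff[OF sub3_Zs 1 this] show ?thesis unfolding 2 3 by (simp add: algebra_simps)
qed

text \<open>For the weights (2, 4, 1) the monomial x y^3 has weight 2 + 12 = 14, while y z^3, z x^3
  and xyz have weight 7. The other two cases are cyclic images.\<close>

lemma Zs_monomials:
 assumes w: "w \<in> C3 p"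
 shows "cX * (cY ^ 3 * w) + cc lam * (cX * cY * cZ * dg (wt 2 4 1) w) \<in> Zs p"
  "cY * (cZ ^ 3 * w) + cc lam * (cX * cY * cZ * dg (wt 1 2 4) w) \<in> Zs p"
  "cZ * (cX ^ 3 * w) + cc lam * (cX * cY * cZ * dg (wt 4 1 2) w) \<in> Zs p"
 using Zs_weighted[OF w, of "cX * cY ^ 3" 2 4 1] Zs_weighted[OF w, of "cY * cZ ^ 3" 1 2 4] Zs_weighted[OF w, of "cZ * cX ^ 3" 4 1 2]
 by (simp_all add: fx_def fy_def fz_def fp_def algebra_simps power2_eq_square power3_eq_cube)

lemma Zs_mono: "q \<le> p ==> Zs p \<subseteq> Zs q"
 unfolding Zs_def C3_def using ordge_mono by blast

lemma grad_mult_bounds: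
 assumes "!!i j k. g i j k \<le> i + j + k"
 shows "bdd3 (%i j k. 1 + of_nat (g i j k) / of_nat (i + j + k + 2))"
  "Re (1 + of_nat (g i j k) / of_nat (i + j + k + 2)) \<ge> 1"
proof -
 have *: "1 + of_nat (g i j k) / of_nat (i + j + k + 2) = (of_real (1 + real (g i j k) / real (i + j + k + 2)) :: complex)" for i j k
  by simp
 show "bdd3 (%i j k. 1 + of_nat (g i j k) / of_nat (i + j + k + 2))"
 proof (rule bdd3I)
  fix i j k
  have "real (g i j k) \<le> real (i + j + k + 2)" using assms[of i j k] by (intro of_nat_mono) simp
  then have "real (g i j k) / real (i + j + k + 2) \<le> 1" by (simp add: divide_simps)
  then show "cmod (1 + of_nat (g i j k) / of_nat (i + j + k + 2)) \<le> 2" unfolding * norm_of_real by (simp del: of_nat_add)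
 qed
 show "Re (1 + of_nat (g i j k) / of_nat (i + j + k + 2)) \<ge> 1" unfolding * Re_complex_of_real by simp
qed

text \<open>\<open>cycle_step\<close> applies with multipliers of real part at least 1 from
  \<open>Zs_gradient\<close> and at most 4/7 from \<open>Zs_monomials\<close>, and the cycle puts x
  xyz, y xyz, z xyz times \<open>C3 p\<close> into \<open>Zs\<close>. The extra order of w pays for
  splitting off one variable, which gives xyz w itself; then \<open>pure_powers\<close> takes
  over.\<close>

lemma C3_pure_power:
 assumes w: "w \<in> C3 (Suc p)"
 shows "cX ^ 7 * w \<in> Zs (p - 1)" "cY ^ 7 * w \<in> Zs (p - 1)" "cZ ^ 7 * w \<in> Zs (p - 1)"
proof -
 note C = closed_C3[of p] and S = sub3_Zs[of "p - 1"]
 note mc = closed3_multc[OF C]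
 let ?m = "cX * cY * cZ"
 have mono: "P \<in> Zs p ==> P \<in> Zs (p - 1)" for P using Zs_mono[of "p - 1" p] by auto
 have gb: "bdd3 (%i j k. 1 + of_nat i / of_nat (i + j + k + 2))" "bdd3 (%i j k. 1 + of_nat j / of_nat (i + j + k + 2))" "bdd3 (%i j k. 1 + of_nat k / of_nat (i + j + k + 2))"
  using grad_mult_bounds(1)[of "%i j k. i"] grad_mult_bounds(1)[of "%i j k. j"] grad_mult_bounds(1)[of "%i j k. k"] by simp_all
 have gr: "Re (1 + of_nat i / of_nat (i + j + k + 2)) \<ge> 1" "Re (1 + of_nat j / of_nat (i + j + k + 2)) \<ge> 1" "Re (1 + of_nat k / of_nat (i + j + k + 2)) \<ge> 1" for i j k
  using grad_mult_bounds(2)[of "%i j k. i"] grad_mult_bounds(2)[of "%i j k. j"] grad_mult_bounds(2)[of "%i j k. k"] by simp_all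
 have h1: "\<exists>ka. bdd3 ka & (\<forall>w\<in>C3 p. cX * (?m * w) - cZ * (cZ * (?m * dg ka w)) \<in> Zs (p - 1))"
  by (rule cycle_step[OF C S lam mc(1,2,3) _ gb(3) gr(3) wt_bounds(1,2)[of 4 1 2] Zs_gradient(1) mono[OF Zs_monomials(3)]]) auto
 have h2: "\<exists>ka. bdd3 ka & (\<forall>w\<in>C3 p. cZ * (?m * w) - cY * (cY * (?m * dg ka w)) \<in> Zs (p - 1))"
  by (rule cycle_step[OF C S lam mc(3,1,2) _ gb(2) gr(2) wt_bounds(1,2)[of 1 2 4] Zs_gradient(3) mono[OF Zs_monomials(2)]]) (auto simp: mult_ac)
 have h3: "\<exists>ka. bdd3 ka & (\<forall>w\<in>C3 p. cY * (?m * w) - cX * (cX * (?m * dg ka w)) \<in> Zs (p - 1))"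
  by (rule cycle_step[OF C S lam mc(2,3,1) _ gb(1) gr(1) wt_bounds(1,2)[of 2 4 1] Zs_gradient(2) mono[OF Zs_monomials(1)]]) (auto simp: mult_ac)
 have X: "cX * (?m * g) \<in> Zs (p - 1)" if "g \<in> C3 p" for g
  by (rule cycle_reduction[OF C solvable_C3 S mc(1,2,3) _ _ h1 h2 h3 that]) auto
 have Y: "cY * (?m * g) \<in> Zs (p - 1)" if "g \<in> C3 p" for g
  by (rule cycle_reduction[OF C solvable_C3 S mc(2,3,1) _ _ h3 h1 h2 that]) (auto simp: mult_ac)
 have Z: "cZ * (?m * g) \<in> Zs (p - 1)" if "g \<in> C3 p" for g
  by (rule cycle_reduction[OF C solvable_C3 S mc(3,1,2) _ _ h2 h3 h1 that]) (auto simp: mult_ac)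
 have m: "?m * w \<in> Zs (p - 1)" if w: "w \<in> C3 (Suc p)" for w
 proof -
  have "ordge (3 * 1 - 2) w" using w ordge_mono[of "Suc p" w 1] by (auto simp: C3_def)
  then obtain A B C where d: "w = cX ^ 1 * A + cY ^ 1 * B + cZ ^ 1 * C"
   "!!q. ordge q w ==> ordge (q - 1) A & ordge (q - 1) B & ordge (q - 1) C"
   "conv3 w ==> conv3 A & conv3 B & conv3 C" using decompose_powers[of 1 w] by blast
  have "A \<in> C3 p" "B \<in> C3 p" "C \<in> C3 p" using d(2)[of "Suc p"] d(3) w by (auto simp: C3_def)
  then have "cX * (?m * A) + cY * (?m * B) + cZ * (?m * C) \<in> Zs (p - 1)"
   by (intro sub3_add[OF S] X Y Z)
  then show ?thesis unfolding d(1) by (simp add: algebra_simps)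
 qed
 note C1 = closed_C3[of "Suc p"]
 have sub: "w \<in> C3 (Suc p) ==> w \<in> C3 p" for w using ordge_mono[of "Suc p" w p] by (auto simp: C3_def)
 have n: "cX * cY ^ 3 * w \<in> Zs (p - 1)" "cY * cZ ^ 3 * w \<in> Zs (p - 1)" "cZ * cX ^ 3 * w \<in> Zs (p - 1)" if w: "w \<in> C3 (Suc p)" for w
 proof -
  have "cc lam * (?m * dg (wt a b c) w) \<in> Zs (p - 1)" if "a \<le> 4" "b \<le> 4" "c \<le> 4" for a b c
   using closed3_dg[OF C1 w wt_bounds(1)[OF that]] m sub3_cc[OF S] by blast
  from sub3_diff[OF S mono[OF Zs_monomials(1)[OF sub[OF w]]] this[of 2 4 1]]
   sub3_diff[OF S mono[OF Zs_monomials(2)[OF sub[OF w]]] this[of 1 2 4]]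
   sub3_diff[OF S mono[OF Zs_monomials(3)[OF sub[OF w]]] this[of 4 1 2]]
  show "cX * cY ^ 3 * w \<in> Zs (p - 1)" "cY * cZ ^ 3 * w \<in> Zs (p - 1)" "cZ * cX ^ 3 * w \<in> Zs (p - 1)" by (simp_all add: mult.assoc)
 qed
 have r: "\<exists>ka. bdd3 ka & (\<forall>w\<in>C3 (Suc p). cX ^ 3 * w + 3 * (cY * (cZ\<^sup>2 * w)) + cX * (cY * dg ka w) \<in> Zs (p - 1))"
  "\<exists>ka. bdd3 ka & (\<forall>w\<in>C3 (Suc p). cY ^ 3 * w + 3 * (cZ * (cX\<^sup>2 * w)) + cY * (cZ * dg ka w) \<in> Zs (p - 1))"
  "\<exists>ka. bdd3 ka & (\<forall>w\<in>C3 (Suc p). cZ ^ 3 * w + 3 * (cX * (cY\<^sup>2 * w)) + cZ * (cX * dg ka w) \<in> Zs (p - 1))"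
 proof -
  have e: "cc lam * (a * (b * dg mu w)) = a * (b * dg (%i j k. lam * mu i j k) w)" for a b w mu
  proof -
   have "dg (%i j k. lam * mu i j k) w = cc lam * dg mu w" by (rule ps3_eqI) simp
   then show ?thesis by (simp add: mult_ac)
  qed
  have bl: "bdd3 mu ==> bdd3 (%i j k. lam * mu i j k)" for mu
   by (rule bdd3_mult) (auto simp: bdd3_def)
  show "\<exists>ka. bdd3 ka & (\<forall>w\<in>C3 (Suc p). cX ^ 3 * w + 3 * (cY * (cZ\<^sup>2 * w)) + cX * (cY * dg ka w) \<in> Zs (p - 1))"
   by (intro exI conjI ballI, rule bl, rule gb(3)) (rule Zs_gradient(1)[OF sub, unfolded e])
  show "\<exists>ka. bdd3 ka & (\<forall>w\<in>C3 (Suc p). cY ^ 3 * w + 3 * (cZ * (cX\<^sup>2 * w)) + cY * (cZ * dg ka w) \<in> Zs (p - 1))"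
   by (intro exI conjI ballI, rule bl, rule gb(1)) (rule Zs_gradient(2)[OF sub, unfolded e])
  show "\<exists>ka. bdd3 ka & (\<forall>w\<in>C3 (Suc p). cZ ^ 3 * w + 3 * (cX * (cY\<^sup>2 * w)) + cZ * (cX * dg ka w) \<in> Zs (p - 1))"
   by (intro exI conjI ballI, rule bl, rule gb(2)) (rule Zs_gradient(3)[OF sub, unfolded e])
 qed
 have m': "cY * cZ * cX * w \<in> Zs (p - 1)" "cZ * cX * cY * w \<in> Zs (p - 1)" if "w \<in> C3 (Suc p)" for w
  using m[OF that] by (simp_all add: mult_ac)
 note mc1 = closed3_multc[OF C1]
 show "cX ^ 7 * w \<in> Zs (p - 1)" by (rule pure_powers(3)[OF C1 S mc1(1,2,3) r(1,2,3) m n(1,2,3) w])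
 show "cY ^ 7 * w \<in> Zs (p - 1)" by (rule pure_powers(3)[OF C1 S mc1(2,3,1) r(2,3,1) m'(1) n(2,3,1) w])
 show "cZ ^ 7 * w \<in> Zs (p - 1)" by (rule pure_powers(3)[OF C1 S mc1(3,1,2) r(3,1,2) m'(2) n(3,1,2) w])
qed

text \<open>Order 19 = 3 * 7 - 2 already forces a seventh power of some variable. The dependence on
  q keeps the cofactor of f at order q, so that the reduction can be iterated.\<close>

lemma high_order_in_Zs:
 assumes "w \<in> C3 (q + 20)" shows "w \<in> Zs q"
proof -
 have "ordge (3 * 7 - 2) w" using assms ordge_mono[of "q + 20" w 19] by (auto simp: C3_def)
 then obtain A B C where d: "w = cX ^ 7 * A + cY ^ 7 * B + cZ ^ 7 * C"
   "!!q. ordge q w ==> ordge (q - 7) A & ordge (q - 7) B & ordge (q - 7) C"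
   "conv3 w ==> conv3 A & conv3 B & conv3 C" using decompose_powers[of 7 w] by auto
 have "ordge (q + 13) A & ordge (q + 13) B & ordge (q + 13) C" using d(2)[of "q + 20"] assms by (simp add: C3_def add.commute[of q])
 then have "A \<in> C3 (Suc (q + 1))" "B \<in> C3 (Suc (q + 1))" "C \<in> C3 (Suc (q + 1))"
  using d(3) assms ordge_mono[of "q + 13" _ "Suc (q + 1)"] by (auto simp: C3_def)
 then show ?thesis unfolding d(1) using C3_pure_power[of _ "q + 1"] by (intro sub3_add[OF sub3_Zs]) simp_all
qed

definition Dm :: "nat => ps3 set" where "Dm m = {d + fp ^ m * h | d h. d \<in> Dc & conv3 h}"

lemma sub3_Dm: "sub3 (Dm m)"
 unfolding sub3_def
proof (intro conjI ballI allI)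
 have "(0::ps3) = 0 + fp ^ m * 0" by simp
 then show "0 \<in> Dm m" unfolding Dm_def using sub3_0[OF sub3_Dc] conv3_0 by blast
 fix P assume "P \<in> Dm m"
 then obtain d h where P: "P = d + fp ^ m * h" "d \<in> Dc" "conv3 h" by (auto simp: Dm_def)
 show "cc c * P \<in> Dm m" for c
  unfolding Dm_def P(1) using P sub3_cc[OF sub3_Dc, of d c] conv3_cc[of h c]
  by (intro CollectI exI[of _ "cc c * d"] exI[of _ "cc c * h"]) (auto simp: algebra_simps)
 fix Q assume "Q \<in> Dm m"
 then obtain d' h' where Q: "Q = d' + fp ^ m * h'" "d' \<in> Dc" "conv3 h'" by (auto simp: Dm_def)
 show "P + Q \<in> Dm m"
  unfolding Dm_def P(1) Q(1) using P Q sub3_add[OF sub3_Dc, of d d'] conv3_add[of h h']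
  by (intro CollectI exI[of _ "d + d'"] exI[of _ "h + h'"]) (auto simp: algebra_simps)
qed

text \<open>Each factor f costs order 20: the cofactor left by one round is reduced again, and f
  times \<open>Dc\<close> stays in \<open>Dc\<close>. This compares the order topology with the
  f-adic one and is what permits formal series as representatives in the completion.\<close>

theorem high_order_in_Dm: "w \<in> C3 (20 * m) ==> w \<in> Dm m"
proof -
 have "\<exists>d\<in>Dc. \<exists>h\<in>C3 q. w = d + fp ^ m * h" if "w \<in> C3 (q + 20 * m)" for q w
  using that
 proof (induction m arbitrary: q w)
  case 0
  then show ?case using sub3_0[OF sub3_Dc] by force
 next
  case (Suc m)
  then have "w \<in> C3 ((q + 20) + 20 * m)" by (simp add: add_ac)
  from Suc.IH[OF this] obtain d h where d: "d \<in> Dc" "h \<in> C3 (q + 20)" "w = d + fp ^ m * h" by blast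
  obtain d' h' where h: "d' \<in> Dc" "h' \<in> C3 q" "h = d' + fp * h'" using high_order_in_Zs[OF d(2)] by (auto simp: Zs_def)
  have "fp ^ m * d' \<in> Dc" by (induction m) (simp_all add: h fp_Dc mult.assoc)
  then have "d + fp ^ m * d' \<in> Dc" using d sub3_add[OF sub3_Dc] by blast
  moreover have "w = (d + fp ^ m * d') + fp ^ Suc m * h'" by (simp add: d h algebra_simps)
  ultimately show ?case using h by blast
 qed
 from this[of w 0] show "w \<in> C3 (20 * m) ==> w \<in> Dm m" by (auto simp: Dm_def C3_def)
qed

end

section \<open>Closures in the order topology\<close>

definition trunc3 :: "nat => ps3 => ps3" where
 "trunc3 N P = mk (%i j k. if i + j + k < N then cf P i j k else 0)"

lemma ordge_trunc3: "ordge N (P - trunc3 N P)"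
 by (simp add: ordge_def trunc3_def)

lemma ordge_trunc3_ge: "ordge p P ==> ordge p (trunc3 N P)"
 by (simp add: ordge_def trunc3_def)

lemma conv3_trunc3: "conv3 (trunc3 N P)"
proof (rule conv3I)
 fix i j k
 let ?B = "\<Sum>(a,b,c)\<in>{..<N} \<times> {..<N} \<times> {..<N}. cmod (cf P a b c)"
 have "cmod (cf P i j k) \<le> ?B" if "i + j + k < N"
  using member_le_sum[of "(i, j, k)" "{..<N} \<times> {..<N} \<times> {..<N}" "%(a,b,c). cmod (cf P a b c)"] that by auto
 moreover have "0 \<le> ?B" by (rule sum_nonneg) auto
 ultimately show "cmod (cf (trunc3 N P) i j k) \<le> ?B * 1 ^ (i + j + k)" by (simp add: trunc3_def)
qed

definition cl3 :: "ps3 set => ps3 set" where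
 "cl3 S = {P. \<forall>N. \<exists>Q\<in>S. ordge N (P - Q)}"

lemma cl3_mono: "S \<subseteq> T ==> cl3 S \<subseteq> cl3 T" by (fastforce simp: cl3_def)
lemma cl3_superset: "S \<subseteq> cl3 S"
proof
 fix P assume "P \<in> S"
 moreover have "ordge N (P - P)" for N by simp
 ultimately show "P \<in> cl3 S" unfolding cl3_def by blast
qed
lemma cl3_idem: "cl3 (cl3 S) = cl3 S"
proof
 show "cl3 (cl3 S) \<subseteq> cl3 S"
 proof
  fix P assume P: "P \<in> cl3 (cl3 S)"
  show "P \<in> cl3 S" unfolding cl3_def
  proof (intro CollectI allI)
   fix N
   obtain Q where Q: "Q \<in> cl3 S" "ordge N (P - Q)" using P unfolding cl3_def[of "cl3 S"] by blast
   obtain R where "R \<in> S" "ordge N (Q - R)" using Q(1) unfolding cl3_def by blast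
   then show "\<exists>R\<in>S. ordge N (P - R)" using ordge_add[OF Q(2), of "Q - R"] by auto
  qed
 qed
qed (rule cl3_superset)

lemma sub3_cl3: assumes S: "sub3 S" shows "sub3 (cl3 S)"
 unfolding sub3_def
proof (intro conjI ballI allI)
 show "0 \<in> cl3 S" using cl3_superset sub3_0[OF S] by blast
 fix P assume P: "P \<in> cl3 S"
 show "cc c * P \<in> cl3 S" for c unfolding cl3_def
 proof (intro CollectI allI)
  fix N obtain Q where "Q \<in> S" "ordge N (P - Q)" using P by (auto simp: cl3_def)
  then show "\<exists>Q\<in>S. ordge N (cc c * P - Q)" using sub3_cc[OF S, of Q c] ordge_cc[of N "P - Q" c]
   by (intro bexI[of _ "cc c * Q"]) (auto simp: algebra_simps)
 qed
 fix Q assume Q: "Q \<in> cl3 S"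
 show "P + Q \<in> cl3 S" unfolding cl3_def
 proof (intro CollectI allI)
  fix N obtain P' where "P' \<in> S" "ordge N (P - P')" using P by (auto simp: cl3_def)
  moreover obtain Q' where "Q' \<in> S" "ordge N (Q - Q')" using Q by (auto simp: cl3_def)
  ultimately show "\<exists>R\<in>S. ordge N (P + Q - R)" using sub3_add[OF S, of P' Q'] ordge_add[of N "P - P'" "Q - Q'"]
   by (intro bexI[of _ "P' + Q'"]) (auto simp: algebra_simps)
 qed
qed

lemma cl3_image:
 assumes P: "P \<in> cl3 S" and T: "!!Q. Q \<in> S ==> T Q \<in> S'" "!!P Q. T (P - Q) = T P - T Q" "!!N P. ordge N P ==> ordge N (T P)"
 shows "T P \<in> cl3 S'"
 unfolding cl3_def
proof (intro CollectI allI)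
 fix N obtain Q where "Q \<in> S" "ordge N (P - Q)" using P by (auto simp: cl3_def)
 then show "\<exists>Q\<in>S'. ordge N (T P - Q)" using T by (metis (no_types, lifting))
qed

lemma cl3_limit:
 assumes "S = cl3 S" "!!N. \<exists>Q\<in>S. ordge N (P - Q)" shows "P \<in> S"
 using assms unfolding cl3_def by blast

text \<open>The sum of a series whose n-th term has order at least n: a coefficient of degree d sees
  only the terms up to d.\<close>

definition fsum :: "(nat => ps3) => ps3" where
 "fsum a = mk (%i j k. \<Sum>n\<le>i + j + k. cf (a n) i j k)"

lemma ordge_fsum: assumes "!!n. ordge n (a n)" shows "ordge N (fsum a - (\<Sum>n<N. a n))"
 unfolding ordge_def
proof (intro allI impI)
 fix i j k assume *: "i + j + k < N"
 have "(\<Sum>n<N. cf (a n) i j k) = (\<Sum>n\<le>i + j + k. cf (a n) i j k)"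
  by (rule sum.mono_neutral_right) (use * assms in \<open>auto simp: ordge_def\<close>)
 then show "cf (fsum a - (\<Sum>n<N. a n)) i j k = 0" by (simp add: fsum_def cf_sum)
qed

lemma fsum_add: "fsum (%n. a n + b n) = fsum a + fsum b"
 by (rule ps3_eqI) (simp add: fsum_def sum.distrib)

context klein begin

lemma ordge_fp_le: "ordge N P ==> ordge N (fp * P)"
 and ordge_fp_power_le: "ordge N P ==> ordge N (fp ^ m * P)"
 and ordge_beta_le: "ordge N P ==> ordge N (beta P)"
 using ordge_mono[OF ordge_fp] ordge_mono[OF ordge_fp_power] ordge_mono[OF ordge_beta] by simp_all

lemma conv3_fp_power: "conv3 h ==> conv3 (fp ^ m * h)"
 by (induction m) (simp_all add: conv3_fp mult.assoc)

lemma conv3_Dc: "d \<in> Dc ==> conv3 d"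
 by (auto simp: Dc_def div3_def intro!: conv3_add conv3_d)

lemma conv3_Dm: "P \<in> Dm m ==> conv3 P"
 by (auto simp: Dm_def conv3_Dc conv3_fp_power conv3_add)

section \<open>Relations between formal series\<close>

definition Dhat :: "ps3 set" where "Dhat = cl3 Dc"
definition Dh :: "nat => ps3 set" where "Dh m = cl3 (Dm m)"
text \<open>The formal series that vanish in the f-adic completion, that is, modulo d(Ker df) +
  (f^m) for every m.\<close>

definition Khat :: "ps3 set" where "Khat = (\<Inter>m. Dh m)"

lemma sub3_Dhat: "sub3 Dhat" and sub3_Dh: "sub3 (Dh m)"
 by (simp_all add: Dhat_def Dh_def sub3_cl3 sub3_Dc sub3_Dm)

lemma sub3_Khat: "sub3 Khat"
 unfolding Khat_def sub3_def using sub3_0[OF sub3_Dh] sub3_add[OF sub3_Dh] sub3_cc[OF sub3_Dh] by auto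

lemma Dhat_closed: "cl3 Dhat = Dhat" and Dh_closed: "cl3 (Dh m) = Dh m"
 by (simp_all add: Dhat_def Dh_def cl3_idem)

lemma Khat_closed: "cl3 Khat = Khat"
proof
 have "cl3 Khat \<subseteq> Dh m" for m
  using cl3_mono[of Khat "Dh m"] unfolding Dh_closed by (auto simp: Khat_def)
 then show "cl3 Khat \<subseteq> Khat" unfolding Khat_def by blast
qed (rule cl3_superset)

text \<open>It suffices to approximate up to order 20 m: the error is convergent, hence in
  \<open>Dm m\<close> by \<open>high_order_in_Dm\<close>. So taking closures adds no convergent
  series.\<close>

lemma conv3_Dh: assumes "conv3 P" "P \<in> Dh m" shows "P \<in> Dm m"
proof -
 obtain Q where Q: "Q \<in> Dm m" "ordge (20 * m) (P - Q)" using assms(2) by (auto simp: Dh_def cl3_def)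
 then have "P - Q \<in> C3 (20 * m)" using assms(1) conv3_Dm conv3_diff by (simp add: C3_def)
 then have "Q + (P - Q) \<in> Dm m" using high_order_in_Dm sub3_add[OF sub3_Dm Q(1)] by blast
 then show ?thesis by simp
qed

lemma Dm_Dh: "P \<in> Dm m ==> P \<in> Dh m" using cl3_superset by (auto simp: Dh_def)

lemma ordge_Dh: assumes "ordge (20 * m) P" shows "P \<in> Dh m"
 unfolding Dh_def cl3_def
proof (intro CollectI allI)
 fix N
 have "trunc3 N P \<in> C3 (20 * m)" using assms by (simp add: C3_def conv3_trunc3 ordge_trunc3_ge)
 then show "\<exists>Q\<in>Dm m. ordge N (P - Q)" using high_order_in_Dm ordge_trunc3 by blast
qed

lemma Dc_Dm: "Dc \<subseteq> Dm m"
proof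
 fix d assume "d \<in> Dc"
 then show "d \<in> Dm m" unfolding Dm_def using conv3_0 by (intro CollectI exI[of _ d] exI[of _ 0]) simp
qed

lemma Dhat_Dh: "Dhat \<subseteq> Dh m" unfolding Dhat_def Dh_def by (rule cl3_mono[OF Dc_Dm])
lemma Dhat_Khat: "Dhat \<subseteq> Khat" unfolding Khat_def using Dhat_Dh by blast

lemma Dm_Suc: "Dm (Suc m) \<subseteq> Dm m"
proof
 fix P assume "P \<in> Dm (Suc m)"
 then obtain d h where "d \<in> Dc" "conv3 h" "P = d + fp ^ m * (fp * h)" by (auto simp: Dm_def mult_ac)
 then show "P \<in> Dm m" unfolding Dm_def using conv3_fp by blast
qed
lemma Dh_Suc: "Dh (Suc m) \<subseteq> Dh m" unfolding Dh_def by (rule cl3_mono[OF Dm_Suc])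
lemma fp_power_Dh: "fp ^ m * P \<in> Dh m"
proof -
 have *: "fp ^ m * Q \<in> Dm m" if "conv3 Q" for Q
  unfolding Dm_def using that sub3_0[OF sub3_Dc] by (intro CollectI exI[of _ 0] exI[of _ Q]) simp
 have "P \<in> cl3 {P. conv3 P}" unfolding cl3_def using ordge_trunc3 conv3_trunc3 by blast
 then show ?thesis unfolding Dh_def
  by (rule cl3_image[where T="%P. fp ^ m * P"]) (simp_all add: * right_diff_distrib ordge_fp_power_le)
qed

lemma fp_Dh: "P \<in> Dh m ==> fp * P \<in> Dh m" unfolding Dh_def
proof (rule cl3_image[where T="%P. fp * P" and S="Dm m"])
 fix Q assume "Q \<in> Dm m"
 then obtain d h where "d \<in> Dc" "conv3 h" "Q = d + fp ^ m * h" by (auto simp: Dm_def)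
 then show "fp * Q \<in> Dm m" unfolding Dm_def using fp_Dc conv3_fp
  by (intro CollectI exI[of _ "fp * d"] exI[of _ "fp * h"]) (auto simp: algebra_simps)
qed (simp_all add: right_diff_distrib ordge_fp_le)

lemma fp_Dhat: "P \<in> Dhat ==> fp * P \<in> Dhat" unfolding Dhat_def
 by (rule cl3_image[where T="%P. fp * P" and S=Dc]) (simp_all add: fp_Dc right_diff_distrib ordge_fp_le)
lemma fp_Khat: "P \<in> Khat ==> fp * P \<in> Khat" by (auto simp: Khat_def fp_Dh)

lemma beta_Dhat: "P \<in> Dhat ==> beta P \<in> Dhat" unfolding Dhat_def
 by (rule cl3_image[where T=beta and S=Dc]) (simp_all add: beta_Dc beta_diff ordge_beta_le)

text \<open>Continuity of \<open>beta\<close> for the f-adic topology. A multiple of f^k has order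
  at least 3 k, which is at least 20 m once k >= 7 m, and \<open>beta\<close> does not lower
  orders.\<close>

lemma beta_Dh: assumes "P \<in> Dh k" "7 * m \<le> k" shows "beta P \<in> Dh m"
proof -
 obtain Q where Q: "Q \<in> Dm k" "ordge (20 * m) (P - Q)" using assms by (auto simp: Dh_def cl3_def)
 obtain d h where d: "d \<in> Dc" "conv3 h" "Q = d + fp ^ k * h" using Q by (auto simp: Dm_def)
 have "ordge (20 * m) (fp ^ k * h)" using ordge_fp_power[of 0 h k] assms(2) by (auto intro: ordge_mono)
 then have "beta (fp ^ k * h) \<in> Dh m" "beta (P - Q) \<in> Dh m"
  using Q(2) by (auto intro!: ordge_Dh intro: ordge_beta_le)
 moreover have "beta d \<in> Dh m" using beta_Dc[OF d(1)] Dc_Dm Dm_Dh by blast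
 moreover have "beta P = beta d + beta (fp ^ k * h) + beta (P - Q)" by (simp add: d flip: beta_add)
 ultimately show ?thesis using sub3_add[OF sub3_Dh] by metis
qed

lemma beta_Khat: "P \<in> Khat ==> beta P \<in> Khat" unfolding Khat_def using beta_Dh by blast

text \<open>The convergent identity for truncations passes to the closure. The truncation is taken
  at N + 1 because the divergence loses one order.\<close>

lemma dfw_beta_div_formal: "dfw a b c - beta (div3 a b c) \<in> Dhat"
 unfolding Dhat_def cl3_def
proof (intro CollectI allI)
 fix N
 let ?t = "trunc3 (Suc N)"
 let ?Q = "dfw (?t a) (?t b) (?t c) - beta (div3 (?t a) (?t b) (?t c))"
 have t: "ordge (Suc N) (P - ?t P)" for P by (rule ordge_trunc3)
 have "ordge N (div3 (a - ?t a) (b - ?t b) (c - ?t c))"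
  unfolding div3_def using ordge_d(1)[OF t[of a]] ordge_d(2)[OF t[of b]] ordge_d(3)[OF t[of c]] by (auto intro!: ordge_add)
 then have 1: "ordge N (beta (div3 (a - ?t a) (b - ?t b) (c - ?t c)))" by (rule ordge_beta_le)
 have g: "ordge q P ==> ordge q (fx * P)" "ordge q P ==> ordge q (fy * P)" "ordge q P ==> ordge q (fz * P)" for q P
 proof -
  assume P: "ordge q P"
  have v: "ordge q (cX * R)" "ordge q (cY * R)" "ordge q (cZ * R)" if "ordge q R" for R
   using ordge_var[OF that, THEN ordge_mono, of q] by simp_all
  have vp: "ordge q (cX ^ n * R)" "ordge q (cY ^ n * R)" "ordge q (cZ ^ n * R)" if "ordge q R" for R n
   using ordge_var_power[OF that, of n, THEN ordge_mono, of q] by simp_all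
  show "ordge q (fx * P)" "ordge q (fy * P)" "ordge q (fz * P)"
   unfolding fx_def fy_def fz_def distrib_right mult.assoc
   by (intro ordge_add ordge_numeral ordge_cc v vp P)+
 qed
 have 2: "ordge N (dfw (a - ?t a) (b - ?t b) (c - ?t c))"
  unfolding dfw_def by (intro ordge_add g ordge_mono[OF t]) simp_all
 have "ordge N (dfw a b c - beta (div3 a b c) - ?Q)"
  using ordge_diff[OF 2 1] by (simp add: dfw_diff div3_diff beta_diff algebra_simps)
 moreover have "?Q \<in> Dc" by (rule dfw_beta_div) (rule conv3_trunc3)+
 ultimately show "\<exists>Q\<in>Dc. ordge N (dfw a b c - beta (div3 a b c) - Q)" by blast
qed

text \<open>The relation a b = b (a + b), a form of ab - ba = b^2. It is
  \<open>dfw_beta_div_formal\<close> for f times the radial primitive of h, whose divergence is f h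
  + \<open>beta h\<close>.\<close>

lemma beta_fp_formal: "fp * beta h - beta (fp * h + beta h) \<in> Dhat"
proof -
 define u where "u = fp * Einv h"
 have 1: "div3 (cX * u) (cY * u) (cZ * u) = fp * h + beta h"
 proof -
  have "div3 (cX * u) (cY * u) (cZ * u) = fp * div3 (cX * Einv h) (cY * Einv h) (cZ * Einv h)
    + dfw (cX * Einv h) (cY * Einv h) (cZ * Einv h)"
   by (simp add: div3_def dfw_def u_def d_fp algebra_simps)
  then show ?thesis by (simp add: div3_radial dfw_radial beta_def)
 qed
 have 2: "dfw (cX * u) (cY * u) (cZ * u) = fp * beta h" by (simp add: dfw_radial u_def beta_def)
 show ?thesis using dfw_beta_div_formal[of "cX * u" "cY * u" "cZ * u"] 1 2 by simp
qed

section \<open>The action of C[[b]] and the b-torsion\<close>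

definition smp :: "complex fps => ps3 => ps3" where
 "smp S P = fsum (%n. cc (fps_nth S n) * (beta ^^ n) P)"

lemma ordge_beta_funpow: "ordge n ((beta ^^ n) P)"
 using ordge_beta_power[of 0 P n] by (auto intro: ordge_mono)

lemma smp_approx: "ordge N (smp S P - (\<Sum>n<N. cc (fps_nth S n) * (beta ^^ n) P))"
 unfolding smp_def by (rule ordge_fsum) (intro ordge_cc ordge_beta_funpow)

lemma beta_funpow_add: "(beta ^^ n) (P + Q) = (beta ^^ n) P + (beta ^^ n) Q"
 and beta_funpow_diff: "(beta ^^ n) (P - Q) = (beta ^^ n) P - (beta ^^ n) Q"
 and beta_funpow_cc: "(beta ^^ n) (cc c * P) = cc c * (beta ^^ n) P"
 and beta_funpow_0: "(beta ^^ n) 0 = 0"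
 by (induction n) (simp_all add: beta_add beta_diff beta_cc)
lemma beta_funpow_sum: "(beta ^^ n) (sum F A) = (\<Sum>a\<in>A. (beta ^^ n) (F a))"
 by (induction A rule: infinite_finite_induct) (auto simp: beta_funpow_add beta_funpow_0)

lemma smp_add: "smp S (P + Q) = smp S P + smp S Q"
 and smp_add_left: "smp (S + T) P = smp S P + smp T P"
 by (simp_all add: smp_def beta_funpow_add distrib_left distrib_right cc_add fsum_add)

lemma smp_const: "smp (fps_const c) P = cc c * P"
proof (rule ps3_eqI)
 fix i j k
 have "(\<Sum>n\<le>i+j+k. cf (cc (if n = 0 then c else 0) * (beta ^^ n) P) i j k) = (\<Sum>n\<in>{0}. cf (cc c * (beta ^^ n) P) i j k)"
  by (rule sum.mono_neutral_cong_right) auto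
 then show "cf (smp (fps_const c) P) i j k = cf (cc c * P) i j k" by (simp add: smp_def fsum_def)
qed

lemma smp_one: "smp 1 P = P" using smp_const[of 1 P] by simp
lemma smp_zero: "smp 0 P = 0" using smp_const[of 0 P] by simp

lemma beta_funpow_ordge: "ordge N P ==> ordge N ((beta ^^ n) P)"
 by (induction n) (simp_all add: ordge_beta_le)

lemma smp_ordge: "ordge N P ==> ordge N (smp S P)"
proof -
 assume "ordge N P"
 then have "ordge N (\<Sum>n<N. cc (fps_nth S n) * (beta ^^ n) P)" by (intro ordge_sum ordge_cc beta_funpow_ordge)
 from ordge_add[OF smp_approx[of N S P] this] show ?thesis by simp
qed

text \<open>Modulo order N both sides are finite double sums over powers of \<open>beta\<close>;
  they differ by the terms with n + m >= N, which themselves have order N.\<close>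

lemma smp_mult: "smp (S * T) P = smp S (smp T P)"
proof (rule ordge_eqI)
 fix N
 let ?b = "%n. (beta ^^ n) P"
 let ?s = "fps_nth S" and ?t = "fps_nth T"
 define R where "R = smp T P - (\<Sum>m<N. cc (?t m) * ?b m)"
 have R: "ordge N R" unfolding R_def by (rule smp_approx)
 define U where "U = (\<Sum>m<N. cc (?t m) * ?b m)"
 have "smp T P = U + R" by (simp add: R_def U_def)
 then have "smp S (smp T P) = smp S U + smp S R" by (simp add: smp_add)
 then have 1: "ordge N (smp S (smp T P) - (\<Sum>n<N. cc (?s n) * (beta ^^ n) U))"
  using ordge_add[OF smp_approx[of N S U] smp_ordge[OF R, of S]] by (simp add: algebra_simps)
 have 2: "(\<Sum>n<N. cc (?s n) * (beta ^^ n) U) = (\<Sum>(n,m)\<in>{..<N} \<times> {..<N}. cc (?s n * ?t m) * ?b (n + m))"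
  by (simp add: U_def beta_funpow_sum beta_funpow_cc sum_distrib_left cc_mult mult.assoc funpow_add sum.cartesian_product)
 have 3: "(\<Sum>l<N. cc (fps_nth (S * T) l) * ?b l) = (\<Sum>(n,m)\<in>{(n,m). n + m < N}. cc (?s n * ?t m) * ?b (n + m))"
 proof -
  have cc_sum: "cc (sum g A) = (\<Sum>a\<in>A. cc (g a))" for g and A :: "nat set"
   by (induction A rule: infinite_finite_induct) (auto simp: cc_add)
  have "(\<Sum>l<N. cc (fps_nth (S * T) l) * ?b l) = (\<Sum>l<N. \<Sum>n\<le>l. cc (?s n * ?t (l - n)) * ?b (n + (l - n)))"
   by (rule sum.cong) (simp_all add: fps_mult_nth atLeast0AtMost cc_sum sum_distrib_right)
  also have "\<dots> = (\<Sum>(n,m)\<in>{(n,m). n + m < N}. cc (?s n * ?t m) * ?b (n + m))"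
   using sum.triangle_reindex[of "%n m. cc (?s n * ?t m) * ?b (n + m)" N] by simp
  finally show ?thesis .
 qed
 have "(\<Sum>(n,m)\<in>{..<N} \<times> {..<N}. cc (?s n * ?t m) * ?b (n + m)) - (\<Sum>(n,m)\<in>{(n,m). n + m < N}. cc (?s n * ?t m) * ?b (n + m))
  = (\<Sum>(n,m)\<in>{..<N} \<times> {..<N} - {(n,m). n + m < N}. cc (?s n * ?t m) * ?b (n + m))"
  by (rule sum_diff[symmetric]) auto
 moreover have "ordge N \<dots>"
 proof (rule ordge_sum)
  fix x assume "x \<in> {..<N} \<times> {..<N} - {(n,m). n + m < N}"
  then show "ordge N (case x of (n, m) => cc (?s n * ?t m) * ?b (n + m))"
   by (auto intro!: ordge_cc ordge_mono[OF ordge_beta_funpow])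
 qed
 ultimately have "ordge N ((\<Sum>n<N. cc (?s n) * (beta ^^ n) U) - (\<Sum>l<N. cc (fps_nth (S * T) l) * ?b l))"
  unfolding 2 3 by simp
 from ordge_add[OF 1 this] smp_approx[of N "S * T" P]
 have "ordge N (smp S (smp T P) - (\<Sum>l<N. cc (fps_nth (S * T) l) * ?b l))" "ordge N (smp (S * T) P - (\<Sum>l<N. cc (fps_nth (S * T) l) * ?b l))" by simp_all
 from ordge_diff[OF this(2,1)] show "ordge N (smp (S * T) P - smp S (smp T P))" by simp
qed

lemma smp_X: "smp fps_X P = beta P"
proof (rule ps3_eqI)
 fix i j k
 show "cf (smp fps_X P) i j k = cf (beta P) i j k"
 proof (cases "i + j + k")
  case 0
  then show ?thesis using ordge_beta[of 0 P] by (simp add: smp_def fsum_def ordge_def)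
 next
  case (Suc n)
  have "(\<Sum>n\<le>i+j+k. cf (cc (if n = 1 then 1 else 0) * (beta ^^ n) P) i j k) = (\<Sum>n\<in>{1}. cf (cc 1 * (beta ^^ n) P) i j k)"
   by (rule sum.mono_neutral_cong_right) (use Suc in auto)
  then show ?thesis by (simp add: smp_def fsum_def)
 qed
qed

lemma smp_X_power: "smp (fps_X ^ n) P = (beta ^^ n) P"
 by (induction n) (simp_all add: smp_one smp_mult smp_X)

lemma smp_diff: "smp S (P - Q) = smp S P - smp S Q"
 using smp_add[of S "P - Q" Q] by simp
lemma smp_diff_left: "smp (S - T) P = smp S P - smp T P"
 using smp_add_left[of "S - T" T P] by simp
lemma smp_zero_right: "smp S 0 = 0" using smp_diff[of S 0 0] by simp
lemma smp_sum: "smp S (sum F A) = (\<Sum>a\<in>A. smp S (F a))"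
 by (induction A rule: infinite_finite_induct) (auto simp: smp_add smp_zero_right)
lemma smp_beta_funpow: "smp S ((beta ^^ n) P) = (beta ^^ n) (smp S P)"
 by (metis mult.commute smp_X_power smp_mult)

lemma smp_closed:
 assumes "cl3 K = K" "sub3 K" "!!P. P \<in> K ==> beta P \<in> K" "P \<in> K"
 shows "smp S P \<in> K"
proof (rule cl3_limit[OF assms(1)[symmetric]])
 fix N
 have "(beta ^^ n) P \<in> K" for n by (induction n) (auto simp: assms)
 then have "(\<Sum>n<N. cc (fps_nth S n) * (beta ^^ n) P) \<in> K" by (intro sub3_sum sub3_cc assms(2))
 then show "\<exists>Q\<in>K. ordge N (smp S P - Q)" using smp_approx by blast
qed

lemma smp_Khat: "P \<in> Khat ==> smp S P \<in> Khat" by (rule smp_closed[OF Khat_closed sub3_Khat beta_Khat])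

text \<open>The preimage of the b-torsion of the completed module; formal series modulo
  \<open>KK\<close> will be the module attached to f.\<close>

definition KK :: "ps3 set" where "KK = {P. \<exists>n. (beta ^^ n) P \<in> Khat}"

lemma Khat_funpow: "P \<in> Khat ==> (beta ^^ n) P \<in> Khat" by (induction n) (auto simp: beta_Khat)

lemma sub3_KK: "sub3 KK"
 unfolding sub3_def
proof (intro conjI ballI allI)
 show "0 \<in> KK" unfolding KK_def using sub3_0[OF sub3_Khat] by (auto simp: beta_funpow_0)
 fix P assume "P \<in> KK"
 then obtain n where n: "(beta ^^ n) P \<in> Khat" by (auto simp: KK_def)
 then show "cc c * P \<in> KK" for c unfolding KK_def using sub3_cc[OF sub3_Khat] by (auto simp: beta_funpow_cc)
 fix Q assume "Q \<in> KK"
 then obtain m where m: "(beta ^^ m) Q \<in> Khat" by (auto simp: KK_def)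
 have "(beta ^^ (n + m)) (P + Q) = (beta ^^ m) ((beta ^^ n) P) + (beta ^^ n) ((beta ^^ m) Q)"
 proof -
  have "(beta ^^ (n + m)) P = (beta ^^ m) ((beta ^^ n) P)" by (simp add: add.commute[of n] funpow_add)
  moreover have "(beta ^^ (n + m)) Q = (beta ^^ n) ((beta ^^ m) Q)" by (simp add: funpow_add)
  ultimately show ?thesis by (simp add: beta_funpow_add)
 qed
 then have "(beta ^^ (n + m)) (P + Q) \<in> Khat"
  using sub3_add[OF sub3_Khat Khat_funpow[OF n] Khat_funpow[OF m]] by simp
 then show "P + Q \<in> KK" by (auto simp: KK_def)
qed

lemma Khat_KK: "Khat \<subseteq> KK" unfolding KK_def by (auto intro: exI[of _ 0])

lemma smp_KK: "P \<in> KK ==> smp S P \<in> KK"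
 unfolding KK_def mem_Collect_eq smp_beta_funpow[symmetric] using smp_Khat by blast

lemma KK_beta_cancel: "(beta ^^ n) P \<in> KK ==> P \<in> KK"
proof -
 assume "(beta ^^ n) P \<in> KK"
 then obtain m where "(beta ^^ m) ((beta ^^ n) P) \<in> Khat" by (auto simp: KK_def)
 then have "(beta ^^ (m + n)) P \<in> Khat" by (simp add: funpow_add)
 then show ?thesis unfolding KK_def by blast
qed

text \<open>The submodule of multiples of b^n is stable under a, by the relation a b = b (a + b).
  This is what makes the tail of a series in a and b divisible by a power of b.\<close>

lemma beta_fp_funpow: "\<exists>Q. fp * (beta ^^ n) P - (beta ^^ n) Q \<in> Dhat"
proof (induction n)
 case 0
 show ?case using sub3_0[OF sub3_Dhat] by (auto intro!: exI[of _ "fp * P"])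
next
 case (Suc n)
 then obtain Q where Q: "fp * (beta ^^ n) P - (beta ^^ n) Q \<in> Dhat" by blast
 have 1: "fp * beta ((beta ^^ n) P) - beta (fp * (beta ^^ n) P + beta ((beta ^^ n) P)) + beta (fp * (beta ^^ n) P - (beta ^^ n) Q) \<in> Dhat"
  by (intro sub3_add[OF sub3_Dhat] beta_fp_formal beta_Dhat Q)
 have 2: "(beta ^^ Suc n) (Q + beta P) = beta ((beta ^^ n) Q) + beta (beta ((beta ^^ n) P))"
  by (simp add: beta_add beta_funpow_add) (simp add: funpow_swap1)
 have "fp * (beta ^^ Suc n) P - (beta ^^ Suc n) (Q + beta P) \<in> Dhat"
  using 1 unfolding 2 by (simp add: beta_add beta_diff algebra_simps)
 then show ?case by blast
qed

lemma beta_fp_power_funpow: "\<exists>Q. fp ^ i * (beta ^^ n) P - (beta ^^ n) Q \<in> Dhat"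
proof (induction i)
 case 0
 show ?case using sub3_0[OF sub3_Dhat] by (auto intro!: exI[of _ "P"])
next
 case (Suc i)
 then obtain Q where Q: "fp ^ i * (beta ^^ n) P - (beta ^^ n) Q \<in> Dhat" by blast
 obtain R where R: "fp * (beta ^^ n) Q - (beta ^^ n) R \<in> Dhat" using beta_fp_funpow by blast
 from sub3_add[OF sub3_Dhat fp_Dhat[OF Q] R] show ?case by (auto simp: algebra_simps)
qed

end

section \<open>Invariant forms and generation over C[[b]]\<close>

definition mon :: "nat \<times> nat \<times> nat => ps3" where
 "mon e = cX ^ fst e * (cY ^ fst (snd e) * cZ ^ snd (snd e))"

lemma cf_mon_mult: "cf (cX ^ a * (cY ^ b * (cZ ^ c * P))) i j k = (if a \<le> i & b \<le> j & c \<le> k then cf P (i - a) (j - b) (k - c) else 0)"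
 by (auto simp: cf_var_power)

lemma cf_mon: "cf (mon (a, b, c)) i j k = (if i = a & j = b & k = c then 1 else 0)"
 using cf_mon_mult[of a b c 1 i j k] by (auto simp: mon_def cf_one)

lemma cf_cc_const: "cf (cc c) i j k = (if i = 0 & j = 0 & k = 0 then c else 0)"
 using cf_cc[of c 1 i j k] by (simp add: cf_one)

text \<open>The projection to one residue class of i + 2 j + 4 k modulo 7; the offset
  \<open>s\<close> records the weight of the factors already pulled out in front. The volume form
  has weight 1 + 2 + 4 = 7, so invariance of a 3-form is invariance of its coefficient.\<close>

definition pz :: "nat => ps3 => ps3" where
 "pz s = dg (%i j k. if (i + 2 * j + 4 * k + s) mod 7 = 0 then 1 else 0)"

lemma pz_var: "pz s (cX * P) = cX * pz (s + 1) P" "pz s (cY * P) = cY * pz (s + 2) P" "pz s (cZ * P) = cZ * pz (s + 4) P"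
 unfolding pz_def by (simp_all add: dg_cX dg_cY dg_cZ add_ac)
lemma pz_7: "pz (s + 7) P = pz s P"
 unfolding pz_def by (simp flip: add.assoc)
lemma pz_cc: "pz s (cc c * P) = cc c * pz s P" and pz_add: "pz s (P + Q) = pz s P + pz s Q" and pz_diff: "pz s (P - Q) = pz s P - pz s Q"
 by (simp_all add: pz_def dg_cc dg_add dg_diff)
lemma pz_numeral: "pz s (numeral n * P) = numeral n * pz s P"
 using pz_cc[of s "numeral n" P] by (simp add: cc_numeral)

text \<open>The partial derivatives lower the weight by 1, 2, 4, which is a shift by 6, 5, 3 modulo
  7.\<close>

lemma pz_div3: "pz 0 (div3 a b c) = div3 (pz 6 a) (pz 5 b) (pz 3 c)"
proof (rule ps3_eqI)
 fix i j k :: nat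
 have "(Suc i + 2 * j + 4 * k + 6) mod 7 = (i + 2 * j + 4 * k) mod 7"
  "(i + 2 * Suc j + 4 * k + 5) mod 7 = (i + 2 * j + 4 * k) mod 7"
  "(i + 2 * j + 4 * Suc k + 3) mod 7 = (i + 2 * j + 4 * k) mod 7"
  by (simp_all add: mod_simps) presburger+
 then show "cf (pz 0 (div3 a b c)) i j k = cf (div3 (pz 6 a) (pz 5 b) (pz 3 c)) i j k"
  unfolding pz_def div3_def by (simp del: mult_Suc_right add_Suc add_Suc_right)
qed

definition inv7 :: "ps3 => bool" where "inv7 P \<longleftrightarrow> pz 0 P = P"

lemma inv7_iff: "inv7 P \<longleftrightarrow> (\<forall>i j k. cf P i j k ~= 0 \<longrightarrow> (i + 2 * j + 4 * k) mod 7 = 0)"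
proof
 assume "inv7 P"
 then have *: "cf (pz 0 P) i j k = cf P i j k" for i j k by (simp add: inv7_def)
 show "\<forall>i j k. cf P i j k ~= 0 \<longrightarrow> (i + 2 * j + 4 * k) mod 7 = 0"
 proof (intro allI impI)
  fix i j k assume "cf P i j k ~= 0"
  then show "(i + 2 * j + 4 * k) mod 7 = 0" using *[of i j k] by (simp add: pz_def split: if_splits)
 qed
next
 assume *: "\<forall>i j k. cf P i j k ~= 0 \<longrightarrow> (i + 2 * j + 4 * k) mod 7 = 0"
 show "inv7 P" unfolding inv7_def pz_def
 proof (rule ps3_eqI)
  fix i j k
  show "cf (dg (%i j k. if (i + 2 * j + 4 * k + 0) mod 7 = 0 then 1 else 0) P) i j k = cf P i j k"
   by (cases "cf P i j k = 0") (use * in auto)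
 qed
qed

lemma inv7_pz: "inv7 (pz 0 P)" by (auto simp: inv7_iff pz_def)
lemma inv7_add: "inv7 P ==> inv7 Q ==> inv7 (P + Q)" and inv7_diff: "inv7 P ==> inv7 Q ==> inv7 (P - Q)"
 and inv7_cc: "inv7 P ==> inv7 (cc c * P)" and inv7_dg: "inv7 P ==> inv7 (dg ka P)"
 by (auto simp: inv7_def pz_add pz_diff pz_cc) (auto simp: pz_def dg_dg mult.commute, metis dg_dg mult.commute)
lemma inv7_0: "inv7 0" by (simp add: inv7_iff)
lemma inv7_sum: "(!!a. a \<in> A ==> inv7 (F a)) ==> inv7 (sum F A)"
 by (induction A rule: infinite_finite_induct) (auto simp: inv7_0 inv7_add)
lemma inv7_fsum: "(!!n. inv7 (a n)) ==> inv7 (fsum a)"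
 unfolding inv7_iff fsum_def cf_mk by (metis (no_types, lifting) sum.neutral)
lemma inv7_mon: "(a + 2 * b + 4 * c) mod 7 = 0 ==> inv7 (mon (a, b, c))"
 by (simp add: inv7_iff cf_mon)

text \<open>The generators are used up one at a time: all monomials divisible by the first are
  collected into one multiple of it, and what remains is divisible by the others. This also handles
  infinitely many monomials, with a finite number of additions in \<open>S\<close>.\<close>

lemma monomial_ideal_induct:
 assumes S: "sub3 S" and g: "!!a b c w. (a, b, c) \<in> set gs ==> cX ^ a * (cY ^ b * (cZ ^ c * w)) \<in> S"
  and P: "!!i j k. cf P i j k ~= 0 ==> \<exists>(a, b, c)\<in>set gs. a \<le> i & b \<le> j & c \<le> k"
 shows "P \<in> S"
 using g P
proof (induction gs arbitrary: P)
 case Nil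
 then have "P = 0" by (intro ps3_eqI) auto
 then show ?case using sub3_0[OF S] by simp
next
 case (Cons g gs)
 obtain a b c where abc: "g = (a, b, c)" by (cases g)
 define w where "w = mk (%i j k. cf P (i + a) (j + b) (k + c))"
 define Q where "Q = cX ^ a * (cY ^ b * (cZ ^ c * w))"
 have cq: "cf Q i j k = (if a \<le> i & b \<le> j & c \<le> k then cf P i j k else 0)" for i j k
  unfolding Q_def cf_mon_mult by (simp add: w_def)
 have "P - Q \<in> S"
 proof (rule Cons.IH)
  fix i j k assume "cf (P - Q) i j k ~= 0"
  then have "\<not> (a \<le> i & b \<le> j & c \<le> k)" "cf P i j k ~= 0" by (auto simp: cq split: if_splits)
  then show "\<exists>(a, b, c)\<in>set gs. a \<le> i & b \<le> j & c \<le> k" using Cons.prems(2)[of i j k] abc by auto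
 qed (use Cons.prems(1) in auto)
 moreover have "Q \<in> S" unfolding Q_def using Cons.prems(1) abc by auto
 ultimately show ?case using sub3_add[OF S] by fastforce
qed

text \<open>For b < 3 the congruence determines a modulo 7. One coordinate plane serves for all
  three, since multiplication by 2 modulo 7 permutes the weights 1, 2, 4 cyclically.\<close>

lemma plane_exponents:
 fixes a b :: nat
 assumes "(a + 2 * b) mod 7 = 0"
 shows "a = 0 & b = 0 \<or> 3 \<le> a & 2 \<le> b \<or> 5 \<le> a & 1 \<le> b \<or> 7 \<le> a \<or> 7 \<le> b \<or> 1 \<le> a & 3 \<le> b"
proof -
 consider "b = 0" | "b = 1" | "b = 2" | "b \<ge> 3" by linarith
 then show ?thesis using assms by cases presburger+
qed

context klein begin

definition JJ :: "ps3 set" where "JJ = {dfw a b c | a b c. True}"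

lemma sub3_JJ: "sub3 JJ"
 unfolding sub3_def JJ_def
proof (intro conjI ballI allI)
 have "0 = dfw 0 0 0" by (simp add: dfw_def)
 then show "0 \<in> {dfw a b c | a b c. True}" by blast
 fix P assume "P \<in> {dfw a b c | a b c. True}"
 then obtain a b c where P: "P = dfw a b c" by blast
 show "cc d * P \<in> {dfw a b c | a b c. True}" for d unfolding P dfw_cc[symmetric] by blast
 fix Q assume "Q \<in> {dfw a b c | a b c. True}"
 then obtain a' b' c' where Q: "Q = dfw a' b' c'" by blast
 show "P + Q \<in> {dfw a b c | a b c. True}" unfolding P Q dfw_add[symmetric] by blast
qed

lemma JJ_mono: "28 * (m + cc (lam/4) * (cX * cY * cZ)) = of_int a * (cX * fx) + of_int b * (cY * fy) + of_int c * (cZ * fz)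
 ==> m * w + cc (lam/4) * (cX * cY * cZ * w) \<in> JJ"
proof -
 assume *: "28 * (m + cc (lam/4) * (cX * cY * cZ)) = of_int a * (cX * fx) + of_int b * (cY * fy) + of_int c * (cZ * fz)"
 have "28 * (m + cc (lam/4) * (cX * cY * cZ)) * w = dfw (of_int a * (cX * w)) (of_int b * (cY * w)) (of_int c * (cZ * w))"
  unfolding * by (simp add: dfw_def algebra_simps)
 then have "cc 28 * (m * w + cc (lam/4) * (cX * cY * cZ * w)) = dfw (of_int a * (cX * w)) (of_int b * (cY * w)) (of_int c * (cZ * w))"
  by (simp add: cc_numeral algebra_simps)
 then have "cc 28 * (m * w + cc (lam/4) * (cX * cY * cZ * w)) \<in> JJ" unfolding JJ_def by blast
 then show ?thesis using sub3_cancel[OF sub3_JJ] by (metis zero_neq_numeral)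
qed

text \<open>The coefficients solve a circulant system of determinant 28: the field (x, 9 y, -3 z)
  kills y z^3 and z x^3, multiplies x y^3 by 1 + 27 = 28 and xyz by 7.\<close>

lemma JJ_monomials:
 "cX * (cY ^ 3 * w) + cc (lam/4) * (cX * cY * cZ * w) \<in> JJ"
 "cY * (cZ ^ 3 * w) + cc (lam/4) * (cX * cY * cZ * w) \<in> JJ"
 "cZ * (cX ^ 3 * w) + cc (lam/4) * (cX * cY * cZ * w) \<in> JJ"
proof -
 have 28: "28 * (cc (lam / 4) * P) = 7 * (cc lam * P)" for P
 proof -
  have "28 * (cc (lam / 4) * P) = cc 28 * (cc (lam/4) * P)" by (simp add: cc_numeral)
  also have "\<dots> = cc 7 * (cc lam * P)" unfolding mult.assoc[symmetric] cc_mult[symmetric] by simp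
  finally show ?thesis by (simp add: cc_numeral)
 qed
 have c28: "28 * cc (lam / 4) = cc lam * 7"
  using 28[of 1] by simp
 show "cX * (cY ^ 3 * w) + cc (lam/4) * (cX * cY * cZ * w) \<in> JJ"
  using JJ_mono[of "cX * cY ^ 3" 1 9 "-3" w]
  by (simp add: c28 fx_def fy_def fz_def algebra_simps power2_eq_square power3_eq_cube)
 show "cY * (cZ ^ 3 * w) + cc (lam/4) * (cX * cY * cZ * w) \<in> JJ"
  using JJ_mono[of "cY * cZ ^ 3" "-3" 1 9 w]
  by (simp add: c28 fx_def fy_def fz_def algebra_simps power2_eq_square power3_eq_cube)
 show "cZ * (cX ^ 3 * w) + cc (lam/4) * (cX * cY * cZ * w) \<in> JJ"
  using JJ_mono[of "cZ * cX ^ 3" 9 "-3" 1 w]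
  by (simp add: c28 fx_def fy_def fz_def algebra_simps power2_eq_square power3_eq_cube)
qed

lemma JJ_gradient:
 "cX ^ 3 * w + 3 * (cY * (cZ\<^sup>2 * w)) + cc lam * (cX * (cY * w)) \<in> JJ"
 "cY ^ 3 * w + 3 * (cZ * (cX\<^sup>2 * w)) + cc lam * (cY * (cZ * w)) \<in> JJ"
 "cZ ^ 3 * w + 3 * (cX * (cY\<^sup>2 * w)) + cc lam * (cZ * (cX * w)) \<in> JJ"
proof -
 have *: "dfw 0 0 w \<in> JJ" "dfw w 0 0 \<in> JJ" "dfw 0 w 0 \<in> JJ" by (auto simp: JJ_def)
 show "cX ^ 3 * w + 3 * (cY * (cZ\<^sup>2 * w)) + cc lam * (cX * (cY * w)) \<in> JJ" using *(1) by (simp add: dfw_def fz_def algebra_simps)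
 show "cY ^ 3 * w + 3 * (cZ * (cX\<^sup>2 * w)) + cc lam * (cY * (cZ * w)) \<in> JJ" using *(2) by (simp add: dfw_def fx_def algebra_simps)
 show "cZ ^ 3 * w + 3 * (cX * (cY\<^sup>2 * w)) + cc lam * (cZ * (cX * w)) \<in> JJ" using *(3) by (simp add: dfw_def fy_def algebra_simps)
qed

text \<open>The same cycle as in \<open>C3_pure_power\<close>, now modulo the Jacobian ideal alone.
  The diagonal multipliers become the constants 1 and 1/4, so the gap condition of
  \<open>cycle_step\<close> holds trivially.\<close>

lemma JJ_m4: assumes "ordge 1 w" shows "cX * cY * cZ * w \<in> JJ"
proof -
 let ?m = "cX * cY * cZ"
 note C = closed_UNIV and S = sub3_JJ
 note mc = closed3_multc[OF C]
 have b: "bdd3 (%i j k. c)" for c by (auto simp: bdd3_def)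
 have b1: "dg (%i j k. 1) w = w" for w by (simp add: dg_1)
 have l4: "cc lam * (Q * dg (%i j k. 1/4) w) = cc (lam/4) * (Q * w)" for Q w
 proof -
  have "cc lam * (Q * (cc (1/4) * w)) = (cc lam * cc (1/4)) * (Q * w)" by (simp add: mult_ac)
  then show ?thesis by (simp add: dg_const flip: cc_mult)
 qed
 have h1: "\<exists>ka. bdd3 ka & (\<forall>w\<in>UNIV. cX * (?m * w) - cZ * (cZ * (?m * dg ka w)) \<in> JJ)"
  by (rule cycle_step[OF C S lam mc(1,2,3) _ b[of 1] _ b[of "1/4"]]) (simp_all add: b1 l4 JJ_gradient JJ_monomials)
 have h2: "\<exists>ka. bdd3 ka & (\<forall>w\<in>UNIV. cZ * (?m * w) - cY * (cY * (?m * dg ka w)) \<in> JJ)"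
  by (rule cycle_step[OF C S lam mc(3,1,2) _ b[of 1] _ b[of "1/4"]]) (simp_all only: b1 l4 JJ_gradient JJ_monomials, simp_all add: mult_ac)
 have h3: "\<exists>ka. bdd3 ka & (\<forall>w\<in>UNIV. cY * (?m * w) - cX * (cX * (?m * dg ka w)) \<in> JJ)"
  by (rule cycle_step[OF C S lam mc(2,3,1) _ b[of 1] _ b[of "1/4"]]) (simp_all only: b1 l4 JJ_gradient JJ_monomials, simp_all add: mult_ac)
 have X: "cX * (?m * g) \<in> JJ" for g
  by (rule cycle_reduction[OF C solvable_UNIV S mc(1,2,3) _ _ h1 h2 h3]) auto
 have Y: "cY * (?m * g) \<in> JJ" for g
  by (rule cycle_reduction[OF C solvable_UNIV S mc(2,3,1) _ _ h3 h1 h2]) (auto simp: mult_ac)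
 have Z: "cZ * (?m * g) \<in> JJ" for g
  by (rule cycle_reduction[OF C solvable_UNIV S mc(3,1,2) _ _ h2 h3 h1]) (auto simp: mult_ac)
 have "ordge (3 * 1 - 2) w" using assms by simp
 then obtain A B C where d: "w = cX ^ 1 * A + cY ^ 1 * B + cZ ^ 1 * C" by (rule decompose_powers) auto
 have "cX * (?m * A) + cY * (?m * B) + cZ * (?m * C) \<in> JJ"
   by (intro sub3_add[OF S] X Y Z)
 then show ?thesis unfolding d by (simp add: algebra_simps)
qed

lemma JJ_pure_powers:
 assumes C: "closed3 C" and S: "sub3 S" "JJ \<subseteq> S" and m: "!!w. w \<in> C ==> cX * cY * cZ * w \<in> S" and w: "w \<in> C"
 shows "cX ^ 3 * cY\<^sup>2 * w \<in> S" "cX ^ 5 * cY * w \<in> S" "cX ^ 7 * w \<in> S"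
  "cY ^ 3 * cZ\<^sup>2 * w \<in> S" "cY ^ 5 * cZ * w \<in> S" "cY ^ 7 * w \<in> S"
  "cZ ^ 3 * cX\<^sup>2 * w \<in> S" "cZ ^ 5 * cX * w \<in> S" "cZ ^ 7 * w \<in> S"
  "cX * cY ^ 3 * w \<in> S" "cY * cZ ^ 3 * w \<in> S" "cZ * cX ^ 3 * w \<in> S"
proof -
 have n: "cX * cY ^ 3 * w \<in> S" "cY * cZ ^ 3 * w \<in> S" "cZ * cX ^ 3 * w \<in> S" if w: "w \<in> C" for w
 proof -
  have "cc (lam/4) * (cX * cY * cZ * w) \<in> S" using m[OF w] sub3_cc[OF S(1)] by blast
  from sub3_diff[OF S(1) subsetD[OF S(2) JJ_monomials(1)[of w]] this] sub3_diff[OF S(1) subsetD[OF S(2) JJ_monomials(2)[of w]] this]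
   sub3_diff[OF S(1) subsetD[OF S(2) JJ_monomials(3)[of w]] this]
  show "cX * cY ^ 3 * w \<in> S" "cY * cZ ^ 3 * w \<in> S" "cZ * cX ^ 3 * w \<in> S" by (simp_all add: mult.assoc)
 qed
 have bl: "bdd3 (%i j k. lam)" by (auto simp: bdd3_def)
 have e: "cc lam * (a * (b * w)) = a * (b * dg (%i j k. lam) w)" for a b w by (simp add: dg_const mult_ac)
 have r: "\<exists>ka. bdd3 ka & (\<forall>w\<in>C. cX ^ 3 * w + 3 * (cY * (cZ\<^sup>2 * w)) + cX * (cY * dg ka w) \<in> S)"
  "\<exists>ka. bdd3 ka & (\<forall>w\<in>C. cY ^ 3 * w + 3 * (cZ * (cX\<^sup>2 * w)) + cY * (cZ * dg ka w) \<in> S)"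
  "\<exists>ka. bdd3 ka & (\<forall>w\<in>C. cZ ^ 3 * w + 3 * (cX * (cY\<^sup>2 * w)) + cZ * (cX * dg ka w) \<in> S)"
  using bl JJ_gradient[unfolded e] S(2) by blast+
 have m': "cY * cZ * cX * w \<in> S" "cZ * cX * cY * w \<in> S" if "w \<in> C" for w
  using m[OF that] by (simp_all add: mult_ac)
 note mc1 = closed3_multc[OF C]
 show "cX ^ 3 * cY\<^sup>2 * w \<in> S" "cX ^ 5 * cY * w \<in> S" "cX ^ 7 * w \<in> S"
  by (rule pure_powers[OF C S(1) mc1(1,2,3) r(1,2,3) m n(1,2,3) w]; simp)+
 show "cY ^ 3 * cZ\<^sup>2 * w \<in> S" "cY ^ 5 * cZ * w \<in> S" "cY ^ 7 * w \<in> S"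
  by (rule pure_powers[OF C S(1) mc1(2,3,1) r(2,3,1) m'(1) n(2,3,1) w]; simp)+
 show "cZ ^ 3 * cX\<^sup>2 * w \<in> S" "cZ ^ 5 * cX * w \<in> S" "cZ ^ 7 * w \<in> S"
  by (rule pure_powers[OF C S(1) mc1(3,1,2) r(3,1,2) m'(2) n(3,1,2) w]; simp)+
 show "cX * cY ^ 3 * w \<in> S" "cY * cZ ^ 3 * w \<in> S" "cZ * cX ^ 3 * w \<in> S" by (rule n[OF w])+
qed

lemma high_order_in_JJ: assumes "ordge 20 P" shows "P \<in> JJ"
proof -
 have "ordge (3 * 7 - 2) P" using ordge_mono[OF assms, of 19] by simp
 then obtain A B C where d: "P = cX ^ 7 * A + cY ^ 7 * B + cZ ^ 7 * C"
   "!!q. ordge q P ==> ordge (q - 7) A & ordge (q - 7) B & ordge (q - 7) C"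
  using decompose_powers[of 7 P] by (metis one_le_numeral)
 have o: "A \<in> {P. ordge 1 P}" "B \<in> {P. ordge 1 P}" "C \<in> {P. ordge 1 P}"
  using d(2)[OF assms] ordge_mono[of 13 _ 1] by auto
 have m: "cX * cY * cZ * w \<in> JJ" if "w \<in> {P. ordge 1 P}" for w using JJ_m4 that by simp
 note pp = JJ_pure_powers[OF closed_ordge[of 1] sub3_JJ order_refl m]
 show ?thesis unfolding d(1) by (intro sub3_add[OF sub3_JJ] pp(3,6,9) o)
qed

text \<open>Modulo the Jacobian ideal and the line of xyz, all the listed monomials and their
  multiples vanish, and every invariant monomial other than 1 is such a multiple. The remaining
  multiple of xyz is traded for x y^3.\<close>

lemma invariant_mod_JJ:
 assumes P: "inv7 P"
 obtains c0 c1 where "P - cc c0 - cc c1 * (cX * cY ^ 3) \<in> JJ"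
proof -
 let ?m = "cX * cY * cZ"
 define S where "S = {j + cc c * ?m | j c. j \<in> JJ}"
 have S: "sub3 S"
  unfolding sub3_def
 proof (intro conjI ballI allI)
  show "0 \<in> S" unfolding S_def using sub3_0[OF sub3_JJ] by (intro CollectI exI[of _ 0]) simp
  fix P assume "P \<in> S"
  then obtain j c where P: "P = j + cc c * ?m" "j \<in> JJ" by (auto simp: S_def)
  show "cc d * P \<in> S" for d unfolding S_def P(1)
   by (intro CollectI exI[of _ "cc d * j"] exI[of _ "d * c"]) (use sub3_cc[OF sub3_JJ P(2)] in \<open>simp add: cc_mult algebra_simps\<close>)
  fix Q assume "Q \<in> S"
  then obtain j' c' where Q: "Q = j' + cc c' * ?m" "j' \<in> JJ" by (auto simp: S_def)
  show "P + Q \<in> S" unfolding S_def P(1) Q(1)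
   by (intro CollectI exI[of _ "j + j'"] exI[of _ "c + c'"]) (use sub3_add[OF sub3_JJ P(2) Q(2)] in \<open>simp add: cc_add algebra_simps\<close>)
 qed
 have JS: "JJ \<subseteq> S"
 proof
  fix j assume "j \<in> JJ" then show "j \<in> S" unfolding S_def by (intro CollectI exI[of _ j] exI[of _ 0]) simp
 qed
 have m: "?m * w \<in> S" for w
 proof -
  define c where "c = cf w 0 0 0"
  have "ordge 1 (w - cc c)" using cf_cc[of c 1] by (simp add: ordge_def c_def cf_one)
  then have "?m * (w - cc c) \<in> JJ" by (rule JJ_m4)
  then show ?thesis unfolding S_def by (intro CollectI exI[of _ "?m * (w - cc c)"] exI[of _ c]) (simp add: algebra_simps)
 qed
 define c0 where "c0 = cf P 0 0 0"
 note pp = JJ_pure_powers[OF closed_UNIV S JS m UNIV_I]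
 have "P - cc c0 \<in> S"
 proof (rule monomial_ideal_induct[OF S, where gs = "[(1,1,1),(3,2,0),(5,1,0),(7,0,0),(0,3,2),(0,5,1),(0,7,0),(2,0,3),(1,0,5),(0,0,7),(1,3,0),(0,1,3),(3,0,1)]"])
  fix a b c :: nat and w
  assume "(a, b, c) \<in> set [(1,1,1),(3,2,0),(5,1,0),(7,0,0),(0,3,2),(0,5,1),(0,7,0),(2,0,3),(1,0,5),(0,0,7),(1,3,0),(0,1,3),(3,0,1)]"
  then show "cX ^ a * (cY ^ b * (cZ ^ c * w)) \<in> S"
   using pp[of w] m[of w] by (auto simp: mult_ac)
 next
  fix i j k assume *: "cf (P - cc c0) i j k ~= 0"
  have "(i, j, k) ~= (0, 0, 0)"
  proof
   assume "(i, j, k) = (0, 0, 0)" then show False using * by (simp add: c0_def cf_cc_const)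
  qed
  moreover have "(i + 2 * j + 4 * k) mod 7 = 0"
   using * P unfolding inv7_iff by (auto simp: cf_cc_const split: if_splits)
  ultimately have "1 \<le> i & 1 \<le> j & 1 \<le> k \<or> 3 \<le> i & 2 \<le> j \<or> 5 \<le> i & 1 \<le> j \<or> 7 \<le> i \<or> 3 \<le> j & 2 \<le> k \<or> 5 \<le> j & 1 \<le> k \<or> 7 \<le> j
   \<or> 2 \<le> i & 3 \<le> k \<or> 1 \<le> i & 5 \<le> k \<or> 7 \<le> k \<or> 1 \<le> i & 3 \<le> j \<or> 1 \<le> j & 3 \<le> k \<or> 3 \<le> i & 1 \<le> k"
  \<comment> \<open>If all exponents are positive, xyz divides the monomial; otherwise it lies in a
    coordinate plane and \<open>plane_exponents\<close> applies.\<close>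
  proof (cases "i = 0 \<or> j = 0 \<or> k = 0")
   case True
   then consider "i = 0" "(j + 2 * k) mod 7 = 0" | "j = 0" "(k + 2 * i) mod 7 = 0" | "k = 0" "(i + 2 * j) mod 7 = 0"
   proof -
    assume c: "i = 0 ==> (j + 2 * k) mod 7 = 0 ==> thesis" "j = 0 ==> (k + 2 * i) mod 7 = 0 ==> thesis" "k = 0 ==> (i + 2 * j) mod 7 = 0 ==> thesis"
    have "i = 0 ==> (j + 2 * k) mod 7 = 0" "j = 0 ==> (k + 2 * i) mod 7 = 0" "k = 0 ==> (i + 2 * j) mod 7 = 0"
     using \<open>(i + 2 * j + 4 * k) mod 7 = 0\<close> by presburger+
    then show thesis using True c by metis
   qed
   then show ?thesis
    using \<open>(i, j, k) ~= (0, 0, 0)\<close> plane_exponents[of j k] plane_exponents[of k i] plane_exponents[of i j] by cases auto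
  qed auto
  then show "\<exists>(a, b, c)\<in>set [(1,1,1),(3,2,0),(5,1,0),(7,0,0),(0,3,2),(0,5,1),(0,7,0),(2,0,3),(1,0,5),(0,0,7),(1,3,0),(0,1,3),(3,0,1)]. a \<le> i & b \<le> j & c \<le> k"
   unfolding list.set bex_simps case_prod_conv by blast
 qed
 then obtain j c where jc: "P - cc c0 = j + cc c * ?m" "j \<in> JJ" by (auto simp: S_def)
 \<comment> \<open>From x y^3 = -(lam/4) xyz modulo \<open>JJ\<close>.\<close>
 define c1 where "c1 = - (4 * c / lam)"
 have "cX * (cY ^ 3 * 1) + cc (lam/4) * (?m * 1) \<in> JJ" by (rule JJ_monomials)
 then have "j - cc c1 * (cX * (cY ^ 3 * 1) + cc (lam/4) * (?m * 1)) \<in> JJ"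
  using sub3_cc[OF sub3_JJ] sub3_diff[OF sub3_JJ jc(2)] by blast
 moreover have "cc c1 * (cc (lam/4) * ?m) = - (cc c * ?m)"
  using lam by (simp add: c1_def cc_uminus flip: mult.assoc cc_mult)
 ultimately have "P - cc c0 - cc c1 * (cX * cY ^ 3) \<in> JJ"
  by (simp add: jc(1) distrib_left algebra_simps)
 then show ?thesis by (rule that)
qed

text \<open>Since f is invariant, its partial derivatives have the weights -1, -2, -4 modulo 7, that
  is 6, 5, 3, and the projection passes to the components of the field.\<close>

lemma pz_dfw: "pz 0 (dfw a b c) = dfw (pz 6 a) (pz 5 b) (pz 3 c)"
proof -
 have p: "pz 7 P = pz 0 P" "pz 8 P = pz 1 P" "pz 9 P = pz 2 P" "pz 10 P = pz 3 P" "pz 12 P = pz 5 P" for P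
  using pz_7[of 0 P] pz_7[of 1 P] pz_7[of 2 P] pz_7[of 3 P] pz_7[of 5 P] by (simp_all add: eval_nat_numeral)
 show ?thesis
  by (simp add: dfw_def fx_def fy_def fz_def distrib_right power2_eq_square power3_eq_cube mult.assoc pz_add pz_numeral pz_cc pz_var p)
   (simp add: eval_nat_numeral)
qed

text \<open>The components of the field can be projected without changing its invariant pairing with
  the gradient. After that, df wedge the field is \<open>beta\<close> of its divergence, and this
  divergence is again invariant.\<close>

lemma invariant_generation:
 assumes "inv7 P"
 obtains c0 c1 P' where "inv7 P'" "P - (cc c0 * 1 + cc c1 * (cX * cY ^ 3)) - beta P' \<in> Dhat"
proof -
 obtain c0 c1 where c: "P - cc c0 - cc c1 * (cX * cY ^ 3) \<in> JJ" using invariant_mod_JJ[OF assms] by blast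
 then obtain u v w where d: "P - cc c0 - cc c1 * (cX * cY ^ 3) = dfw u v w" by (auto simp: JJ_def)
 have i1: "inv7 (cc c0)" using inv7_cc[OF inv7_mon[of 0 0 0], of c0] by (simp add: mon_def)
 have i2: "inv7 (cX * cY ^ 3)" using inv7_mon[of 1 3 0] by (simp add: mon_def)
 have "inv7 (dfw u v w)" unfolding d[symmetric] by (intro inv7_diff assms i1 i2 inv7_cc)
 then have e: "dfw u v w = dfw (pz 6 u) (pz 5 v) (pz 3 w)" by (simp add: inv7_def pz_dfw)
 have "inv7 (div3 (pz 6 u) (pz 5 v) (pz 3 w))" using inv7_pz by (simp flip: pz_div3)
 moreover have "dfw (pz 6 u) (pz 5 v) (pz 3 w) - beta (div3 (pz 6 u) (pz 5 v) (pz 3 w)) \<in> Dhat" by (rule dfw_beta_div_formal)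
 ultimately show ?thesis using that[of "div3 (pz 6 u) (pz 5 v) (pz 3 w)" c0 c1] d e by (simp add: algebra_simps)
qed

lemma beta_funpow_Dhat: "P \<in> Dhat ==> (beta ^^ n) P \<in> Dhat"
 by (induction n) (auto simp: beta_Dhat)

text \<open>Nakayama's lemma by iteration: the quotient P' is reduced again and again, and the
  constants found in round n become the n-th coefficients of the series. The remainder after N
  rounds has order at least N, and \<open>Dhat\<close> is closed.\<close>

lemma generation_step:
 assumes step: "!!P. P \<in> I ==> \<exists>c P'. P' \<in> I & P - (\<Sum>a\<in>A. cc (c a) * g a) - beta P' \<in> Dhat"
  and A: "finite A" and P: "P \<in> I"
 shows "\<exists>S. P - (\<Sum>a\<in>A. smp (S a) (g a)) \<in> Dhat"
proof -
 obtain co nx where s: "!!P. P \<in> I ==> nx P \<in> I & P - (\<Sum>a\<in>A. cc (co P a) * g a) - beta (nx P) \<in> Dhat"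
  using step by metis
 define p where "p n = (nx ^^ n) P" for n
 have pI: "p n \<in> I" for n by (induction n) (auto simp: p_def P s)
 define S where "S a = Abs_fps (%n. co (p n) a)" for a
 have part: "P - (\<Sum>n<N. (beta ^^ n) (\<Sum>a\<in>A. cc (co (p n) a) * g a)) - (beta ^^ N) (p N) \<in> Dhat" for N
 proof (induction N)
  case 0
  then show ?case using sub3_0[OF sub3_Dhat] by (simp add: p_def)
 next
  case (Suc N)
  have "p N - (\<Sum>a\<in>A. cc (co (p N) a) * g a) - beta (p (Suc N)) \<in> Dhat" using s[OF pI[of N]] by (simp add: p_def)
  then have "(beta ^^ N) (p N - (\<Sum>a\<in>A. cc (co (p N) a) * g a) - beta (p (Suc N))) \<in> Dhat"
   by (rule beta_funpow_Dhat)
  then have "P - (\<Sum>n<N. (beta ^^ n) (\<Sum>a\<in>A. cc (co (p n) a) * g a)) - (beta ^^ N) (\<Sum>a\<in>A. cc (co (p N) a) * g a)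
    - (beta ^^ N) (beta (p (Suc N))) \<in> Dhat"
  proof -
   have *: "(x - y - z) + (z - u - v) = x - y - u - v" for x y z u v :: ps3 by simp
   show ?thesis using sub3_add[OF sub3_Dhat Suc \<open>(beta ^^ N) _ \<in> Dhat\<close>] unfolding beta_funpow_diff * .
  qed
  moreover have "(beta ^^ N) (beta (p (Suc N))) = (beta ^^ Suc N) (p (Suc N))" by (simp add: funpow_swap1)
  ultimately show ?case unfolding sum.lessThan_Suc diff_diff_eq[symmetric] by simp
 qed
 have "P - (\<Sum>a\<in>A. smp (S a) (g a)) \<in> Dhat"
 proof (rule cl3_limit[OF Dhat_closed[symmetric]])
  fix N
  let ?Q = "P - (\<Sum>n<N. (beta ^^ n) (\<Sum>a\<in>A. cc (co (p n) a) * g a)) - (beta ^^ N) (p N)"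
  have "ordge N (\<Sum>a\<in>A. smp (S a) (g a) - (\<Sum>n<N. cc (co (p n) a) * (beta ^^ n) (g a)))"
   by (rule ordge_sum) (use smp_approx[of N "S _"] in \<open>simp add: S_def\<close>)
  moreover have "(\<Sum>a\<in>A. \<Sum>n<N. cc (co (p n) a) * (beta ^^ n) (g a)) = (\<Sum>n<N. (beta ^^ n) (\<Sum>a\<in>A. cc (co (p n) a) * g a))"
   by (subst sum.swap) (simp add: beta_funpow_sum beta_funpow_cc)
  ultimately have "ordge N ((\<Sum>a\<in>A. smp (S a) (g a)) - (\<Sum>n<N. (beta ^^ n) (\<Sum>a\<in>A. cc (co (p n) a) * g a)))"
   by (simp add: sum_subtractf)
  from ordge_diff[OF ordge_beta_funpow[of N "p N"] this]
  have "ordge N (P - (\<Sum>a\<in>A. smp (S a) (g a)) - ?Q)" by (simp add: algebra_simps)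
  then show "\<exists>Q\<in>Dhat. ordge N (P - (\<Sum>a\<in>A. smp (S a) (g a)) - Q)" using part by blast
 qed
 then show ?thesis by blast
qed

lemma generation_invariant:
 assumes "inv7 P"
 obtains S T where "P - smp S 1 - smp T (cX * cY ^ 3) \<in> Dhat"
proof -
 define g where "g b = (if b then 1 else cX * cY ^ 3)" for b
 have "\<exists>S. P - (\<Sum>a\<in>UNIV. smp (S a) (g a)) \<in> Dhat"
 proof (rule generation_step[where I = "{P. inv7 P}"])
  fix P assume "P \<in> {P. inv7 P}"
  then obtain c0 c1 P' where "inv7 P'" "P - (cc c0 * 1 + cc c1 * (cX * cY ^ 3)) - beta P' \<in> Dhat"
   using invariant_generation by blast
  then show "\<exists>c P'. P' \<in> {P. inv7 P} & P - (\<Sum>a\<in>UNIV. cc (c a) * g a) - beta P' \<in> Dhat"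
   by (intro exI[of _ "%b. if b then c0 else c1"] exI[of _ P']) (simp add: UNIV_bool g_def add.commute)
 qed (use assms in auto)
 then show ?thesis using that by (auto simp: UNIV_bool g_def algebra_simps)
qed

text \<open>Generators for all series, not only the invariant ones: the action of a series in a and
  b is defined by a unique limit in the whole module, and that uniqueness comes from finite
  generation.\<close>

lemma finite_generation:
 "\<exists>S. P - (\<Sum>a\<in>{..<20} \<times> {..<20} \<times> {..<20}. smp (S a) (mon a)) \<in> Dhat"
proof (rule generation_step[where I = UNIV])
 fix P
 have "P - trunc3 20 P \<in> JJ" using high_order_in_JJ ordge_trunc3 by blast
 then obtain u v w where d: "P - trunc3 20 P = dfw u v w" by (auto simp: JJ_def)
 define c where "c = (%(i, j, k). if i + j + k < 20 then cf P i j k else 0)"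
 have "trunc3 20 P = (\<Sum>a\<in>{..<20} \<times> {..<20} \<times> {..<20}. cc (c a) * mon a)"
 proof (rule ps3_eqI)
  fix i j k :: nat
  have "(\<Sum>a\<in>{..<20} \<times> {..<20} \<times> {..<20}. c a * cf (mon a) i j k) = (\<Sum>a\<in>{..<20} \<times> {..<20} \<times> {..<20}. if a = (i, j, k) then c a else 0)"
   by (rule sum.cong) (auto simp: cf_mon split: prod.splits if_splits)
  also have "\<dots> = (if i + j + k < 20 then cf P i j k else 0)" by (auto simp: sum.delta c_def)
  finally show "cf (trunc3 20 P) i j k = cf (\<Sum>a\<in>{..<20} \<times> {..<20} \<times> {..<20}. cc (c a) * mon a) i j k"
   by (simp add: trunc3_def cf_sum)
 qed
 then have "P - (\<Sum>a\<in>{..<20} \<times> {..<20} \<times> {..<20}. cc (c a) * mon a) = dfw u v w" using d by simp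
 then show "\<exists>c P'. P' \<in> UNIV & P - (\<Sum>a\<in>{..<20} \<times> {..<20} \<times> {..<20}. cc (c a) * mon a) - beta P' \<in> Dhat"
  using dfw_beta_div_formal by (intro exI[of _ c] exI[of _ "div3 u v w"]) simp
qed auto

text \<open>Induction on the number of generators. If they are independent modulo \<open>KK\<close>,
  congruences modulo all b^N force the coefficients to vanish. Otherwise a relation is divided by
  its lowest power of b, which \<open>KK\<close> permits, and then expresses one generator through
  the others.\<close>

lemma separated_of_generation:
 assumes "finite A" "!!P. \<exists>S. P - (\<Sum>a\<in>A. smp (S a) (g a)) \<in> KK" "!!N. \<exists>Q. P - (beta ^^ N) Q \<in> KK"
 shows "P \<in> KK"
 using assms
proof (induction "card A" arbitrary: A rule: less_induct)
 case less
 note KK = sub3_KK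
 show ?case
 proof (cases "\<exists>T. (\<Sum>a\<in>A. smp (T a) (g a)) \<in> KK & (\<exists>b\<in>A. T b ~= 0)")
  case False
  then have F: "!!T. (\<Sum>a\<in>A. smp (T a) (g a)) \<in> KK ==> \<forall>b\<in>A. T b = 0" by blast
  obtain S where S: "P - (\<Sum>a\<in>A. smp (S a) (g a)) \<in> KK" using less.prems(2) by blast
  have "S a = 0" if a: "a \<in> A" for a
  proof (rule fps_ext)
   fix n
   obtain Q where Q: "P - (beta ^^ Suc n) Q \<in> KK" using less.prems(3) by blast
   obtain T where T: "Q - (\<Sum>a\<in>A. smp (T a) (g a)) \<in> KK" using less.prems(2) by blast
   have "(P - (beta ^^ Suc n) Q) - (P - (\<Sum>a\<in>A. smp (S a) (g a))) + smp (fps_X ^ Suc n) (Q - (\<Sum>a\<in>A. smp (T a) (g a))) \<in> KK"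
    by (rule sub3_add[OF KK sub3_diff[OF KK Q S] smp_KK[OF T]])
   also have "(P - (beta ^^ Suc n) Q) - (P - (\<Sum>a\<in>A. smp (S a) (g a))) + smp (fps_X ^ Suc n) (Q - (\<Sum>a\<in>A. smp (T a) (g a)))
    = (\<Sum>a\<in>A. smp (S a - fps_X ^ Suc n * T a) (g a))"
    by (simp only: smp_diff smp_X_power smp_diff_left smp_mult sum_subtractf smp_sum beta_funpow_sum) simp
   finally have "S a - fps_X ^ Suc n * T a = 0" using F[of "%a. S a - fps_X ^ Suc n * T a"] a by blast
   then have "S a = fps_X ^ Suc n * T a" by simp
   then show "fps_nth (S a) n = fps_nth 0 n" by (simp only: fps_X_power_mult_nth) simp
  qed
  then show ?thesis using S by (simp add: smp_zero)
 next
  case True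
  then obtain T b where T: "(\<Sum>a\<in>A. smp (T a) (g a)) \<in> KK" "b \<in> A" "T b ~= 0" by blast
  define B where "B = {a\<in>A. T a ~= 0}"
  have "finite B" "B ~= {}" using less.prems(1) T by (auto simp: B_def)
  \<comment> \<open>The generator whose coefficient has the lowest b-adic order; after the division
    this coefficient is a unit.\<close>
  then obtain b where b: "b \<in> B" "!!a. a \<in> B ==> subdegree (T b) \<le> subdegree (T a)"
   using ex_min_if_finite[of "(%a. subdegree (T a)) ` B"] by (metis (no_types, lifting) arg_min_if_finite(1) arg_min_least)
  define s where "s = subdegree (T b)"
  define T' where "T' a = fps_shift s (T a)" for a
  have T': "T a = fps_X ^ s * T' a" if "a \<in> A" for a
  proof (cases "T a = 0")
   case False
   then have "s \<le> subdegree (T a)" using b(2) that by (auto simp: B_def s_def)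
   then show ?thesis unfolding T'_def by (metis fps_shift_times_fps_X_power mult.commute)
  qed (simp add: T'_def)
  have nz: "fps_nth (T' b) 0 ~= 0" using b(1) by (simp add: T'_def s_def B_def)
  have "(\<Sum>a\<in>A. smp (T a) (g a)) = (beta ^^ s) (\<Sum>a\<in>A. smp (T' a) (g a))"
   by (simp add: T' smp_mult smp_X_power beta_funpow_sum)
  then have R: "(\<Sum>a\<in>A. smp (T' a) (g a)) \<in> KK" using T(1) KK_beta_cancel by metis
  have bA: "b \<in> A" using b by (simp add: B_def)
  show ?thesis
  proof (rule less.hyps[of "A - {b}"])
   show "card (A - {b}) < card A" using less.prems(1) bA by (metis card_Diff1_less)
   show "finite (A - {b})" using less.prems(1) by simp
   show "\<exists>Q. P - (beta ^^ N) Q \<in> KK" for N by (rule less.prems(3))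
   fix P
   obtain S where S: "P - (\<Sum>a\<in>A. smp (S a) (g a)) \<in> KK" using less.prems(2) by blast
   define c where "c = S b * inverse (T' b)"
   have "P - (\<Sum>a\<in>A. smp (S a) (g a)) + smp c (\<Sum>a\<in>A. smp (T' a) (g a)) \<in> KK"
    by (rule sub3_add[OF KK S smp_KK[OF R]])
   moreover have "(\<Sum>a\<in>A. smp (S a) (g a)) - smp c (\<Sum>a\<in>A. smp (T' a) (g a)) = (\<Sum>a\<in>A. smp (S a - c * T' a) (g a))"
    by (simp add: smp_diff_left smp_sum smp_mult sum_subtractf)
   moreover have "\<dots> = (\<Sum>a\<in>A - {b}. smp (S a - c * T' a) (g a))"
   proof -
    have "S b - c * T' b = 0" using inverse_mult_eq_1[OF nz] by (simp add: c_def mult.assoc)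
    then show ?thesis using sum.remove[OF less.prems(1) bA, of "%a. smp (S a - c * T' a) (g a)"] by (simp add: smp_zero)
   qed
   ultimately have "P - (\<Sum>a\<in>A - {b}. smp (S a - c * T' a) (g a)) \<in> KK" by (simp add: algebra_simps)
   then show "\<exists>S. P - (\<Sum>a\<in>A - {b}. smp (S a) (g a)) \<in> KK" by (rule exI[of _ "%a. S a - c * T' a"])
  qed
 qed
qed

theorem separated: "(!!N. \<exists>Q. P - (beta ^^ N) Q \<in> KK) ==> P \<in> KK"
 using separated_of_generation[of "{..<20} \<times> {..<20} \<times> {..<20}" mon P] finite_generation Dhat_Khat Khat_KK by blast

end

section \<open>Germs and their Taylor series\<close>

definition tm3 :: "ps3 => complex ^ 3 => nat \<times> nat \<times> nat => complex" where
 "tm3 P p = (%(i, j, k). cf P i j k * (vec_nth p 1) ^ i * (vec_nth p 2) ^ j * (vec_nth p 3) ^ k)"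

definition small3 :: "real => (complex ^ 3) set" where "small3 r = {p. \<forall>i. cmod (vec_nth p i) < r}"

lemma small3_iff: "p \<in> small3 r \<longleftrightarrow> cmod (vec_nth p 1) < r & cmod (vec_nth p 2) < r & cmod (vec_nth p 3) < r"
 by (simp add: small3_def forall_3)

lemma small3_mono: "p \<in> small3 r ==> r \<le> s ==> p \<in> small3 s"
 by (auto simp: small3_def intro: less_le_trans)

lemma open_small3: "open (small3 r)"
proof -
 have "small3 r = (\<Inter>i\<in>UNIV. {p. cmod (vec_nth p i) < r})" by (auto simp: small3_def)
 moreover have "open {p :: complex ^ 3. cmod (vec_nth p i) < r}" for i
  by (intro open_Collect_less continuous_intros)
 ultimately show ?thesis by (auto intro!: open_INT)
qed

lemma convex_small3: "convex (small3 r)"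
proof -
 have "small3 r = (\<Inter>i\<in>UNIV. (%p. vec_nth p i) -` ball 0 r)" by (auto simp: small3_def)
 moreover have "convex ((%p::complex^3. vec_nth p i) -` ball 0 r)" for i
  by (rule convex_linear_vimage) (auto simp: bounded_linear.linear[OF bounded_linear_vec_nth])
 ultimately show ?thesis by (auto intro!: convex_INT)
qed

definition has_ps :: "fun3 => ps3 => bool" where
 "has_ps g P \<longleftrightarrow> conv3 P & (\<exists>r>0. \<forall>p\<in>small3 r. (tm3 P p has_sum g p) UNIV)"

lemma geometric3_summable:
 fixes q :: real assumes "0 \<le> q" "q < 1"
 shows "(%(i, j, k). q ^ (i + j + k)) summable_on (UNIV :: (nat \<times> nat \<times> nat) set)"
proof -
 have s: "(%n. norm (q ^ n)) summable_on UNIV"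
  using assms by (intro norm_summable_imp_summable_on) (auto simp: norm_power summable_geometric)
 have 2: "(%e. norm (case e of (j, k) => q ^ j * q ^ k)) summable_on (UNIV \<times> UNIV)"
  unfolding Infinite_Sum.abs_summable_on_Sigma_iff
  using s assms by (auto simp: norm_mult abs_mult infsum_cmult_right' intro!: summable_on_cmult_right summable_on_cmult_left)
 have 3: "(%e. norm (case e of (i, (j, k)) => q ^ i * (q ^ j * q ^ k))) summable_on (UNIV \<times> (UNIV \<times> UNIV))"
  unfolding Infinite_Sum.abs_summable_on_Sigma_iff
  using s 2 assms by (auto simp: norm_mult abs_mult case_prod_unfold infsum_cmult_right' intro!: summable_on_cmult_right summable_on_cmult_left)
 then have "(%(i, (j, k)). q ^ i * (q ^ j * q ^ k)) summable_on UNIV"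
  using abs_summable_summable[OF 3] by simp
 then show ?thesis by (simp add: power_add mult_ac case_prod_unfold)
qed

lemma tm3_bound:
 assumes "!!i j k. cmod (cf P i j k) \<le> C * R ^ (i + j + k)" "R > 0" "C \<ge> 0" "p \<in> small3 \<rho>"
 shows "cmod (tm3 P p (i, j, k)) \<le> C * (R * \<rho>) ^ (i + j + k)"
proof -
 have "cmod (tm3 P p (i, j, k)) = cmod (cf P i j k) * (cmod (vec_nth p 1) ^ i * cmod (vec_nth p 2) ^ j * cmod (vec_nth p 3) ^ k)"
  by (simp add: tm3_def norm_mult norm_power)
 also have "\<dots> \<le> (C * R ^ (i + j + k)) * (\<rho> ^ i * \<rho> ^ j * \<rho> ^ k)"
 proof -
  have "cmod (vec_nth p 1) < \<rho>" using assms(4) by (simp add: small3_iff)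
  then have "0 \<le> \<rho>" using norm_ge_zero[of "vec_nth p 1"] by linarith
  then show ?thesis using assms by (intro mult_mono power_mono) (auto simp: small3_def less_imp_le)
 qed
 also have "\<dots> = C * (R * \<rho>) ^ (i + j + k)" by (simp add: power_add power_mult_distrib)
 finally show ?thesis .
qed

lemma tm3_abs_summable:
 assumes "!!i j k. cmod (cf P i j k) \<le> C * R ^ (i + j + k)" "R > 0" "C \<ge> 0" "p \<in> small3 (1 / (2 * R))"
 shows "(%e. norm (tm3 P p e)) summable_on UNIV"
proof (rule Infinite_Sum.abs_summable_on_comparison_test)
 have *: "(%(i, j, k). C * (1/2) ^ (i + j + k)) summable_on (UNIV :: (nat \<times> nat \<times> nat) set)"
  using summable_on_cmult_right[OF geometric3_summable[of "1/2"], of C] by (simp add: case_prod_unfold)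
 then show "(%e. norm (case e of (i, j, k) => C * (1/2) ^ (i + j + k))) summable_on (UNIV :: (nat \<times> nat \<times> nat) set)"
  using assms(3) by (simp add: case_prod_unfold)
 fix e :: "nat \<times> nat \<times> nat"
 obtain i j k where e: "e = (i, j, k)" by (cases e)
 show "norm (tm3 P p e) \<le> norm ((%(i, j, k). C * (1/2) ^ (i + j + k)) e)"
  unfolding e using tm3_bound[OF assms, of i j k] assms(2,3) by simp
qed

lemma has_psE:
 assumes "has_ps g P"
 obtains r where "r > 0" "!!p. p \<in> small3 r ==> (tm3 P p has_sum g p) UNIV" "!!p. p \<in> small3 r ==> (%e. norm (tm3 P p e)) summable_on UNIV"
proof -
 obtain r where r: "r > 0" "!!p. p \<in> small3 r ==> (tm3 P p has_sum g p) UNIV" using assms by (auto simp: has_ps_def)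
 obtain C R where CR: "C \<ge> 0" "R \<ge> 1" "!!i j k. cmod (cf P i j k) \<le> C * R ^ (i + j + k)"
  using assms conv3E unfolding has_ps_def by metis
 show ?thesis
 proof (rule that[of "min r (1 / (2 * R))"])
  show "(%e. norm (tm3 P p e)) summable_on UNIV" if "p \<in> small3 (min r (1 / (2 * R)))" for p
   using tm3_abs_summable[of P C R p] CR small3_mono[OF that, of "1 / (2 * R)"] by simp
 qed (use r CR small3_mono in \<open>auto\<close>)
qed

lemma has_ps_exists: assumes "conv3 P" shows "has_ps (%p. infsum (tm3 P p) UNIV) P"
proof -
 obtain C R where CR: "C \<ge> 0" "R \<ge> 1" "!!i j k. cmod (cf P i j k) \<le> C * R ^ (i + j + k)" using assms conv3E by metis
 have "(tm3 P p has_sum infsum (tm3 P p) UNIV) UNIV" if "p \<in> small3 (1 / (2 * R))" for p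
  using abs_summable_summable[OF tm3_abs_summable[of P C R p]] CR that by (simp add: has_sum_infsum)
 then show ?thesis unfolding has_ps_def using assms CR by (intro conjI exI[of _ "1 / (2 * R)"]) auto
qed

lemma has_ps_add: assumes "has_ps g P" "has_ps h Q" shows "has_ps (%p. g p + h p) (P + Q)"
proof -
 obtain r where r: "r > 0" "!!p. p \<in> small3 r ==> (tm3 P p has_sum g p) UNIV" using has_psE[OF assms(1)] by metis
 obtain s where s: "s > 0" "!!p. p \<in> small3 s ==> (tm3 Q p has_sum h p) UNIV" using has_psE[OF assms(2)] by metis
 have "tm3 (P + Q) p = (%e. tm3 P p e + tm3 Q p e)" for p by (auto simp: tm3_def fun_eq_iff distrib_right)
 moreover have "(tm3 P p has_sum g p) UNIV" "(tm3 Q p has_sum h p) UNIV" if "p \<in> small3 (min r s)" for p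
  using r(2)[OF small3_mono[OF that]] s(2)[OF small3_mono[OF that]] by simp_all
 moreover have "conv3 (P + Q)" using assms by (simp add: has_ps_def conv3_add)
 ultimately show ?thesis unfolding has_ps_def using r(1) s(1)
  by (intro conjI exI[of _ "min r s"]) (auto intro!: has_sum_add)
qed

lemma has_ps_cmult: assumes "has_ps g P" shows "has_ps (%p. c * g p) (cc c * P)"
proof -
 obtain r where r: "r > 0" "!!p. p \<in> small3 r ==> (tm3 P p has_sum g p) UNIV" using has_psE[OF assms(1)] by metis
 have "tm3 (cc c * P) p = (%e. c * tm3 P p e)" for p by (auto simp: tm3_def fun_eq_iff mult.assoc)
 then show ?thesis unfolding has_ps_def using assms r
  by (intro conjI exI[of _ r]) (auto simp: has_ps_def conv3_cc intro!: has_sum_cmult_right)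
qed

lemma has_ps_diff: assumes "has_ps g P" "has_ps h Q" shows "has_ps (%p. g p - h p) (P - Q)"
 using has_ps_add[OF assms(1) has_ps_cmult[OF assms(2), of "-1"]] by (simp add: cc_uminus)

lemma has_ps_reindex:
 assumes "(tm3 P p has_sum s) UNIV" "inj h" "!!e. tm3 Q p (h e) = c * tm3 P p e" "!!e. e \<notin> range h ==> tm3 Q p e = 0"
 shows "(tm3 Q p has_sum (c * s)) UNIV"
proof -
 have "((%e. c * tm3 P p e) has_sum (c * s)) UNIV" by (rule has_sum_cmult_right[OF assms(1)])
 then have "((tm3 Q p \<circ> h) has_sum (c * s)) UNIV" using assms(3) by (simp add: o_def)
 then have "(tm3 Q p has_sum (c * s)) (range h)" by (simp add: has_sum_reindex[OF assms(2)])
 then show ?thesis using has_sum_cong_neutral[of UNIV "range h" "tm3 Q p" "tm3 Q p"] assms(4) by auto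
qed

lemma has_ps_var:
 assumes "has_ps g P"
 shows "has_ps (%p. vec_nth p 1 * g p) (cX * P)" "has_ps (%p. vec_nth p 2 * g p) (cY * P)" "has_ps (%p. vec_nth p 3 * g p) (cZ * P)"
proof -
 obtain r where r: "r > 0" "!!p. p \<in> small3 r ==> (tm3 P p has_sum g p) UNIV" using has_psE[OF assms(1)] by metis
 have cP: "conv3 P" using assms by (simp add: has_ps_def)
 have "(tm3 (cX * P) p has_sum (vec_nth p 1 * g p)) UNIV" if "p \<in> small3 r" for p
 proof (rule has_ps_reindex[OF r(2)[OF that], where h = "%(i, j, k). (Suc i, j, k)"])
  fix e :: "nat \<times> nat \<times> nat"
  assume "e \<notin> range (%(i, j, k). (Suc i, j, k))"
  then have "fst e = 0" by (cases e; cases "fst e") (auto simp: image_iff)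
  then show "tm3 (cX * P) p e = 0" by (cases e) (simp add: tm3_def)
 qed (auto simp: tm3_def inj_on_def)
 moreover have "(tm3 (cY * P) p has_sum (vec_nth p 2 * g p)) UNIV" if "p \<in> small3 r" for p
 proof (rule has_ps_reindex[OF r(2)[OF that], where h = "%(i, j, k). (i, Suc j, k)"])
  fix e :: "nat \<times> nat \<times> nat"
  assume "e \<notin> range (%(i, j, k). (i, Suc j, k))"
  then have "fst (snd e) = 0" by (cases e; cases "fst (snd e)") (auto simp: image_iff)
  then show "tm3 (cY * P) p e = 0" by (cases e) (simp add: tm3_def)
 qed (auto simp: tm3_def inj_on_def)
 moreover have "(tm3 (cZ * P) p has_sum (vec_nth p 3 * g p)) UNIV" if "p \<in> small3 r" for p
 proof (rule has_ps_reindex[OF r(2)[OF that], where h = "%(i, j, k). (i, j, Suc k)"])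
  fix e :: "nat \<times> nat \<times> nat"
  assume "e \<notin> range (%(i, j, k). (i, j, Suc k))"
  then have "snd (snd e) = 0" by (cases e; cases "snd (snd e)") (auto simp: image_iff)
  then show "tm3 (cZ * P) p e = 0" by (cases e) (simp add: tm3_def)
 qed (auto simp: tm3_def inj_on_def)
 ultimately show "has_ps (%p. vec_nth p 1 * g p) (cX * P)" "has_ps (%p. vec_nth p 2 * g p) (cY * P)" "has_ps (%p. vec_nth p 3 * g p) (cZ * P)"
  unfolding has_ps_def using r(1) conv3_var[OF cP] by blast+
qed

lemma has_ps_one: "has_ps (%p. 1) 1"
proof -
 have "(tm3 1 p has_sum 1) UNIV" for p
 proof -
  have "(tm3 1 p has_sum (\<Sum>e\<in>{(0,0,0)}. tm3 1 p e)) {(0,0,0)}" by (rule has_sum_finite) simp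
  then have "(tm3 1 p has_sum 1) {(0,0,0)}" by (simp add: tm3_def cf_one)
  then show ?thesis
   using has_sum_cong_neutral[of UNIV "{(0,0,0)}" "tm3 1 p" "tm3 1 p"] by (auto simp: tm3_def cf_one)
 qed
 moreover have "conv3 1" by (rule conv3I[of _ 1 1]) (simp add: cf_one)
 ultimately show ?thesis unfolding has_ps_def using zero_less_one by blast
qed

lemma has_ps_cong: assumes "has_ps g P" "eventually (%p. g p = h p) (nhds 0)" shows "has_ps h P"
proof -
 obtain r where r: "r > 0" "!!p. p \<in> small3 r ==> (tm3 P p has_sum g p) UNIV" using has_psE[OF assms(1)] by metis
 obtain e where e: "e > 0" "!!p. dist p 0 < e ==> g p = h p" using assms(2) unfolding eventually_nhds_metric by blast
 have near: "dist p 0 < e" if "p \<in> small3 (e / 4)" for p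
 proof -
  have "norm p \<le> (\<Sum>i\<in>UNIV. cmod (vec_nth p i))" by (simp add: norm_vec_def L2_set_le_sum)
  then show ?thesis using that e(1) by (simp add: small3_iff sum_3)
 qed
 have "(tm3 P p has_sum h p) UNIV" if "p \<in> small3 (min r (e / 4))" for p
  using r(2)[OF small3_mono[OF that]] e(2)[OF near[OF small3_mono[OF that]]] by simp
 then show ?thesis unfolding has_ps_def using assms r e
  by (intro conjI exI[of _ "min r (e / 4)"]) (auto simp: has_ps_def)
qed

lemma has_ps_eq_0: assumes "has_ps g P" shows "g 0 = cf P 0 0 0"
proof -
 obtain r where r: "r > 0" "!!p. p \<in> small3 r ==> (tm3 P p has_sum g p) UNIV" using has_psE[OF assms(1)] by metis
 have "(tm3 P 0 has_sum (\<Sum>e\<in>{(0,0,0)}. tm3 P 0 e)) {(0,0,0)}" by (rule has_sum_finite) simp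
 then have "(tm3 P 0 has_sum cf P 0 0 0) UNIV"
  using has_sum_cong_neutral[of UNIV "{(0,0,0)}" "tm3 P 0" "tm3 P 0"] by (auto simp: tm3_def)
 moreover have "(tm3 P 0 has_sum g 0) UNIV" using r by (auto simp: small3_def)
 ultimately show ?thesis using has_sum_unique by blast
qed

definition dtm3 :: "ps3 => complex ^ 3 => complex ^ 3 => nat \<times> nat \<times> nat => complex" where
 "dtm3 P p h = (%(i, j, k). cf P i j k *
  (of_nat i * (vec_nth p 1) ^ (i - 1) * vec_nth h 1 * (vec_nth p 2) ^ j * (vec_nth p 3) ^ k
  + (vec_nth p 1) ^ i * (of_nat j * (vec_nth p 2) ^ (j - 1) * vec_nth h 2) * (vec_nth p 3) ^ k
  + (vec_nth p 1) ^ i * (vec_nth p 2) ^ j * (of_nat k * (vec_nth p 3) ^ (k - 1) * vec_nth h 3)))"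

lemma has_derivative_tm3: "((%p. tm3 P p e) has_derivative (%h. dtm3 P p h e)) (at p within S)"
proof -
 obtain i j k where e: "e = (i, j, k)" by (cases e)
 have pw: "((%p::complex^3. (vec_nth p m) ^ n) has_derivative (%h. of_nat n * (vec_nth p m) ^ (n - 1) * vec_nth h m)) (at p within S)" for m n
  by (rule derivative_eq_intros bounded_linear.has_derivative[OF bounded_linear_vec_nth] | simp add: mult_ac)+
 show ?thesis unfolding e tm3_def dtm3_def prod.case
  by (rule has_derivative_eq_rhs[OF has_derivative_mult[OF has_derivative_mult[OF has_derivative_mult[OF has_derivative_const pw] pw] pw]])
   (simp add: fun_eq_iff algebra_simps)
qed

text \<open>Termwise differentiation. For |x|, |y|, |z| at most 1/(4 R) the differentiated terms are
  dominated by 4 C R / 2^(i + j + k): the exponent produced by differentiation is absorbed by 2^(i +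
  j + k), and one missing power of 1/(4 R) accounts for the factor 4 R.\<close>

lemma tm3_partial_sums:
 assumes P: "conv3 P"
 obtains r where "r > 0"
  "!!p. p \<in> small3 r ==> (tm3 P p has_sum infsum (tm3 P p) UNIV) UNIV"
  "!!p. p \<in> small3 r ==> ((%p. infsum (tm3 P p) UNIV) has_derivative
    (%h. infsum (tm3 (dX P) p) UNIV * vec_nth h 1 + infsum (tm3 (dY P) p) UNIV * vec_nth h 2 + infsum (tm3 (dZ P) p) UNIV * vec_nth h 3)) (at p)"
proof -
 obtain C R where CR: "C \<ge> 0" "R \<ge> 1" "!!i j k. cmod (cf P i j k) \<le> C * R ^ (i + j + k)"
  using conv3E[OF P] by metis
 have dc: "conv3 (dX P)" "conv3 (dY P)" "conv3 (dZ P)" by (simp_all add: conv3_d P)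
 obtain r0 where r0: "r0 > 0" "!!p. p \<in> small3 r0 ==> (tm3 P p has_sum infsum (tm3 P p) UNIV) UNIV"
  using has_psE[OF has_ps_exists[OF P]] by metis
 obtain r1 where r1: "r1 > 0" "!!p. p \<in> small3 r1 ==> (tm3 (dX P) p has_sum infsum (tm3 (dX P) p) UNIV) UNIV"
  using has_psE[OF has_ps_exists[OF dc(1)]] by metis
 obtain r2 where r2: "r2 > 0" "!!p. p \<in> small3 r2 ==> (tm3 (dY P) p has_sum infsum (tm3 (dY P) p) UNIV) UNIV"
  using has_psE[OF has_ps_exists[OF dc(2)]] by metis
 obtain r3 where r3: "r3 > 0" "!!p. p \<in> small3 r3 ==> (tm3 (dZ P) p has_sum infsum (tm3 (dZ P) p) UNIV) UNIV"
  using has_psE[OF has_ps_exists[OF dc(3)]] by metis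
 define r where "r = min r0 (min r1 (min r2 (min r3 (1 / (4 * R)))))"
 have r: "r > 0" "r \<le> r0" "r \<le> r1" "r \<le> r2" "r \<le> r3" "r \<le> 1 / (4 * R)"
  using r0(1) r1(1) r2(1) r3(1) CR unfolding r_def by auto
 define a1 where "a1 p = (%(i, j, k). cf P i j k * (of_nat i * (vec_nth p 1) ^ (i - 1) * (vec_nth p 2) ^ j * (vec_nth p 3) ^ k))" for p :: "complex ^ 3"
 define a2 where "a2 p = (%(i, j, k). cf P i j k * ((vec_nth p 1) ^ i * (of_nat j * (vec_nth p 2) ^ (j - 1)) * (vec_nth p 3) ^ k))" for p :: "complex ^ 3"
 define a3 where "a3 p = (%(i, j, k). cf P i j k * ((vec_nth p 1) ^ i * (vec_nth p 2) ^ j * (of_nat k * (vec_nth p 3) ^ (k - 1))))" for p :: "complex ^ 3"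
 have dt: "dtm3 P p h e = a1 p e * vec_nth h 1 + a2 p e * vec_nth h 2 + a3 p e * vec_nth h 3" for p h e
  by (cases e) (simp add: dtm3_def a1_def a2_def a3_def algebra_simps)
 have reix: "(a has_sum s) UNIV" if "(t has_sum s) UNIV" "inj g" "!!e. a (g e) = t e" "!!e. e \<notin> range g ==> a e = 0"
  for a t :: "nat \<times> nat \<times> nat => complex" and s g
 proof -
  have "((a \<circ> g) has_sum s) UNIV" using that by (simp add: o_def)
  then have "(a has_sum s) (range g)" by (simp add: has_sum_reindex[OF that(2)])
  then show ?thesis using has_sum_cong_neutral[of UNIV "range g" a a] that(4) by auto
 qed
 have h1: "(a1 p has_sum infsum (tm3 (dX P) p) UNIV) UNIV" if "p \<in> small3 r" for p
 proof (rule reix[OF r1(2), where g = "%(i, j, k). (Suc i, j, k)"])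
  fix e :: "nat \<times> nat \<times> nat" assume "e \<notin> range (%(i, j, k). (Suc i, j, k))"
  then have "fst e = 0" by (cases e; cases "fst e") (auto simp: image_iff)
  then show "a1 p e = 0" by (cases e) (simp add: a1_def)
 qed (use small3_mono[OF that] r in \<open>auto simp: a1_def tm3_def inj_on_def\<close>)
 have h2: "(a2 p has_sum infsum (tm3 (dY P) p) UNIV) UNIV" if "p \<in> small3 r" for p
 proof (rule reix[OF r2(2), where g = "%(i, j, k). (i, Suc j, k)"])
  fix e :: "nat \<times> nat \<times> nat" assume "e \<notin> range (%(i, j, k). (i, Suc j, k))"
  then have "fst (snd e) = 0" by (cases e; cases "fst (snd e)") (auto simp: image_iff)
  then show "a2 p e = 0" by (cases e) (simp add: a2_def)
 qed (use small3_mono[OF that] r in \<open>auto simp: a2_def tm3_def inj_on_def\<close>)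
 have h3: "(a3 p has_sum infsum (tm3 (dZ P) p) UNIV) UNIV" if "p \<in> small3 r" for p
 proof (rule reix[OF r3(2), where g = "%(i, j, k). (i, j, Suc k)"])
  fix e :: "nat \<times> nat \<times> nat" assume "e \<notin> range (%(i, j, k). (i, j, Suc k))"
  then have "snd (snd e) = 0" by (cases e; cases "snd (snd e)") (auto simp: image_iff)
  then show "a3 p e = 0" by (cases e) (simp add: a3_def)
 qed (use small3_mono[OF that] r in \<open>auto simp: a3_def tm3_def inj_on_def\<close>)
 define M where "M = (%(i, j, k). (4 * C * R) * (1/2) ^ (i + j + k) :: real)"
 have Msum: "M summable_on UNIV"
  using summable_on_cmult_right[OF geometric3_summable[of "1/2"], of "4 * C * R"] by (simp add: M_def case_prod_unfold)
 have bound: "c * (real n * (x1 ^ (if n = 0 then 0 else n - 1) * x2 ^ j * x3 ^ k)) \<le> (4 * C * R) * (1/2) ^ (n + j + k)"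
  if "0 \<le> x1" "x1 \<le> r" "0 \<le> x2" "x2 \<le> r" "0 \<le> x3" "x3 \<le> r" "c \<le> C * R ^ (n + j + k)" "0 \<le> c" for x1 x2 x3 c n j k
 proof (cases n)
  case 0
  then show ?thesis using CR by simp
 next
  case (Suc m)
  have q: "r \<le> 1 / (4 * R)" by (rule r)
  have "x1 ^ m * x2 ^ j * x3 ^ k \<le> (1 / (4 * R)) ^ m * (1 / (4 * R)) ^ j * (1 / (4 * R)) ^ k"
   using that q CR by (intro mult_mono power_mono mult_nonneg_nonneg zero_le_power) auto
  also have "\<dots> = (1 / (4 * R)) ^ (m + j + k)" by (simp add: power_add)
  finally have 1: "x1 ^ m * x2 ^ j * x3 ^ k \<le> (1 / (4 * R)) ^ (m + j + k)" .
  have "n < 2 ^ n" by (rule less_exp)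
  also have "(2::nat) ^ n \<le> 2 ^ (n + j + k)" by (rule power_increasing) auto
  finally have "real n \<le> 2 ^ (n + j + k)" by (metis less_imp_le of_nat_le_iff of_nat_numeral of_nat_power)
  then have "c * (real n * (x1 ^ m * x2 ^ j * x3 ^ k)) \<le> (C * R ^ (n + j + k)) * (2 ^ (n + j + k) * (1 / (4 * R)) ^ (m + j + k))"
   using 1 that CR by (intro mult_mono) (auto intro!: mult_nonneg_nonneg)
  also have "\<dots> = (4 * C * R) * (1/2) ^ (n + j + k)"
  proof -
   define N where "N = m + j + k"
   have "R ^ N * (2 ^ N * (1 / (4 * R)) ^ N) = (R * (2 * (1 / (4 * R)))) ^ N" by (simp only: power_mult_distrib)
   also have "R * (2 * (1 / (4 * R))) = 1/2" using CR(2) by simp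
   finally have h: "R ^ N * (2 ^ N * (1 / (4 * R)) ^ N) = (1/2) ^ N" .
   have "C * R ^ Suc N * (2 ^ Suc N * (1 / (4 * R)) ^ N) = C * R * 2 * (R ^ N * (2 ^ N * (1 / (4 * R)) ^ N))" by simp
   then have "C * R ^ Suc N * (2 ^ Suc N * (1 / (4 * R)) ^ N) = 4 * C * R * (1/2) ^ Suc N" unfolding h by simp
   then show ?thesis by (simp only: Suc N_def add_Suc)
  qed
  finally show ?thesis by (simp add: Suc)
 qed
 have b1: "cmod (a1 p e) \<le> M e" and b2: "cmod (a2 p e) \<le> M e" and b3: "cmod (a3 p e) \<le> M e" if "p \<in> small3 r" for p e
 proof -
  obtain i j k where e: "e = (i, j, k)" by (cases e)
  have p: "cmod (vec_nth p m) \<le> r" for m using that by (simp add: small3_def less_imp_le)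
  note b = bound[OF norm_ge_zero p norm_ge_zero p norm_ge_zero p _ norm_ge_zero]
  have n: "(if n = 0 then 0 else n - 1) = n - (1::nat)" for n by simp
  show "cmod (a1 p e) \<le> M e" using b[of "cf P i j k" i j k 1 2 3] CR(3)[of i j k]
   by (simp add: e a1_def M_def norm_mult norm_power n mult_ac)
  show "cmod (a2 p e) \<le> M e" using b[of "cf P i j k" j i k 2 1 3] CR(3)[of i j k]
   by (simp add: e a2_def M_def norm_mult norm_power n mult_ac add_ac)
  show "cmod (a3 p e) \<le> M e" using b[of "cf P i j k" k i j 3 1 2] CR(3)[of i j k]
   by (simp add: e a3_def M_def norm_mult norm_power n mult_ac add_ac)
 qed
 \<comment> \<open>An enumeration of the exponent triples turns the unordered sums into ordinary
   series, to which the theorem on termwise differentiation applies.\<close>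
 define d where "d = from_nat_into (UNIV :: (nat \<times> nat \<times> nat) set)"
 have inf: "infinite (UNIV :: (nat \<times> nat \<times> nat) set)" by (simp add: finite_prod)
 have d: "bij_betw d UNIV UNIV" unfolding d_def by (rule bij_betw_from_nat_into) (simp_all add: inf)
 have sums: "(%n. a (d n)) sums s" if "(a has_sum s) UNIV" for a :: "nat \<times> nat \<times> nat => complex" and s
  using has_sum_imp_sums that has_sum_reindex_bij_betw[OF d, of a s] by blast
 have Ms: "summable (%n. M (d n))"
  using summable_on_reindex_bij_betw[OF d, of M] Msum by (simp add: summable_on_UNIV_nonneg_real_iff M_def case_prod_unfold CR(1,2) order_trans[OF zero_le_one])
 let ?g' = "%p (h::complex^3). infsum (tm3 (dX P) p) UNIV * vec_nth h 1 + infsum (tm3 (dY P) p) UNIV * vec_nth h 2 + infsum (tm3 (dZ P) p) UNIV * vec_nth h 3"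
 have tail: "cmod ((\<Sum>i<n. a (d i)) - s) \<le> suminf (%i. M (d (i + n)))" if "(a has_sum s) UNIV" "!!e. cmod (a e) \<le> M e" for a s n
 proof -
  have sm: "summable (%i. cmod (a (d (i + n))))"
   by (rule summable_comparison_test'[OF summable_ignore_initial_segment[OF Ms, of n], of 0]) (use that(2) in auto)
  have "suminf (%i. a (d (i + n))) = s - (\<Sum>i<n. a (d i))"
   using suminf_minus_initial_segment[OF sums_summable[OF sums[OF that(1)]], of n] sums_unique[OF sums[OF that(1)]] by simp
  then have "cmod ((\<Sum>i<n. a (d i)) - s) = cmod (suminf (%i. a (d (i + n))))" by (simp add: norm_minus_commute)
  also have "\<dots> \<le> suminf (%i. cmod (a (d (i + n))))" by (rule summable_norm[OF sm])
  also have "\<dots> \<le> suminf (%i. M (d (i + n)))" by (rule suminf_le[OF that(2) sm summable_ignore_initial_segment[OF Ms]])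
  finally show ?thesis .
 qed
 have "\<exists>g. \<forall>x\<in>small3 r. (%n. tm3 P x (d n)) sums g x & (g has_derivative ?g' x) (at x within small3 r)"
 proof (rule has_derivative_series[where x = 0 and l = "infsum (tm3 P 0) UNIV", OF convex_small3 has_derivative_tm3])
  fix e :: real assume e: "e > 0"
  obtain N where N: "!!n. n \<ge> N ==> norm (suminf (%i. M (d (i + n)))) < e / 3"
   using suminf_exist_split[OF _ Ms, of "e / 3"] e by auto
  have "norm ((\<Sum>i<n. dtm3 P x h (d i)) - ?g' x h) \<le> e * norm h" if n: "n \<ge> N" and x: "x \<in> small3 r" for n x h
  proof -
   have t: "cmod ((\<Sum>i<n. a1 x (d i)) - infsum (tm3 (dX P) x) UNIV) \<le> e / 3"
    "cmod ((\<Sum>i<n. a2 x (d i)) - infsum (tm3 (dY P) x) UNIV) \<le> e / 3"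
    "cmod ((\<Sum>i<n. a3 x (d i)) - infsum (tm3 (dZ P) x) UNIV) \<le> e / 3"
    using tail[OF h1[OF x] b1[OF x], of n] tail[OF h2[OF x] b2[OF x], of n] tail[OF h3[OF x] b3[OF x], of n] N[OF n] by auto
   have hn: "cmod (vec_nth h m) \<le> norm h" for m by (rule Finite_Cartesian_Product.norm_nth_le)
   have m: "cmod (u * vec_nth h m) \<le> e / 3 * norm h" if "cmod u \<le> e / 3" for u m
    unfolding norm_mult using that hn e by (intro mult_mono) auto
   have "(\<Sum>i<n. dtm3 P x h (d i)) - ?g' x h = ((\<Sum>i<n. a1 x (d i)) - infsum (tm3 (dX P) x) UNIV) * vec_nth h 1
     + ((\<Sum>i<n. a2 x (d i)) - infsum (tm3 (dY P) x) UNIV) * vec_nth h 2 + ((\<Sum>i<n. a3 x (d i)) - infsum (tm3 (dZ P) x) UNIV) * vec_nth h 3"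
    by (simp only: dt sum.distrib flip: sum_distrib_right) (simp add: algebra_simps)
   also have "norm \<dots> \<le> e / 3 * norm h + e / 3 * norm h + e / 3 * norm h"
    by (intro norm_triangle_mono m t)
   finally show ?thesis by simp
  qed
  then show "\<forall>\<^sub>F n in sequentially. \<forall>x\<in>small3 r. \<forall>h. norm ((\<Sum>i<n. dtm3 P x h (d i)) - ?g' x h) \<le> e * norm h"
   unfolding eventually_sequentially by blast
 next
  show "0 \<in> small3 r" using r by (simp add: small3_def)
  have "0 \<in> small3 r0" using r0(1) by (simp add: small3_def)
  then show "(%n. tm3 P 0 (d n)) sums infsum (tm3 P 0) UNIV" by (intro sums r0(2))
 qed
 then obtain g where g: "!!x. x \<in> small3 r ==> (%n. tm3 P x (d n)) sums g x" "!!x. x \<in> small3 r ==> (g has_derivative ?g' x) (at x within small3 r)"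
  by blast
 have eq: "g x = infsum (tm3 P x) UNIV" if "x \<in> small3 r" for x
  using sums_unique2[OF g(1)[OF that] sums[OF r0(2)]] small3_mono[OF that] r by blast
 show ?thesis
 proof (rule that[OF r(1)])
  fix p assume p: "p \<in> small3 r"
  show "(tm3 P p has_sum infsum (tm3 P p) UNIV) UNIV" using r0(2) small3_mono[OF p] r by blast
  have "(g has_derivative ?g' p) (at p)" using g(2)[OF p] at_within_open[OF p open_small3] by simp
  then show "((%p. infsum (tm3 P p) UNIV) has_derivative ?g' p) (at p)"
   by (rule has_derivative_transform_within_open[OF _ open_small3 p eq])
 qed
qed

lemma has_ps_has_derivative:
 assumes "has_ps g P"
 obtains r where "r > 0" "!!p. p \<in> small3 r ==> g p = infsum (tm3 P p) UNIV"
  "!!p. p \<in> small3 r ==> (g has_derivative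
    (%h. infsum (tm3 (dX P) p) UNIV * vec_nth h 1 + infsum (tm3 (dY P) p) UNIV * vec_nth h 2 + infsum (tm3 (dZ P) p) UNIV * vec_nth h 3)) (at p)"
proof -
 have P: "conv3 P" using assms by (simp add: has_ps_def)
 obtain r where r: "r > 0" "!!p. p \<in> small3 r ==> (tm3 P p has_sum infsum (tm3 P p) UNIV) UNIV"
  "!!p. p \<in> small3 r ==> ((%p. infsum (tm3 P p) UNIV) has_derivative
    (%h. infsum (tm3 (dX P) p) UNIV * vec_nth h 1 + infsum (tm3 (dY P) p) UNIV * vec_nth h 2 + infsum (tm3 (dZ P) p) UNIV * vec_nth h 3)) (at p)"
  by (rule tm3_partial_sums[OF P]) (rule that)
 obtain s where s: "s > 0" "!!p. p \<in> small3 s ==> (tm3 P p has_sum g p) UNIV" using has_psE[OF assms] by metis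
 define q where "q = min r s"
 have q: "q > 0" "p \<in> small3 q ==> p \<in> small3 r" "p \<in> small3 q ==> p \<in> small3 s" for p
  using r(1) s(1) small3_mono[of p q r] small3_mono[of p q s] by (simp_all add: q_def)
 have eq: "g p = infsum (tm3 P p) UNIV" if "p \<in> small3 q" for p
  using infsumI[OF s(2)[OF q(3)[OF that]]] by simp
 show ?thesis
 proof (rule that[OF q(1) eq])
  fix p assume p: "p \<in> small3 q"
  show "(g has_derivative
    (%h. infsum (tm3 (dX P) p) UNIV * vec_nth h 1 + infsum (tm3 (dY P) p) UNIV * vec_nth h 2 + infsum (tm3 (dZ P) p) UNIV * vec_nth h 3)) (at p)"
   by (rule has_derivative_transform_within_open[OF r(3)[OF q(2)[OF p]] open_small3 p]) (simp add: eq)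
 qed
qed

lemma zero_small3: "r > 0 ==> 0 \<in> small3 r" by (simp add: small3_def)

lemma eventually_small3: "r > 0 ==> eventually (%p. p \<in> small3 r) (nhds 0)"
 using open_small3 zero_small3 eventually_nhds by blast

lemma has_ps_pd:
 assumes "has_ps g P"
 shows "has_ps (pd 1 g) (dX P)" "has_ps (pd 2 g) (dY P)" "has_ps (pd 3 g) (dZ P)"
proof -
 have P: "conv3 P" using assms by (simp add: has_ps_def)
 obtain r where r: "r > 0" "!!p. p \<in> small3 r ==> (g has_derivative
    (%h. infsum (tm3 (dX P) p) UNIV * vec_nth h 1 + infsum (tm3 (dY P) p) UNIV * vec_nth h 2 + infsum (tm3 (dZ P) p) UNIV * vec_nth h 3)) (at p)"
  by (rule has_ps_has_derivative[OF assms]) (rule that)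
 have ax: "vec_nth (axis 1 1 :: complex ^ 3) 2 = 0" "vec_nth (axis 1 1 :: complex ^ 3) 3 = 0" "vec_nth (axis 2 1 :: complex ^ 3) 1 = 0"
  "vec_nth (axis 2 1 :: complex ^ 3) 3 = 0" "vec_nth (axis 3 1 :: complex ^ 3) 1 = 0" "vec_nth (axis 3 1 :: complex ^ 3) 2 = 0"
  by (simp_all add: axis_def)
 have "pd 1 g p = infsum (tm3 (dX P) p) UNIV & pd 2 g p = infsum (tm3 (dY P) p) UNIV & pd 3 g p = infsum (tm3 (dZ P) p) UNIV"
  if "p \<in> small3 r" for p
  unfolding pd_def frechet_derivative_at[OF r(2)[OF that], symmetric] by (simp add: ax)
 then have *: "p \<in> small3 r ==> infsum (tm3 (dX P) p) UNIV = pd 1 g p" "p \<in> small3 r ==> infsum (tm3 (dY P) p) UNIV = pd 2 g p"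
   "p \<in> small3 r ==> infsum (tm3 (dZ P) p) UNIV = pd 3 g p" for p by simp_all
 note ev = eventually_mono[OF eventually_small3[OF r(1)]]
 show "has_ps (pd 1 g) (dX P)" by (rule has_ps_cong[OF has_ps_exists[OF conv3_d(1)[OF P]] ev[OF *(1)]])
 show "has_ps (pd 2 g) (dY P)" by (rule has_ps_cong[OF has_ps_exists[OF conv3_d(2)[OF P]] ev[OF *(2)]])
 show "has_ps (pd 3 g) (dZ P)" by (rule has_ps_cong[OF has_ps_exists[OF conv3_d(3)[OF P]] ev[OF *(3)]])
qed

lemma has_ps_holo: assumes "has_ps g P" shows "holo_germ g"
proof -
 obtain r where r: "r > 0" "!!p. p \<in> small3 r ==> (g has_derivative
    (%h. infsum (tm3 (dX P) p) UNIV * vec_nth h 1 + infsum (tm3 (dY P) p) UNIV * vec_nth h 2 + infsum (tm3 (dZ P) p) UNIV * vec_nth h 3)) (at p)"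
  by (rule has_ps_has_derivative[OF assms]) (rule that)
 have "Vector_Spaces.linear (*s) (*) (%h::complex^3. a * vec_nth h 1 + b * vec_nth h 2 + c * vec_nth h 3)" for a b c
  unfolding Vector_Spaces.linear_iff
  by (intro conjI vec.vector_space_axioms vector_space_over_itself.vector_space_axioms) (simp_all add: algebra_simps)
 then show ?thesis unfolding holo_germ_def using r(2)
  by (intro exI[of _ "small3 r"] conjI ballI open_small3 zero_small3 r(1)) blast
qed

lemma pd_eventually_zero:
 assumes "eventually (%p. g p = 0) (nhds 0)" shows "eventually (%p. pd i g p = 0) (nhds 0)"
proof -
 obtain U where U: "open U" "0 \<in> U" "!!p. p \<in> U ==> g p = 0" using assms unfolding eventually_nhds by blast
 have "pd i g p = 0" if p: "p \<in> U" for p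
 proof -
  have "(g has_derivative (%h. 0)) (at p)"
   by (rule has_derivative_transform_within_open[OF has_derivative_const[of 0] U(1) p]) (simp add: U(3))
  then show ?thesis unfolding pd_def by (simp add: frechet_derivative_at[symmetric])
 qed
 then show ?thesis unfolding eventually_nhds using U by blast
qed

text \<open>The constant coefficient is the value at 0, and the partial derivatives of a function
  vanishing near 0 vanish near 0. Every coefficient is thus reached by differentiating in one
  variable after the other.\<close>

lemma has_ps_zero_unique:
 assumes "has_ps g P" "eventually (%p. g p = 0) (nhds 0)" shows "P = 0"
proof (rule ps3_eqI)
 have base: "cf P 0 0 0 = 0" if "has_ps g P" "eventually (%p. g p = 0) (nhds 0)" for g P
  using has_ps_eq_0[OF that(1)] eventually_nhds_x_imp_x[OF that(2)] by simp
 have k: "cf P 0 0 k = 0" if "has_ps g P" "eventually (%p. g p = 0) (nhds 0)" for g P k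
  using that
 proof (induction k arbitrary: g P)
  case (Suc k)
  from Suc.IH[OF has_ps_pd(3)[OF Suc.prems(1)] pd_eventually_zero[OF Suc.prems(2)]] show ?case
   by (simp del: of_nat_Suc)
 qed (use base in blast)
 have j: "cf P 0 j k = 0" if "has_ps g P" "eventually (%p. g p = 0) (nhds 0)" for g P j k
  using that
 proof (induction j arbitrary: g P)
  case (Suc j)
  from Suc.IH[OF has_ps_pd(2)[OF Suc.prems(1)] pd_eventually_zero[OF Suc.prems(2)]] show ?case
   by (simp del: of_nat_Suc)
 qed (use k in blast)
 have "cf P i j k = 0" if "has_ps g P" "eventually (%p. g p = 0) (nhds 0)" for g P i j k
  using that
 proof (induction i arbitrary: g P)
  case (Suc i)
  from Suc.IH[OF has_ps_pd(1)[OF Suc.prems(1)] pd_eventually_zero[OF Suc.prems(2)]] show ?case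
   by (simp del: of_nat_Suc)
 qed (use j in blast)
 then show "cf P i j k = cf 0 i j k" for i j k using assms by simp
qed

lemma has_ps_unique:
 assumes "has_ps g P" "has_ps h Q" "eventually (%p. g p = h p) (nhds 0)" shows "P = Q"
proof -
 have "eventually (%p. g p - h p = 0) (nhds 0)" using assms(3) by (rule eventually_mono) simp
 then show ?thesis using has_ps_zero_unique[OF has_ps_diff[OF assms(1,2)]] by simp
qed

lemma has_ps_eventually_eq:
 assumes "has_ps g P" "has_ps h P" shows "eventually (%p. g p = h p) (nhds 0)"
proof -
 obtain r where r: "r > 0" "!!p. p \<in> small3 r ==> g p = infsum (tm3 P p) UNIV" by (rule has_ps_has_derivative[OF assms(1)]) (rule that)
 obtain s where s: "s > 0" "!!p. p \<in> small3 s ==> h p = infsum (tm3 P p) UNIV" by (rule has_ps_has_derivative[OF assms(2)]) (rule that)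
 show ?thesis using eventually_conj[OF eventually_small3[OF r(1)] eventually_small3[OF s(1)]]
  by (rule eventually_mono) (simp add: r s)
qed

section \<open>Holomorphic germs have Taylor series\<close>

definition circ :: "real => real => complex" where "circ r t = of_real r * exp (2 * pi * \<i> * t)"

lemma norm_circ: "r > 0 ==> cmod (circ r t) = r"
 by (simp add: circ_def norm_mult norm_exp_eq_Re)

lemma continuous_circ [continuous_intros]: "continuous_on S t ==> continuous_on S (%x. circ r (t x))"
 unfolding circ_def by (intro continuous_intros)

text \<open>Cauchy's formula as an average over a parametrised circle. In this form the coefficients
  are integrals over [0, 1], continuous in further parameters, so that the formula can be
  iterated.\<close>

lemma cauchy_coefficients:
 assumes "continuous_on (cball 0 r) h" "h holomorphic_on ball 0 r" "r > 0" "cmod w < r"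
 shows "(%n. integral {0..1} (%t. h (circ r t) / circ r t ^ n) * w ^ n) sums h w"
proof -
 have c: "circlepath 0 r = circ r" by (auto simp: circlepath circ_def)
 have "(deriv ^^ n) h 0 / fact n = integral {0..1} (%t. h (circ r t) / circ r t ^ n)" for n
 proof -
  have nz: "circ r t ~= 0" for t using norm_circ[OF assms(3), of t] assms(3) by auto
  have "(deriv ^^ n) h 0 = (fact n) / (2 * pi * \<i>) * contour_integral (circlepath 0 r) (%u. h u / (u - 0) ^ Suc n)"
   by (rule Cauchy_higher_derivative_integral_circlepath(2)[OF assms(1,2)]) (use assms(3) in simp)
  also have "contour_integral (circlepath 0 r) (%u. h u / (u - 0) ^ Suc n)
   = integral {0..1} (%t. h (circ r t) / (circ r t - 0) ^ Suc n * vector_derivative (circlepath 0 r) (at t))"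
   by (simp add: contour_integral_integral c)
  also have "\<dots> = integral {0..1} (%t. (2 * pi * \<i>) * (h (circ r t) / circ r t ^ n))"
  proof (rule integral_cong)
   fix t
   have "vector_derivative (circlepath 0 r) (at t) = 2 * pi * \<i> * circ r t"
    by (simp add: vector_derivative_circlepath circ_def)
   then show "h (circ r t) / (circ r t - 0) ^ Suc n * vector_derivative (circlepath 0 r) (at t) = (2 * pi * \<i>) * (h (circ r t) / circ r t ^ n)"
    using nz[of t] by (simp add: field_simps)
  qed
  also have "\<dots> = (2 * pi * \<i>) * integral {0..1} (%t. h (circ r t) / circ r t ^ n)" by (rule integral_mult_right)
  finally show ?thesis by simp
 qed
 moreover have "(%n. (deriv ^^ n) h 0 / fact n * (w - 0) ^ n) sums h w"
  by (rule holomorphic_power_series[OF assms(2)]) (use assms(4) in simp)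
 ultimately show ?thesis by simp
qed

lemma sums_integral:
 fixes f :: "nat => real => complex"
 assumes "!!n. continuous_on {0..1} (f n)" "!!n t. t \<in> {0..1} ==> cmod (f n t) \<le> B n" "summable B"
  "!!t. t \<in> {0..1} ==> (%n. f n t) sums F t"
 shows "(%n. integral {0..1} (f n)) sums integral {0..1} F"
proof -
 have "uniform_limit {0..1} (%N t. \<Sum>n<N. f n t) (%t. suminf (%n. f n t)) sequentially"
  by (rule Weierstrass_m_test[OF _ assms(3)]) (use assms(2) in auto)
 then have "uniform_limit {0..1} (%N t. \<Sum>n<N. f n t) F sequentially"
  by (rule uniform_limit_cong'[THEN iffD1, rotated 2]) (use sums_unique[OF assms(4)] in auto)
 then obtain I J where IJ: "!!N. ((%t. \<Sum>n<N. f n t) has_integral I N) {0..1}" "(F has_integral J) {0..1}" "(I \<longlongrightarrow> J) sequentially"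
  by (rule uniform_limit_integral) (use assms(1) in \<open>auto intro!: continuous_intros\<close>)
 have "integral {0..1} (%t. \<Sum>n<N. f n t) = (\<Sum>n<N. integral {0..1} (f n))" for N
  by (rule integral_sum) (use assms(1) integrable_continuous_real in auto)
 then have "I = (%N. \<Sum>n<N. integral {0..1} (f n))" using integral_unique[OF IJ(1)] by (intro ext) simp
 then show ?thesis using IJ(3) integral_unique[OF IJ(2)] by (simp add: sums_def)
qed

lemma circle_average_bound:
 fixes f :: "real => complex"
 assumes "continuous_on {0..1} f" "!!t. t \<in> {0..1} ==> cmod (f t) \<le> B" "r > 0"
 shows "cmod (integral {0..1} (%t. f t / circ r t ^ n)) \<le> B / r ^ n"
proof -
 have nz: "circ r t ~= 0" for t using norm_circ[OF assms(3), of t] assms(3) by auto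
 have "norm (integral {0..1} (%t. f t / circ r t ^ n)) \<le> (B / r ^ n) * (1 - 0)"
 proof (rule integral_bound)
  show "continuous_on {0..1} (%t. f t / circ r t ^ n)" using nz by (intro continuous_intros assms) auto
  show "norm (f t / circ r t ^ n) \<le> B / r ^ n" if "t \<in> {0..1}" for t
   using assms(2)[OF that] assms(3) by (auto simp: norm_divide norm_power norm_circ intro!: divide_right_mono)
 qed simp
 then show ?thesis by simp
qed

definition vec3 :: "complex => complex => complex => complex ^ 3" where
 "vec3 x y z = x *s axis 1 1 + y *s axis 2 1 + z *s axis 3 1"

lemma vec3_nth [simp]: "vec_nth (vec3 x y z) 1 = x" "vec_nth (vec3 x y z) 2 = y" "vec_nth (vec3 x y z) 3 = z"
 by (simp_all add: vec3_def axis_def)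
lemma vec3_eta: "vec3 (vec_nth p 1) (vec_nth p 2) (vec_nth p 3) = p"
 by (simp add: vec_eq_iff forall_3)

lemma vec3_add_axis: "vec3 x y 0 + w *s axis 3 1 = vec3 x y w" "vec3 x 0 z + w *s axis 2 1 = vec3 x w z" "vec3 0 y z + w *s axis 1 1 = vec3 w y z"
 by (simp_all add: vec3_def add_ac)

lemma continuous_smult_axis: "continuous_on S f ==> continuous_on S (%x. f x *s (axis i 1 :: complex ^ 3))"
proof -
 have "linear (%c. c *s (axis i 1 :: complex ^ 3))"
  by (rule linearI) (auto simp: vec_eq_iff distrib_right)
 then have "bounded_linear (%c. c *s (axis i 1 :: complex ^ 3))" by (simp add: linear_conv_bounded_linear)
 then show "continuous_on S f ==> continuous_on S (%x. f x *s (axis i 1 :: complex ^ 3))" by (rule bounded_linear.continuous_on)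
qed

lemma continuous_vec3 [continuous_intros]:
 "continuous_on S f ==> continuous_on S g ==> continuous_on S h ==> continuous_on S (%x. vec3 (f x) (g x) (h x))"
 unfolding vec3_def by (intro continuous_intros continuous_smult_axis)

lemma holomorphic_slice:
 assumes "!!p. p \<in> V ==> \<exists>D. Vector_Spaces.linear (*s) (*) D & (g has_derivative D) (at p)"
  "!!w. w \<in> S ==> q + w *s axis i 1 \<in> V"
 shows "(%w. g (q + w *s axis i 1 :: complex ^ 3)) holomorphic_on S"
 unfolding holomorphic_on_def field_differentiable_def
proof
 fix w assume w: "w \<in> S"
 obtain D where D: "Vector_Spaces.linear (*s) (*) D" "(g has_derivative D) (at (q + w *s axis i 1))" using assms w by blast
 have "linear (%c. c *s (axis i 1 :: complex ^ 3))"
  by (rule linearI) (auto simp: vec_eq_iff distrib_right)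
 then have bl: "bounded_linear (%c. c *s (axis i 1 :: complex ^ 3))" by (simp add: linear_conv_bounded_linear)
 have "((%w. q + w *s axis i 1) has_derivative (%h. 0 + h *s axis i 1)) (at w within S)"
  by (intro has_derivative_add has_derivative_const bounded_linear.has_derivative[OF bl] has_derivative_ident)
 from has_derivative_compose[OF this D(2)]
 have "((%w. g (q + w *s axis i 1)) has_derivative (%h. D (h *s axis i 1))) (at w within S)" by simp
 moreover have "D (h *s axis i 1) = D (axis i 1) * h" for h
  using D(1) unfolding Vector_Spaces.linear_iff by (simp add: mult.commute)
 ultimately have "((%w. g (q + w *s axis i 1)) has_field_derivative D (axis i 1)) (at w within S)"
  by (simp add: has_field_derivative_def)
 then show "\<exists>f'. ((%w. g (q + w *s axis i 1)) has_field_derivative f') (at w within S)" by blast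
qed

text \<open>Iterated Cauchy averages over the torus. The expansions \<open>s3\<close>,
  \<open>s2\<close>, \<open>s1\<close> in z, y, x keep the preceding variables on their circles;
  \<open>t2\<close>, \<open>t1\<close>, \<open>t0\<close> integrate them term by term and thereby
  bring all coefficients to the form \<open>A1\<close>. The Cauchy bounds make the triple series
  absolutely convergent, so the iterated sums equal the unordered one.\<close>

theorem holo_germ_has_ps:
 assumes "holo_germ g" shows "\<exists>P. has_ps g P"
proof -
 obtain U where U: "open U" "0 \<in> U" "!!p. p \<in> U ==> \<exists>D. Vector_Spaces.linear (*s) (*) D & (g has_derivative D) (at p)"
  using assms unfolding holo_germ_def by blast
 obtain e where e: "e > 0" "ball 0 e \<subseteq> U" using U(1,2) open_contains_ball by blast
 \<comment> \<open>A point whose coordinates have modulus at most r has norm at most 3 r, which is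
   less than e.\<close>
 define r where "r = e / 4"
 have r: "r > 0" using e by (simp add: r_def)
 define B where "B = cball (0::complex) r"
 have inU: "vec3 x y z \<in> U" if "x \<in> B" "y \<in> B" "z \<in> B" for x y z
 proof -
  have "norm (vec3 x y z) \<le> (\<Sum>i\<in>UNIV. cmod (vec_nth (vec3 x y z) i))" by (simp add: norm_vec_def L2_set_le_sum)
  also have "\<dots> < e" using that e(1) by (simp add: B_def r_def sum_3)
  finally show ?thesis using e(2) by auto
 qed
 have gcont: "continuous_on U g"
 proof (rule continuous_at_imp_continuous_on, rule ballI)
  fix p assume "p \<in> U"
  from U(3)[OF this] show "isCont g p" using has_derivative_continuous by blast
 qed
 have Gcont: "continuous_on S (%s. g (vec3 (a s) (b s) (c s)))"
  if "continuous_on S a" "continuous_on S b" "continuous_on S c" "!!s. s \<in> S ==> a s \<in> B & b s \<in> B & c s \<in> B"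
  for S and a b c :: "'s::topological_space => complex"
  by (rule continuous_on_compose2[OF gcont continuous_vec3[OF that(1-3)]]) (use inU that(4) in auto)
 have G3: "(%z. g (vec3 x y z)) holomorphic_on ball 0 r" if "x \<in> B" "y \<in> B" for x y
 proof -
  have "(%z. g (vec3 x y 0 + z *s axis 3 1)) holomorphic_on ball 0 r"
   by (rule holomorphic_slice[OF U(3)]) (use that in \<open>auto simp: vec3_add_axis intro: inU simp: B_def\<close>)
  then show ?thesis by (simp add: vec3_add_axis)
 qed
 have G2: "(%y. g (vec3 x y z)) holomorphic_on ball 0 r" if "x \<in> B" "z \<in> B" for x z
 proof -
  have "(%y. g (vec3 x 0 z + y *s axis 2 1)) holomorphic_on ball 0 r"
   by (rule holomorphic_slice[OF U(3)]) (use that in \<open>auto simp: vec3_add_axis intro: inU simp: B_def\<close>)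
  then show ?thesis by (simp add: vec3_add_axis)
 qed
 have G1: "(%x. g (vec3 x y z)) holomorphic_on ball 0 r" if "y \<in> B" "z \<in> B" for y z
 proof -
  have "(%x. g (vec3 0 y z + x *s axis 1 1)) holomorphic_on ball 0 r"
   by (rule holomorphic_slice[OF U(3)]) (use that in \<open>auto simp: vec3_add_axis intro: inU simp: B_def\<close>)
  then show ?thesis by (simp add: vec3_add_axis)
 qed
 have E: "circ r t \<in> B" for t using norm_circ[OF r, of t] by (simp add: B_def)
 have Enz [simp]: "circ r t ~= 0" for t using norm_circ[OF r, of t] r by auto
 have wB: "w \<in> B" if "cmod w < r" for w using that by (simp add: B_def)
 have compB: "compact (B \<times> B \<times> B)" by (simp add: B_def compact_Times)
 have "continuous_on (B \<times> B \<times> B) (%s. g (vec3 (fst s) (fst (snd s)) (snd (snd s))))"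
  by (rule Gcont) (auto intro!: continuous_intros)
 from compact_imp_bounded[OF compact_continuous_image[OF this compB]]
 obtain M where M': "!!s. s \<in> B \<times> B \<times> B ==> cmod (g (vec3 (fst s) (fst (snd s)) (snd (snd s)))) \<le> M"
  unfolding bounded_iff by blast
 have M: "cmod (g (vec3 x y z)) \<le> M" if "x \<in> B" "y \<in> B" "z \<in> B" for x y z
  using M'[of "(x, y, z)"] that by simp
 have "0 \<in> B" using r by (simp add: B_def)
 then have M0: "M \<ge> 0" using order_trans[OF norm_ge_zero M] by blast
 define A3 where "A3 k t1 t2 = integral {0..1} (%t3. g (vec3 (circ r t1) (circ r t2) (circ r t3)) / circ r t3 ^ k)" for k t1 t2
 define A2 where "A2 j k t1 = integral {0..1} (%t2. A3 k t1 t2 / circ r t2 ^ j)" for j k t1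
 define A1 where "A1 i j k = integral {0..1} (%t1. A2 j k t1 / circ r t1 ^ i)" for i j k
 define B2 where "B2 z j t1 = integral {0..1} (%t2. g (vec3 (circ r t1) (circ r t2) z) / circ r t2 ^ j)" for z j t1
 have cont_int: "continuous_on S (%s. integral {0..1} (f s))"
  if "continuous_on (S \<times> {0..1}) (%(s, t). f s t)" for S and f :: "'s::topological_space => real => complex"
  using integral_continuous_on_param[of S 0 1 f] that by simp
 have A3c: "continuous_on ({0..1} \<times> {0..1}) (%s. A3 k (fst s) (snd s))" for k
  unfolding A3_def by (rule cont_int) (auto simp: case_prod_unfold intro!: continuous_intros Gcont E Enz)
 have A3c': "continuous_on {0..1} (%t2. A3 k t1 t2)" if "t1 \<in> {0..1}" for k t1
 proof -
  have "continuous_on {0..1} (%t::real. (t1, t))" by (rule continuous_on_Pair[OF continuous_on_const continuous_on_id])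
  moreover have "(%t. (t1, t)) ` {0..1} \<subseteq> {0..1} \<times> {0..1}" using that by auto
  ultimately have "continuous_on {0..1} (%t. A3 k (fst (t1, t)) (snd (t1, t)))" by (rule continuous_on_compose2[OF A3c[of k]])
  then show ?thesis by simp
 qed
 have A2c: "continuous_on {0..1} (%t1. A2 j k t1)" for j k
  unfolding A2_def by (rule cont_int) (auto simp: case_prod_unfold intro!: continuous_intros A3c Enz)
 have B2c: "continuous_on {0..1} (%t1. B2 z j t1)" if "z \<in> B" for z j
  unfolding B2_def by (rule cont_int) (auto simp: case_prod_unfold intro!: continuous_intros Gcont E Enz that)
 have A3b: "cmod (A3 k t1 t2) \<le> M / r ^ k" for k t1 t2
  unfolding A3_def by (rule circle_average_bound[OF _ _ r]) (auto intro!: Gcont continuous_intros E M)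
 have A2b: "cmod (A2 j k t1) \<le> M / r ^ k / r ^ j" if "t1 \<in> {0..1}" for j k t1
  unfolding A2_def by (rule circle_average_bound[OF A3c'[OF that] A3b r])
 have A1b: "cmod (A1 i j k) \<le> M / r ^ k / r ^ j / r ^ i" for i j k
  unfolding A1_def by (rule circle_average_bound[OF A2c A2b r])
 have B2b: "cmod (B2 z j t1) \<le> M / r ^ j" if "z \<in> B" for z j t1
  unfolding B2_def by (rule circle_average_bound[OF _ _ r]) (auto intro!: Gcont continuous_intros E M that)
 have geo: "summable (%n. c / r ^ n * cmod w ^ n)" if "cmod w < r" for w and c :: real
 proof -
  have "summable (%n. c * (cmod w / r) ^ n)" using that r by (intro summable_mult summable_geometric) simp
  then show ?thesis by (simp add: power_divide field_simps)
 qed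
 have s3: "(%k. A3 k t1 t2 * z ^ k) sums g (vec3 (circ r t1) (circ r t2) z)" if "cmod z < r" for t1 t2 z
  unfolding A3_def by (rule cauchy_coefficients[OF _ _ r that, where h = "%z. g (vec3 (circ r t1) (circ r t2) z)"])
   (auto intro!: Gcont G3 continuous_intros E simp: B_def[symmetric])
 have s2: "(%j. B2 z j t1 * y ^ j) sums g (vec3 (circ r t1) y z)" if "cmod z < r" "cmod y < r" for t1 y z
  unfolding B2_def by (rule cauchy_coefficients[OF _ _ r that(2), where h = "%y. g (vec3 (circ r t1) y z)"])
   (auto intro!: Gcont G2 continuous_intros E wB that(1) simp: B_def[symmetric])
 have s1: "(%i. integral {0..1} (%t1. g (vec3 (circ r t1) y z) / circ r t1 ^ i) * x ^ i) sums g (vec3 x y z)"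
  if "cmod z < r" "cmod y < r" "cmod x < r" for x y z
  by (rule cauchy_coefficients[OF _ _ r that(3), where h = "%x. g (vec3 x y z)"])
   (auto intro!: Gcont G1 continuous_intros wB that(1,2) simp: B_def[symmetric])
 have t2: "(%k. A2 j k t1 * z ^ k) sums B2 z j t1" if "cmod z < r" "t1 \<in> {0..1}" for z j t1
 proof -
  have "(%k. integral {0..1} (%t2. A3 k t1 t2 * z ^ k / circ r t2 ^ j)) sums B2 z j t1"
   unfolding B2_def
  proof (rule sums_integral[where B = "%k. (M / r ^ j) / r ^ k * cmod z ^ k"])
   show "cmod (A3 k t1 t2 * z ^ k / circ r t2 ^ j) \<le> (M / r ^ j) / r ^ k * cmod z ^ k" for k t2
    using mult_right_mono[OF A3b[of k t1 t2], of "cmod z ^ k / r ^ j"] r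
    by (simp add: norm_divide norm_mult norm_power norm_circ[OF r] field_simps)
   show "continuous_on {0..1} (%t2. A3 k t1 t2 * z ^ k / circ r t2 ^ j)" for k
    by (intro continuous_intros A3c'[OF that(2)]) simp
   show "summable (%k. (M / r ^ j) / r ^ k * cmod z ^ k)" by (rule geo[OF that(1)])
   show "(%k. A3 k t1 t2 * z ^ k / circ r t2 ^ j) sums (g (vec3 (circ r t1) (circ r t2) z) / circ r t2 ^ j)" for t2
    by (intro sums_divide s3 that(1))
  qed
  moreover have "integral {0..1} (%t2. A3 k t1 t2 * z ^ k / circ r t2 ^ j) = A2 j k t1 * z ^ k" for k
   unfolding A2_def by (subst integral_mult_left[symmetric]) (simp add: mult.commute)
  ultimately show ?thesis by simp
 qed
 have t1: "(%j. integral {0..1} (%t1. B2 z j t1 / circ r t1 ^ i) * y ^ j) sums integral {0..1} (%t1. g (vec3 (circ r t1) y z) / circ r t1 ^ i)"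
  if "cmod z < r" "cmod y < r" for y z i
 proof -
  have "(%j. integral {0..1} (%t1. B2 z j t1 * y ^ j / circ r t1 ^ i)) sums integral {0..1} (%t1. g (vec3 (circ r t1) y z) / circ r t1 ^ i)"
  proof (rule sums_integral[where B = "%k. (M / r ^ i) / r ^ k * cmod y ^ k"])
   show "cmod (B2 z k t1 * y ^ k / circ r t1 ^ i) \<le> (M / r ^ i) / r ^ k * cmod y ^ k" for k t1
    using mult_right_mono[OF B2b[OF wB[OF that(1)], of k t1], of "cmod y ^ k / r ^ i"] r
    by (simp add: norm_divide norm_mult norm_power norm_circ[OF r] field_simps)
   show "continuous_on {0..1} (%t1. B2 z k t1 * y ^ k / circ r t1 ^ i)" for k
    by (intro continuous_intros B2c[OF wB[OF that(1)]]) simp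
   show "summable (%k. (M / r ^ i) / r ^ k * cmod y ^ k)" by (rule geo[OF that(2)])
   show "(%k. B2 z k t1 * y ^ k / circ r t1 ^ i) sums (g (vec3 (circ r t1) y z) / circ r t1 ^ i)" for t1
    by (intro sums_divide s2 that)
  qed
  moreover have "integral {0..1} (%t1. B2 z j t1 * y ^ j / circ r t1 ^ i) = integral {0..1} (%t1. B2 z j t1 / circ r t1 ^ i) * y ^ j" for j
   by (subst integral_mult_left[symmetric]) (simp add: mult.commute)
  ultimately show ?thesis by simp
 qed
 have t0: "(%k. A1 i j k * z ^ k) sums integral {0..1} (%t1. B2 z j t1 / circ r t1 ^ i)" if "cmod z < r" for z i j
 proof -
  have "(%k. integral {0..1} (%t1. A2 j k t1 * z ^ k / circ r t1 ^ i)) sums integral {0..1} (%t1. B2 z j t1 / circ r t1 ^ i)"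
  proof (rule sums_integral[where B = "%k. (M / r ^ j / r ^ i) / r ^ k * cmod z ^ k"])
   show "cmod (A2 j k t1 * z ^ k / circ r t1 ^ i) \<le> (M / r ^ j / r ^ i) / r ^ k * cmod z ^ k" if "t1 \<in> {0..1}" for k t1
    using mult_right_mono[OF A2b[OF that, of j k], of "cmod z ^ k / r ^ i"] r
    by (simp add: norm_divide norm_mult norm_power norm_circ[OF r] field_simps)
   show "continuous_on {0..1} (%t1. A2 j k t1 * z ^ k / circ r t1 ^ i)" for k
    by (intro continuous_intros A2c) simp
   show "summable (%k. (M / r ^ j / r ^ i) / r ^ k * cmod z ^ k)" by (rule geo[OF that])
   show "(%k. A2 j k t1 * z ^ k / circ r t1 ^ i) sums (B2 z j t1 / circ r t1 ^ i)" if "t1 \<in> {0..1}" for t1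
    by (intro sums_divide t2 that \<open>cmod z < r\<close>)
  qed
  moreover have "integral {0..1} (%t1. A2 j k t1 * z ^ k / circ r t1 ^ i) = A1 i j k * z ^ k" for k
   unfolding A1_def by (subst integral_mult_left[symmetric]) (simp add: mult.commute)
  ultimately show ?thesis by simp
 qed
 define P where "P = mk A1"
 have Pb: "cmod (cf P i j k) \<le> M * (1 / r) ^ (i + j + k)" for i j k
  using A1b[of i j k] r by (simp add: P_def power_add power_divide field_simps)
 have "conv3 P" using Pb by (rule conv3I)
 moreover have "(tm3 P p has_sum g p) UNIV" if p: "p \<in> small3 (1 / (2 * (1 / r)))" for p
 proof -
  define x y z where "x = vec_nth p 1" and "y = vec_nth p 2" and "z = vec_nth p 3"
  have xyz: "cmod x < r" "cmod y < r" "cmod z < r" using p r by (auto simp: small3_iff x_def y_def z_def)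
  have "(%e. norm (tm3 P p e)) summable_on UNIV" by (rule tm3_abs_summable[OF Pb _ M0 p]) (use r in simp)
  then have sm: "tm3 P p summable_on UNIV" by (rule abs_summable_summable)
  have sm': "tm3 P p summable_on (UNIV \<times> UNIV)" using sm by simp
  have smi: "(%(j, k). tm3 P p (i, j, k)) summable_on (UNIV \<times> UNIV)" for i
   using summable_on_SigmaD1[of "%a b. tm3 P p (a, b)" UNIV "%_. UNIV" i] sm by (simp add: case_prod_unfold)
  have smj: "(%k. tm3 P p (i, j, k)) summable_on UNIV" for i j
   using summable_on_SigmaD1[OF smi, of j i] by simp
  have v3: "((%k. tm3 P p (i, j, k)) has_sum (x ^ i * y ^ j * integral {0..1} (%t1. B2 z j t1 / circ r t1 ^ i))) UNIV" for i j
  proof -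
   have "(%k. tm3 P p (i, j, k)) sums (x ^ i * y ^ j * integral {0..1} (%t1. B2 z j t1 / circ r t1 ^ i))"
    using sums_mult[OF t0[OF xyz(3), of i j], of "x ^ i * y ^ j"] by (simp add: tm3_def P_def x_def y_def z_def mult_ac)
   from sums_unique2[OF has_sum_imp_sums[OF has_sum_infsum[OF smj[of i j]]] this] show ?thesis
    using has_sum_infsum[OF smj[of i j]] by simp
  qed
  have v2: "((%(j, k). tm3 P p (i, j, k)) has_sum (x ^ i * integral {0..1} (%t1. g (vec3 (circ r t1) y z) / circ r t1 ^ i))) (UNIV \<times> UNIV)" for i
  proof -
   have "((%j. x ^ i * y ^ j * integral {0..1} (%t1. B2 z j t1 / circ r t1 ^ i)) has_sum infsum (%(j, k). tm3 P p (i, j, k)) (UNIV \<times> UNIV)) UNIV"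
    using has_sum_SigmaD[OF has_sum_infsum[OF smi[of i]], of "%j. x ^ i * y ^ j * integral {0..1} (%t1. B2 z j t1 / circ r t1 ^ i)"] v3 by simp
   note 1 = has_sum_imp_sums[OF this]
   have 2: "(%j. x ^ i * y ^ j * integral {0..1} (%t1. B2 z j t1 / circ r t1 ^ i)) sums (x ^ i * integral {0..1} (%t1. g (vec3 (circ r t1) y z) / circ r t1 ^ i))"
    using sums_mult[OF t1[OF xyz(3,2), of i], of "x ^ i"] by (simp only: mult.assoc mult.commute[of "y ^ _"])
   show ?thesis using has_sum_infsum[OF smi[of i]] unfolding sums_unique2[OF 1 2] .
  qed
  have "((%i. x ^ i * integral {0..1} (%t1. g (vec3 (circ r t1) y z) / circ r t1 ^ i)) has_sum infsum (tm3 P p) (UNIV \<times> UNIV)) UNIV"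
   using has_sum_SigmaD[OF has_sum_infsum[OF sm'], of "%i. x ^ i * integral {0..1} (%t1. g (vec3 (circ r t1) y z) / circ r t1 ^ i)"] v2
   by (simp add: case_prod_unfold)
  note 1 = has_sum_imp_sums[OF this]
  have 2: "(%i. x ^ i * integral {0..1} (%t1. g (vec3 (circ r t1) y z) / circ r t1 ^ i)) sums g p"
   using s1[OF xyz(3,2,1)] by (simp only: mult.commute[of "x ^ _"]) (simp add: x_def y_def z_def vec3_eta)
  have "infsum (tm3 P p) UNIV = g p" using sums_unique2[OF 1 2] by simp
  then show ?thesis using has_sum_infsum[OF sm] by simp
 qed
 moreover have "1 / (2 * (1 / r)) > 0" using r by simp
 ultimately show ?thesis unfolding has_ps_def by blast
qed

section \<open>The module of the germ\<close>

text \<open>Cosets of cosets are handled through a map \<open>pj\<close> from a set \<open>A\<close>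
  in an ordinary additive group. It describes carrier, zero and addition but need not be injective;
  its kernel is recorded by \<open>pker\<close>.\<close>

definition presents :: "('m, 'x) ring_scheme => 'a::ab_group_add set => ('a => 'm) => bool" where
 "presents R A pj \<longleftrightarrow> 0 \<in> A & (\<forall>x\<in>A. \<forall>y\<in>A. x + y \<in> A) & (\<forall>x\<in>A. - x \<in> A) & carrier R = pj ` A &
  \<zero>\<^bsub>R\<^esub> = pj 0 & (\<forall>x\<in>A. \<forall>y\<in>A. pj x \<oplus>\<^bsub>R\<^esub> pj y = pj (x + y))"

lemma presentsD:
 assumes "presents R A pj"
 shows "0 \<in> A" "x \<in> A ==> y \<in> A ==> x + y \<in> A" "x \<in> A ==> - x \<in> A" "carrier R = pj ` A" "\<zero>\<^bsub>R\<^esub> = pj 0"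
  "x \<in> A ==> y \<in> A ==> pj x \<oplus>\<^bsub>R\<^esub> pj y = pj (x + y)"
 using assms unfolding presents_def by simp_all

lemma presents_diff_mem: "presents R A pj ==> x \<in> A ==> y \<in> A ==> x - y \<in> A"
 using presentsD(2)[of R A pj x "- y"] presentsD(3)[of R A pj y] by simp

lemma presents_sum_mem: "presents R A pj ==> (!!i. i \<in> I ==> f i \<in> A) ==> sum f I \<in> A"
 by (induction I rule: infinite_finite_induct) (auto simp: presentsD(1,2))

lemma presents_abelian_group:
 fixes R (structure)
 assumes p: "presents R A pj"
 shows "abelian_group R"
proof (rule abelian_groupI)
 note d = presentsD[OF p]
 fix x y z assume "x \<in> carrier R" "y \<in> carrier R" "z \<in> carrier R"
 then obtain a b c where abc: "x = pj a" "a \<in> A" "y = pj b" "b \<in> A" "z = pj c" "c \<in> A" unfolding d(4) by blast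
 show "x \<oplus> y \<in> carrier R" using abc by (simp add: d)
 show "x \<oplus> y \<oplus> z = x \<oplus> (y \<oplus> z)" using abc by (simp add: d add.assoc)
 show "x \<oplus> y = y \<oplus> x" using abc by (simp add: d add.commute)
 show "\<zero> \<oplus> x = x" using abc by (simp add: d)
 have "pj (- a) \<oplus> x = \<zero>" using abc by (simp add: d)
 then show "\<exists>y\<in>carrier R. y \<oplus> x = \<zero>" using abc d(3,4) by blast
qed (use presentsD[OF p] in auto)

lemma presents_finsum:
 fixes R (structure)
 assumes p: "presents R A pj" and f: "!!i. i \<in> I ==> f i \<in> A" and g: "!!i. i \<in> I ==> g i = pj (f i)"
 shows "finsum R g I = pj (sum f I)"
proof -
 interpret abelian_group R by (rule presents_abelian_group[OF p])
 note d = presentsD[OF p]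
 show ?thesis
  using f g
 proof (induction I rule: infinite_finite_induct)
  case (infinite I)
  then show ?case by (simp add: finsum_infinite d)
 next
  case empty
  then show ?case by (simp add: d)
 next
  case (insert i I)
  have "sum f I \<in> A" by (rule presents_sum_mem[OF p]) (use insert in auto)
  then show ?case using insert by (simp add: finsum_insert d Pi_iff)
 qed
qed

lemma presents_minus:
 fixes R (structure)
 assumes p: "presents R A pj" and "x \<in> A" "y \<in> A"
 shows "pj x \<ominus> pj y = pj (x - y)"
proof -
 interpret abelian_group R by (rule presents_abelian_group[OF p])
 note d = presentsD[OF p]
 have "\<ominus> pj y = pj (- y)"
  by (rule minus_equality) (use assms in \<open>simp_all add: d\<close>)
 then show ?thesis using assms by (simp add: a_minus_def d)
qed

definition abpres :: "'m abmod => 'a::ab_group_add set => (complex fps => 'a => 'a) => ('a => 'a) => ('a => 'm) => bool" where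
 "abpres M A sm am pj \<longleftrightarrow> presents M A pj & (\<forall>S. \<forall>x\<in>A. sm S x \<in> A & S \<odot>\<^bsub>M\<^esub> pj x = pj (sm S x)) &
  (\<forall>x\<in>A. am x \<in> A & aop M (pj x) = pj (am x))"

lemma abpresD:
 assumes "abpres M A sm am pj"
 shows "presents M A pj" "x \<in> A ==> sm S x \<in> A" "x \<in> A ==> S \<odot>\<^bsub>M\<^esub> pj x = pj (sm S x)"
  "x \<in> A ==> am x \<in> A" "x \<in> A ==> aop M (pj x) = pj (am x)"
 using assms unfolding abpres_def by simp_all

definition pker :: "'a::ab_group_add set => ('a => 'm) => 'a set => bool" where
 "pker A pj K \<longleftrightarrow> (\<forall>x\<in>A. \<forall>y\<in>A. pj x = pj y \<longleftrightarrow> x - y \<in> K)"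

text \<open>A quotient keeps the presenting set and only enlarges the kernel, from \<open>K\<close>
  to \<open>B\<close>. The unions over representatives in \<open>ab_quot\<close> collapse, because
  all members of a coset lead to the same coset.\<close>

lemma abpres_quotient:
 assumes M: "abpres M A sm am pj" and k: "pker A pj K" and B: "K \<subseteq> B" "B \<subseteq> A" "0 \<in> B"
  "!!x y. x \<in> B ==> y \<in> B ==> x - y \<in> B"
  and sm: "!!S x y. x \<in> A ==> y \<in> A ==> x - y \<in> B ==> sm S x - sm S y \<in> B"
  and am: "!!x y. x \<in> A ==> y \<in> A ==> x - y \<in> B ==> am x - am y \<in> B"
  and N: "N = pj ` B"
 shows "abpres (ab_quot M N) A sm am (%x. N +>\<^bsub>M\<^esub> pj x)" "pker A (%x. N +>\<^bsub>M\<^esub> pj x) B"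
proof -
 note p = abpresD(1)[OF M] and d = presentsD[OF abpresD(1)[OF M]] and md = abpresD[OF M]
 define q where "q x = pj ` {y\<in>A. y - x \<in> B}" for x
 have Badd: "x + y \<in> B" if "x \<in> B" "y \<in> B" for x y
  using B(4)[OF that(1) B(4)[OF B(3) that(2)]] by simp
 have co: "N +>\<^bsub>M\<^esub> pj x = q x" if "x \<in> A" for x
 proof -
  have "N +>\<^bsub>M\<^esub> pj x = (%b. pj (b + x)) ` B"
  proof -
   have "pj b \<oplus>\<^bsub>M\<^esub> pj x = pj (b + x)" if "b \<in> B" for b using d(6)[OF subsetD[OF B(2) that] \<open>x \<in> A\<close>] .
   then show ?thesis unfolding a_r_coset_def' N by (simp add: UNION_singleton_eq_range image_image cong: image_cong)
  qed
  also have "\<dots> = q x"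
  proof
   show "(%b. pj (b + x)) ` B \<subseteq> q x"
   proof
    fix z assume "z \<in> (%b. pj (b + x)) ` B"
    then obtain b where b: "b \<in> B" "z = pj (b + x)" by blast
    have "b + x \<in> A" using d(2)[OF subsetD[OF B(2) b(1)] that] .
    then show "z \<in> q x" unfolding q_def b(2) using b(1) by (intro imageI) simp
   qed
   show "q x \<subseteq> (%b. pj (b + x)) ` B"
   proof
    fix z assume "z \<in> q x"
    then obtain y where "y \<in> A" "y - x \<in> B" "z = pj y" by (auto simp: q_def)
    then show "z \<in> (%b. pj (b + x)) ` B" by (intro image_eqI[of _ _ "y - x"]) simp_all
   qed
  qed
  finally show ?thesis .
 qed
 have qeq: "q x = q y" if "x - y \<in> B" for x y
 proof -
  have "z - x \<in> B \<longleftrightarrow> z - y \<in> B" for z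
  proof
   assume "z - x \<in> B" from Badd[OF this that] show "z - y \<in> B" by simp
  next
   assume "z - y \<in> B" from B(4)[OF this that] show "z - x \<in> B" by simp
  qed
  then show ?thesis by (simp add: q_def)
 qed
 have qmem: "pj x \<in> q x" if "x \<in> A" for x using that B(3) by (auto simp: q_def)
 have qinj: "x - y \<in> B" if xy: "x \<in> A" "y \<in> A" "q x = q y" for x y
 proof -
  have "pj x \<in> q y" using qmem[OF xy(1)] xy(3) by simp
  then obtain z where z: "z \<in> A" "z - y \<in> B" "pj x = pj z" unfolding q_def by blast
  have "x - z \<in> K" using k xy(1) z(1,3) unfolding pker_def by blast
  then have "x - z \<in> B" using B(1) by blast
  from Badd[OF this z(2)] show ?thesis by simp
 qed
 show "pker A (%x. N +>\<^bsub>M\<^esub> pj x) B"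
  unfolding pker_def
 proof (intro ballI)
  fix x y assume xy: "x \<in> A" "y \<in> A"
  show "N +>\<^bsub>M\<^esub> pj x = N +>\<^bsub>M\<^esub> pj y \<longleftrightarrow> x - y \<in> B"
   unfolding co[OF xy(1)] co[OF xy(2)] using qeq[of x y] qinj[OF xy] by (rule iffI[rotated])
 qed
 have un: "(\<Union>c\<in>q x. N +>\<^bsub>M\<^esub> F c) = q (h x)"
  if "x \<in> A" "!!y. y \<in> A ==> h y \<in> A" "!!y. y \<in> A ==> F (pj y) = pj (h y)" "!!y. y \<in> A ==> y - x \<in> B ==> h y - h x \<in> B" for x F h
 proof -
  have e: "N +>\<^bsub>M\<^esub> F c = q (h x)" if c: "c \<in> q x" for c
  proof -
   obtain y where y: "y \<in> A" "y - x \<in> B" "c = pj y" using c unfolding q_def by blast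
   have "N +>\<^bsub>M\<^esub> F c = q (h y)" unfolding y(3) \<open>!!y. y \<in> A ==> F (pj y) = pj (h y)\<close>[OF y(1)]
    by (rule co[OF \<open>!!y. y \<in> A ==> h y \<in> A\<close>[OF y(1)]])
   also have "q (h y) = q (h x)" by (rule qeq[OF \<open>!!y. y \<in> A ==> y - x \<in> B ==> h y - h x \<in> B\<close>[OF y(1,2)]])
   finally show ?thesis .
  qed
  have "(\<Union>c\<in>q x. N +>\<^bsub>M\<^esub> F c) = (\<Union>c\<in>q x. q (h x))" by (rule SUP_cong[OF refl e])
  also have "\<dots> = q (h x)" using qmem[OF that(1)] by blast
  finally show ?thesis .
 qed
 have eq: "(%x. N +>\<^bsub>M\<^esub> pj x) x = q x" if "x \<in> A" for x using co[OF that] .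
 show "abpres (ab_quot M N) A sm am (%x. N +>\<^bsub>M\<^esub> pj x)"
  unfolding abpres_def presents_def
 proof (intro conjI ballI allI)
  show "carrier (ab_quot M N) = (%x. N +>\<^bsub>M\<^esub> pj x) ` A"
   unfolding ab_quot_def A_RCOSETS_def' abmod.simps partial_object.select_convs d(4) by blast
  show "\<zero>\<^bsub>ab_quot M N\<^esub> = N +>\<^bsub>M\<^esub> pj 0"
  proof -
   have "{y \<in> A. y \<in> B} = B" using B(2) by blast
   then show ?thesis unfolding co[OF d(1)] by (simp add: ab_quot_def q_def N)
  qed
  fix x y assume xy: "x \<in> A" "y \<in> A"
  show "(N +>\<^bsub>M\<^esub> pj x) \<oplus>\<^bsub>ab_quot M N\<^esub> (N +>\<^bsub>M\<^esub> pj y) = N +>\<^bsub>M\<^esub> pj (x + y)"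
  proof -
   have "q x <+>\<^bsub>M\<^esub> q y = q (x + y)"
   proof
    show "q x <+>\<^bsub>M\<^esub> q y \<subseteq> q (x + y)"
    proof
     fix z assume "z \<in> q x <+>\<^bsub>M\<^esub> q y"
     then obtain a b where ab: "a \<in> A" "a - x \<in> B" "b \<in> A" "b - y \<in> B" "z = pj a \<oplus>\<^bsub>M\<^esub> pj b"
      unfolding set_add_def' q_def by blast
     have "z = pj (a + b)" "a + b \<in> A" "a + b - (x + y) \<in> B"
      using Badd[OF ab(2,4)] ab d(2)[OF ab(1,3)] d(6)[OF ab(1,3)] by (simp_all add: algebra_simps)
     then show "z \<in> q (x + y)" unfolding q_def by blast
    qed
    show "q (x + y) \<subseteq> q x <+>\<^bsub>M\<^esub> q y"
    proof
     fix z assume "z \<in> q (x + y)"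
     then obtain c where c: "c \<in> A" "c - (x + y) \<in> B" "z = pj c" unfolding q_def by blast
     have "c - x \<in> A" using c(1) xy(1) presents_diff_mem[OF p] by blast
     moreover have "(c - x) - y \<in> B" using c(2) by (simp add: algebra_simps)
     ultimately have "pj (c - x) \<in> q y" unfolding q_def by blast
     moreover have "z = pj x \<oplus>\<^bsub>M\<^esub> pj (c - x)" using d(6)[OF xy(1) \<open>c - x \<in> A\<close>] c(3) by simp
     ultimately show "z \<in> q x <+>\<^bsub>M\<^esub> q y" unfolding set_add_def' using qmem[OF xy(1)] by blast
    qed
   qed
   then show ?thesis using xy by (simp add: ab_quot_def co d(2))
  qed
  show "x + y \<in> A" using xy d(2) by blast
 next
  fix S x assume x: "x \<in> A"
  show "sm S x \<in> A" using md(2)[OF x] .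
  show "S \<odot>\<^bsub>ab_quot M N\<^esub> (N +>\<^bsub>M\<^esub> pj x) = N +>\<^bsub>M\<^esub> pj (sm S x)"
   using un[of x "sm S" "%c. S \<odot>\<^bsub>M\<^esub> c"] x md(2,3) sm by (simp add: ab_quot_def co)
 next
  fix x assume x: "x \<in> A"
  show "am x \<in> A" using md(4)[OF x] .
  show "aop (ab_quot M N) (N +>\<^bsub>M\<^esub> pj x) = N +>\<^bsub>M\<^esub> pj (am x)"
   using un[of x am "aop M"] x md(4,5) am by (simp add: ab_quot_def co)
  show "- x \<in> A" using d(3)[OF x] .
 qed (rule d(1))
qed

lemma abpres_sub:
 assumes M: "abpres M A sm am pj" and B: "B \<subseteq> A" "0 \<in> B" "!!x y. x \<in> B ==> y \<in> B ==> x - y \<in> B"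
  "!!S x. x \<in> B ==> sm S x \<in> B" "!!x. x \<in> B ==> am x \<in> B"
 shows "abpres (ab_sub M (pj ` B)) B sm am pj"
proof -
 have neg: "- x \<in> B" if "x \<in> B" for x using B(3)[OF B(2) that] by simp
 have add: "x + y \<in> B" if "x \<in> B" "y \<in> B" for x y using B(3)[OF that(1) neg[OF that(2)]] by simp
 have inA: "x \<in> A" if "x \<in> B" for x using that B(1) by blast
 show ?thesis unfolding abpres_def presents_def ab_sub_def
  by (simp add: B(2,4,5) neg add inA abpresD(3,5)[OF M] presentsD(5,6)[OF abpresD(1)[OF M]])
qed

lemma abpres_bop: "abpres M A sm am pj ==> x \<in> A ==> bop M (pj x) = pj (sm fps_X x)"
 by (simp add: bop_def abpresD(3))

lemma abpres_bop_funpow: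
 assumes "abpres M A sm am pj" "x \<in> A"
 shows "(bop M ^^ n) (pj x) = pj ((sm fps_X ^^ n) x)" "(sm fps_X ^^ n) x \<in> A"
 using assms by (induction n) (simp_all add: abpres_bop[OF assms(1)] abpresD(2)[OF assms(1)])

text \<open>Cosets of germs indexed by formal series: \<open>P\<close> itself may diverge, only the
  Taylor series of the members converge.\<close>

definition cs :: "ps3 set => ps3 => fun3 set" where
 "cs D P = {g. \<exists>Q. has_ps g Q & Q - P \<in> D}"

locale klein_germ = klein +
 fixes f :: fun3
 assumes f_def: "f = (%p. let x = vec_nth p 1; y = vec_nth p 2; z = vec_nth p 3 in
       x * y ^ 3 + y * z ^ 3 + z * x ^ 3 + lam * x * y * z)"
begin

lemma has_ps_f_mult: assumes "has_ps g P" shows "has_ps (%p. f p * g p) (fp * P)"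
proof -
 note v = has_ps_var
 have "has_ps (%p. vec_nth p 1 * (vec_nth p 2 * (vec_nth p 2 * (vec_nth p 2 * g p))) + vec_nth p 2 * (vec_nth p 3 * (vec_nth p 3 * (vec_nth p 3 * g p)))
   + vec_nth p 3 * (vec_nth p 1 * (vec_nth p 1 * (vec_nth p 1 * g p))) + lam * (vec_nth p 1 * (vec_nth p 2 * (vec_nth p 3 * g p))))
  (cX * (cY * (cY * (cY * P))) + cY * (cZ * (cZ * (cZ * P))) + cZ * (cX * (cX * (cX * P))) + cc lam * (cX * (cY * (cZ * P))))"
  by (intro has_ps_add has_ps_cmult v assms)
 moreover have "fp * P = cX * (cY * (cY * (cY * P))) + cY * (cZ * (cZ * (cZ * P))) + cZ * (cX * (cX * (cX * P))) + cc lam * (cX * (cY * (cZ * P)))"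
  by (simp add: fp_def power3_eq_cube algebra_simps)
 moreover have "(%p. f p * g p) = (%p. vec_nth p 1 * (vec_nth p 2 * (vec_nth p 2 * (vec_nth p 2 * g p))) + vec_nth p 2 * (vec_nth p 3 * (vec_nth p 3 * (vec_nth p 3 * g p)))
   + vec_nth p 3 * (vec_nth p 1 * (vec_nth p 1 * (vec_nth p 1 * g p))) + lam * (vec_nth p 1 * (vec_nth p 2 * (vec_nth p 3 * g p))))"
  by (simp add: f_def Let_def power3_eq_cube algebra_simps fun_eq_iff)
 ultimately show ?thesis by simp
qed

lemma has_ps_f_power: "has_ps g P ==> has_ps (%p. f p ^ k * g p) (fp ^ k * P)"
proof (induction k)
 case (Suc k)
 from has_ps_f_mult[OF Suc.IH[OF Suc.prems]] show ?case by (simp add: mult.assoc)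
qed simp

lemma has_ps_f: "has_ps f fp"
 using has_ps_f_mult[OF has_ps_one] by simp

lemma has_ps_gradient_mult:
 assumes "has_ps g P"
 shows "has_ps (%p. pd 1 f p * g p) (fx * P)" "has_ps (%p. pd 2 f p * g p) (fy * P)" "has_ps (%p. pd 3 f p * g p) (fz * P)"
proof -
 have sq: "a\<^sup>2 = a * a" for a :: complex by (rule power2_eq_square)
 have F1: "has_ps (%p. (vec_nth p 2 * (vec_nth p 2 * (vec_nth p 2 * g p)) + 3 * (vec_nth p 3 * (vec_nth p 1 * (vec_nth p 1 * g p)))) + lam * (vec_nth p 2 * (vec_nth p 3 * g p)))
  ((cY * (cY * (cY * P)) + cc 3 * (cZ * (cX * (cX * P)))) + cc lam * (cY * (cZ * P)))" if "has_ps g P" for g P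
  by (intro has_ps_add has_ps_cmult has_ps_var that)
 have F2: "has_ps (%p. (vec_nth p 3 * (vec_nth p 3 * (vec_nth p 3 * g p)) + 3 * (vec_nth p 1 * (vec_nth p 2 * (vec_nth p 2 * g p)))) + lam * (vec_nth p 3 * (vec_nth p 1 * g p)))
  ((cZ * (cZ * (cZ * P)) + cc 3 * (cX * (cY * (cY * P)))) + cc lam * (cZ * (cX * P)))" if "has_ps g P" for g P
  by (intro has_ps_add has_ps_cmult has_ps_var that)
 have F3: "has_ps (%p. (vec_nth p 1 * (vec_nth p 1 * (vec_nth p 1 * g p)) + 3 * (vec_nth p 2 * (vec_nth p 3 * (vec_nth p 3 * g p)))) + lam * (vec_nth p 1 * (vec_nth p 2 * g p)))
  ((cX * (cX * (cX * P)) + cc 3 * (cY * (cZ * (cZ * P)))) + cc lam * (cX * (cY * P)))" if "has_ps g P" for g P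
  by (intro has_ps_add has_ps_cmult has_ps_var that)
 have e: "cY * (cY * (cY * P)) + cc 3 * (cZ * (cX * (cX * P))) + cc lam * (cY * (cZ * P)) = fx * P"
  "cZ * (cZ * (cZ * P)) + cc 3 * (cX * (cY * (cY * P))) + cc lam * (cZ * (cX * P)) = fy * P"
  "cX * (cX * (cX * P)) + cc 3 * (cY * (cZ * (cZ * P))) + cc lam * (cX * (cY * P)) = fz * P" for P
  by (simp_all add: fx_def fy_def fz_def cc_numeral power2_eq_square power3_eq_cube algebra_simps)
 note ev = has_ps_eventually_eq[OF has_ps_pd(1)[OF has_ps_f, unfolded d_fp], of "%p. vec_nth p 2 * (vec_nth p 2 * (vec_nth p 2 * 1)) + 3 * (vec_nth p 3 * (vec_nth p 1 * (vec_nth p 1 * 1))) + lam * (vec_nth p 2 * (vec_nth p 3 * 1))"]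
  has_ps_eventually_eq[OF has_ps_pd(2)[OF has_ps_f, unfolded d_fp], of "%p. vec_nth p 3 * (vec_nth p 3 * (vec_nth p 3 * 1)) + 3 * (vec_nth p 1 * (vec_nth p 2 * (vec_nth p 2 * 1))) + lam * (vec_nth p 3 * (vec_nth p 1 * 1))"]
  has_ps_eventually_eq[OF has_ps_pd(3)[OF has_ps_f, unfolded d_fp], of "%p. vec_nth p 1 * (vec_nth p 1 * (vec_nth p 1 * 1)) + 3 * (vec_nth p 2 * (vec_nth p 3 * (vec_nth p 3 * 1))) + lam * (vec_nth p 1 * (vec_nth p 2 * 1))"]
 show "has_ps (%p. pd 1 f p * g p) (fx * P)"
 proof (rule has_ps_cong[OF F1[OF assms, unfolded e]])
  have "has_ps (%p. vec_nth p 2 * (vec_nth p 2 * (vec_nth p 2 * 1)) + 3 * (vec_nth p 3 * (vec_nth p 1 * (vec_nth p 1 * 1))) + lam * (vec_nth p 2 * (vec_nth p 3 * 1))) fx"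
   using F1[OF has_ps_one, unfolded e] by simp
  from ev(1)[OF this]
  show "\<forall>\<^sub>F p in nhds 0. vec_nth p 2 * (vec_nth p 2 * (vec_nth p 2 * g p)) + 3 * (vec_nth p 3 * (vec_nth p 1 * (vec_nth p 1 * g p))) + lam * (vec_nth p 2 * (vec_nth p 3 * g p)) = pd 1 f p * g p"
   by (rule eventually_mono) (simp add: algebra_simps)
 qed
 show "has_ps (%p. pd 2 f p * g p) (fy * P)"
 proof (rule has_ps_cong[OF F2[OF assms, unfolded e]])
  have "has_ps (%p. vec_nth p 3 * (vec_nth p 3 * (vec_nth p 3 * 1)) + 3 * (vec_nth p 1 * (vec_nth p 2 * (vec_nth p 2 * 1))) + lam * (vec_nth p 3 * (vec_nth p 1 * 1))) fy"
   using F2[OF has_ps_one, unfolded e] by simp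
  from ev(2)[OF this]
  show "\<forall>\<^sub>F p in nhds 0. vec_nth p 3 * (vec_nth p 3 * (vec_nth p 3 * g p)) + 3 * (vec_nth p 1 * (vec_nth p 2 * (vec_nth p 2 * g p))) + lam * (vec_nth p 3 * (vec_nth p 1 * g p)) = pd 2 f p * g p"
   by (rule eventually_mono) (simp add: algebra_simps)
 qed
 show "has_ps (%p. pd 3 f p * g p) (fz * P)"
 proof (rule has_ps_cong[OF F3[OF assms, unfolded e]])
  have "has_ps (%p. vec_nth p 1 * (vec_nth p 1 * (vec_nth p 1 * 1)) + 3 * (vec_nth p 2 * (vec_nth p 3 * (vec_nth p 3 * 1))) + lam * (vec_nth p 1 * (vec_nth p 2 * 1))) fz"
   using F3[OF has_ps_one, unfolded e] by simp
  from ev(3)[OF this]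
  show "\<forall>\<^sub>F p in nhds 0. vec_nth p 1 * (vec_nth p 1 * (vec_nth p 1 * g p)) + 3 * (vec_nth p 2 * (vec_nth p 3 * (vec_nth p 3 * g p))) + lam * (vec_nth p 1 * (vec_nth p 2 * g p)) = pd 3 f p * g p"
   by (rule eventually_mono) (simp add: algebra_simps)
 qed
qed

lemma ext_d_eq: "ext_d \<eta> = (%p. pd 1 (\<eta> 1) p + pd 2 (\<eta> 2) p + pd 3 (\<eta> 3) p)"
 by (simp add: ext_d_def fun_eq_iff sum_3)
lemma df_wedge_eq: "df_wedge f \<eta> = (%p. pd 1 f p * \<eta> 1 p + pd 2 f p * \<eta> 2 p + pd 3 f p * \<eta> 3 p)"
 by (simp add: df_wedge_def fun_eq_iff sum_3)

lemma has_ps_forms: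
 assumes "has_ps (\<eta> 1) a" "has_ps (\<eta> 2) b" "has_ps (\<eta> 3) c"
 shows "has_ps (ext_d \<eta>) (div3 a b c)" "has_ps (df_wedge f \<eta>) (dfw a b c)"
 unfolding ext_d_eq df_wedge_eq div3_def dfw_def
 by (intro has_ps_add has_ps_pd has_ps_gradient_mult assms)+

lemma Omega2_has_ps:
 assumes "\<eta> \<in> Omega2"
 obtains a b c where "has_ps (\<eta> 1) a" "has_ps (\<eta> 2) b" "has_ps (\<eta> 3) c"
 using assms holo_germ_has_ps[of "\<eta> 1"] holo_germ_has_ps[of "\<eta> 2"] holo_germ_has_ps[of "\<eta> 3"] by (auto simp: Omega2_def)

lemma exists_form:
 assumes "conv3 a" "conv3 b" "conv3 c"
 obtains \<eta> where "\<eta> \<in> Omega2" "has_ps (\<eta> 1) a" "has_ps (\<eta> 2) b" "has_ps (\<eta> 3) c"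
proof -
 define \<eta> :: "3 => fun3" where "\<eta> i = (%p. infsum (tm3 (if i = 1 then a else if i = 2 then b else c) p) UNIV)" for i
 have h: "has_ps (\<eta> 1) a" "has_ps (\<eta> 2) b" "has_ps (\<eta> 3) c"
  using has_ps_exists[OF assms(1)] has_ps_exists[OF assms(2)] has_ps_exists[OF assms(3)] by (simp_all add: \<eta>_def)
 moreover have "\<eta> \<in> Omega2" using h[THEN has_ps_holo] by (simp add: Omega2_def forall_3)
 ultimately show ?thesis using that by blast
qed

lemma Omega3_simps [simp]: "carrier Omega3 = {g. holo_germ g}" "\<zero>\<^bsub>Omega3\<^esub> = (%p. 0)" "g \<oplus>\<^bsub>Omega3\<^esub> h = (%p. g p + h p)"
 by (simp_all add: Omega3_def)

text \<open>A Taylor series in the closure \<open>Dh k\<close> is convergent, so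
  \<open>conv3_Dh\<close> returns it to \<open>Dm k\<close>, and its components define actual
  germs.\<close>

lemma D_sub_eq: "D_sub f k = cs (Dh k) 0"
proof
 show "D_sub f k \<subseteq> cs (Dh k) 0"
 proof
  fix g assume "g \<in> D_sub f k"
  then obtain \<eta> h where g: "holo_germ g" "\<eta> \<in> Ker_df f" "holo_germ h" "\<forall>\<^sub>F p in nhds 0. g p = ext_d \<eta> p + f p ^ k * h p"
   by (auto simp: D_sub_def)
  have e: "\<eta> \<in> Omega2" "\<forall>\<^sub>F p in nhds 0. df_wedge f \<eta> p = 0" using g(2) by (auto simp: Ker_df_def)
  obtain a b c where abc: "has_ps (\<eta> 1) a" "has_ps (\<eta> 2) b" "has_ps (\<eta> 3) c" using Omega2_has_ps[OF e(1)] .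
  obtain H where H: "has_ps h H" using holo_germ_has_ps[OF g(3)] by blast
  have 0: "dfw a b c = 0" by (rule has_ps_zero_unique[OF has_ps_forms(2)[OF abc] e(2)])
  have "has_ps (%p. ext_d \<eta> p + f p ^ k * h p) (div3 a b c + fp ^ k * H)"
   by (intro has_ps_add has_ps_forms abc has_ps_f_power H)
  from has_ps_cong[OF this] have "has_ps g (div3 a b c + fp ^ k * H)" using g(4) by (simp add: eq_commute)
  moreover have "div3 a b c + fp ^ k * H \<in> Dm k"
  proof -
   have "conv3 a" "conv3 b" "conv3 c" "conv3 H" using abc H unfolding has_ps_def by simp_all
   then have "div3 a b c \<in> Dc" unfolding Dc_def using 0 by blast
   then show ?thesis unfolding Dm_def using \<open>conv3 H\<close> by blast
  qed
  ultimately show "g \<in> cs (Dh k) 0" using Dm_Dh unfolding cs_def by auto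
 qed
 show "cs (Dh k) 0 \<subseteq> D_sub f k"
 proof
  fix g assume "g \<in> cs (Dh k) 0"
  then obtain Q where Q: "has_ps g Q" "Q \<in> Dh k" by (auto simp: cs_def)
  then have "Q \<in> Dm k" using conv3_Dh by (auto simp: has_ps_def)
  then obtain a b c H where d: "Q = div3 a b c + fp ^ k * H" "conv3 a" "conv3 b" "conv3 c" "dfw a b c = 0" "conv3 H"
   by (auto simp: Dm_def Dc_def)
  obtain \<eta> where \<eta>: "\<eta> \<in> Omega2" "has_ps (\<eta> 1) a" "has_ps (\<eta> 2) b" "has_ps (\<eta> 3) c" using exists_form[OF d(2-4)] .
  define h where "h = (%p. infsum (tm3 H p) UNIV)"
  have h: "has_ps h H" unfolding h_def by (rule has_ps_exists[OF d(6)])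
  have z: "has_ps (%p. 0) 0" using has_ps_cmult[OF has_ps_one, of 0] by simp
  have "\<forall>\<^sub>F p in nhds 0. df_wedge f \<eta> p = 0"
   using has_ps_eventually_eq[OF has_ps_forms(2)[OF \<eta>(2-4), unfolded d(5)] z] .
  then have "\<eta> \<in> Ker_df f" using \<eta>(1) by (simp add: Ker_df_def)
  moreover have "has_ps (%p. ext_d \<eta> p + f p ^ k * h p) Q"
   unfolding d(1) by (intro has_ps_add has_ps_forms \<eta> has_ps_f_power h)
  then have "\<forall>\<^sub>F p in nhds 0. g p = ext_d \<eta> p + f p ^ k * h p" by (rule has_ps_eventually_eq[OF Q(1)])
  ultimately show "g \<in> D_sub f k" using has_ps_holo[OF Q(1)] has_ps_holo[OF h] by (auto simp: D_sub_def)
 qed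
qed

lemma coset_eq:
 assumes "has_ps g P" shows "D_sub f k +>\<^bsub>Omega3\<^esub> g = cs (Dh k) P"
proof
 show "D_sub f k +>\<^bsub>Omega3\<^esub> g \<subseteq> cs (Dh k) P"
 proof
  fix x assume "x \<in> D_sub f k +>\<^bsub>Omega3\<^esub> g"
  then obtain d Q where d: "has_ps d Q" "Q \<in> Dh k" "x = (%p. d p + g p)" by (auto simp: a_r_coset_def' D_sub_eq cs_def)
  from has_ps_add[OF d(1) assms] d show "x \<in> cs (Dh k) P" by (auto simp: cs_def intro!: exI[of _ "Q + P"])
 qed
 show "cs (Dh k) P \<subseteq> D_sub f k +>\<^bsub>Omega3\<^esub> g"
 proof
  fix x assume "x \<in> cs (Dh k) P"
  then obtain Q where Q: "has_ps x Q" "Q - P \<in> Dh k" by (auto simp: cs_def)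
  then have "(%p. x p - g p) \<in> cs (Dh k) 0" using has_ps_diff[OF Q(1) assms] by (auto simp: cs_def)
  then show "x \<in> D_sub f k +>\<^bsub>Omega3\<^esub> g" unfolding a_r_coset_def' D_sub_eq by (auto intro!: bexI[of _ "%p. x p - g p"])
 qed
qed

lemma cs_eqI: "sub3 D ==> P - P' \<in> D ==> cs D P = cs D P'"
proof -
 assume D: "sub3 D" and P: "P - P' \<in> D"
 have "Q - P \<in> D \<longleftrightarrow> Q - P' \<in> D" for Q
  using sub3_add[OF D _ P, of "Q - P"] sub3_diff[OF D _ P, of "Q - P'"] by auto
 then show "cs D P = cs D P'" by (simp add: cs_def)
qed

text \<open>Truncation at order 20 k changes the series only by an element of \<open>Dh k\<close>,
  so every formal class contains a polynomial germ and no class is empty.\<close>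

lemma cs_rep: obtains g P' where "has_ps g P'" "P' - P \<in> Dh k" "g \<in> cs (Dh k) P" "cs (Dh k) P = D_sub f k +>\<^bsub>Omega3\<^esub> g"
proof -
 define P' where "P' = trunc3 (20 * k) P"
 define g where "g = (%p. infsum (tm3 P' p) UNIV)"
 have g: "has_ps g P'" unfolding g_def P'_def by (intro has_ps_exists conv3_trunc3)
 have "P - P' \<in> Dh k" unfolding P'_def by (intro ordge_Dh ordge_trunc3)
 then have d: "P' - P \<in> Dh k" using sub3_uminus[OF sub3_Dh] by fastforce
 moreover have "cs (Dh k) P = D_sub f k +>\<^bsub>Omega3\<^esub> g" using cs_eqI[OF sub3_Dh d] coset_eq[OF g] by simp
 ultimately show ?thesis using that[OF g d] g by (auto simp: cs_def)
qed

lemma cs_inter: "g \<in> cs (Dh k) P ==> g \<in> cs (Dh k) Q ==> P - Q \<in> Dh k"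
proof -
 assume "g \<in> cs (Dh k) P" "g \<in> cs (Dh k) Q"
 then obtain R R' where R: "has_ps g R" "R - P \<in> Dh k" "has_ps g R'" "R' - Q \<in> Dh k" by (auto simp: cs_def)
 have "R = R'" by (rule has_ps_unique[OF R(1,3)]) simp
 then show ?thesis using sub3_diff[OF sub3_Dh R(4,2)] by simp
qed

lemma cs_eq_iff: "cs (Dh k) P = cs (Dh k) Q \<longleftrightarrow> P - Q \<in> Dh k"
 using cs_rep[of P k] cs_inter cs_eqI[OF sub3_Dh] by metis

lemma rcosets_eq: "a_rcosets\<^bsub>Omega3\<^esub> (D_sub f k) = range (cs (Dh k))"
proof
 show "a_rcosets\<^bsub>Omega3\<^esub> (D_sub f k) \<subseteq> range (cs (Dh k))"
 proof
  fix C assume "C \<in> a_rcosets\<^bsub>Omega3\<^esub> (D_sub f k)"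
  then obtain g where g: "holo_germ g" "C = D_sub f k +>\<^bsub>Omega3\<^esub> g" unfolding A_RCOSETS_def' by auto
  obtain P where "has_ps g P" using holo_germ_has_ps[OF g(1)] by blast
  then show "C \<in> range (cs (Dh k))" using coset_eq g(2) by auto
 qed
 show "range (cs (Dh k)) \<subseteq> a_rcosets\<^bsub>Omega3\<^esub> (D_sub f k)"
 proof
  fix C assume "C \<in> range (cs (Dh k))"
  then obtain P where P: "C = cs (Dh k) P" by blast
  obtain g P' where g: "has_ps g P'" "P' - P \<in> Dh k" "g \<in> cs (Dh k) P" "cs (Dh k) P = D_sub f k +>\<^bsub>Omega3\<^esub> g" using cs_rep[of P k] .
  have "holo_germ g" by (rule has_ps_holo[OF g(1)])
  then show "C \<in> a_rcosets\<^bsub>Omega3\<^esub> (D_sub f k)" unfolding A_RCOSETS_def' P g(4) by auto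
 qed
qed

section \<open>The completed module as a quotient of formal series\<close>

definition pic :: "ps3 => compl" where "pic P = (%k. cs (Dh k) P)"

lemma pic_eq_iff: "pic P = pic Q \<longleftrightarrow> P - Q \<in> Khat"
 by (auto simp: pic_def fun_eq_iff cs_eq_iff Khat_def)

text \<open>Representatives of consecutive cosets differ by d k + f^k H k. Dropping the d k, which
  vanish in every coset space, leaves the series P 0 + sum of f^k H k; it converges because f^k
  raises the order, and its class at level m is the given one.\<close>

lemma pic_carrier: "carrier (compl_group f) = range pic"
proof
 have "cs (Dh (Suc k)) P \<subseteq> cs (Dh k) P" for k P using Dh_Suc[of k] by (auto simp: cs_def)
 then show "range pic \<subseteq> carrier (compl_group f)" by (auto simp: compl_group_def pic_def rcosets_eq)
 show "carrier (compl_group f) \<subseteq> range pic"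
 proof
  fix h assume h: "h \<in> carrier (compl_group f)"
  have "\<exists>g P. has_ps g P & h k = cs (Dh k) P" for k
  proof -
   have "h k \<in> range (cs (Dh k))" using h by (simp add: compl_group_def rcosets_eq)
   then obtain P where P: "h k = cs (Dh k) P" by blast
   obtain g P' where g: "has_ps g P'" "P' - P \<in> Dh k" "g \<in> cs (Dh k) P" "cs (Dh k) P = D_sub f k +>\<^bsub>Omega3\<^esub> g" using cs_rep[of P k] .
   show ?thesis using g(1) P g(4) coset_eq[OF g(1)] by auto
  qed
  then obtain g P where gP: "!!k. has_ps (g k) (P k)" "!!k. h k = cs (Dh k) (P k)" by metis
  have "\<exists>d H. d \<in> Dc & conv3 H & P (Suc k) - P k = d + fp ^ k * H" for k
  proof -
   have "g (Suc k) \<in> h (Suc k)" unfolding gP(2) cs_def using gP(1) sub3_0[OF sub3_Dh] by (auto intro!: exI[of _ "P (Suc k)"])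
   then have "g (Suc k) \<in> h k" using h by (auto simp: compl_group_def)
   moreover have "g (Suc k) \<in> cs (Dh k) (P (Suc k))" unfolding cs_def using gP(1) sub3_0[OF sub3_Dh] by (auto intro!: exI[of _ "P (Suc k)"])
   ultimately have "P (Suc k) - P k \<in> Dh k" using cs_inter gP(2) by simp
   moreover have "conv3 (P (Suc k) - P k)" using gP(1) by (intro conv3_diff) (simp_all add: has_ps_def)
   ultimately show ?thesis using conv3_Dh[of "P (Suc k) - P k" k] by (auto simp: Dm_def)
  qed
  then obtain d H where dH: "!!k. d k \<in> Dc" "!!k. conv3 (H k)" "!!k. P (Suc k) - P k = d k + fp ^ k * H k" by metis
  define R where "R = P 0 + fsum (%k. fp ^ k * H k)"
  have o: "ordge k (fp ^ k * H k)" for k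
   using ordge_fp_power[of 0 "H k" k] by (auto intro: ordge_mono)
  have P: "P m = P 0 + (\<Sum>k<m. d k) + (\<Sum>k<m. fp ^ k * H k)" for m
  proof (induction m)
   case (Suc m)
   have "P (Suc m) = P m + (d m + fp ^ m * H m)" using dH(3)[of m] by (simp add: algebra_simps)
   then show ?case using Suc by (simp add: algebra_simps)
  qed simp
  have "R - P m \<in> Dh m" for m
  proof (rule cl3_limit[OF Dh_closed[symmetric]])
   fix N
   let ?N = "max N m"
   have "(\<Sum>k<?N. fp ^ k * H k) - (\<Sum>k<m. fp ^ k * H k) = (\<Sum>k\<in>{..<?N} - {..<m}. fp ^ k * H k)"
    by (rule sum_diff[symmetric]) auto
   moreover have "\<dots> \<in> Dh m"
   proof (rule sub3_sum[OF sub3_Dh])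
    fix k assume "k \<in> {..<?N} - {..<m}"
    then have "m \<le> k" by simp
    then have "fp ^ k = fp ^ m * fp ^ (k - m)" by (simp flip: power_add)
    then show "fp ^ k * H k \<in> Dh m" using fp_power_Dh[of m "fp ^ (k - m) * H k"] by (simp only: mult.assoc)
   qed
   moreover have "(\<Sum>k<m. d k) \<in> Dh m" using dH(1) Dc_Dm Dm_Dh by (intro sub3_sum[OF sub3_Dh]) blast
   ultimately have "((\<Sum>k<?N. fp ^ k * H k) - (\<Sum>k<m. fp ^ k * H k)) - (\<Sum>k<m. d k) \<in> Dh m" using sub3_diff[OF sub3_Dh] by simp
   moreover have "ordge N (R - P m - (((\<Sum>k<?N. fp ^ k * H k) - (\<Sum>k<m. fp ^ k * H k)) - (\<Sum>k<m. d k)))"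
    using ordge_mono[OF ordge_fsum[of "%k. fp ^ k * H k", OF o, of ?N], of N] by (simp add: R_def P[of m] algebra_simps)
   ultimately show "\<exists>Q\<in>Dh m. ordge N (R - P m - Q)" by blast
  qed
  then have "pic R = h" by (simp add: pic_def fun_eq_iff gP(2) cs_eq_iff)
  then show "h \<in> range pic" by blast
 qed
qed

lemma pic_presents: "presents (compl_group f) UNIV pic"
 unfolding presents_def
proof (intro conjI ballI)
 show "carrier (compl_group f) = pic ` UNIV" by (rule pic_carrier)
 show "\<zero>\<^bsub>compl_group f\<^esub> = pic 0" by (simp add: compl_group_def pic_def fun_eq_iff D_sub_eq)
 fix P Q
 have "cs (Dh k) P <+>\<^bsub>Omega3\<^esub> cs (Dh k) Q = cs (Dh k) (P + Q)" for k
 proof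
  show "cs (Dh k) P <+>\<^bsub>Omega3\<^esub> cs (Dh k) Q \<subseteq> cs (Dh k) (P + Q)"
  proof
   fix x assume "x \<in> cs (Dh k) P <+>\<^bsub>Omega3\<^esub> cs (Dh k) Q"
   then obtain g g' R R' where g: "has_ps g R" "R - P \<in> Dh k" "has_ps g' R'" "R' - Q \<in> Dh k" "x = (%p. g p + g' p)"
    by (auto simp: set_add_def' cs_def)
   then have "has_ps x (R + R')" "(R + R') - (P + Q) \<in> Dh k"
    using has_ps_add[OF g(1,3)] sub3_add[OF sub3_Dh g(2,4)] by (simp_all add: algebra_simps)
   then show "x \<in> cs (Dh k) (P + Q)" by (auto simp: cs_def)
  qed
  show "cs (Dh k) (P + Q) \<subseteq> cs (Dh k) P <+>\<^bsub>Omega3\<^esub> cs (Dh k) Q"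
  proof
   fix x assume "x \<in> cs (Dh k) (P + Q)"
   then obtain R where R: "has_ps x R" "R - (P + Q) \<in> Dh k" by (auto simp: cs_def)
   obtain g P' where g: "has_ps g P'" "P' - P \<in> Dh k" "g \<in> cs (Dh k) P" "cs (Dh k) P = D_sub f k +>\<^bsub>Omega3\<^esub> g" using cs_rep[of P k] .
   have "(R - P') - Q \<in> Dh k" using sub3_diff[OF sub3_Dh R(2) g(2)] by (simp add: algebra_simps)
   then have "(%p. x p - g p) \<in> cs (Dh k) Q" using has_ps_diff[OF R(1) g(1)] by (auto simp: cs_def)
   moreover have "x = g \<oplus>\<^bsub>Omega3\<^esub> (%p. x p - g p)" by simp
   ultimately show "x \<in> cs (Dh k) P <+>\<^bsub>Omega3\<^esub> cs (Dh k) Q" unfolding set_add_def' using g(3) by blast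
  qed
 qed
 then show "pic P \<oplus>\<^bsub>compl_group f\<^esub> pic Q = pic (P + Q)" by (simp add: compl_group_def pic_def)
qed auto

lemma coset_union:
 assumes T: "!!g Q. has_ps g Q ==> has_ps (F g) (T Q)" "!!Q. Q - P \<in> Dh k ==> T Q - T P \<in> Dh k"
 shows "(\<Union>g\<in>cs (Dh k) P. D_sub f k +>\<^bsub>Omega3\<^esub> F g) = cs (Dh k) (T P)"
proof -
 have "D_sub f k +>\<^bsub>Omega3\<^esub> F g = cs (Dh k) (T P)" if "g \<in> cs (Dh k) P" for g
 proof -
  obtain Q where Q: "has_ps g Q" "Q - P \<in> Dh k" using \<open>g \<in> cs (Dh k) P\<close> by (auto simp: cs_def)
  show ?thesis using coset_eq[OF T(1)[OF Q(1)]] cs_eqI[OF sub3_Dh T(2)[OF Q(2)]] by simp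
 qed
 moreover obtain g P' where "has_ps g P'" "P' - P \<in> Dh k" "g \<in> cs (Dh k) P" "cs (Dh k) P = D_sub f k +>\<^bsub>Omega3\<^esub> g" using cs_rep[of P k] .
 ultimately show ?thesis by auto
qed

lemma compl_scale_pic: "compl_scale f c (pic P) = pic (cc c * P)"
 unfolding compl_scale_def pic_def
 by (rule ext, rule coset_union[OF has_ps_cmult]) (use sub3_cc[OF sub3_Dh] in \<open>fastforce simp: right_diff_distrib[symmetric]\<close>)+

lemma compl_a_pic: "compl_a f (pic P) = pic (fp * P)"
 unfolding compl_a_def pic_def
 by (rule ext, rule coset_union[OF has_ps_f_mult]) (use fp_Dh in \<open>fastforce simp: right_diff_distrib[symmetric]\<close>)+

text \<open>Existence combines \<open>dfw_beta_div_formal\<close> with the continuity of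
  \<open>beta\<close>. For uniqueness, the radial primitive of a truncation of P is an actual form
  with divergence in the given coset; it determines any candidate at each level m.\<close>

lemma compl_b_pic: "compl_b f (pic P) = pic (beta P)"
 unfolding compl_b_def
proof (rule the_equality)
 have main: "df_wedge f \<eta> \<in> pic (beta P) m" if "7 * m \<le> k" "\<eta> \<in> Omega2" "ext_d \<eta> \<in> pic P k" for m k \<eta>
 proof -
  note h = that
  obtain a b c where abc: "has_ps (\<eta> 1) a" "has_ps (\<eta> 2) b" "has_ps (\<eta> 3) c" using Omega2_has_ps[OF h(2)] .
  obtain Q where Q: "has_ps (ext_d \<eta>) Q" "Q - P \<in> Dh k" using h(3) by (auto simp: pic_def cs_def)
  have "Q = div3 a b c" by (rule has_ps_unique[OF Q(1) has_ps_forms(1)[OF abc]]) simp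
  then have "beta (div3 a b c - P) \<in> Dh m" using beta_Dh[OF Q(2) that(1)] by simp
  from sub3_add[OF sub3_Dh subsetD[OF Dhat_Dh dfw_beta_div_formal[of a b c]] this]
  have "dfw a b c - beta P \<in> Dh m" by (simp add: beta_diff)
  then show ?thesis unfolding pic_def cs_def using has_ps_forms(2)[OF abc] by blast
 qed
 then show "pic (beta P) \<in> carrier (compl_group f) & (\<forall>m. \<exists>K. \<forall>k\<ge>K. \<forall>\<eta>\<in>Omega2. ext_d \<eta> \<in> pic P k \<longrightarrow> df_wedge f \<eta> \<in> pic (beta P) m)"
  unfolding pic_carrier by blast
 fix h assume h: "h \<in> carrier (compl_group f) & (\<forall>m. \<exists>K. \<forall>k\<ge>K. \<forall>\<eta>\<in>Omega2. ext_d \<eta> \<in> pic P k \<longrightarrow> df_wedge f \<eta> \<in> h m)"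
 then obtain R where R: "h = pic R" unfolding pic_carrier by blast
 have "R - beta P \<in> Dh m" for m
 proof -
  obtain K where K: "!!k \<eta>. k \<ge> K ==> \<eta> \<in> Omega2 ==> ext_d \<eta> \<in> pic P k ==> df_wedge f \<eta> \<in> h m" using h by blast
  \<comment> \<open>Large enough both for the candidate's threshold \<open>K\<close> and for
    \<open>beta\<close> to map level k into level m.\<close>
  define k where "k = max K (7 * m)"
  define P' where "P' = trunc3 (20 * k) P"
  define u where "u = Einv P'"
  have cu: "conv3 u" unfolding u_def P'_def by (intro conv3_Einv conv3_trunc3)
  obtain \<eta> where \<eta>: "\<eta> \<in> Omega2" "has_ps (\<eta> 1) (cX * u)" "has_ps (\<eta> 2) (cY * u)" "has_ps (\<eta> 3) (cZ * u)"
   using exists_form[OF conv3_var[OF cu]] .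
  have "P - P' \<in> Dh k" unfolding P'_def by (intro ordge_Dh ordge_trunc3)
  then have "P' - P \<in> Dh k" using sub3_uminus[OF sub3_Dh] by fastforce
  moreover have "has_ps (ext_d \<eta>) P'" using has_ps_forms(1)[OF \<eta>(2-4)] by (simp add: u_def div3_radial)
  ultimately have e: "ext_d \<eta> \<in> pic P k" by (auto simp: pic_def cs_def)
  have "df_wedge f \<eta> \<in> cs (Dh m) R" using K[OF _ \<eta>(1) e] R by (simp add: k_def pic_def)
  moreover have "df_wedge f \<eta> \<in> cs (Dh m) (beta P)" using main[OF _ \<eta>(1) e] by (simp add: k_def pic_def)
  ultimately show ?thesis by (rule cs_inter)
 qed
 then show "h = pic (beta P)" unfolding R pic_eq_iff by (simp add: Khat_def)
qed

lemma compl_b_funpow: "(compl_b f ^^ n) (pic P) = pic ((beta ^^ n) P)"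
 by (induction n) (simp_all add: compl_b_pic)

lemma compl_smult_pic: "compl_smult f S (pic P) = pic (smp S P)"
 unfolding compl_smult_def
proof (rule the_equality)
 let ?s = "%k. finsum (compl_group f) (%n. compl_scale f (fps_nth S n) ((compl_b f ^^ n) (pic P))) {..<k}"
 have "?s k = pic (\<Sum>n<k. cc (fps_nth S n) * (beta ^^ n) P)" for k
  by (rule presents_finsum[OF pic_presents]) (simp_all add: compl_b_funpow compl_scale_pic)
 moreover have "(\<Sum>n<k. cc (fps_nth S n) * (beta ^^ n) P) - smp S P \<in> Dh m" if "20 * m \<le> k" for k m
  using ordge_Dh[OF ordge_mono[OF ordge_uminus[OF smp_approx[of k S P]] that]] by simp
 ultimately have main: "?s k m = pic (smp S P) m" if "20 * m \<le> k" for k m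
  using that by (simp add: pic_def cs_eq_iff)
 then show "pic (smp S P) \<in> carrier (compl_group f) & (\<forall>m. \<exists>K. \<forall>k\<ge>K. ?s k m = pic (smp S P) m)"
  unfolding pic_carrier by blast
 fix h assume h: "h \<in> carrier (compl_group f) & (\<forall>m. \<exists>K. \<forall>k\<ge>K. ?s k m = h m)"
 show "h = pic (smp S P)"
 proof
  fix m
  obtain K where "!!k. k \<ge> K ==> ?s k m = h m" using h by blast
  then show "h m = pic (smp S P) m" using main[of m "max K (20 * m)"] by force
 qed
qed

lemma compl_mod_abpres: "abpres (compl_mod f) UNIV smp ((*) fp) pic"
proof -
 have "presents (compl_mod f) UNIV pic" using pic_presents unfolding presents_def by (simp add: compl_mod_def)
 then show ?thesis unfolding abpres_def by (simp add: compl_mod_def compl_smult_pic compl_a_pic)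
qed

lemma compl_mod_pker: "pker UNIV pic Khat" by (simp add: pker_def pic_eq_iff)

lemma b_torsion_eq: "b_torsion (compl_mod f) = pic ` KK"
proof -
 have s: "smp fps_X = beta" by (rule ext) (rule smp_X)
 have "(bop (compl_mod f) ^^ n) (pic P) = \<zero>\<^bsub>compl_mod f\<^esub> \<longleftrightarrow> (beta ^^ n) P \<in> Khat" for n P
  using abpres_bop_funpow(1)[OF compl_mod_abpres, of P n] pic_eq_iff[of "(beta ^^ n) P" 0] presentsD(5)[OF abpresD(1)[OF compl_mod_abpres]]
  by (simp add: s)
 then show ?thesis unfolding b_torsion_def presentsD(4)[OF abpresD(1)[OF compl_mod_abpres]] by (auto simp: KK_def)
qed

definition piH :: "ps3 => compl set" where "piH P = b_torsion (compl_mod f) +>\<^bsub>compl_mod f\<^esub> pic P"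

text \<open>Induction on the torsion exponent: f \<open>beta Q\<close> is
  \<open>beta (f Q + beta Q)\<close> up to \<open>Dhat\<close>, and the term with two factors
  \<open>beta\<close> is torsion already. The power of \<open>beta\<close> gathered in this way is
  finally cancelled.\<close>

lemma fp_KK: "P \<in> KK ==> fp * P \<in> KK"
proof -
 assume "P \<in> KK"
 then obtain n where n: "(beta ^^ n) P \<in> Khat" by (auto simp: KK_def)
 have "(beta ^^ m) (fp * Q) \<in> KK" if "(beta ^^ m) Q \<in> Khat" for m Q
  using that
 proof (induction m arbitrary: Q)
  case 0
  then show ?case using fp_Khat Khat_KK by auto
 next
  case (Suc m)
  have Q: "(beta ^^ m) (beta Q) \<in> Khat" using Suc.prems by (simp add: funpow_swap1)
  have 1: "(beta ^^ m) (fp * beta Q) \<in> KK" by (rule Suc.IH[OF Q])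
  have "(beta ^^ m) (fp * beta Q - beta (fp * Q + beta Q)) \<in> KK"
   using beta_funpow_Dhat[OF beta_fp_formal, of m Q] Dhat_Khat Khat_KK by blast
  from sub3_diff[OF sub3_KK 1 this] have "(beta ^^ m) (beta (fp * Q)) + (beta ^^ m) (beta (beta Q)) \<in> KK"
   by (simp add: beta_funpow_diff beta_add beta_funpow_add)
  moreover have "(beta ^^ m) (beta (beta Q)) \<in> KK"
   using beta_Khat[OF Q] Khat_KK by (auto simp: funpow_swap1)
  ultimately have "(beta ^^ m) (beta (fp * Q)) \<in> KK" using sub3_diff[OF sub3_KK] by fastforce
  then show ?case by (simp add: funpow_swap1)
 qed
 from this[OF n] show "fp * P \<in> KK" by (rule KK_beta_cancel)
qed

lemma H_abpres: "abpres (H_mod f) UNIV smp ((*) fp) piH" and H_pker: "pker UNIV piH KK"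
proof -
 have sm: "smp S x - smp S y \<in> KK" if "x \<in> UNIV" "y \<in> UNIV" "x - y \<in> KK" for S x y
  using smp_KK[OF that(3), of S] by (simp add: smp_diff)
 have am: "fp * x - fp * y \<in> KK" if "x \<in> UNIV" "y \<in> UNIV" "x - y \<in> KK" for x y
  using fp_KK[OF that(3)] by (simp add: right_diff_distrib)
 note q = abpres_quotient[OF compl_mod_abpres compl_mod_pker Khat_KK subset_UNIV sub3_0[OF sub3_KK] sub3_diff[OF sub3_KK] sm am b_torsion_eq]
 show "abpres (H_mod f) UNIV smp ((*) fp) piH" unfolding H_mod_def piH_def[abs_def] by (rule q(1))
 show "pker UNIV piH KK" unfolding piH_def[abs_def] by (rule q(2))
qed

lemma H_class_eq: "has_ps g P ==> H_class f g = piH P"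
 unfolding H_class_def piH_def pic_def by (simp add: coset_eq)

end

section \<open>Period functionals\<close>

text \<open>The expansion at X = 0 of Gamma(1 + cX) / Gamma(n + 1 + cX). The normalisation makes all
  coefficients rational expressions in c; for c nonzero there is a simple zero exactly when n <
  0.\<close>

definition gam :: "complex => int => complex fps" where
 "gam c n = (if 0 \<le> n then (\<Prod>m<nat n. inverse (of_nat (Suc m) + fps_const c * fps_X))
  else (\<Prod>m<nat (- n). fps_const c * fps_X - of_nat m))"

lemma gam_lower: "gam c (n - 1) = (of_int n + fps_const c * fps_X) * gam c n"
proof (cases "n \<ge> 1")
 case True
 define m where "m = nat (n - 1)"
 have n: "n = int (Suc m)" using True by (simp add: m_def)
 have "fps_nth (of_nat (Suc m) + fps_const c * fps_X) 0 ~= (0 :: complex)" by (simp del: of_nat_Suc)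
 then have "(of_nat (Suc m) + fps_const c * fps_X) * inverse (of_nat (Suc m) + fps_const c * fps_X) = 1"
  by (metis inverse_mult_eq_1')
 moreover have "nat (int (Suc m)) = Suc m" "nat (int m) = m" by simp_all
 ultimately show ?thesis unfolding n by (simp add: gam_def mult_ac del: of_nat_Suc) (simp add: mult_ac)
next
 case False
 define m where "m = nat (- n)"
 have n: "n = - int m" using False by (simp add: m_def)
 have "nat (- (- int m - 1)) = Suc m" by simp
 then have "gam c (- int m - 1) = (\<Prod>k<Suc m. fps_const c * fps_X - of_nat k)" by (simp add: gam_def del: prod.lessThan_Suc)
 moreover have "gam c (- int m) = (\<Prod>k<m. fps_const c * fps_X - of_nat k)" by (simp add: gam_def)
 ultimately show ?thesis unfolding n by (simp add: algebra_simps)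
qed

lemma gam_form: assumes "c ~= 0" obtains U where "gam c n = fps_X ^ (if n < 0 then 1 else 0) * U" "fps_nth U 0 ~= 0"
proof (cases "n < 0")
 case False
 have "fps_nth (\<Prod>m<k. inverse (of_nat (Suc m) + fps_const c * fps_X)) 0 ~= (0 :: complex)" for k
  by (induction k) (simp_all del: of_nat_Suc)
 then show ?thesis using False that[of "gam c n"] by (simp add: gam_def)
next
 case True
 define k where "k = nat (- n) - 1"
 have k: "nat (- n) = Suc k" using True by (simp add: k_def)
 define U where "U = fps_const c * (\<Prod>m<k. fps_const c * fps_X - of_nat (Suc m))"
 have "gam c n = fps_X * U"
  using True by (simp add: gam_def k prod.lessThan_Suc_shift U_def mult_ac del: of_nat_Suc prod.lessThan_Suc)
 moreover have "fps_nth (\<Prod>m<k. fps_const c * fps_X - of_nat (Suc m)) 0 ~= (0 :: complex)" for k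
  by (induction k) (simp_all del: of_nat_Suc)
 then have "fps_nth U 0 ~= 0" using assms by (simp add: U_def)
 ultimately show ?thesis using True that[of U] by simp
qed

text \<open>The division by 7 is exact for the three circulant weights at invariant exponents, see
  \<open>weights_sum\<close>.\<close>

definition cw :: "nat => nat => nat => nat => nat => nat => int" where
 "cw p q r a b c = int ((p * a + q * b + r * c) div 7)"

definition neg :: "int => nat" where "neg n = (if n < 0 then 1 else 0)"

text \<open>Pairing with a table of numbers over a box. For a table of bounded support the box is
  immaterial (\<open>bxs_stable\<close>), and multiplication by a variable becomes a shift of the
  table.\<close>

definition bxs :: "nat => ps3 => (nat => nat => nat => complex) => complex" where
 "bxs N P t = (\<Sum>i<Suc N. \<Sum>j<Suc N. \<Sum>l<Suc N. cf P i j l * t i j l)"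

definition vanishes :: "nat => (nat => nat => nat => complex) => bool" where
 "vanishes N t \<longleftrightarrow> (\<forall>i j l. N < i + j + l \<longrightarrow> t i j l = 0)"

lemma sum_shift_zero:
 assumes "G N (Suc N) = (0 :: complex)"
 shows "(\<Sum>i<Suc N. if i = 0 then 0 else G (i - 1) i) = (\<Sum>i<Suc N. G i (Suc i))"
 using assms by (subst sum.lessThan_Suc_shift) simp

lemma bxs_cX: "vanishes N t ==> bxs N (cX * P) t = bxs N P (%i. t (Suc i))"
proof -
 assume t: "vanishes N t"
 have "bxs N (cX * P) t = (\<Sum>i<Suc N. if i = 0 then 0 else (%a i. \<Sum>j<Suc N. \<Sum>l<Suc N. cf P a j l * t i j l) (i - 1) i)"
  unfolding bxs_def by (rule sum.cong) auto
 also have "\<dots> = bxs N P (%i. t (Suc i))"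
  unfolding bxs_def by (rule sum_shift_zero) (use t in \<open>simp add: vanishes_def\<close>)
 finally show ?thesis .
qed

lemma bxs_cY: "vanishes N t ==> bxs N (cY * P) t = bxs N P (%i j. t i (Suc j))"
proof -
 assume t: "vanishes N t"
 have "(\<Sum>j<Suc N. \<Sum>l<Suc N. cf (cY * P) i j l * t i j l) = (\<Sum>j<Suc N. if j = 0 then 0 else (%a j. \<Sum>l<Suc N. cf P i a l * t i j l) (j - 1) j)" for i
  by (rule sum.cong) auto
 also have "\<dots> i = (\<Sum>j<Suc N. \<Sum>l<Suc N. cf P i j l * t i (Suc j) l)" for i
  by (rule sum_shift_zero) (use t in \<open>simp add: vanishes_def\<close>)
 finally show ?thesis unfolding bxs_def by simp
qed

lemma bxs_cZ: "vanishes N t ==> bxs N (cZ * P) t = bxs N P (%i j l. t i j (Suc l))"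
proof -
 assume t: "vanishes N t"
 have "(\<Sum>l<Suc N. cf (cZ * P) i j l * t i j l) = (\<Sum>l<Suc N. if l = 0 then 0 else (%a l. cf P i j a * t i j l) (l - 1) l)" for i j
  by (rule sum.cong) auto
 also have "\<dots> i j = (\<Sum>l<Suc N. cf P i j l * t i j (Suc l))" for i j
  by (rule sum_shift_zero) (use t in \<open>simp add: vanishes_def\<close>)
 finally show ?thesis unfolding bxs_def by simp
qed

lemma bxs_add: "bxs N (P + Q) t = bxs N P t + bxs N Q t"
 and bxs_add_right: "bxs N P (%i j l. t i j l + u i j l) = bxs N P t + bxs N P u"
 by (simp_all add: bxs_def sum.distrib algebra_simps del: sum.lessThan_Suc)

lemma bxs_cc: "bxs N (cc c * P) t = c * bxs N P t"
 and bxs_cmult_right: "bxs N P (%i j l. c * t i j l) = c * bxs N P t"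
 by (simp_all add: bxs_def sum_distrib_left mult.assoc mult.left_commute[of c] del: sum.lessThan_Suc)

lemma bxs_numeral: "bxs N (numeral n * P) t = numeral n * bxs N P t"
 using bxs_cc[of N "numeral n" P t] by (simp add: cc_numeral)

lemma bxs_diff: "bxs N (P - Q) t = bxs N P t - bxs N Q t"
 using bxs_add[of N P "cc (-1) * Q" t] by (simp add: bxs_cc) (simp add: cc_uminus)

lemma bxs_stable: assumes "vanishes N t" "N \<le> M" shows "bxs M P t = bxs N P t"
proof -
 have z: "t i j l = 0" if "i > N \<or> j > N \<or> l > N" for i j l using assms(1) that by (auto simp: vanishes_def)
 have 1: "(\<Sum>l<Suc M. cf P i j l * t i j l) = (\<Sum>l<Suc N. cf P i j l * t i j l)" for i j
  by (rule sum.mono_neutral_right) (use assms(2) z in auto)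
 have 2: "(\<Sum>j<Suc M. \<Sum>l<Suc N. cf P i j l * t i j l) = (\<Sum>j<Suc N. \<Sum>l<Suc N. cf P i j l * t i j l)" for i
  by (rule sum.mono_neutral_right) (use assms(2) z in auto)
 have 3: "(\<Sum>i<Suc M. \<Sum>j<Suc N. \<Sum>l<Suc N. cf P i j l * t i j l) = (\<Sum>i<Suc N. \<Sum>j<Suc N. \<Sum>l<Suc N. cf P i j l * t i j l)"
  by (rule sum.mono_neutral_right) (use assms(2) z in auto)
 show ?thesis unfolding bxs_def 1 2 3 ..
qed

lemma bxs_dX: assumes "vanishes N (%i. t (Suc i))" shows "bxs N (dX P) (%i. t (Suc i)) = bxs (Suc N) P (%i j l. of_nat i * t i j l)"
proof -
 have "bxs (Suc N) P (%i j l. of_nat i * t i j l) = (\<Sum>i<Suc N. \<Sum>j<Suc (Suc N). \<Sum>l<Suc (Suc N). cf P (Suc i) j l * (of_nat (Suc i) * t (Suc i) j l))"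
  unfolding bxs_def by (subst sum.lessThan_Suc_shift) (simp del: sum.lessThan_Suc of_nat_Suc)
 also have "\<dots> = (\<Sum>i<Suc (Suc N). \<Sum>j<Suc (Suc N). \<Sum>l<Suc (Suc N). cf (dX P) i j l * t (Suc i) j l)"
 proof -
  have "t (Suc (Suc N)) j l = 0" for j l using assms by (simp add: vanishes_def)
  then show ?thesis by (simp add: sum.lessThan_Suc[of _ "Suc N"] mult_ac del: sum.lessThan_Suc of_nat_Suc)
 qed
 also have "\<dots> = bxs (Suc N) (dX P) (%i. t (Suc i))" by (simp only: bxs_def)
 also have "\<dots> = bxs N (dX P) (%i. t (Suc i))" by (rule bxs_stable[OF assms]) simp
 finally show ?thesis ..
qed

text \<open>At i = 0 the truncated difference i - 1 gives a spurious entry of the table, but it is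
  multiplied by i = 0.\<close>

lemma bxs_dX_gen:
 assumes "vanishes N t" shows "bxs N (dX P) t = bxs (Suc N) P (%i j l. of_nat i * t (i - 1) j l)"
proof -
 have *: "bxs N (dX P) (%i. (%i. t (i - 1)) (Suc i)) = bxs (Suc N) P (%i j l. of_nat i * (%i. t (i - 1)) i j l)"
  by (rule bxs_dX) (use assms in simp)
 then show ?thesis by simp
qed

lemma bxs_dY_gen:
 assumes "vanishes N t" shows "bxs N (dY P) t = bxs (Suc N) P (%i j l. of_nat j * t i (j - 1) l)"
proof -
 define sw where "sw Q = mk (%i j l. cf Q j i l)" for Q
 have s: "bxs N Q u = bxs N (sw Q) (%i j l. u j i l)" for Q u N
  unfolding bxs_def sw_def by (subst sum.swap) simp
 have "sw (dY P) = dX (sw P)" by (rule ps3_eqI) (simp add: sw_def)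
 moreover have "vanishes N (%i j l. t j i l)" using assms by (auto simp: vanishes_def add_ac)
 ultimately show ?thesis unfolding s[where Q = "dY P"] s[where Q = P] by (simp add: bxs_dX_gen)
qed

lemma bxs_dZ_gen:
 assumes "vanishes N t" shows "bxs N (dZ P) t = bxs (Suc N) P (%i j l. of_nat l * t i j (l - 1))"
proof -
 define sw where "sw Q = mk (%i j l. cf Q i l j)" for Q
 have s: "bxs N Q u = bxs N (sw Q) (%i j l. u i l j)" for Q u N
  unfolding bxs_def sw_def by (rule sum.cong[OF refl]) (subst sum.swap, simp)
 have "sw (dZ P) = dY (sw P)" by (rule ps3_eqI) (simp add: sw_def)
 moreover have "vanishes N (%i j l. t i l j)" using assms by (auto simp: vanishes_def add_ac)
 ultimately show ?thesis unfolding s[where Q = "dZ P"] s[where Q = P] by (simp add: bxs_dY_gen)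
qed

lemma bxs_ordge: assumes "ordge q P" "vanishes n t" "n < q" shows "bxs N P t = 0"
proof -
 have "cf P i j l * t i j l = 0" for i j l
  using assms by (cases "i + j + l < q") (auto simp: ordge_def vanishes_def)
 then show ?thesis unfolding bxs_def by (simp only: sum.neutral_const)
qed

context klein begin

text \<open>Up to a constant factor, the coefficient of x^-a y^-b z^-c in exp(-f), expanded in the
  four monomials of f: the integers in the Gamma factors are exponents of x y^3, y z^3, z x^3, xyz
  whose product is x^-a y^-b z^-c and whose sum is -(k + 1). The parameter moves them by X, X, X, -4
  X, along the relation (x y^3)(y z^3)(z x^3) = (xyz)^4.\<close>

definition PSI :: "int => nat => nat => nat => complex fps" where
 "PSI k a b c = (if (a + 2 * b + 4 * c) mod 7 = 0 then
  fps_const ((- 1) powi k * lam powi (int (a + b + c) - 4 * k - 4)) *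
  (gam 1 (k + 1 - cw 2 4 1 a b c) * gam 1 (k + 1 - cw 1 2 4 a b c) * gam 1 (k + 1 - cw 4 1 2 a b c)
   * gam (- 4) (int (a + b + c) - 4 * k - 4)) else 0)"

lemma PSI_form:
 assumes "(a + 2 * b + 4 * c) mod 7 = 0"
 obtains U where "PSI k a b c = fps_X ^ (neg (k + 1 - cw 2 4 1 a b c) + neg (k + 1 - cw 1 2 4 a b c) + neg (k + 1 - cw 4 1 2 a b c)
   + neg (int (a + b + c) - 4 * k - 4)) * U" "fps_nth U 0 ~= 0"
proof -
 obtain U1 where U1: "gam 1 (k + 1 - cw 2 4 1 a b c) = fps_X ^ neg (k + 1 - cw 2 4 1 a b c) * U1" "fps_nth U1 0 ~= 0"
  using gam_form[of 1 "k + 1 - cw 2 4 1 a b c"] unfolding neg_def by (metis zero_neq_one)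
 obtain U2 where U2: "gam 1 (k + 1 - cw 1 2 4 a b c) = fps_X ^ neg (k + 1 - cw 1 2 4 a b c) * U2" "fps_nth U2 0 ~= 0"
  using gam_form[of 1 "k + 1 - cw 1 2 4 a b c"] unfolding neg_def by (metis zero_neq_one)
 obtain U3 where U3: "gam 1 (k + 1 - cw 4 1 2 a b c) = fps_X ^ neg (k + 1 - cw 4 1 2 a b c) * U3" "fps_nth U3 0 ~= 0"
  using gam_form[of 1 "k + 1 - cw 4 1 2 a b c"] unfolding neg_def by (metis zero_neq_one)
 obtain U4 where U4: "gam (- 4) (int (a + b + c) - 4 * k - 4) = fps_X ^ neg (int (a + b + c) - 4 * k - 4) * U4" "fps_nth U4 0 ~= 0"
  using gam_form[of "- 4" "int (a + b + c) - 4 * k - 4"] unfolding neg_def by (metis neg_equal_0_iff_equal zero_neq_numeral)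
 let ?C = "(- 1) powi k * lam powi (int (a + b + c) - 4 * k - 4)"
 show ?thesis
 proof (rule that[of "fps_const ?C * (U1 * U2 * U3 * U4)"])
  show "PSI k a b c = fps_X ^ (neg (k + 1 - cw 2 4 1 a b c) + neg (k + 1 - cw 1 2 4 a b c) + neg (k + 1 - cw 4 1 2 a b c)
   + neg (int (a + b + c) - 4 * k - 4)) * (fps_const ?C * (U1 * U2 * U3 * U4))"
   unfolding PSI_def U1(1) U2(1) U3(1) U4(1) using assms by (simp add: power_add mult_ac)
  show "fps_nth (fps_const ?C * (U1 * U2 * U3 * U4)) 0 ~= 0"
   using lam U1 U2 U3 U4 by (simp add: power_int_eq_0_iff)
 qed
qed

lemma PSI_order:
 assumes "s < neg (k + 1 - cw 2 4 1 a b c) + neg (k + 1 - cw 1 2 4 a b c) + neg (k + 1 - cw 4 1 2 a b c) + neg (int (a + b + c) - 4 * k - 4)"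
 shows "fps_nth (PSI k a b c) s = 0"
proof (cases "(a + 2 * b + 4 * c) mod 7 = 0")
 case True
 then obtain U where "PSI k a b c = fps_X ^ (neg (k + 1 - cw 2 4 1 a b c) + neg (k + 1 - cw 1 2 4 a b c) + neg (k + 1 - cw 4 1 2 a b c)
   + neg (int (a + b + c) - 4 * k - 4)) * U" by (rule PSI_form)
 then show ?thesis using assms by (simp add: fps_X_power_mult_nth)
qed (simp add: PSI_def)

lemma PSI_lead:
 assumes "s = neg (k + 1 - cw 2 4 1 a b c) + neg (k + 1 - cw 1 2 4 a b c) + neg (k + 1 - cw 4 1 2 a b c) + neg (int (a + b + c) - 4 * k - 4)"
  "(a + 2 * b + 4 * c) mod 7 = 0"
 shows "fps_nth (PSI k a b c) s ~= 0"
proof -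
 obtain U where "PSI k a b c = fps_X ^ s * U" "fps_nth U 0 ~= 0" using PSI_form[OF assms(2), of k] unfolding assms(1) by metis
 then show ?thesis by (simp add: fps_X_power_mult_nth)
qed

lemma weights_sum:
 assumes "(a + 2 * b + 4 * c) mod 7 = 0"
 shows "7 * cw 2 4 1 a b c = 2 * int a + 4 * int b + int c" "7 * cw 1 2 4 a b c = int a + 2 * int b + 4 * int c"
  "7 * cw 4 1 2 a b c = 4 * int a + int b + 2 * int c"
proof -
 have *: "7 * int (m div 7) = int m" if "m mod 7 = 0" for m using that by presburger
 have m: "(2 * a + 4 * b + 1 * c) mod 7 = 0" "(1 * a + 2 * b + 4 * c) mod 7 = 0" "(4 * a + 1 * b + 2 * c) mod 7 = 0"
  using assms by presburger+
 show "7 * cw 2 4 1 a b c = 2 * int a + 4 * int b + int c" unfolding cw_def *[OF m(1)] by simp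
 show "7 * cw 1 2 4 a b c = int a + 2 * int b + 4 * int c" unfolding cw_def *[OF m(2)] by simp
 show "7 * cw 4 1 2 a b c = 4 * int a + int b + 2 * int c" unfolding cw_def *[OF m(3)] by simp
qed

text \<open>Each weight is at least (a + b + c)/7, so beyond this bound the three circulant
  arguments are all negative and the order in X is at least 3. This makes the functionals finite
  sums.\<close>

lemma PSI_vanish:
 assumes "int (a + b + c) > 7 * (k + 1)" "k \<ge> -1" "s \<le> 2" shows "fps_nth (PSI k a b c) s = 0"
proof (cases "(a + 2 * b + 4 * c) mod 7 = 0")
 case True
 note w = weights_sum[OF True]
 have "k + 1 - cw 2 4 1 a b c < 0" "k + 1 - cw 1 2 4 a b c < 0" "k + 1 - cw 4 1 2 a b c < 0"
  using w assms(1) by auto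
 then show ?thesis using assms(3) by (intro PSI_order) (simp add: neg_def)
qed (simp add: PSI_def)

text \<open>The four arguments add up to -(k + 1) < 0, so one of them is negative and contributes a
  zero.\<close>

lemma PSI_0: assumes "k \<ge> 0" shows "fps_nth (PSI k a b c) 0 = 0"
proof (cases "(a + 2 * b + 4 * c) mod 7 = 0")
 case True
 note w = weights_sum[OF True]
 have "k + 1 - cw 2 4 1 a b c < 0 \<or> k + 1 - cw 1 2 4 a b c < 0 \<or> k + 1 - cw 4 1 2 a b c < 0 \<or> int (a + b + c) - 4 * k - 4 < 0"
  using w assms by auto
 then show ?thesis by (intro PSI_order) (auto simp: neg_def)
qed (simp add: PSI_def)

lemma cw_shift:
 assumes "(a + 2 * b + 4 * c) mod 7 = 0"
 shows "cw 2 4 1 (Suc a) (b + 3) c = cw 2 4 1 a b c + 2" "cw 1 2 4 (Suc a) (b + 3) c = cw 1 2 4 a b c + 1" "cw 4 1 2 (Suc a) (b + 3) c = cw 4 1 2 a b c + 1"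
  "cw 2 4 1 a (Suc b) (c + 3) = cw 2 4 1 a b c + 1" "cw 1 2 4 a (Suc b) (c + 3) = cw 1 2 4 a b c + 2" "cw 4 1 2 a (Suc b) (c + 3) = cw 4 1 2 a b c + 1"
  "cw 2 4 1 (a + 3) b (Suc c) = cw 2 4 1 a b c + 1" "cw 1 2 4 (a + 3) b (Suc c) = cw 1 2 4 a b c + 1" "cw 4 1 2 (a + 3) b (Suc c) = cw 4 1 2 a b c + 2"
  "cw 2 4 1 (Suc a) (Suc b) (Suc c) = cw 2 4 1 a b c + 1" "cw 1 2 4 (Suc a) (Suc b) (Suc c) = cw 1 2 4 a b c + 1" "cw 4 1 2 (Suc a) (Suc b) (Suc c) = cw 4 1 2 a b c + 1"
proof -
 have m: "(Suc a + 2 * (b + 3) + 4 * c) mod 7 = 0" "(a + 2 * Suc b + 4 * (c + 3)) mod 7 = 0" "((a + 3) + 2 * b + 4 * Suc c) mod 7 = 0"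
  "(Suc a + 2 * Suc b + 4 * Suc c) mod 7 = 0" using assms by presburger+
 note w = weights_sum[OF assms] weights_sum[OF m(1)] weights_sum[OF m(2)] weights_sum[OF m(3)] weights_sum[OF m(4)]
 show "cw 2 4 1 (Suc a) (b + 3) c = cw 2 4 1 a b c + 2" "cw 1 2 4 (Suc a) (b + 3) c = cw 1 2 4 a b c + 1" "cw 4 1 2 (Suc a) (b + 3) c = cw 4 1 2 a b c + 1"
  "cw 2 4 1 a (Suc b) (c + 3) = cw 2 4 1 a b c + 1" "cw 1 2 4 a (Suc b) (c + 3) = cw 1 2 4 a b c + 2" "cw 4 1 2 a (Suc b) (c + 3) = cw 4 1 2 a b c + 1"
  "cw 2 4 1 (a + 3) b (Suc c) = cw 2 4 1 a b c + 1" "cw 1 2 4 (a + 3) b (Suc c) = cw 1 2 4 a b c + 1" "cw 4 1 2 (a + 3) b (Suc c) = cw 4 1 2 a b c + 2"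
  "cw 2 4 1 (Suc a) (Suc b) (Suc c) = cw 2 4 1 a b c + 1" "cw 1 2 4 (Suc a) (Suc b) (Suc c) = cw 1 2 4 a b c + 1" "cw 4 1 2 (Suc a) (Suc b) (Suc c) = cw 4 1 2 a b c + 1"
  using w by simp_all
qed

text \<open>Raising (a, b, c) by the exponents of one monomial of f, together with k, lowers the
  argument of that monomial by one and fixes the other three; \<open>gam_lower\<close> and the sign
  (-1)^k do the rest.\<close>

lemma PSI_shift:
 "PSI (k + 1) (Suc a) (b + 3) c = - ((of_int (k + 1 - cw 2 4 1 a b c) + fps_X) * PSI k a b c)"
 "PSI (k + 1) a (Suc b) (c + 3) = - ((of_int (k + 1 - cw 1 2 4 a b c) + fps_X) * PSI k a b c)"
 "PSI (k + 1) (a + 3) b (Suc c) = - ((of_int (k + 1 - cw 4 1 2 a b c) + fps_X) * PSI k a b c)"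
 "fps_const lam * PSI (k + 1) (Suc a) (Suc b) (Suc c) = - ((of_int (int (a + b + c) - 4 * k - 4) - 4 * fps_X) * PSI k a b c)"
proof -
 have c: "(Suc a + 2 * (b + 3) + 4 * c) mod 7 = 0 \<longleftrightarrow> (a + 2 * b + 4 * c) mod 7 = 0"
  "(a + 2 * Suc b + 4 * (c + 3)) mod 7 = 0 \<longleftrightarrow> (a + 2 * b + 4 * c) mod 7 = 0"
  "((a + 3) + 2 * b + 4 * Suc c) mod 7 = 0 \<longleftrightarrow> (a + 2 * b + 4 * c) mod 7 = 0"
  "(Suc a + 2 * Suc b + 4 * Suc c) mod 7 = 0 \<longleftrightarrow> (a + 2 * b + 4 * c) mod 7 = 0" by presburger+
 define n1 n2 n3 n4 where "n1 = k + 1 - cw 2 4 1 a b c" and "n2 = k + 1 - cw 1 2 4 a b c" and "n3 = k + 1 - cw 4 1 2 a b c"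
  and "n4 = int (a + b + c) - 4 * k - 4"
 have s: "(- 1 :: complex) powi (k + 1) = - ((- 1) powi k)" by (simp add: power_int_add)
 have g: "gam 1 (n - 1) = (of_int n + fps_X) * gam 1 n" for n using gam_lower[of 1 n] by simp
 have c4: "fps_const (- 4 :: complex) = - 4" by (simp add: numeral_fps_const flip: fps_const_neg)
 have g4: "gam (- 4) (n - 1) = (of_int n - 4 * fps_X) * gam (- 4) n" for n
  using gam_lower[of "-4" n] unfolding c4 by simp
 have l: "lam * lam powi (n - 1) = lam powi n" for n using lam power_int_diff[of lam n 1] by simp
 have cl: "fps_const lam * (fps_const (- (u * lam powi (n - 1))) * v) = - (fps_const (u * lam powi n) * v)" for u n and v :: "complex fps"
  unfolding l[of n, symmetric] by (simp add: mult_ac flip: fps_const_neg fps_const_mult)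
 show "PSI (k + 1) (Suc a) (b + 3) c = - ((of_int (k + 1 - cw 2 4 1 a b c) + fps_X) * PSI k a b c)"
 proof (cases "(a + 2 * b + 4 * c) mod 7 = 0")
  case True
  note w = cw_shift[OF True]
  have e: "k + 1 + 1 - cw 2 4 1 (Suc a) (b + 3) c = n1 - 1" "k + 1 + 1 - cw 1 2 4 (Suc a) (b + 3) c = n2" "k + 1 + 1 - cw 4 1 2 (Suc a) (b + 3) c = n3"
   "int (Suc a + (b + 3) + c) - 4 * (k + 1) - 4 = n4" unfolding w n1_def n2_def n3_def n4_def by simp_all
  show ?thesis unfolding PSI_def c e g s n1_def[symmetric] n2_def[symmetric] n3_def[symmetric] n4_def[symmetric] using True
   by (simp add: mult_ac flip: fps_const_neg)
 qed (simp only: PSI_def c if_False mult_zero_right minus_zero)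
 show "PSI (k + 1) a (Suc b) (c + 3) = - ((of_int (k + 1 - cw 1 2 4 a b c) + fps_X) * PSI k a b c)"
 proof (cases "(a + 2 * b + 4 * c) mod 7 = 0")
  case True
  note w = cw_shift[OF True]
  have e: "k + 1 + 1 - cw 2 4 1 a (Suc b) (c + 3) = n1" "k + 1 + 1 - cw 1 2 4 a (Suc b) (c + 3) = n2 - 1" "k + 1 + 1 - cw 4 1 2 a (Suc b) (c + 3) = n3"
   "int (a + Suc b + (c + 3)) - 4 * (k + 1) - 4 = n4" unfolding w n1_def n2_def n3_def n4_def by simp_all
  show ?thesis unfolding PSI_def c e g s n1_def[symmetric] n2_def[symmetric] n3_def[symmetric] n4_def[symmetric] using True
   by (simp add: mult_ac flip: fps_const_neg)
 qed (simp only: PSI_def c if_False mult_zero_right minus_zero)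
 show "PSI (k + 1) (a + 3) b (Suc c) = - ((of_int (k + 1 - cw 4 1 2 a b c) + fps_X) * PSI k a b c)"
 proof (cases "(a + 2 * b + 4 * c) mod 7 = 0")
  case True
  note w = cw_shift[OF True]
  have e: "k + 1 + 1 - cw 2 4 1 (a + 3) b (Suc c) = n1" "k + 1 + 1 - cw 1 2 4 (a + 3) b (Suc c) = n2" "k + 1 + 1 - cw 4 1 2 (a + 3) b (Suc c) = n3 - 1"
   "int ((a + 3) + b + Suc c) - 4 * (k + 1) - 4 = n4" unfolding w n1_def n2_def n3_def n4_def by simp_all
  show ?thesis unfolding PSI_def c e g s n1_def[symmetric] n2_def[symmetric] n3_def[symmetric] n4_def[symmetric] using True
   by (simp add: mult_ac flip: fps_const_neg)
 qed (simp only: PSI_def c if_False mult_zero_right minus_zero)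
 show "fps_const lam * PSI (k + 1) (Suc a) (Suc b) (Suc c) = - ((of_int (int (a + b + c) - 4 * k - 4) - 4 * fps_X) * PSI k a b c)"
 proof (cases "(a + 2 * b + 4 * c) mod 7 = 0")
  case True
  note w = cw_shift[OF True]
  have e: "k + 1 + 1 - cw 2 4 1 (Suc a) (Suc b) (Suc c) = n1" "k + 1 + 1 - cw 1 2 4 (Suc a) (Suc b) (Suc c) = n2" "k + 1 + 1 - cw 4 1 2 (Suc a) (Suc b) (Suc c) = n3"
   "int (Suc a + Suc b + Suc c) - 4 * (k + 1) - 4 = n4 - 1" unfolding w n1_def n2_def n3_def n4_def by simp_all
  have "fps_const lam * PSI (k + 1) (Suc a) (Suc b) (Suc c) = fps_const lam * (fps_const (- ((- 1) powi k * lam powi (n4 - 1))) * (gam 1 n1 * gam 1 n2 * gam 1 n3 * ((of_int n4 - 4 * fps_X) * gam (- 4) n4)))"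
   unfolding PSI_def c(4) e g4 s using True by simp
  also have "\<dots> = - ((of_int n4 - 4 * fps_X) * PSI k a b c)"
   unfolding cl PSI_def n1_def[symmetric] n2_def[symmetric] n3_def[symmetric] n4_def[symmetric] using True by (simp add: mult_ac)
  finally show ?thesis by (simp add: n4_def)
 qed (simp only: PSI_def c if_False mult_zero_right minus_zero)
qed

text \<open>Integration by parts for the formal integral. The exponents of each variable annihilate
  (1, 1, 1, -4), for instance 1 + 3 - 4 = 0, so X drops out of the first three identities. In the
  last one the entries add up to -1, and the surviving X produces the logarithm.\<close>

lemma PSI_gradient:
 "PSI (k + 1) (Suc a) (b + 3) c + 3 * PSI (k + 1) (a + 3) b (Suc c) + fps_const lam * PSI (k + 1) (Suc a) (Suc b) (Suc c) = of_nat a * PSI k a b c"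
 "3 * PSI (k + 1) (Suc a) (b + 3) c + PSI (k + 1) a (Suc b) (c + 3) + fps_const lam * PSI (k + 1) (Suc a) (Suc b) (Suc c) = of_nat b * PSI k a b c"
 "3 * PSI (k + 1) a (Suc b) (c + 3) + PSI (k + 1) (a + 3) b (Suc c) + fps_const lam * PSI (k + 1) (Suc a) (Suc b) (Suc c) = of_nat c * PSI k a b c"
 "PSI (k + 1) (Suc a) (b + 3) c + PSI (k + 1) a (Suc b) (c + 3) + PSI (k + 1) (a + 3) b (Suc c) + fps_const lam * PSI (k + 1) (Suc a) (Suc b) (Suc c)
  = (of_int (k + 1) + fps_X) * PSI k a b c"
proof -
 define n1 n2 n3 n4 where "n1 = k + 1 - cw 2 4 1 a b c" and "n2 = k + 1 - cw 1 2 4 a b c" and "n3 = k + 1 - cw 4 1 2 a b c"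
  and "n4 = int (a + b + c) - 4 * k - 4"
 note sh = PSI_shift[of k a b c, folded n1_def n2_def n3_def n4_def]
 have "(a + 2 * b + 4 * c) mod 7 = 0 ==> n1 + 3 * n3 + n4 = - int a & 3 * n1 + n2 + n4 = - int b & 3 * n2 + n3 + n4 = - int c & n1 + n2 + n3 + n4 = - (k + 1)"
  using weights_sum[of a b c] by (simp add: n1_def n2_def n3_def n4_def)
 then have d: "PSI k a b c = 0 \<or> n1 + 3 * n3 + n4 = - int a & 3 * n1 + n2 + n4 = - int b & 3 * n2 + n3 + n4 = - int c & n1 + n2 + n3 + n4 = - (k + 1)"
  by (cases "(a + 2 * b + 4 * c) mod 7 = 0") (auto simp: PSI_def)
 have e: "- of_int (n1 + 3 * n3 + n4) * PSI k a b c = of_nat a * PSI k a b c" "- of_int (3 * n1 + n2 + n4) * PSI k a b c = of_nat b * PSI k a b c"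
  "- of_int (3 * n2 + n3 + n4) * PSI k a b c = of_nat c * PSI k a b c" "(- of_int (n1 + n2 + n3 + n4) + fps_X) * PSI k a b c = (of_int (k + 1) + fps_X) * PSI k a b c"
  by (insert d, (elim disjE conjE, simp, simp only: of_int_minus of_int_of_nat_eq minus_minus)+)
 have id: "- ((of_int n1 + fps_X) * P) + 3 * - ((of_int n3 + fps_X) * P) + - ((of_int n4 - 4 * fps_X) * P) = - of_int (n1 + 3 * n3 + n4) * P"
  "3 * - ((of_int n1 + fps_X) * P) + - ((of_int n2 + fps_X) * P) + - ((of_int n4 - 4 * fps_X) * P) = - of_int (3 * n1 + n2 + n4) * P"
  "3 * - ((of_int n2 + fps_X) * P) + - ((of_int n3 + fps_X) * P) + - ((of_int n4 - 4 * fps_X) * P) = - of_int (3 * n2 + n3 + n4) * P"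
  "- ((of_int n1 + fps_X) * P) + - ((of_int n2 + fps_X) * P) + - ((of_int n3 + fps_X) * P) + - ((of_int n4 - 4 * fps_X) * P) = (- of_int (n1 + n2 + n3 + n4) + fps_X) * P"
  for P :: "complex fps" by (simp_all add: algebra_simps)
 show "PSI (k + 1) (Suc a) (b + 3) c + 3 * PSI (k + 1) (a + 3) b (Suc c) + fps_const lam * PSI (k + 1) (Suc a) (Suc b) (Suc c) = of_nat a * PSI k a b c"
  unfolding sh id by (rule e)
 show "3 * PSI (k + 1) (Suc a) (b + 3) c + PSI (k + 1) a (Suc b) (c + 3) + fps_const lam * PSI (k + 1) (Suc a) (Suc b) (Suc c) = of_nat b * PSI k a b c"
  unfolding sh id by (rule e)
 show "3 * PSI (k + 1) a (Suc b) (c + 3) + PSI (k + 1) (a + 3) b (Suc c) + fps_const lam * PSI (k + 1) (Suc a) (Suc b) (Suc c) = of_nat c * PSI k a b c"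
  unfolding sh id by (rule e)
 show "PSI (k + 1) (Suc a) (b + 3) c + PSI (k + 1) a (Suc b) (c + 3) + PSI (k + 1) (a + 3) b (Suc c) + fps_const lam * PSI (k + 1) (Suc a) (Suc b) (Suc c)
  = (of_int (k + 1) + fps_X) * PSI k a b c"
  unfolding sh id by (rule e)
qed

text \<open>The indices are raised by one because x^i y^j z^l dx dy dz is x^(i+1) y^(j+1) z^(l+1)
  times the logarithmic form dx/x dy/y dz/z.\<close>

definition tau :: "nat => int => nat => nat => nat => complex" where
 "tau s k i j l = fps_nth (PSI k (Suc i) (Suc j) (Suc l)) s"

lemma tau_vanish: assumes "k \<ge> -1" "s \<le> 2" "7 * k + 4 \<le> int N" shows "vanishes N (tau s k)"
 unfolding vanishes_def tau_def using assms by (intro allI impI PSI_vanish) auto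

definition Lc :: "nat => int => ps3 => complex" where "Lc s k P = bxs (nat (7 * k + 20)) P (tau s k)"

lemma Lc_eq: assumes "k \<ge> -1" "s \<le> 2" "7 * k + 4 \<le> int N" shows "bxs N P (tau s k) = Lc s k P"
proof -
 define M where "M = max N (nat (7 * k + 20))"
 have "bxs M P (tau s k) = bxs N P (tau s k)" by (rule bxs_stable[OF tau_vanish[OF assms]]) (simp add: M_def)
 moreover have "bxs M P (tau s k) = bxs (nat (7 * k + 20)) P (tau s k)"
  by (rule bxs_stable[OF tau_vanish[OF assms(1,2)]]) (use assms(1) in \<open>simp_all add: M_def\<close>)
 ultimately show ?thesis by (simp add: Lc_def)
qed

lemma Lc_add: "Lc s k (P + Q) = Lc s k P + Lc s k Q" and Lc_diff: "Lc s k (P - Q) = Lc s k P - Lc s k Q"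
 and Lc_cc: "Lc s k (cc c * P) = c * Lc s k P"
 by (simp_all add: Lc_def bxs_add bxs_diff bxs_cc)

lemma Lc_0: assumes "k \<ge> 0" shows "Lc 0 k P = 0"
proof -
 have "tau 0 k = (%i j l. 0)" using PSI_0[OF assms] by (simp add: tau_def fun_eq_iff)
 then show ?thesis by (simp add: Lc_def bxs_def del: sum.lessThan_Suc)
qed

lemma Lc_minus: assumes "s \<le> 2" shows "Lc s (-1) P = 0"
proof -
 have "tau s (-1) = (%i j l. 0)" using PSI_vanish[of "-1"] assms by (simp add: tau_def fun_eq_iff)
 then show ?thesis by (simp add: Lc_def bxs_def del: sum.lessThan_Suc)
qed

lemma Lc_ordge: assumes "ordge q P" "k \<ge> 0" "s \<le> 2" "7 * k + 4 < int q" shows "Lc s k P = 0"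
proof -
 have "vanishes (nat (7 * k + 4)) (tau s k)" using assms by (intro tau_vanish) auto
 then show ?thesis unfolding Lc_def using assms by (intro bxs_ordge[where n = "nat (7 * k + 4)"]) auto
qed

lemma tau_gradient:
 "tau s (k + 1) i (Suc (Suc (Suc j))) l + 3 * tau s (k + 1) (Suc (Suc i)) j (Suc l) + lam * tau s (k + 1) i (Suc j) (Suc l) = of_nat i * tau s k (i - 1) j l"
 "tau s (k + 1) i j (Suc (Suc (Suc l))) + 3 * tau s (k + 1) (Suc i) (Suc (Suc j)) l + lam * tau s (k + 1) (Suc i) j (Suc l) = of_nat j * tau s k i (j - 1) l"
 "tau s (k + 1) (Suc (Suc (Suc i))) j l + 3 * tau s (k + 1) i (Suc j) (Suc (Suc l)) + lam * tau s (k + 1) (Suc i) (Suc j) l = of_nat l * tau s k i j (l - 1)"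
 "tau s (k + 1) (Suc i) (Suc (Suc (Suc j))) l + tau s (k + 1) i (Suc j) (Suc (Suc (Suc l))) + tau s (k + 1) (Suc (Suc (Suc i))) j (Suc l)
  + lam * tau s (k + 1) (Suc i) (Suc j) (Suc l) = of_int (k + 1) * tau s k i j l + (if s = 0 then 0 else tau (s - 1) k i j l)"
proof -
 have n3: "a + 3 = Suc (Suc (Suc a))" for a by simp
 have c: "3 * F = fps_const 3 * F" "of_nat m * F = fps_const (of_nat m) * F" "of_int z * F = fps_const (of_int z) * F" for F :: "complex fps" and m z
  by (simp_all add: numeral_fps_const fps_of_nat fps_of_int)
 note g = arg_cong[where f = "%F. fps_nth F s", OF PSI_gradient(1)[of k i "Suc j" "Suc l"]]
  arg_cong[where f = "%F. fps_nth F s", OF PSI_gradient(2)[of k "Suc i" j "Suc l"]]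
  arg_cong[where f = "%F. fps_nth F s", OF PSI_gradient(3)[of k "Suc i" "Suc j" l]]
  arg_cong[where f = "%F. fps_nth F s", OF PSI_gradient(4)[of k "Suc i" "Suc j" "Suc l"]]
 note g' = g[unfolded n3 c distrib_right fps_add_nth fps_mult_left_const_nth fps_X_mult_nth]
 show "tau s (k + 1) i (Suc (Suc (Suc j))) l + 3 * tau s (k + 1) (Suc (Suc i)) j (Suc l) + lam * tau s (k + 1) i (Suc j) (Suc l) = of_nat i * tau s k (i - 1) j l"
  using g'(1) unfolding tau_def by (cases i) (simp_all only: of_nat_0 mult_zero_left diff_Suc_1)
 show "tau s (k + 1) i j (Suc (Suc (Suc l))) + 3 * tau s (k + 1) (Suc i) (Suc (Suc j)) l + lam * tau s (k + 1) (Suc i) j (Suc l) = of_nat j * tau s k i (j - 1) l"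
  using g'(2) unfolding tau_def by (cases j) (simp_all only: of_nat_0 mult_zero_left diff_Suc_1 add_ac)
 show "tau s (k + 1) (Suc (Suc (Suc i))) j l + 3 * tau s (k + 1) i (Suc j) (Suc (Suc l)) + lam * tau s (k + 1) (Suc i) (Suc j) l = of_nat l * tau s k i j (l - 1)"
  using g'(3) unfolding tau_def by (cases l) (simp_all only: of_nat_0 mult_zero_left diff_Suc_1 add_ac)
 show "tau s (k + 1) (Suc i) (Suc (Suc (Suc j))) l + tau s (k + 1) i (Suc j) (Suc (Suc (Suc l))) + tau s (k + 1) (Suc (Suc (Suc i))) j (Suc l)
  + lam * tau s (k + 1) (Suc i) (Suc j) (Suc l) = of_int (k + 1) * tau s k i j l + (if s = 0 then 0 else tau (s - 1) k i j l)"
  using g'(4) unfolding tau_def .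
qed

text \<open>\<open>tau_gradient\<close> summed against coefficients: df wedge eta pairs at level k +
  1 as d eta does at level k. For multiplication by f the summand X of \<open>PSI_gradient\<close>
  brings in the functional with s - 1.\<close>

lemma Lc_gradient:
 assumes k: "k \<ge> -1" "s \<le> 2"
 shows "Lc s (k + 1) (dfw a b c) = Lc s k (div3 a b c)"
  "Lc s (k + 1) (fp * P) = of_int (k + 1) * Lc s k P + (if s = 0 then 0 else Lc (s - 1) k P)"
proof -
 define N where "N = nat (7 * k + 40)"
 define t where "t = tau s (k + 1)"
 have "vanishes (Suc N) t" unfolding t_def using k by (intro tau_vanish) (auto simp: N_def)
 then have t0: "Suc N < i + j + l ==> t i j l = 0" for i j l by (simp add: vanishes_def)
 have v: "vanishes N (tau s k)" using k by (intro tau_vanish) (auto simp: N_def)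
 have L: "Lc s (k + 1) P = bxs (Suc N) P t" for P unfolding t_def using k by (intro Lc_eq[symmetric]) (auto simp: N_def)
 have L': "Lc s k P = bxs N P (tau s k)" for P using k by (intro Lc_eq[symmetric]) (auto simp: N_def)
 have e: "fx * a = cY * (cY * (cY * a)) + 3 * (cX * (cX * (cZ * a))) + cc lam * (cY * (cZ * a))"
  "fy * b = cZ * (cZ * (cZ * b)) + 3 * (cX * (cY * (cY * b))) + cc lam * (cX * (cZ * b))"
  "fz * c = cX * (cX * (cX * c)) + 3 * (cY * (cZ * (cZ * c))) + cc lam * (cX * (cY * c))"
  "fp * P = cX * (cY * (cY * (cY * P))) + cY * (cZ * (cZ * (cZ * P))) + cX * (cX * (cX * (cZ * P))) + cc lam * (cX * (cY * (cZ * P)))"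
  by (simp_all add: fx_def fy_def fz_def fp_def power2_eq_square power3_eq_cube algebra_simps)
 have "bxs (Suc N) (fx * a) t = bxs N (dX a) (tau s k)"
  unfolding e bxs_dX_gen[OF v] tau_gradient(1)[symmetric] t_def[symmetric]
  by (simp add: bxs_add bxs_numeral bxs_cc bxs_cX bxs_cY bxs_cZ vanishes_def t0 bxs_add_right bxs_cmult_right)
 moreover have "bxs (Suc N) (fy * b) t = bxs N (dY b) (tau s k)"
  unfolding e bxs_dY_gen[OF v] tau_gradient(2)[symmetric] t_def[symmetric]
  by (simp add: bxs_add bxs_numeral bxs_cc bxs_cX bxs_cY bxs_cZ vanishes_def t0 bxs_add_right bxs_cmult_right)
 moreover have "bxs (Suc N) (fz * c) t = bxs N (dZ c) (tau s k)"
  unfolding e bxs_dZ_gen[OF v] tau_gradient(3)[symmetric] t_def[symmetric]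
  by (simp add: bxs_add bxs_numeral bxs_cc bxs_cX bxs_cY bxs_cZ vanishes_def t0 bxs_add_right bxs_cmult_right)
 ultimately show "Lc s (k + 1) (dfw a b c) = Lc s k (div3 a b c)"
  unfolding L L' dfw_def div3_def by (simp only: bxs_add)
 have "Lc s (k + 1) (fp * P) = bxs (Suc N) P (%i j l. of_int (k + 1) * tau s k i j l + (if s = 0 then 0 else tau (s - 1) k i j l))"
  unfolding L e tau_gradient(4)[symmetric] t_def[symmetric]
  by (simp add: bxs_add bxs_numeral bxs_cc bxs_cX bxs_cY bxs_cZ vanishes_def t0 bxs_add_right bxs_cmult_right)
 also have "\<dots> = of_int (k + 1) * bxs (Suc N) P (tau s k) + bxs (Suc N) P (%i j l. if s = 0 then 0 else tau (s - 1) k i j l)"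
  by (simp only: bxs_add_right bxs_cmult_right)
 also have "bxs (Suc N) P (tau s k) = Lc s k P" using k by (intro Lc_eq) (auto simp: N_def)
 also have "bxs (Suc N) P (%i j l. if s = 0 then 0 else tau (s - 1) k i j l) = (if s = 0 then 0 else Lc (s - 1) k P)"
 proof (cases "s = 0")
  case True
  then show ?thesis by (simp add: bxs_def del: sum.lessThan_Suc)
 next
  case False
  have "bxs (Suc N) P (tau (s - 1) k) = Lc (s - 1) k P" using k by (intro Lc_eq) (auto simp: N_def)
  then show ?thesis using False by simp
 qed
 finally show "Lc s (k + 1) (fp * P) = of_int (k + 1) * Lc s k P + (if s = 0 then 0 else Lc (s - 1) k P)" .
qed

lemma Lc_mon: assumes "s \<le> 2" shows "Lc s (int n) (mon (a, b, c)) = tau s (int n) a b c"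
proof -
 define N where "N = 7 * n + 20 + a + b + c"
 have "Lc s (int n) (mon (a, b, c)) = bxs N (mon (a, b, c)) (tau s (int n))"
  using assms by (intro Lc_eq[symmetric]) (auto simp: N_def)
 also have "\<dots> = (\<Sum>i<Suc N. \<Sum>j<Suc N. \<Sum>l<Suc N. if l = c then if j = b then if i = a then tau s (int n) i j l else 0 else 0 else 0)"
  unfolding bxs_def by (intro sum.cong refl) (simp add: cf_mon)
 also have "\<dots> = tau s (int n) a b c"
  using N_def by (simp add: sum.delta del: sum.lessThan_Suc)
 finally show ?thesis .
qed

text \<open>Only s = 1 and s = 2 appear: s = 0 gives zero by \<open>PSI_0\<close>, and the bound on
  the support in \<open>PSI_vanish\<close> stops at s = 2.\<close>

definition LL :: "ps3 => jordan2" where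
 "LL P = (Abs_fps (%n. Lc 1 (int n) P), Abs_fps (%n. Lc 2 (int n) P))"

end

section \<open>The rank two Jordan model\<close>

definition sc :: "complex fps => jordan2 => jordan2" where
 "sc S v = (S * fst v, S * snd v)"

definition dab :: "complex fps => complex fps" where "dab P = fps_X\<^sup>2 * fps_deriv P + fps_X * P"

text \<open>With b acting as X this is the module on Log s (first component) and 1 (second
  component), where a 1 = b 1 and a Log s = b Log s + b 1.\<close>

definition aN :: "jordan2 => jordan2" where
 "aN v = (dab (fst v), dab (snd v) + fps_X * fst v)"

lemma dab_nth: "fps_nth (dab P) n = (if n = 0 then 0 else of_nat n * fps_nth P (n - 1))"
proof (cases n)
 case (Suc m)
 then show ?thesis by (cases m) (simp_all add: dab_def power2_eq_square mult.assoc algebra_simps)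
qed (simp add: dab_def power2_eq_square)

lemma dab_add: "dab (P + Q) = dab P + dab Q" and dab_diff: "dab (P - Q) = dab P - dab Q"
 and dab_mult: "dab (S * P) = S * dab P + fps_X\<^sup>2 * fps_deriv S * P" and dab_const: "dab (fps_const c * P) = fps_const c * dab P"
 by (simp_all add: dab_def algebra_simps)

lemma aN_add: "aN (v + w) = aN v + aN w" and aN_diff: "aN (v - w) = aN v - aN w"
 and aN_sc: "aN (sc S v) = sc S (aN v) + sc (fps_X\<^sup>2 * fps_deriv S) v"
 by (simp_all add: aN_def sc_def dab_add dab_diff dab_mult prod_eq_iff algebra_simps)

lemma sc_add: "sc S (v + w) = sc S v + sc S w" and sc_diff: "sc S (v - w) = sc S v - sc S w" and sc_add_left: "sc (S + T) v = sc S v + sc T v"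
 and sc_diff_left: "sc (S - T) v = sc S v - sc T v"
 and sc_mult: "sc (S * T) v = sc S (sc T v)" and sc_one [simp]: "sc 1 v = v" and sc_zero [simp]: "sc 0 v = 0" "sc S 0 = 0"
 by (simp_all add: sc_def prod_eq_iff algebra_simps)

context klein begin

lemma LL_eqI: "(!!n s. s = 1 \<or> s = 2 ==> Lc s (int n) P = fps_nth (if s = 1 then fst v else snd v) n) ==> LL P = v"
 by (simp add: LL_def prod_eq_iff fps_eq_iff)

lemma LL_add: "LL (P + Q) = LL P + LL Q" and LL_diff: "LL (P - Q) = LL P - LL Q" and LL_cc: "LL (cc c * P) = sc (fps_const c) (LL P)"
 by (simp_all add: LL_def Lc_add Lc_diff Lc_cc sc_def prod_eq_iff fps_eq_iff)

lemma LL_dfw: "LL (dfw a b c) = sc fps_X (LL (div3 a b c))"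
proof (rule LL_eqI)
 fix n s :: nat assume s: "s = 1 \<or> s = 2"
 have "Lc s (int n) (dfw a b c) = Lc s (int n - 1) (div3 a b c)" using Lc_gradient(1)[of "int n - 1" s a b c] s by auto
 then show "Lc s (int n) (dfw a b c) = fps_nth (if s = 1 then fst (sc fps_X (LL (div3 a b c))) else snd (sc fps_X (LL (div3 a b c)))) n"
  using s by (cases n) (auto simp: sc_def LL_def Lc_minus)
qed

lemma LL_beta: "LL (beta P) = sc fps_X (LL P)"
 using LL_dfw[of "cX * Einv P" "cY * Einv P" "cZ * Einv P"] unfolding dfw_radial div3_radial by (simp add: beta_def)

lemma LL_fp: "LL (fp * P) = aN (LL P)"
proof (rule LL_eqI)
 fix n s :: nat assume s: "s = 1 \<or> s = 2"
 have "Lc s (int n) (fp * P) = of_nat n * Lc s (int n - 1) P + Lc (s - 1) (int n - 1) P"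
  using Lc_gradient(2)[of "int n - 1" s P] s by auto
 then show "Lc s (int n) (fp * P) = fps_nth (if s = 1 then fst (aN (LL P)) else snd (aN (LL P))) n"
  using s by (cases n) (auto simp: aN_def dab_nth LL_def Lc_minus Lc_0)
qed

lemma LL_beta_funpow: "LL ((beta ^^ n) P) = sc (fps_X ^ n) (LL P)"
 by (induction n) (simp_all add: LL_beta sc_mult)

lemma LL_zero_iff: "LL P = 0 \<longleftrightarrow> (\<forall>n. Lc 1 (int n) P = 0 & Lc 2 (int n) P = 0)"
 by (auto simp: LL_def prod_eq_iff fps_eq_iff)

lemma Lc_smp: assumes s: "s = 1 \<or> s = 2" shows "Lc s (int n) (smp S P) = (\<Sum>m\<le>n. fps_nth S m * Lc s (int (n - m)) P)"
proof -
 define N where "N = 7 * n + 20"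
 have "Lc s (int n) (smp S P - (\<Sum>m<N. cc (fps_nth S m) * (beta ^^ m) P)) = 0"
  by (rule Lc_ordge[OF smp_approx]) (use s in \<open>auto simp: N_def\<close>)
 then have "Lc s (int n) (smp S P) = Lc s (int n) (\<Sum>m<N. cc (fps_nth S m) * (beta ^^ m) P)" by (simp add: Lc_diff)
 also have "\<dots> = (\<Sum>m<N. fps_nth S m * Lc s (int n) ((beta ^^ m) P))"
  by (induction N) (simp_all add: Lc_add Lc_cc, simp add: Lc_def bxs_def del: sum.lessThan_Suc)
 also have "\<dots> = (\<Sum>m<N. if m \<le> n then fps_nth S m * Lc s (int (n - m)) P else 0)"
 proof (rule sum.cong[OF refl])
  fix m
  have "Lc s (int n) ((beta ^^ m) P) = fps_nth (if s = 1 then fst (LL ((beta ^^ m) P)) else snd (LL ((beta ^^ m) P))) n"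
   using s by (auto simp: LL_def)
  also have "\<dots> = (if m \<le> n then Lc s (int (n - m)) P else 0)"
   unfolding LL_beta_funpow using s by (auto simp: sc_def fps_X_power_mult_nth LL_def)
  finally show "fps_nth S m * Lc s (int n) ((beta ^^ m) P) = (if m \<le> n then fps_nth S m * Lc s (int (n - m)) P else 0)" by simp
 qed
 also have "\<dots> = (\<Sum>m\<le>n. fps_nth S m * Lc s (int (n - m)) P)"
  by (rule sum.mono_neutral_cong_right) (auto simp: N_def)
 finally show ?thesis .
qed

lemma LL_smp: "LL (smp S P) = sc S (LL P)"
 by (rule LL_eqI) (auto simp: Lc_smp sc_def LL_def fps_mult_nth atLeast0AtMost)

lemma LL_fp_power: "i < m ==> fps_nth (fst (LL (fp ^ m * P))) i = 0 & fps_nth (snd (LL (fp ^ m * P))) i = 0"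
proof (induction m arbitrary: i)
 case (Suc m)
 have "LL (fp ^ Suc m * P) = aN (LL (fp ^ m * P))" by (simp add: LL_fp mult.assoc)
 then show ?case using Suc by (cases i) (simp_all add: aN_def dab_nth)
qed simp

text \<open>The n-th coefficients see only Taylor coefficients up to degree 7 n + 4, so P may be
  replaced by some d + f^(n+1) h. For d = div(eta) with df wedge eta = 0 one has X
  \<open>LL d\<close> = 0, and f^(n+1) raises the X-order beyond n.\<close>

lemma LL_Khat: assumes "P \<in> Khat" shows "LL P = 0"
 unfolding LL_zero_iff
proof
 fix n
 have "P \<in> cl3 (Dm (Suc n))" using assms by (auto simp: Khat_def Dh_def)
 then obtain Q where Q: "Q \<in> Dm (Suc n)" "ordge (7 * n + 20) (P - Q)" by (auto simp: cl3_def)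
 obtain d h where d: "Q = d + fp ^ Suc n * h" "d \<in> Dc" using Q(1) by (auto simp: Dm_def)
 obtain a b c where "d = div3 a b c" "dfw a b c = 0" using d(2) by (auto simp: Dc_def)
 then have "sc fps_X (LL d) = LL 0" using LL_dfw[of a b c] by simp
 moreover have "LL 0 = 0" using LL_diff[of 0 0] by simp
 ultimately have "LL d = 0" by (simp add: sc_def prod_eq_iff)
 then have "LL Q = LL (fp ^ Suc n * h)" by (simp add: d LL_add)
 then have "fps_nth (fst (LL Q)) n = 0 & fps_nth (snd (LL Q)) n = 0" using LL_fp_power[of n "Suc n" h] by (simp only: lessI)
 then have "Lc 1 (int n) Q = 0 & Lc 2 (int n) Q = 0" by (simp add: LL_def)
 moreover have "Lc 1 (int n) (P - Q) = 0" "Lc 2 (int n) (P - Q) = 0" by (rule Lc_ordge[OF Q(2)]; simp)+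
 ultimately show "Lc 1 (int n) P = 0 & Lc 2 (int n) P = 0" by (simp add: Lc_diff)
qed

lemma LL_KK: assumes "P \<in> KK" shows "LL P = 0"
proof -
 obtain n where "(beta ^^ n) P \<in> Khat" using assms by (auto simp: KK_def)
 then have "sc (fps_X ^ n) (LL P) = 0" using LL_Khat LL_beta_funpow by metis
 then show ?thesis by (simp add: sc_def prod_eq_iff)
qed

lemma LL_mon: "fps_nth (fst (LL (mon (a, b, c)))) n = tau 1 (int n) a b c" "fps_nth (snd (LL (mon (a, b, c)))) n = tau 2 (int n) a b c"
 by (simp_all add: LL_def Lc_mon)

lemma order_factor: assumes "!!i. i < n ==> fps_nth F i = 0" "fps_nth F n ~= 0"
 obtains U where "F = fps_X ^ n * U" "fps_nth U 0 ~= (0 :: complex)"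
proof (rule that[of "fps_shift n F"])
 show "F = fps_X ^ n * fps_shift n F" using assms(1) by (simp add: fps_eq_iff fps_X_power_mult_nth)
qed (simp add: assms(2))

lemma LL_one: obtains P where "fst (LL 1) = P" "fps_nth P 0 ~= 0"
proof (rule that[OF refl])
 have "mon (0, 0, 0) = 1" by (simp add: mon_def)
 moreover have "tau 1 0 0 0 0 ~= 0" unfolding tau_def by (rule PSI_lead) (simp_all add: cw_def neg_def)
 ultimately show "fps_nth (fst (LL 1)) 0 ~= 0" using LL_mon(1)[of 0 0 0 0] by simp
qed

text \<open>The raised exponents (2, 4, 1) have weights 3, 2, 2 and sum 7. Among k - 2, k - 1, k -
  1, 3 - 4 k there are 3, 2, 1 negative numbers for k = 0, 1, 2; hence s = 2 starts at k = 1 and s =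
  1 at k = 2.\<close>

lemma LL_w4: obtains U V where "LL (cX * cY ^ 3) = (fps_X ^ 2 * U, fps_X * V)" "fps_nth U 0 ~= 0" "fps_nth V 0 ~= 0"
proof -
 have m: "mon (1, 3, 0) = cX * cY ^ 3" by (simp add: mon_def)
 note n = LL_mon[of 1 3 0, unfolded m]
 have z: "tau 1 0 1 3 0 = 0" "tau 1 1 1 3 0 = 0" "tau 2 0 1 3 0 = 0" unfolding tau_def by (rule PSI_order, simp add: cw_def neg_def)+
 have nz: "tau 1 2 1 3 0 ~= 0" "tau 2 1 1 3 0 ~= 0" unfolding tau_def by (rule PSI_lead; simp add: cw_def neg_def)+
 have 1: "fps_nth (fst (LL (cX * cY ^ 3))) i = 0" if "i < 2" for i
 proof -
  have "i = 0 \<or> i = 1" using that by auto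
  then show ?thesis unfolding n using z by auto
 qed
 have 2: "fps_nth (fst (LL (cX * cY ^ 3))) 2 ~= 0" "fps_nth (snd (LL (cX * cY ^ 3))) 1 ~= 0" unfolding n using nz by simp_all
 have 3: "fps_nth (snd (LL (cX * cY ^ 3))) i = 0" if "i < 1" for i unfolding n using z that by simp
 obtain U where U: "fst (LL (cX * cY ^ 3)) = fps_X ^ 2 * U" "fps_nth U 0 ~= 0" using order_factor[OF 1 2(1)] .
 obtain V where V: "snd (LL (cX * cY ^ 3)) = fps_X ^ 1 * V" "fps_nth V 0 ~= 0" using order_factor[OF 3 2(2)] .
 show ?thesis by (rule that[OF _ U(2) V(2)]) (simp add: prod_eq_iff U(1) V(1))
qed

text \<open>The raised exponents (1, 4, 3) have weights 3, 3, 2 and sum 8: again 3, 2, 1 negative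
  arguments for k = 0, 1, 2.\<close>

lemma LL_w2: obtains U V where "LL (cY ^ 3 * cZ ^ 2) = (fps_X ^ 2 * U, fps_X * V)" "fps_nth U 0 ~= 0" "fps_nth V 0 ~= 0"
proof -
 have m: "mon (0, 3, 2) = cY ^ 3 * cZ ^ 2" by (simp add: mon_def)
 note n = LL_mon[of 0 3 2, unfolded m]
 have z: "tau 1 0 0 3 2 = 0" "tau 1 1 0 3 2 = 0" "tau 2 0 0 3 2 = 0" unfolding tau_def by (rule PSI_order, simp add: cw_def neg_def)+
 have nz: "tau 1 2 0 3 2 ~= 0" "tau 2 1 0 3 2 ~= 0" unfolding tau_def by (rule PSI_lead; simp add: cw_def neg_def)+
 have 1: "fps_nth (fst (LL (cY ^ 3 * cZ ^ 2))) i = 0" if "i < 2" for i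
 proof -
  have "i = 0 \<or> i = 1" using that by auto
  then show ?thesis unfolding n using z by auto
 qed
 have 2: "fps_nth (fst (LL (cY ^ 3 * cZ ^ 2))) 2 ~= 0" "fps_nth (snd (LL (cY ^ 3 * cZ ^ 2))) 1 ~= 0" unfolding n using nz by simp_all
 have 3: "fps_nth (snd (LL (cY ^ 3 * cZ ^ 2))) i = 0" if "i < 1" for i unfolding n using z that by simp
 obtain U where U: "fst (LL (cY ^ 3 * cZ ^ 2)) = fps_X ^ 2 * U" "fps_nth U 0 ~= 0" using order_factor[OF 1 2(1)] .
 obtain V where V: "snd (LL (cY ^ 3 * cZ ^ 2)) = fps_X ^ 1 * V" "fps_nth V 0 ~= 0" using order_factor[OF 3 2(2)] .
 show ?thesis by (rule that[OF _ U(2) V(2)]) (simp add: prod_eq_iff U(1) V(1))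
qed

text \<open>The raised exponents (1, 8, 1) have weights 5, 3, 2 and sum 10: there are 3 negative
  arguments for k = 0, then 2 for k = 1, 2, 3, and 1 for k = 4.\<close>

lemma LL_w3: obtains U V where "LL (cY ^ 7) = (fps_X ^ 4 * U, fps_X * V)" "fps_nth U 0 ~= 0" "fps_nth V 0 ~= 0"
proof -
 have m: "mon (0, 7, 0) = cY ^ 7" by (simp add: mon_def)
 note n = LL_mon[of 0 7 0, unfolded m]
 have z: "tau 1 0 0 7 0 = 0" "tau 1 1 0 7 0 = 0" "tau 1 2 0 7 0 = 0" "tau 1 3 0 7 0 = 0" "tau 2 0 0 7 0 = 0" unfolding tau_def by (rule PSI_order, simp add: cw_def neg_def)+
 have nz: "tau 1 4 0 7 0 ~= 0" "tau 2 1 0 7 0 ~= 0" unfolding tau_def by (rule PSI_lead; simp add: cw_def neg_def)+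
 have 1: "fps_nth (fst (LL (cY ^ 7))) i = 0" if "i < 4" for i
 proof -
  have "i = 0 \<or> i = 1 \<or> i = 2 \<or> i = 3" using that by auto
  then show ?thesis unfolding n using z by auto
 qed
 have 2: "fps_nth (fst (LL (cY ^ 7))) 4 ~= 0" "fps_nth (snd (LL (cY ^ 7))) 1 ~= 0" unfolding n using nz by simp_all
 have 3: "fps_nth (snd (LL (cY ^ 7))) i = 0" if "i < 1" for i unfolding n using z that by simp
 obtain U where U: "fst (LL (cY ^ 7)) = fps_X ^ 4 * U" "fps_nth U 0 ~= 0" using order_factor[OF 1 2(1)] .
 obtain V where V: "snd (LL (cY ^ 7)) = fps_X ^ 1 * V" "fps_nth V 0 ~= 0" using order_factor[OF 3 2(2)] .
 show ?thesis by (rule that[OF _ U(2) V(2)]) (simp add: prod_eq_iff U(1) V(1))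
qed

text \<open>P is generated by 1 and x y^3 modulo \<open>Dhat\<close>, and the images of these two
  have a determinant equal to X times a unit. So both coefficients vanish when \<open>LL P\<close>
  does.\<close>

lemma LL_injective: assumes "inv7 P" "LL P = 0" shows "P \<in> KK"
proof -
 obtain S T where ST: "P - smp S 1 - smp T (cX * cY ^ 3) \<in> Dhat" using generation_invariant[OF assms(1)] .
 then have D: "P - smp S 1 - smp T (cX * cY ^ 3) \<in> Khat" using Dhat_Khat by blast
 obtain p where p: "fst (LL 1) = p" "fps_nth p 0 ~= 0" using LL_one .
 obtain U V where UV: "LL (cX * cY ^ 3) = (fps_X ^ 2 * U, fps_X * V)" "fps_nth U 0 ~= 0" "fps_nth V 0 ~= 0" using LL_w4 .
 define r where "r = snd (LL 1)"
 have *: "LL P - sc S (LL 1) - sc T (LL (cX * cY ^ 3)) = 0" using LL_Khat[OF D] by (simp add: LL_diff LL_smp)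
 have f: "fst (LL P - sc S (LL 1) - sc T (LL (cX * cY ^ 3))) = 0 - S * p - T * (fps_X ^ 2 * U)"
  "snd (LL P - sc S (LL 1) - sc T (LL (cX * cY ^ 3))) = 0 - S * r - T * (fps_X * V)"
  unfolding assms(2) fst_diff snd_diff sc_def UV(1) fst_conv snd_conv p(1) r_def by simp_all
 have 1: "S * p + T * (fps_X ^ 2 * U) = - (0 - S * p - T * (fps_X ^ 2 * U))" "S * r + T * (fps_X * V) = - (0 - S * r - T * (fps_X * V))"
  by (simp_all only: diff_0 minus_diff_eq diff_minus_eq_add add.commute)
 note 1 = 1[folded f, unfolded *, unfolded fst_zero snd_zero minus_zero]
 have id: "x * (t * (w * p - x * u * r)) = p * (s * r + t * (x * w)) - r * (s * p + t * (x ^ 2 * u))" for x t u w s :: "complex fps"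
  by (simp add: algebra_simps power2_eq_square)
 have t: "fps_X * (T * (V * p - fps_X * U * r)) = 0" unfolding id[of fps_X T V U S] 1 by (simp only: mult_zero_right diff_0_right)
 define W where "W = V * p - fps_X * U * r"
 have "fps_nth W 0 = fps_nth V 0 * fps_nth p 0"
  unfolding W_def by (simp only: fps_sub_nth fps_mult_nth_0 fps_X_nth zero_neq_one if_False mult_zero_left diff_0_right)
 then have W: "fps_nth W 0 ~= 0" using UV(3) p(2) by (simp only: mult_eq_0_iff simp_thms)
 have ne: "F ~= 0" if "fps_nth F 0 ~= (0 :: complex)" for F using that by auto
 have T: "T = 0" using t unfolding W_def[symmetric] by (simp only: mult_eq_0_iff fps_X_neq_zero ne[OF W] simp_thms)
 have "S * p = 0" using 1(1) unfolding T by (simp only: mult_zero_left add_0_right)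
 then have S: "S = 0" by (simp only: mult_eq_0_iff ne[OF p(2)] simp_thms)
 have "P \<in> Dhat" using ST unfolding T S smp_zero diff_0_right .
 then show ?thesis by (rule subsetD[OF Khat_KK subsetD[OF Dhat_Khat]])
qed

end

section \<open>Submodules of a rank two Jordan model\<close>

text \<open>When phi has the same fibres as \<open>pj\<close>, the structure is presented by the
  image of phi, and then injectively. This is how a module of cosets becomes a concrete submodule of
  the Jordan model.\<close>

lemma abpres_transport:
 assumes M: "abpres M A sm am pj" and \<phi>: "!!x y. x \<in> A ==> y \<in> A ==> \<phi> (x + y) = \<phi> x + \<phi> y"
  and k: "!!x y. x \<in> A ==> y \<in> A ==> \<phi> x = \<phi> y \<longleftrightarrow> pj x = pj y"
  and s: "!!S x. x \<in> A ==> \<phi> (sm S x) = sm' S (\<phi> x)" and a: "!!x. x \<in> A ==> \<phi> (am x) = am' (\<phi> x)" and B: "\<phi> ` A = B"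
 obtains pj' where "abpres M B sm' am' pj'" "inj_on pj' B" "!!x. x \<in> A ==> pj' (\<phi> x) = pj x"
proof -
 define pj' where "pj' y = pj (SOME x. x \<in> A & \<phi> x = y)" for y
 have e: "pj' (\<phi> x) = pj x" if "x \<in> A" for x
 proof -
  have "(SOME z. z \<in> A & \<phi> z = \<phi> x) \<in> A & \<phi> (SOME z. z \<in> A & \<phi> z = \<phi> x) = \<phi> x" by (rule someI[of _ x]) (simp add: that)
  then show ?thesis unfolding pj'_def using k[OF _ that] by blast
 qed
 note d = presentsD[OF abpresD(1)[OF M]]
 have z: "\<phi> 0 = 0" using \<phi>[OF d(1) d(1)] by simp
 have n: "- \<phi> x = \<phi> (- x)" if "x \<in> A" for x
  using \<phi>[OF that d(3)[OF that]] z by (simp add: minus_unique)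
 have "presents M B pj'"
  unfolding presents_def B[symmetric]
 proof (intro conjI ballI)
  show "0 \<in> \<phi> ` A" using z d(1) by force
  show "carrier M = pj' ` \<phi> ` A" unfolding d(4) image_image by (rule image_cong[OF refl]) (simp add: e)
  show "\<zero>\<^bsub>M\<^esub> = pj' 0" using e[OF d(1)] by (simp add: z d(5))
  fix x y assume x: "x \<in> \<phi> ` A"
  then obtain x' where x': "x = \<phi> x'" "x' \<in> A" by blast
  show "- x \<in> \<phi> ` A" using x' n d(3) by auto
  assume "y \<in> \<phi> ` A"
  then obtain y' where y': "y = \<phi> y'" "y' \<in> A" by blast
  show "x + y \<in> \<phi> ` A" using x' y' by (auto simp flip: \<phi> intro!: imageI d(2))
  show "pj' x \<oplus>\<^bsub>M\<^esub> pj' y = pj' (x + y)"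
   using e[OF d(2)[OF x'(2) y'(2)]] \<phi>[OF x'(2) y'(2)] e[OF x'(2)] e[OF y'(2)] d(6)[OF x'(2) y'(2)] x' y' by simp
 qed
 moreover have "sm' S (\<phi> x) \<in> B & S \<odot>\<^bsub>M\<^esub> pj' (\<phi> x) = pj' (sm' S (\<phi> x))" if "x \<in> A" for S x
  using imageI[OF abpresD(2)[OF M that, of S], of \<phi>] abpresD(3)[OF M that, of S] e[OF that] e[OF abpresD(2)[OF M that, of S]] s[OF that, of S] B by auto
 moreover have "am' (\<phi> x) \<in> B & aop M (pj' (\<phi> x)) = pj' (am' (\<phi> x))" if "x \<in> A" for x
  using imageI[OF abpresD(4)[OF M that], of \<phi>] abpresD(5)[OF M that] e[OF that] e[OF abpresD(4)[OF M that]] a[OF that] B by auto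
 ultimately have "abpres M B sm' am' pj'" unfolding abpres_def B[symmetric] by blast
 moreover have "inj_on pj' B" unfolding B[symmetric] by (auto intro!: inj_onI simp: e k)
 ultimately show ?thesis using that e by blast
qed

definition nice :: "'m abmod => (jordan2) set => (jordan2 => 'm) => bool" where
 "nice M A pj \<longleftrightarrow> abpres M A sc aN pj & inj_on pj A"

lemma niceD: assumes "nice M A pj"
 shows "abpres M A sc aN pj" "inj_on pj A" "presents M A pj" "0 \<in> A" "x \<in> A ==> y \<in> A ==> x + y \<in> A" "x \<in> A ==> y \<in> A ==> x - y \<in> A"
  "carrier M = pj ` A" "\<zero>\<^bsub>M\<^esub> = pj 0" "x \<in> A ==> y \<in> A ==> pj x \<oplus>\<^bsub>M\<^esub> pj y = pj (x + y)"
  "x \<in> A ==> sc S x \<in> A" "x \<in> A ==> S \<odot>\<^bsub>M\<^esub> pj x = pj (sc S x)" "x \<in> A ==> aN x \<in> A" "x \<in> A ==> aop M (pj x) = pj (aN x)"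
  "x \<in> A ==> y \<in> A ==> pj x \<ominus>\<^bsub>M\<^esub> pj y = pj (x - y)"
proof -
 show *: "abpres M A sc aN pj" "inj_on pj A" using assms by (auto simp: nice_def)
 show p: "presents M A pj" by (rule abpresD(1)[OF *(1)])
 show "0 \<in> A" "x \<in> A ==> y \<in> A ==> x + y \<in> A" "carrier M = pj ` A" "\<zero>\<^bsub>M\<^esub> = pj 0" "x \<in> A ==> y \<in> A ==> pj x \<oplus>\<^bsub>M\<^esub> pj y = pj (x + y)"
  using presentsD[OF p] by simp_all
 show "x \<in> A ==> y \<in> A ==> x - y \<in> A" by (rule presents_diff_mem[OF p])
 show "x \<in> A ==> sc S x \<in> A" "x \<in> A ==> S \<odot>\<^bsub>M\<^esub> pj x = pj (sc S x)" "x \<in> A ==> aN x \<in> A" "x \<in> A ==> aop M (pj x) = pj (aN x)"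
  using abpresD[OF *(1)] by simp_all
 show "x \<in> A ==> y \<in> A ==> pj x \<ominus>\<^bsub>M\<^esub> pj y = pj (x - y)" by (rule presents_minus[OF p])
qed

lemma nice_sub:
 assumes "nice M A pj" "B \<subseteq> A" "0 \<in> B" "!!x y. x \<in> B ==> y \<in> B ==> x - y \<in> B" "!!S x. x \<in> B ==> sc S x \<in> B" "!!x. x \<in> B ==> aN x \<in> B"
 shows "nice (ab_sub M (pj ` B)) B pj"
 unfolding nice_def using abpres_sub[OF niceD(1)[OF assms(1)] assms(2-6)] inj_on_subset[OF niceD(2)[OF assms(1)] assms(2)] by blast

section \<open>Bases and ranks\<close>

primrec lc :: "complex fps list => (jordan2) list => jordan2" where
 "lc xs [] = 0"
| "lc xs (e # es) = sc (hd xs) e + lc (tl xs) es"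

lemma lc_sum: "length xs = length es ==> (\<Sum>i<length es. sc (xs ! i) (es ! i)) = lc xs es"
proof (induction es arbitrary: xs)
 case (Cons e es)
 then obtain c xs' where "xs = c # xs'" by (cases xs) auto
 then show ?case using Cons by (simp add: sum.lessThan_Suc_shift del: sum.lessThan_Suc)
qed simp

lemma lc_replicate: "length es = n ==> lc (replicate n 0) es = 0"
 by (induction es arbitrary: n) auto

lemma nice_basis:
 assumes M: "nice M A pj" and es: "set es \<subseteq> A"
 shows "is_basis M (map pj es) \<longleftrightarrow> (\<forall>v\<in>A. \<exists>!xs. length xs = length es & v = lc xs es)"
proof -
 have esA: "es ! i \<in> A" if "i < length es" for i by (rule subsetD[OF es nth_mem[OF that]])
 have m: "lc xs es \<in> A" if "length xs = length es" for xs
  unfolding lc_sum[OF that, symmetric] by (intro presents_sum_mem[OF niceD(3)[OF M]] niceD(10)[OF M] esA) simp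
 have f: "finsum M (%i. (xs ! i) \<odot>\<^bsub>M\<^esub> (map pj es ! i)) {..<length es} = pj (lc xs es)" if "length xs = length es" for xs
  unfolding lc_sum[OF that, symmetric]
  by (rule presents_finsum[OF niceD(3)[OF M]]) (simp_all add: esA niceD(10)[OF M] niceD(11)[OF M])
 have *: "(length xs = length es & pj v = finsum M (%i. (xs ! i) \<odot>\<^bsub>M\<^esub> (map pj es ! i)) {..<length es}) \<longleftrightarrow> length xs = length es & v = lc xs es"
  if "v \<in> A" for xs v
  using m[of xs] f[of xs] inj_on_eq_iff[OF niceD(2)[OF M] that, of "lc xs es"] by (cases "length xs = length es") simp_all
 show ?thesis unfolding is_basis_def niceD(7)[OF M] using es * by (auto simp: subset_iff)
qed

lemma basis_independent:
 assumes M: "nice M A pj" and es: "set es \<subseteq> A" and b: "is_basis M (map pj es)" and l: "length xs = length es" "lc xs es = 0"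
 shows "xs = replicate (length es) 0"
proof -
 have "\<exists>!xs. length xs = length es & 0 = lc xs es" using nice_basis[OF M es] b niceD(4)[OF M] by blast
 moreover have "length (replicate (length es) (0 :: complex fps)) = length es & 0 = lc (replicate (length es) 0) es" by (simp add: lc_replicate)
 ultimately show ?thesis using l by (metis (no_types, lifting))
qed

lemma nice_ab_module:
 assumes M: "nice M A pj" and es: "set es \<subseteq> A" and b: "!!v. v \<in> A ==> \<exists>!xs. length xs = length es & v = lc xs es"
 shows "ab_module M"
 unfolding ab_module_def
proof (intro conjI ballI allI)
 note d = niceD[OF M]
 have ex: "\<exists>v\<in>A. x = pj v" if "x \<in> carrier M" for x using that d(7) by blast
 show "Module.module fps_ring M"
 proof (rule moduleI)
  show "cring (fps_ring :: complex fps ring)" by (rule cring_from_type_algebra)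
  show "abelian_group M" by (rule presents_abelian_group[OF d(3)])
  fix a b :: "complex fps" and x assume "x \<in> carrier M"
  then obtain v where v: "v \<in> A" "x = pj v" using ex by blast
  show "a \<odot>\<^bsub>M\<^esub> x \<in> carrier M" unfolding d(7) v(2) d(11)[OF v(1)] by (rule imageI[OF d(10)[OF v(1)]])
  show "(a \<oplus>\<^bsub>fps_ring\<^esub> b) \<odot>\<^bsub>M\<^esub> x = a \<odot>\<^bsub>M\<^esub> x \<oplus>\<^bsub>M\<^esub> b \<odot>\<^bsub>M\<^esub> x"
   using v by (simp add: ring_of_type_algebra_def d sc_add_left)
  show "(a \<otimes>\<^bsub>fps_ring\<^esub> b) \<odot>\<^bsub>M\<^esub> x = a \<odot>\<^bsub>M\<^esub> (b \<odot>\<^bsub>M\<^esub> x)"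
   using v by (simp add: ring_of_type_algebra_def d sc_mult)
  show "\<one>\<^bsub>fps_ring\<^esub> \<odot>\<^bsub>M\<^esub> x = x" using v by (simp add: ring_of_type_algebra_def d)
  fix y assume "y \<in> carrier M"
  then obtain w where w: "w \<in> A" "y = pj w" using ex by blast
  show "a \<odot>\<^bsub>M\<^esub> (x \<oplus>\<^bsub>M\<^esub> y) = a \<odot>\<^bsub>M\<^esub> x \<oplus>\<^bsub>M\<^esub> a \<odot>\<^bsub>M\<^esub> y" using v w by (simp add: d sc_add)
 qed
 show "\<exists>es. is_basis M es" using nice_basis[OF M es] b by blast
 show "aop M \<in> carrier M \<rightarrow> carrier M" by (auto simp: d)
 fix x assume "x \<in> carrier M"
 then obtain v where v: "x = pj v" "v \<in> A" by (auto simp: d)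
 show "aop M (csmult M c x) = csmult M c (aop M x)" for c
 proof -
  have "aN (sc (fps_const c) v) = sc (fps_const c) (aN v)" by (simp add: aN_sc)
  then show ?thesis using v by (simp add: d csmult_def)
 qed
 have "aN (sc fps_X v) - sc fps_X (aN v) = sc fps_X (sc fps_X v)"
  by (simp add: aN_sc power2_eq_square sc_mult)
 then show "aop M (bop M x) \<ominus>\<^bsub>M\<^esub> bop M (aop M x) = bop M (bop M x)" using v by (simp add: d bop_def)
 fix y assume "y \<in> carrier M"
 then obtain w where w: "y = pj w" "w \<in> A" by (auto simp: d)
 show "aop M (x \<oplus>\<^bsub>M\<^esub> y) = aop M x \<oplus>\<^bsub>M\<^esub> aop M y" using v w by (simp add: d aN_add)
qed

definition det2 :: "jordan2 => jordan2 => complex fps" where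
 "det2 a b = fst a * snd b - snd a * fst b"

lemma rank2_basis:
 assumes A: "A = {sc S g + sc T h | S T. True}" and d: "det2 g h ~= 0" and v: "v \<in> A"
 shows "\<exists>!xs. length xs = length [g, h] & v = lc xs [g, h]"
proof -
 obtain S T where ST: "v = sc S g + sc T h" using v A by auto
 show ?thesis
 proof (rule ex1I[of _ "[S, T]"])
  fix xs assume xs: "length xs = length [g, h] & v = lc xs [g, h]"
  then obtain S' T' where c: "xs = [S', T']" by (auto simp: length_Suc_conv)
  have e: "S * fst g + T * fst h = S' * fst g + T' * fst h" "S * snd g + T * snd h = S' * snd g + T' * snd h"
   using xs ST by (simp_all add: c sc_def prod_eq_iff)
  have "(S - S') * det2 g h = ((S * fst g + T * fst h) - (S' * fst g + T' * fst h)) * snd h - ((S * snd g + T * snd h) - (S' * snd g + T' * snd h)) * fst h"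
   "(T - T') * det2 g h = ((S * snd g + T * snd h) - (S' * snd g + T' * snd h)) * fst g - ((S * fst g + T * fst h) - (S' * fst g + T' * fst h)) * snd g"
   by (simp_all add: det2_def algebra_simps)
  then show "xs = [S, T]" unfolding e using d by (simp add: c)
 qed (simp add: ST)
qed

text \<open>The rank is defined by a unique length, so every basis has to be shown to have two
  elements. At most one vector cannot span, as det(g, h) is nonzero, and three vectors are never
  independent.\<close>

lemma rank2_rank:
 assumes M: "nice M A pj" and A: "A = {sc S g + sc T h | S T. True}" and d: "det2 g h ~= 0"
 shows "ab_module M" "ab_rank M = 2"
proof -
 have g: "g \<in> A" unfolding A by (rule CollectI, rule exI[of _ 1], rule exI[of _ 0]) simp
 have h: "h \<in> A" unfolding A by (rule CollectI, rule exI[of _ 0], rule exI[of _ 1]) simp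
 have gh: "set [g, h] \<subseteq> A" using g h by simp
 note b = rank2_basis[OF A d]
 show "ab_module M" by (rule nice_ab_module[OF M gh b])
 have "length es' = 2" if es': "is_basis M es'" for es'
 proof -
  define es where "es = map (inv_into A pj) es'"
  have s: "set es' \<subseteq> pj ` A" using es' niceD(7)[OF M] by (simp add: is_basis_def)
  then have e: "es' = map pj es" "set es \<subseteq> A" unfolding es_def by (auto simp: map_idI subset_iff f_inv_into_f inv_into_into intro!: map_idI[symmetric])
  note ind = basis_independent[OF M e(2) es'[unfolded e(1)]]
  have ex: "\<exists>xs. length xs = length es & v = lc xs es" if "v \<in> A" for v using nice_basis[OF M e(2)] es'[unfolded e(1)] that by blast
  consider "es = []" | a where "es = [a]" | a b where "es = [a, b]" | a b c rest where "es = a # b # c # rest"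
   by (metis list.exhaust)
  then show ?thesis
  proof cases
   case 1
   then have "g = 0" using ex[OF g] by simp
   then show ?thesis using d by (simp add: det2_def)
  next
   case 2
   obtain S T where "g = sc S a" "h = sc T a" using ex[OF g] ex[OF h] by (auto simp: 2)
   then show ?thesis using d by (simp add: det2_def sc_def mult_ac)
  next
   case 3
   then show ?thesis by (simp add: e)
  next
   case 4
   have l: "lc ([x, y, z] @ replicate (length rest) 0) es = sc x a + sc y b + sc z c" for x y z by (simp add: 4 lc_replicate)
   have i: "x = 0 & y = 0 & z = 0" if "sc x a + sc y b + sc z c = 0" for x y z
    using ind[of "[x, y, z] @ replicate (length rest) 0"] that unfolding l by (simp add: 4)
   \<comment> \<open>Three vectors of rank two satisfy det(b, c) a - det(a, c) b + det(a, b) c = 0.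
     After all minors vanish, the entries of a and b themselves give relations between a and b,
     which force a = 0; then a has coefficient 1 in a trivial relation.\<close>
   have "det2 b c = 0 & - det2 a c = 0 & det2 a b = 0"
    by (rule i) (simp add: sc_def det2_def prod_eq_iff algebra_simps)
   then have ab: "fst a * snd b = snd a * fst b" by (simp add: det2_def)
   have "snd b = 0 & - snd a = 0 & (0 :: complex fps) = 0" by (rule i) (use ab in \<open>simp add: sc_def prod_eq_iff algebra_simps\<close>)
   moreover have "fst b = 0 & - fst a = 0 & (0 :: complex fps) = 0" by (rule i) (use ab in \<open>simp add: sc_def prod_eq_iff algebra_simps\<close>)
   ultimately have "a = 0" by (simp add: prod_eq_iff)
   then have "(1 :: complex fps) = 0 & (0 :: complex fps) = 0 & (0 :: complex fps) = 0" by (intro i) simp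
   then show ?thesis by simp
  qed
 qed
 moreover have "is_basis M (map pj [g, h])" using nice_basis[OF M gh] b by blast
 ultimately show "ab_rank M = 2" unfolding ab_rank_def by (intro the_equality) (auto intro: exI[of _ "map pj [g, h]"])
qed

lemma rank0: assumes "presents M A pj" "carrier M = {\<zero>\<^bsub>M\<^esub>}" "!!S. S \<odot>\<^bsub>M\<^esub> \<zero>\<^bsub>M\<^esub> = \<zero>\<^bsub>M\<^esub>" shows "ab_rank M = 0"
proof -
 interpret abelian_group M by (rule presents_abelian_group[OF assms(1)])
 have "es = []" if es: "is_basis M es" for es
 proof (rule ccontr)
  assume n: "es ~= []"
  have i: "es ! i = \<zero>\<^bsub>M\<^esub>" if "i < length es" for i using es assms(2) nth_mem[OF that] by (auto simp: is_basis_def)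
  have "finsum M (%i. (xs ! i) \<odot>\<^bsub>M\<^esub> (es ! i)) {..<length es} = \<zero>\<^bsub>M\<^esub>" for xs :: "complex fps list"
   using add.finprod_one_eqI[of "{..<length es}" "%i. (xs ! i) \<odot>\<^bsub>M\<^esub> (es ! i)"] i assms(3) by (simp add: finsum_def)
  moreover have "\<exists>!xs. length xs = length es & \<zero>\<^bsub>M\<^esub> = finsum M (%i. (xs ! i) \<odot>\<^bsub>M\<^esub> (es ! i)) {..<length es}"
   using es unfolding is_basis_def assms(2) by blast
  ultimately have "\<exists>!xs :: complex fps list. length xs = length es" by simp
  then have "replicate (length es) (0 :: complex fps) = replicate (length es) 1" by (metis length_replicate)
  then show False using n by (auto simp: replicate_eq_replicate)
 qed
 moreover have "is_basis M []" by (simp add: is_basis_def assms(2))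
 ultimately show ?thesis unfolding ab_rank_def by (intro the_equality) auto
qed

section \<open>The action of series in a and b\<close>

definition pop :: "(complex fps => 'a => 'a::comm_monoid_add) => ('a => 'a) => complex poly => 'a => 'a" where
 "pop sm am p v = (\<Sum>i\<le>Polynomial.degree p. sm (fps_const (Polynomial.coeff p i)) ((am ^^ i) v))"

definition part :: "(complex fps => 'a => 'a::comm_monoid_add) => ('a => 'a) => atilde => nat => 'a => 'a" where
 "part sm am u N v = (\<Sum>nu<N. pop sm am (u nu) ((sm fps_X ^^ nu) v))"

lemma abpres_poly_op:
 assumes M: "abpres M A sm am pj" and v: "v \<in> A"
 shows "poly_op M (aop M) p (pj v) = pj (pop sm am p v)" "pop sm am p v \<in> A"
proof -
 have i: "(am ^^ i) v \<in> A & (aop M ^^ i) (pj v) = pj ((am ^^ i) v)" for i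
  by (induction i) (auto simp: v abpresD[OF M])
 show "poly_op M (aop M) p (pj v) = pj (pop sm am p v)"
  unfolding poly_op_def pop_def by (rule presents_finsum[OF abpresD(1)[OF M]]) (simp_all add: i csmult_def abpresD[OF M])
 show "pop sm am p v \<in> A" unfolding pop_def by (rule presents_sum_mem[OF abpresD(1)[OF M]]) (simp add: i abpresD[OF M])
qed

text \<open>Two limits of the same partial sums differ by multiples of every b^N, which
  \<open>sep\<close> excludes. So it suffices to exhibit one \<open>y\<close> with the right
  remainders.\<close>

lemma abpres_at_act:
 assumes M: "abpres M A sm am pj" and k: "pker A pj K" and x: "x \<in> A" and y: "y \<in> A"
  and K: "!!v w. v \<in> K ==> w \<in> K ==> v - w \<in> K" and add: "!!N v w. (sm fps_X ^^ N) (v - w) = (sm fps_X ^^ N) v - (sm fps_X ^^ N) w"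
  and sep: "!!w. w \<in> A ==> (!!N. \<exists>z\<in>A. w - (sm fps_X ^^ N) z \<in> K) ==> w \<in> K"
  and sol: "!!N. \<exists>z\<in>A. y - (part sm am u N x + (sm fps_X ^^ N) z) \<in> K"
 shows "at_act M u (pj x) = pj y"
proof -
 note p = abpresD(1)[OF M]
 note b = abpres_bop_funpow[OF M]
 have pm: "part sm am u N x \<in> A" for N unfolding part_def by (rule presents_sum_mem[OF p]) (simp add: abpres_poly_op(2)[OF M] b x)
 have s: "finsum M (%nu. poly_op M (aop M) (u nu) ((bop M ^^ nu) (pj x))) {..<N} = pj (part sm am u N x)" for N
  unfolding part_def by (rule presents_finsum[OF p]) (simp_all add: abpres_poly_op[OF M] b x)
 have c: "(\<exists>z\<in>carrier M. pj w = finsum M (%nu. poly_op M (aop M) (u nu) ((bop M ^^ nu) (pj x))) {..<N} \<oplus>\<^bsub>M\<^esub> (bop M ^^ N) z)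
   \<longleftrightarrow> (\<exists>z\<in>A. w - (part sm am u N x + (sm fps_X ^^ N) z) \<in> K)" if "w \<in> A" for w N
 proof -
  have "pj w = pj (part sm am u N x) \<oplus>\<^bsub>M\<^esub> (bop M ^^ N) (pj z) \<longleftrightarrow> w - (part sm am u N x + (sm fps_X ^^ N) z) \<in> K" if "z \<in> A" for z
   using that pm[of N] presentsD(2,6)[OF p, of "part sm am u N x" "(sm fps_X ^^ N) z"] k \<open>w \<in> A\<close> b[of z N] by (simp add: pker_def)
  then show ?thesis unfolding s presentsD(4)[OF p] by auto
 qed
 show ?thesis unfolding at_act_def
 proof (rule the_equality)
  show "pj y \<in> carrier M & (\<forall>N. \<exists>z\<in>carrier M. pj y = finsum M (%nu. poly_op M (aop M) (u nu) ((bop M ^^ nu) (pj x))) {..<N} \<oplus>\<^bsub>M\<^esub> (bop M ^^ N) z)"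
   using y sol c[OF y] presentsD(4)[OF p] by blast
  fix y' assume y': "y' \<in> carrier M & (\<forall>N. \<exists>z\<in>carrier M. y' = finsum M (%nu. poly_op M (aop M) (u nu) ((bop M ^^ nu) (pj x))) {..<N} \<oplus>\<^bsub>M\<^esub> (bop M ^^ N) z)"
  then obtain w where w: "y' = pj w" "w \<in> A" using presentsD(4)[OF p] by blast
  have "w - y \<in> K"
  proof (rule sep)
   show "w - y \<in> A" by (rule presents_diff_mem[OF p w(2) y])
   fix N
   obtain z where z: "z \<in> A" "w - (part sm am u N x + (sm fps_X ^^ N) z) \<in> K" using y' w(1) c[OF w(2), of N] by blast
   obtain z' where z': "z' \<in> A" "y - (part sm am u N x + (sm fps_X ^^ N) z') \<in> K" using sol by blast
   have "w - y - (sm fps_X ^^ N) (z - z') \<in> K" using K[OF z(2) z'(2)] by (simp add: add algebra_simps)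
   then show "\<exists>z\<in>A. w - y - (sm fps_X ^^ N) z \<in> K" using presents_diff_mem[OF p z(1) z'(1)] by blast
  qed
  then show "y' = pj y" using k w y by (simp add: pker_def)
 qed
qed

lemma sc_funpow: "(sc fps_X ^^ n) v = sc (fps_X ^ n) v" by (induction n) (simp_all add: sc_mult)

lemma N2_separated: assumes "!!N. \<exists>z. w = sc (fps_X ^ N) z" shows "w = 0"
proof -
 have "fps_nth (fst w) n = 0 & fps_nth (snd w) n = 0" for n
 proof -
  obtain z where "w = sc (fps_X ^ Suc n) z" using assms by blast
  then show ?thesis by (simp add: sc_def fps_X_power_mult_nth del: power_Suc)
 qed
 then show ?thesis by (simp add: prod_eq_iff fps_eq_iff)
qed

lemma nice_at_act:
 assumes M: "nice M A pj" and "x \<in> A" "y \<in> A" "!!N. \<exists>z\<in>A. y = part sc aN u N x + sc (fps_X ^ N) z"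
 shows "at_act M u (pj x) = pj y"
proof (rule abpres_at_act[OF niceD(1)[OF M], where K = "{0}"])
 show "pker A pj {0}" using inj_on_eq_iff[OF niceD(2)[OF M]] by (simp add: pker_def)
 show "\<exists>z\<in>A. y - (part sc aN u N x + (sc fps_X ^^ N) z) \<in> {0}" for N using assms(4)[of N] by (auto simp: sc_funpow)
 show "w \<in> {0}" if h: "!!N. \<exists>z\<in>A. w - (sc fps_X ^^ N) z \<in> {0}" for w
 proof -
  have "w = 0"
  proof (rule N2_separated)
   fix N
   obtain z where "w - (sc fps_X ^^ N) z \<in> {0}" using h[of N] by blast
   then have "w = sc (fps_X ^ N) z" by (simp add: sc_funpow)
   then show "\<exists>z. w = sc (fps_X ^ N) z" by blast
  qed
  then show ?thesis by simp
 qed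
qed (use assms in \<open>simp_all add: sc_funpow sc_diff\<close>)

text \<open>The X-adically convergent sum of the series X^nu \<open>S nu\<close>.\<close>

definition fsx :: "(nat => complex fps) => complex fps" where
 "fsx S = Abs_fps (%n. \<Sum>nu\<le>n. fps_nth (S nu) (n - nu))"

lemma fsx_Suc: "fsx S = S 0 + fps_X * fsx (%nu. S (Suc nu))"
proof (rule fps_ext)
 fix n show "fps_nth (fsx S) n = fps_nth (S 0 + fps_X * fsx (%nu. S (Suc nu))) n"
  by (cases n) (simp_all add: fsx_def sum.atMost_Suc_shift del: sum.atMost_Suc)
qed

lemma fsx_split: "fsx S = (\<Sum>nu<N. fps_X ^ nu * S nu) + fps_X ^ N * fsx (%nu. S (nu + N))"
proof (induction N)
 case (Suc N)
 have "fsx (%nu. S (nu + N)) = S N + fps_X * fsx (%nu. S (nu + Suc N))" using fsx_Suc[of "%nu. S (nu + N)"] by simp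
 with Suc show ?case by (simp add: algebra_simps)
qed simp

lemma X_deriv_power: "fps_X * fps_deriv (fps_X ^ n) = (of_nat n * fps_X ^ n :: complex fps)"
proof (induction n)
 case (Suc n)
 have "fps_X * fps_deriv (fps_X ^ Suc n) = fps_X * fps_X ^ n + fps_X * (fps_X * fps_deriv (fps_X ^ n) :: complex fps)"
  by (simp add: algebra_simps)
 then show ?case unfolding Suc by (simp add: algebra_simps)
qed simp

lemma X2_deriv_power: "fps_X\<^sup>2 * fps_deriv (fps_X ^ n) = fps_X ^ n * (of_nat n * fps_X :: complex fps)"
proof -
 have "fps_X\<^sup>2 * fps_deriv (fps_X ^ n) = fps_X * (fps_X * fps_deriv (fps_X ^ n) :: complex fps)" by (simp add: power2_eq_square mult.assoc)
 then show ?thesis unfolding X_deriv_power by (simp add: mult_ac)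
qed

lemma aN_X_power: "aN (sc (fps_X ^ n) v) = sc (fps_X ^ n) (aN v + sc (of_nat n * fps_X) v)"
 by (simp add: aN_sc sc_add sc_mult X2_deriv_power)

lemma dab_X_power: "dab (fps_X ^ n * y) = fps_X ^ n * (of_nat (Suc n) * fps_X * y + fps_X\<^sup>2 * fps_deriv y)"
 unfolding dab_mult X2_deriv_power by (simp add: dab_def algebra_simps)

text \<open>A generator with leading exponents q and r in its two components. In the alternative q =
  r = 0 the constant term of \<open>v\<close> is unrestricted, since the logarithmic part of a takes
  over its role in \<open>w0_0\<close>.\<close>

locale theme2 =
 fixes q r :: nat and p v :: "complex fps"
 assumes p0: "fps_nth p 0 ~= 0" and rv: "r < q & fps_nth v 0 ~= 0 \<or> q = 0 & r = 0"
begin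

definition g0 :: "jordan2" where "g0 = (fps_X ^ q * p, fps_X ^ r * v)"
definition h0 :: "jordan2" where "h0 = (0, fps_X ^ Suc r)"
definition G :: "(jordan2) set" where "G = {sc S g0 + sc T h0 | S T. True}"
text \<open>The factor by which a multiplies X^q p. Subtracting \<open>tt\<close> times the
  generator from its image under a leaves only a second component, equal to \<open>w0\<close>
  X^(r+1).\<close>

definition tt :: "complex fps" where "tt = of_nat (Suc q) * fps_X + fps_X\<^sup>2 * fps_deriv p * inverse p"
definition w0 :: "complex fps" where
 "w0 = (of_nat r - of_nat q) * v + fps_X * fps_deriv v + fps_X ^ (q - r) * p - fps_X * fps_deriv p * inverse p * v"

lemma r_le_q: "r \<le> q" using rv by auto

text \<open>The constant term is (r - q) v(0) when r < q, and p(0) when q = r = 0. So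
  \<open>w0\<close> is a unit, and \<open>h0\<close> belongs to the module generated by
  \<open>g0\<close>.\<close>

lemma w0_0: "fps_nth w0 0 ~= 0"
 using rv
proof
 assume "r < q & fps_nth v 0 ~= 0"
 moreover then have "fps_nth (of_nat r - of_nat q :: complex fps) 0 ~= 0" by simp
 ultimately show ?thesis by (simp add: w0_def fps_X_power_mult_nth mult.assoc)
next
 assume "q = 0 & r = 0"
 then show ?thesis using p0 unfolding w0_def by (simp add: mult.assoc)
qed

lemma p_inv: "p * inverse p = 1" using p0 by (rule inverse_mult_eq_1')

lemma aN_g0: "aN g0 = sc tt g0 + sc w0 h0"
proof -
 have X: "fps_X ^ q = (fps_X ^ (q - r) * fps_X ^ r :: complex fps)" using r_le_q by (simp flip: power_add)
 have "fps_X\<^sup>2 * fps_deriv p * inverse p * (fps_X ^ q * p) = fps_X ^ q * (fps_X\<^sup>2 * fps_deriv p) * (p * inverse p)" by (simp add: mult_ac)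
 then have 1: "dab (fps_X ^ q * p) = tt * (fps_X ^ q * p)" unfolding dab_X_power tt_def p_inv by (simp add: algebra_simps)
 have 2: "dab (fps_X ^ r * v) + fps_X * (fps_X ^ q * p) = tt * (fps_X ^ r * v) + w0 * fps_X ^ Suc r"
  unfolding dab_X_power tt_def w0_def X by (simp add: algebra_simps power2_eq_square)
 show ?thesis by (simp add: aN_def sc_def g0_def h0_def prod_eq_iff 1) (use 2 in simp)
qed

lemma aN_h0: "aN h0 = sc (of_nat (r + 2) * fps_X) h0"
 using dab_X_power[of "Suc r" 1] by (simp add: aN_def sc_def h0_def dab_def algebra_simps)

lemma G_0: "0 \<in> G" unfolding G_def by (rule CollectI, rule exI[of _ 0], rule exI[of _ 0]) simp
lemma g0_G: "g0 \<in> G" unfolding G_def by (rule CollectI, rule exI[of _ 1], rule exI[of _ 0]) simp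
lemma h0_G: "h0 \<in> G" unfolding G_def by (rule CollectI, rule exI[of _ 0], rule exI[of _ 1]) simp
lemma G_add: "x \<in> G ==> y \<in> G ==> x + y \<in> G"
proof -
 assume "x \<in> G" "y \<in> G"
 then obtain S T S' T' where "x = sc S g0 + sc T h0" "y = sc S' g0 + sc T' h0" by (auto simp: G_def)
 then have "x + y = sc (S + S') g0 + sc (T + T') h0" by (simp add: sc_add_left)
 then show ?thesis unfolding G_def by blast
qed
lemma G_sc: "x \<in> G ==> sc S x \<in> G" unfolding G_def by (auto simp: sc_add) (metis sc_mult)
lemma G_diff: "x \<in> G ==> y \<in> G ==> x - y \<in> G"
 using G_add[of x "sc (-1) y"] G_sc[of y "-1"] by (simp add: sc_def prod_eq_iff minus_prod_def plus_prod_def)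
lemma G_aN: "x \<in> G ==> aN x \<in> G"
proof -
 assume "x \<in> G"
 then obtain S T where "x = sc S g0 + sc T h0" by (auto simp: G_def)
 then have "aN x = sc S (sc tt g0 + sc w0 h0) + sc (fps_X\<^sup>2 * fps_deriv S) g0 + (sc T (sc (of_nat (r + 2) * fps_X) h0) + sc (fps_X\<^sup>2 * fps_deriv T) h0)"
  by (simp only: aN_add aN_sc aN_g0 aN_h0)
 then show ?thesis by (simp only:) (intro G_add G_sc g0_G h0_G)
qed
lemma G_sum: "(!!i. i \<in> I ==> F i \<in> G) ==> sum F I \<in> G"
 by (induction I rule: infinite_finite_induct) (auto simp: G_0 G_add)

lemma det_g0_h0: "det2 g0 h0 ~= 0" using p0 by (auto simp: det2_def g0_def h0_def)

lemma pop_X_power: assumes "y \<in> G" shows "\<exists>z\<in>G. pop sc aN u (sc (fps_X ^ n) y) = sc (fps_X ^ n) z"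
proof -
 have "\<exists>z\<in>G. (aN ^^ i) (sc (fps_X ^ n) y) = sc (fps_X ^ n) z" for i
 proof (induction i)
  case (Suc i)
  then obtain z where "z \<in> G" "(aN ^^ i) (sc (fps_X ^ n) y) = sc (fps_X ^ n) z" by blast
  then show ?case by (intro bexI[of _ "aN z + sc (of_nat n * fps_X) z"]) (simp_all add: aN_X_power G_add G_aN G_sc)
 qed (use assms in auto)
 then obtain z where z: "!!i. z i \<in> G" "!!i. (aN ^^ i) (sc (fps_X ^ n) y) = sc (fps_X ^ n) (z i)" by metis
 have "(\<Sum>i\<in>I. sc (c i) (sc (fps_X ^ n) (z i))) = sc (fps_X ^ n) (\<Sum>i\<in>I. sc (c i) (z i))" for I c
  by (induction I rule: infinite_finite_induct) (auto simp: sc_add sc_mult[symmetric] mult.commute)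
 then show ?thesis unfolding pop_def z(2) by (intro bexI[of _ "\<Sum>i\<le>Polynomial.degree u. sc (fps_const (Polynomial.coeff u i)) (z i)"] G_sum G_sc z(1))
qed

lemma action_exists: "\<exists>y\<in>G. \<forall>N. \<exists>z\<in>G. y = part sc aN u N g0 + sc (fps_X ^ N) z"
proof -
 have "\<exists>S T. pop sc aN (u nu) (sc (fps_X ^ nu) g0) = sc (fps_X ^ nu) (sc S g0 + sc T h0)" for nu
 proof -
  obtain z where z: "z \<in> G" "pop sc aN (u nu) (sc (fps_X ^ nu) g0) = sc (fps_X ^ nu) z" using pop_X_power[OF g0_G] by blast
  obtain S T where "z = sc S g0 + sc T h0" using z(1) unfolding G_def by blast
  then show ?thesis using z(2) by blast
 qed
 then obtain S T where ST: "!!nu. pop sc aN (u nu) (sc (fps_X ^ nu) g0) = sc (fps_X ^ nu) (sc (S nu) g0 + sc (T nu) h0)" by metis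
 have "part sc aN u N g0 = sc (\<Sum>nu<N. fps_X ^ nu * S nu) g0 + sc (\<Sum>nu<N. fps_X ^ nu * T nu) h0" for N
  by (induction N) (simp_all add: part_def sc_funpow ST sc_add_left sc_mult sc_add add_ac)
 then have *: "sc (fsx S) g0 + sc (fsx T) h0 = part sc aN u N g0 + sc (fps_X ^ N) (sc (fsx (%nu. S (nu + N))) g0 + sc (fsx (%nu. T (nu + N))) h0)" for N
  by (subst (1 2) fsx_split[of _ N]) (simp add: sc_add_left sc_mult sc_add add_ac)
 have m: "sc S g0 + sc T h0 \<in> G" for S T by (intro G_add G_sc g0_G h0_G)
 show ?thesis
 proof (rule bexI[where x = "sc (fsx S) g0 + sc (fsx T) h0"])
  show "\<forall>N. \<exists>z\<in>G. sc (fsx S) g0 + sc (fsx T) h0 = part sc aN u N g0 + sc (fps_X ^ N) z"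
  proof
   fix N show "\<exists>z\<in>G. sc (fsx S) g0 + sc (fsx T) h0 = part sc aN u N g0 + sc (fps_X ^ N) z"
    by (rule bexI[where x = "sc (fsx (%nu. S (nu + N))) g0 + sc (fsx (%nu. T (nu + N))) h0"]) (rule *, rule m)
  qed
  show "sc (fsx S) g0 + sc (fsx T) h0 \<in> G" by (rule m)
 qed
qed

lemma pop_linear: "pop sc aN [:a, b:] y = sc (fps_const a) y + sc (fps_const b) (aN y)"
 by (cases "b = 0") (simp_all add: pop_def)

text \<open>Polynomials of degree at most one in a suffice: y = A(b) g0 + a C(b) g0, where C is
  chosen so that C w0 gives the coefficient of \<open>h0\<close> and A corrects the rest.\<close>

lemma action_surj: assumes "y \<in> G" shows "\<exists>u. \<forall>N. \<exists>z\<in>G. y = part sc aN u N g0 + sc (fps_X ^ N) z"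
proof -
 obtain S T where ST: "y = sc S g0 + sc T h0" using assms by (auto simp: G_def)
 define C where "C = T * inverse w0"
 define A where "A = S - C * tt - fps_X\<^sup>2 * fps_deriv C"
 have "C * w0 = T" using inverse_mult_eq_1[OF w0_0] by (simp add: C_def mult.assoc)
 then have y: "y = sc A g0 + aN (sc C g0)"
  unfolding ST aN_sc aN_g0 A_def sc_add sc_diff_left sc_mult[symmetric] by (simp add: algebra_simps)
 define u where "u = (%nu. [:fps_nth A nu, fps_nth C nu:])"
 have sh: "fps_shift N F = fps_const (fps_nth F N) + fps_X * fps_shift (Suc N) F" for N and F :: "complex fps"
 proof (rule fps_ext)
  fix n show "fps_nth (fps_shift N F) n = fps_nth (fps_const (fps_nth F N) + fps_X * fps_shift (Suc N) F) n" by (cases n) simp_all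
 qed
 \<comment> \<open>The remainder after N terms is the same expression in the shifted series,
   multiplied by X^N.\<close>
 have "y = part sc aN u N g0 + (sc (fps_X ^ N) (sc (fps_shift N A) g0) + aN (sc (fps_X ^ N) (sc (fps_shift N C) g0)))" for N
 proof (induction N)
  case 0
  then show ?case by (simp add: part_def y)
 next
  case (Suc N)
  have c: "sc (fps_X ^ N) (sc (fps_shift N F) g0) = sc (fps_const (fps_nth F N)) (sc (fps_X ^ N) g0) + sc (fps_X ^ Suc N) (sc (fps_shift (Suc N) F) g0)" for F
   by (subst sh) (simp add: sc_def prod_eq_iff algebra_simps)
  have "part sc aN u (Suc N) g0 = part sc aN u N g0 + (sc (fps_const (fps_nth A N)) (sc (fps_X ^ N) g0) + sc (fps_const (fps_nth C N)) (aN (sc (fps_X ^ N) g0)))"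
   by (simp add: part_def u_def pop_linear sc_funpow)
  moreover have "aN (sc (fps_const (fps_nth C N)) (sc (fps_X ^ N) g0)) = sc (fps_const (fps_nth C N)) (aN (sc (fps_X ^ N) g0))" by (simp add: aN_sc)
  ultimately show ?case using Suc.IH unfolding c aN_add by (simp add: add_ac)
 qed
 then have "y = part sc aN u N g0 + sc (fps_X ^ N) (sc (fps_shift N A) g0 + (aN (sc (fps_shift N C) g0) + sc (of_nat N * fps_X) (sc (fps_shift N C) g0)))" for N
  unfolding aN_X_power sc_add by simp
 then show ?thesis by (intro exI[of _ u] allI) (blast intro: G_add G_sc G_aN g0_G)
qed

lemma at_span_g0: assumes M: "nice M G pj" shows "at_span M (pj g0) = carrier M"
proof
 show "at_span M (pj g0) \<subseteq> carrier M"
 proof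
  fix x assume "x \<in> at_span M (pj g0)"
  then obtain u where u: "x = at_act M u (pj g0)" by (auto simp: at_span_def)
  obtain y where y: "y \<in> G" "!!N. \<exists>z\<in>G. y = part sc aN u N g0 + sc (fps_X ^ N) z" using action_exists[of u] by blast
  have "x = pj y" unfolding u by (rule nice_at_act[OF M g0_G y])
  then show "x \<in> carrier M" using y niceD(7)[OF M] by blast
 qed
 show "carrier M \<subseteq> at_span M (pj g0)"
 proof
  fix x assume "x \<in> carrier M"
  then obtain y where y: "x = pj y" "y \<in> G" using niceD(7)[OF M] by blast
  obtain u where u: "!!N. \<exists>z\<in>G. y = part sc aN u N g0 + sc (fps_X ^ N) z" using action_surj[OF y(2)] by blast
  have "at_act M u (pj g0) = pj y" by (rule nice_at_act[OF M g0_G y(2) u])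
  then show "x \<in> at_span M (pj g0)" unfolding at_span_def y(1) by (metis (mono_tags, lifting) CollectI)
 qed
qed

end

section \<open>The modules E\<close>

text \<open>A form of the Vandermonde convolution, proved by Pascal's rule. With y = nu it expresses
  that commuting b^nu past a power of a does not change the result on the generator of E_l.\<close>

lemma pochhammer_shift_sum:
 fixes x y :: complex
 shows "(\<Sum>j\<le>I. of_nat (I choose j) * (\<Prod>i<j. - y - of_nat i) * pochhammer (x + y + of_nat j) (I - j)) = pochhammer x I"
proof (induction I arbitrary: x)
 case (Suc I)
 define E where "E j = (\<Prod>i<j. - y - of_nat i)" for j
 define P where "P j m = pochhammer (x + y + of_nat j) m" for j m
 have E: "E (Suc j) = E j * (- y - of_nat j)" for j by (simp add: E_def)
 have P: "P j (Suc m) = (x + y + of_nat j) * P (Suc j) m" for j m by (simp add: P_def pochhammer_rec add_ac)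
 have IH: "(\<Sum>j\<le>I. of_nat (I choose j) * E j * P (Suc j) (I - j)) = pochhammer (x + 1) I"
  using Suc.IH[of "x + 1"] by (simp add: E_def P_def add_ac)
 have 1: "(\<Sum>j\<le>Suc I. of_nat (Suc I choose j) * E j * P j (Suc I - j)) = E 0 * P 0 (Suc I) + (\<Sum>j\<le>I. of_nat (Suc I choose Suc j) * E (Suc j) * P (Suc j) (I - j))"
  by (subst sum.atMost_Suc_shift) (simp del: binomial_Suc_Suc)
 have 2: "(\<Sum>j\<le>I. of_nat (Suc I choose Suc j) * E (Suc j) * P (Suc j) (I - j)) =
   (\<Sum>j\<le>I. of_nat (I choose j) * E (Suc j) * P (Suc j) (I - j)) + (\<Sum>j\<le>I. of_nat (I choose Suc j) * E (Suc j) * P (Suc j) (I - j))"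
  unfolding sum.distrib[symmetric] by (rule sum.cong[OF refl]) (simp add: distrib_right)
 have 3: "(\<Sum>j\<le>Suc I. of_nat (I choose j) * E j * P j (Suc I - j)) = E 0 * P 0 (Suc I) + (\<Sum>j\<le>I. of_nat (I choose Suc j) * E (Suc j) * P (Suc j) (I - j))"
  by (subst sum.atMost_Suc_shift) simp
 have 4: "(\<Sum>j\<le>Suc I. of_nat (I choose j) * E j * P j (Suc I - j)) = (\<Sum>j\<le>I. of_nat (I choose j) * E j * P j (Suc I - j))" by simp
 have 5: "(\<Sum>j\<le>I. of_nat (I choose j) * E j * P j (Suc I - j)) = (\<Sum>j\<le>I. of_nat (I choose j) * E j * ((x + y + of_nat j) * P (Suc j) (I - j)))"
  by (rule sum.cong) (auto simp: Suc_diff_le P)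
 have "(\<Sum>j\<le>Suc I. of_nat (Suc I choose j) * E j * P j (Suc I - j)) = (\<Sum>j\<le>I. of_nat (I choose j) * E (Suc j) * P (Suc j) (I - j))
   + (\<Sum>j\<le>I. of_nat (I choose j) * E j * ((x + y + of_nat j) * P (Suc j) (I - j)))"
  unfolding 1 2 5[symmetric] 4[symmetric] 3 by (simp only: add_ac)
 also have "\<dots> = (\<Sum>j\<le>I. x * (of_nat (I choose j) * E j * P (Suc j) (I - j)))"
  unfolding sum.distrib[symmetric] by (rule sum.cong[OF refl]) (simp add: E algebra_simps)
 also have "\<dots> = pochhammer x (Suc I)" unfolding sum_distrib_left[symmetric] IH by (simp add: pochhammer_rec)
 finally show ?case by (simp only: E_def P_def)
qed simp

lemma gchoose_pochhammer:
 fixes y :: complex assumes "j \<le> I"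
 shows "((- y) gchoose j) * pochhammer (of_nat (Suc (I - j))) j = of_nat (I choose j) * (\<Prod>i<j. - y - of_nat i)"
proof -
 have f: "fact (n + j) = (fact n * pochhammer (of_nat (Suc n)) j :: complex)" for n j by (induction j) (simp_all add: pochhammer_Suc algebra_simps)
 have "fact I = (fact (I - j) * pochhammer (of_nat (Suc (I - j))) j :: complex)" using f[of "I - j" j] assms by simp
 then have p: "pochhammer (of_nat (Suc (I - j))) j = (fact I / fact (I - j) :: complex)" by (simp add: field_simps)
 have g: "(- y) gchoose j = (\<Prod>i<j. - y - of_nat i) / fact j" by (simp add: gbinomial_prod_rev atLeast0LessThan)
 show ?thesis unfolding p g binomial_fact[OF assms] by (simp add: field_simps)
qed

lemma coeff_pderiv_funpow: "Polynomial.coeff ((pderiv ^^ j) p) i = pochhammer (of_nat (Suc i)) j * Polynomial.coeff p (i + j)" for p :: "complex poly"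
proof (induction j arbitrary: i)
 case (Suc j)
 have "Polynomial.coeff ((pderiv ^^ Suc j) p) i = of_nat (Suc i) * (pochhammer (of_nat (Suc (Suc i))) j * Polynomial.coeff p (Suc i + j))"
  by (simp add: coeff_pderiv Suc del: of_nat_Suc)
 also have "\<dots> = pochhammer (of_nat (Suc i)) (Suc j) * Polynomial.coeff p (i + Suc j)"
  by (simp add: pochhammer_rec add_ac)
 finally show ?case .
qed simp

text \<open>The value of a series on 1 in C[[b]] when a b^n = (n + l) b^(n+1): the monomial a^m b^n
  gives (n + l) ... (n + l + m - 1) b^(n+m).\<close>

definition rho :: "complex => atilde => complex fps" where
 "rho l u = Abs_fps (%k. \<Sum>n\<le>k. Polynomial.coeff (u n) (k - n) * pochhammer (of_nat n + l) (k - n))"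

definition dabl :: "complex => complex fps => complex fps" where "dabl l y = fps_X\<^sup>2 * fps_deriv y + fps_const l * (fps_X * y)"

lemma dabl_nth: "fps_nth (dabl l y) k = (if k = 0 then 0 else (of_nat (k - 1) + l) * fps_nth y (k - 1))"
proof (cases k)
 case (Suc m)
 then show ?thesis by (cases m) (simp_all add: dabl_def power2_eq_square mult.assoc algebra_simps)
qed (simp add: dabl_def power2_eq_square)

lemma dabl_one: "dabl 1 y = dab y" by (simp add: dabl_def dab_def)

lemma rho_add: "rho l (%n. u n + v n) = rho l u + rho l v" and rho_diff: "rho l (%n. u n - v n) = rho l u - rho l v"
 by (simp_all add: rho_def fps_eq_iff sum.distrib sum_subtractf distrib_right left_diff_distrib)

lemma rho_fps: "rho l (at_fps S) = S"
proof (rule fps_ext)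
 fix k
 have "fps_nth (rho l (at_fps S)) k = (\<Sum>n\<le>k. if n = k then fps_nth S k else 0)"
  unfolding rho_def fps_nth_Abs_fps at_fps_def
 proof (rule sum.cong[OF refl])
  fix n assume n: "n \<in> {..k}"
  show "Polynomial.coeff [:fps_nth S n:] (k - n) * pochhammer (of_nat n + l) (k - n) = (if n = k then fps_nth S k else 0)"
  proof (cases "n = k")
   case False
   then obtain m where "k - n = Suc m" using n by (cases "k - n") auto
   then show ?thesis using False by simp
  qed simp
 qed
 then show "fps_nth (rho l (at_fps S)) k = fps_nth S k" by simp
qed

lemma at_mult_a: "at_mult at_a u n = [:0, 1:] * u n"
proof -
 have "at_mult at_a u n = (\<Sum>nu\<le>n. if nu = 0 then (\<Sum>j\<le>n. Polynomial.smult (0 gchoose j) ([:0, 1:] * (pderiv ^^ j) (u (n - j)))) else 0)"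
  unfolding at_mult_def by (rule sum.cong) (auto simp: at_a_def)
 also have "\<dots> = (\<Sum>j\<le>n. Polynomial.smult (0 gchoose j) ([:0, 1:] * (pderiv ^^ j) (u (n - j))))" by simp
 also have "\<dots> = (\<Sum>j\<le>n. if j = 0 then [:0, 1:] * u n else 0)"
  by (rule sum.cong) (auto simp: gbinomial_0 gr0_conv_Suc)
 also have "\<dots> = [:0, 1:] * u n" by simp
 finally show ?thesis .
qed

text \<open>The right factor has degree one in a and in b, so only two values of nu survive. Besides
  -l, the coefficient contains -(n - 1), which comes from the derivative of a.\<close>

lemma at_mult_right_gen:
 "at_mult u (%n. at_a n - Polynomial.smult l (at_b n)) n = [:0, 1:] * u n - (if n = 0 then 0 else Polynomial.smult (of_nat (n - 1) + l) (u (n - 1)))"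
proof -
 define v where "v = (%n. at_a n - Polynomial.smult l (at_b n))"
 have v: "v 0 = [:0, 1:]" "v (Suc 0) = [:- l:]" by (simp_all add: v_def at_a_def at_b_def one_pCons)
 have v2: "v i = 0" if "i \<ge> 2" for i using that by (simp add: v_def at_a_def at_b_def)
 have d0: "(pderiv ^^ j) (0 :: complex poly) = 0" for j by (induction j) auto
 have D: "(pderiv ^^ j) (v i) = 0" if "i + j \<ge> 2" for i j
 proof (cases "i \<ge> 2")
  case True
  then show ?thesis by (simp add: v2 d0)
 next
  case False
  show ?thesis
  proof (cases "i = 0")
   case True
   then obtain k where "j = Suc (Suc k)" using \<open>i + j \<ge> 2\<close> by (cases j; cases "j - 1") auto
   then show ?thesis using True by (simp add: v funpow_Suc_right pderiv_pCons d0 del: funpow.simps)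
  next
   case i: False
   then obtain k where "j = Suc k" "i = Suc 0" using \<open>i + j \<ge> 2\<close> False by (cases j) auto
   then show ?thesis by (simp add: v funpow_Suc_right pderiv_pCons d0 del: funpow.simps)
  qed
 qed
 define f where "f nu = (\<Sum>j\<le>n - nu. Polynomial.smult ((- of_nat nu) gchoose j) (u nu * (pderiv ^^ j) (v (n - nu - j))))" for nu
 have f0: "f nu = 0" if "nu + 2 \<le> n" for nu
  unfolding f_def
 proof (rule sum.neutral, intro ballI)
  fix j assume "j \<in> {..n - nu}"
  then have "(pderiv ^^ j) (v (n - nu - j)) = 0" using that by (intro D) auto
  then show "Polynomial.smult ((- of_nat nu) gchoose j) (u nu * (pderiv ^^ j) (v (n - nu - j))) = 0" by simp
 qed
 have m: "at_mult u v n = (\<Sum>nu\<le>n. f nu)" by (simp add: at_mult_def f_def)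
 show ?thesis
 proof (cases n)
  case 0
  then show ?thesis unfolding v_def[symmetric] m by (simp add: f_def v)
 next
  case (Suc k)
  have "(\<Sum>nu\<le>k. f nu) = (\<Sum>nu\<le>k. if nu = k then f k else 0)" by (rule sum.cong) (auto simp: f0 Suc)
  then have "at_mult u v n = f k + f (Suc k)" using m unfolding Suc by simp
  moreover have "f (Suc k) = [:0, 1:] * u (Suc k)" by (simp add: f_def Suc v)
  moreover have "f k = - Polynomial.smult (of_nat k + l) (u k)" by (simp add: f_def Suc v smult_add_left pderiv_pCons)
  ultimately show ?thesis unfolding v_def[symmetric] by (simp add: Suc)
 qed
qed

lemma rho_gen: "rho l (at_mult u (%n. at_a n - Polynomial.smult l (at_b n))) = 0"
proof (rule fps_ext)
 fix k
 have e: "fps_nth (rho l (at_mult u (%n. at_a n - Polynomial.smult l (at_b n)))) k =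
  (\<Sum>n\<le>k. Polynomial.coeff (pCons 0 (u n)) (k - n) * pochhammer (of_nat n + l) (k - n))
  - (\<Sum>n\<le>k. Polynomial.coeff (if n = 0 then 0 else Polynomial.smult (of_nat (n - 1) + l) (u (n - 1))) (k - n) * pochhammer (of_nat n + l) (k - n))"
  unfolding rho_def fps_nth_Abs_fps sum_subtractf[symmetric] by (rule sum.cong[OF refl]) (simp add: at_mult_right_gen left_diff_distrib)
 show "fps_nth (rho l (at_mult u (%n. at_a n - Polynomial.smult l (at_b n)))) k = fps_nth 0 k"
 proof (cases k)
  case 0
  then show ?thesis unfolding e by simp
 next
  case (Suc m)
  have "(\<Sum>n\<le>m. Polynomial.coeff (pCons 0 (u n)) (Suc m - n) * pochhammer (of_nat n + l) (Suc m - n))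
   = (\<Sum>n\<le>m. Polynomial.coeff (u n) (m - n) * ((of_nat n + l) * pochhammer (of_nat n + l + 1) (m - n)))"
   by (rule sum.cong) (auto simp: Suc_diff_le pochhammer_rec)
  then have 1: "(\<Sum>n\<le>Suc m. Polynomial.coeff (pCons 0 (u n)) (Suc m - n) * pochhammer (of_nat n + l) (Suc m - n))
   = (\<Sum>n\<le>m. Polynomial.coeff (u n) (m - n) * ((of_nat n + l) * pochhammer (of_nat n + l + 1) (m - n)))" by simp
  have "(\<Sum>n\<le>Suc m. Polynomial.coeff (if n = 0 then 0 else Polynomial.smult (of_nat (n - 1) + l) (u (n - 1))) (Suc m - n) * pochhammer (of_nat n + l) (Suc m - n))
   = (\<Sum>n\<le>m. (of_nat n + l) * Polynomial.coeff (u n) (m - n) * pochhammer (of_nat (Suc n) + l) (m - n))"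
   by (subst sum.atMost_Suc_shift) simp
  also have "\<dots> = (\<Sum>n\<le>m. Polynomial.coeff (u n) (m - n) * ((of_nat n + l) * pochhammer (of_nat n + l + 1) (m - n)))"
   by (rule sum.cong[OF refl]) (simp add: add_ac mult_ac)
  finally have 2: "(\<Sum>n\<le>Suc m. Polynomial.coeff (if n = 0 then 0 else Polynomial.smult (of_nat (n - 1) + l) (u (n - 1))) (Suc m - n) * pochhammer (of_nat n + l) (Suc m - n))
   = (\<Sum>n\<le>m. Polynomial.coeff (u n) (m - n) * ((of_nat n + l) * pochhammer (of_nat n + l + 1) (m - n)))" .
  show ?thesis using e unfolding Suc 1 2 by simp
 qed
qed

lemma rho_a: "rho l (at_mult at_a u) = dabl l (rho l u)"
proof (rule fps_ext)
 fix k
 show "fps_nth (rho l (at_mult at_a u)) k = fps_nth (dabl l (rho l u)) k"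
 proof (cases k)
  case 0
  then show ?thesis by (simp add: rho_def at_mult_a dabl_nth)
 next
  case (Suc m)
  have "(\<Sum>n\<le>m. Polynomial.coeff (pCons 0 (u n)) (Suc m - n) * pochhammer (of_nat n + l) (Suc m - n))
   = (\<Sum>n\<le>m. (of_nat m + l) * (Polynomial.coeff (u n) (m - n) * pochhammer (of_nat n + l) (m - n)))"
   by (rule sum.cong) (auto simp: Suc_diff_le pochhammer_Suc of_nat_diff)
  then have "(\<Sum>n\<le>Suc m. Polynomial.coeff (pCons 0 (u n)) (Suc m - n) * pochhammer (of_nat n + l) (Suc m - n))
   = (of_nat m + l) * (\<Sum>n\<le>m. Polynomial.coeff (u n) (m - n) * pochhammer (of_nat n + l) (m - n))" by (simp add: sum_distrib_left)
  then show ?thesis unfolding Suc by (simp add: rho_def at_mult_a dabl_nth)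
 qed
qed

lemma sum_triangle: "(\<Sum>n\<le>k. \<Sum>i\<le>n. h i (n - i)) = (\<Sum>i\<le>k. \<Sum>j\<le>k - i. h i j)" for h :: "nat => nat => complex"
proof -
 have "{(i, j). i + j \<le> k} = Sigma {..k} (%i. {..k - i})" by auto
 then show ?thesis unfolding sum.triangle_reindex_eq[symmetric] by (simp add: sum.Sigma)
qed

lemma sum_triangle_swap: "(\<Sum>j\<le>k. \<Sum>m\<le>k - j. g j m) = (\<Sum>m\<le>k. \<Sum>j\<le>k - m. g j m)" for g :: "nat => nat => complex"
proof -
 have "(\<Sum>p\<in>Sigma {..k} (%j. {..k - j}). g (fst p) (snd p)) = (\<Sum>p\<in>Sigma {..k} (%m. {..k - m}). g (snd p) (fst p))"
  by (rule sum.reindex_bij_witness[where i = "%p. (snd p, fst p)" and j = "%p. (snd p, fst p)"]) auto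
 then show ?thesis by (simp add: sum.Sigma case_prod_beta)
qed

text \<open>The triple sum is rearranged so that the sum over j, the number of derivatives in the
  product formula, is innermost; there \<open>pochhammer_shift_sum\<close> evaluates it.\<close>

lemma rho_smult: "rho l (at_mult (at_fps S) u) = S * rho l u"
proof (rule fps_ext)
 fix k
 define g where "g nu j m = fps_nth S nu * (((- of_nat nu) gchoose j) * Polynomial.coeff ((pderiv ^^ j) (u m)) (k - nu - m - j)
   * pochhammer (of_nat (nu + m + j) + l) (k - nu - m - j))" for nu j m :: nat
 have "fps_nth (rho l (at_mult (at_fps S) u)) k = (\<Sum>n\<le>k. \<Sum>nu\<le>n. \<Sum>j\<le>n - nu. g nu j (n - nu - j))"
  unfolding rho_def fps_nth_Abs_fps at_mult_def coeff_sum sum_distrib_right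
 proof (intro sum.cong refl)
  fix n nu j assume "n \<in> {..k}" "nu \<in> {..n}" "j \<in> {..n - nu}"
  then have e: "k - nu - (n - nu - j) - j = k - n" "nu + (n - nu - j) + j = n" by auto
  show "Polynomial.coeff (Polynomial.smult ((- of_nat nu) gchoose j) (at_fps S nu * (pderiv ^^ j) (u (n - nu - j)))) (k - n) * pochhammer (of_nat n + l) (k - n)
    = g nu j (n - nu - j)"
   unfolding g_def e by (simp add: at_fps_def mult_ac)
 qed
 also have "\<dots> = (\<Sum>nu\<le>k. \<Sum>N\<le>k - nu. \<Sum>j\<le>N. g nu j (N - j))" by (rule sum_triangle[where h = "%nu N. \<Sum>j\<le>N. g nu j (N - j)"])
 also have "\<dots> = (\<Sum>nu\<le>k. \<Sum>m\<le>k - nu. \<Sum>j\<le>k - nu - m. g nu j m)"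
 proof (rule sum.cong[OF refl])
  fix nu
  have "(\<Sum>N\<le>k - nu. \<Sum>j\<le>N. g nu j (N - j)) = (\<Sum>i\<le>k - nu. \<Sum>j\<le>k - nu - i. g nu i j)" by (rule sum_triangle)
  also have "\<dots> = (\<Sum>m\<le>k - nu. \<Sum>j\<le>k - nu - m. g nu j m)" by (rule sum_triangle_swap)
  finally show "(\<Sum>N\<le>k - nu. \<Sum>j\<le>N. g nu j (N - j)) = (\<Sum>m\<le>k - nu. \<Sum>j\<le>k - nu - m. g nu j m)" .
 qed
 also have "\<dots> = (\<Sum>nu\<le>k. \<Sum>m\<le>k - nu. fps_nth S nu * (Polynomial.coeff (u m) (k - nu - m) * pochhammer (of_nat m + l) (k - nu - m)))"
 proof (intro sum.cong refl)
  fix nu m :: nat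
  define I where "I = k - nu - m"
  have "(\<Sum>j\<le>I. g nu j m) = (\<Sum>j\<le>I. fps_nth S nu * Polynomial.coeff (u m) I * (of_nat (I choose j) * (\<Prod>i<j. - of_nat nu - of_nat i)
    * pochhammer (of_nat m + l + of_nat nu + of_nat j) (I - j)))"
  proof (rule sum.cong[OF refl])
   fix j assume "j \<in> {..I}"
   then have j: "j \<le> I" by simp
   have a: "of_nat (nu + m + j) + l = of_nat m + l + of_nat nu + of_nat j" by simp
   have "g nu j m = fps_nth S nu * Polynomial.coeff (u m) I * (((- of_nat nu) gchoose j) * pochhammer (of_nat (Suc (I - j))) j
     * pochhammer (of_nat m + l + of_nat nu + of_nat j) (I - j))"
    unfolding g_def I_def[symmetric] coeff_pderiv_funpow a using j by (simp add: mult_ac del: of_nat_Suc)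
   then show "g nu j m = fps_nth S nu * Polynomial.coeff (u m) I * (of_nat (I choose j) * (\<Prod>i<j. - of_nat nu - of_nat i)
     * pochhammer (of_nat m + l + of_nat nu + of_nat j) (I - j))"
    unfolding gchoose_pochhammer[OF j] .
  qed
  also have "\<dots> = fps_nth S nu * Polynomial.coeff (u m) I * pochhammer (of_nat m + l) I"
   unfolding sum_distrib_left[symmetric] pochhammer_shift_sum ..
  finally show "(\<Sum>j\<le>k - nu - m. g nu j m) = fps_nth S nu * (Polynomial.coeff (u m) (k - nu - m) * pochhammer (of_nat m + l) (k - nu - m))"
   by (simp add: I_def mult.assoc)
 qed
 also have "\<dots> = fps_nth (S * rho l u) k"
  by (simp add: rho_def fps_mult_nth sum_distrib_left atLeast0AtMost)
 finally show "fps_nth (rho l (at_mult (at_fps S) u)) k = fps_nth (S * rho l u) k" .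
qed

text \<open>Right division by a - l b, built up from the lowest power of b, leaves a remainder in
  C[[b]]. Since \<open>rho\<close> kills multiples of a - l b and is the identity on C[[b]], the
  remainder is \<open>rho l u\<close>.\<close>

lemma rho_kernel: assumes "rho l u = 0" shows "\<exists>v. u = at_mult v (%n. at_a n - Polynomial.smult l (at_b n))"
proof -
 define v where "v = rec_nat (poly_shift 1 (u 0)) (%n w. poly_shift 1 (u (Suc n) + Polynomial.smult (of_nat n + l) w))"
 define c where "c n = (if n = 0 then 0 else Polynomial.smult (of_nat (n - 1) + l) (v (n - 1)))" for n
 define s where "s n = Polynomial.coeff (u n + c n) 0" for n
 have sh: "[:0, 1:] * poly_shift 1 p + [:Polynomial.coeff p 0:] = p" for p :: "complex poly"
  by (rule poly_eqI) (simp add: coeff_pCons coeff_poly_shift split: nat.split)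
 have v: "v n = poly_shift 1 (u n + c n)" for n by (cases n) (simp_all add: v_def c_def)
 have "u n = at_mult v (%n. at_a n - Polynomial.smult l (at_b n)) n + at_fps (Abs_fps s) n" for n
 proof -
  have "u n + c n = [:0, 1:] * v n + [:s n:]" using sh[of "u n + c n"] unfolding v[symmetric] s_def[symmetric] by (rule sym)
  then have "u n = [:0, 1:] * v n - c n + [:s n:]" by (simp only: eq_diff_eq diff_add_eq)
  then show ?thesis unfolding at_mult_right_gen c_def at_fps_def by simp
 qed
 then have u: "u = (%n. at_mult v (%n. at_a n - Polynomial.smult l (at_b n)) n + at_fps (Abs_fps s) n)" by (rule ext)
 have "rho l u = Abs_fps s" by (subst u) (simp add: rho_add rho_gen rho_fps)
 then have "Abs_fps s = 0" using assms by simp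
 then have "u = at_mult v (%n. at_a n - Polynomial.smult l (at_b n))" by (subst u) (simp add: at_fps_def)
 then show ?thesis by blast
qed

text \<open>By \<open>rho\<close>, the quotient defining E_l is C[[b]] with a acting as
  \<open>dabl l\<close>. Series in a and b are represented in \<open>complex poly fps\<close>, whose
  addition is that of \<open>at_module\<close>.\<close>

lemma E_mod_presentation:
 obtains pj where "abpres (E_mod l) UNIV (*) (dabl l) pj" "inj pj"
proof -
 define sm where "sm S P = Abs_fps (at_mult (at_fps S) (fps_nth P))" for S and P :: "complex poly fps"
 define am where "am P = Abs_fps (at_mult at_a (fps_nth P))" for P :: "complex poly fps"
 define I where "I = {at_mult u (%n. at_a n - Polynomial.smult l (at_b n)) | u. True}"
 define B where "B = {P :: complex poly fps. rho l (fps_nth P) = 0}"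
 have nth: "fps_nth (Abs_fps x) = x" for x :: "nat => complex poly" by (simp add: fun_eq_iff)
 have r: "rho l (fps_nth (x - y)) = rho l (fps_nth x) - rho l (fps_nth y)" "rho l (fps_nth (x + y)) = rho l (fps_nth x) + rho l (fps_nth y)" for x y
  using rho_diff[of l "fps_nth x" "fps_nth y"] rho_add[of l "fps_nth x" "fps_nth y"] by (simp_all add: fps_sub_nth[abs_def] fps_add_nth[abs_def])
 have r0: "rho l (fps_nth 0) = 0" using r(1)[of 0 0] by simp
 have su: "u \<in> range fps_nth" for u :: atilde by (rule image_eqI[where x = "Abs_fps u"]) (simp_all add: nth)
 have M: "abpres at_module UNIV sm am fps_nth"
  unfolding abpres_def presents_def
 proof (intro conjI ballI allI)
  show "carrier at_module = range fps_nth" using su by (auto simp: at_module_def)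
 qed (auto simp: at_module_def sm_def am_def nth fun_eq_iff)
 have k: "pker UNIV (fps_nth :: complex poly fps => _) {0}" by (auto simp: pker_def fps_nth_inject)
 have N: "I = fps_nth ` B"
 proof
  show "I \<subseteq> fps_nth ` B"
  proof
   fix x assume "x \<in> I"
   then have "rho l x = 0" using rho_gen unfolding I_def by blast
   then show "x \<in> fps_nth ` B" by (intro image_eqI[where x = "Abs_fps x"]) (simp_all add: nth B_def)
  qed
  show "fps_nth ` B \<subseteq> I" using rho_kernel unfolding B_def I_def by blast
 qed
 have s: "rho l (fps_nth (sm S x)) = S * rho l (fps_nth x)" "rho l (fps_nth (am x)) = dabl l (rho l (fps_nth x))" for S x
  by (simp_all add: sm_def am_def nth rho_smult rho_a)
 have h1: "{0} \<subseteq> B" "B \<subseteq> UNIV" "0 \<in> B" by (auto simp: B_def r0)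
 have h2: "x - y \<in> B" if "x \<in> B" "y \<in> B" for x y using that by (simp add: B_def r)
 have h3: "sm S x - sm S y \<in> B" if "x \<in> UNIV" "y \<in> UNIV" "x - y \<in> B" for S x y using that by (simp add: B_def r s)
 have h4: "am x - am y \<in> B" if "x \<in> UNIV" "y \<in> UNIV" "x - y \<in> B" for x y using that by (simp add: B_def r s)
 note q = abpres_quotient[OF M k h1 h2 h3 h4 N]
 have qE: "abpres (E_mod l) UNIV sm am (%x. I +>\<^bsub>at_module\<^esub> fps_nth x)" unfolding E_mod_def I_def[symmetric] by (rule q(1))
 have a1: "rho l (fps_nth x) = rho l (fps_nth y) \<longleftrightarrow> I +>\<^bsub>at_module\<^esub> fps_nth x = I +>\<^bsub>at_module\<^esub> fps_nth y" for x y
  using q(2) by (simp add: pker_def B_def r)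
 have a2: "range (%x. rho l (fps_nth x)) = UNIV"
 proof -
  have "S \<in> range (%x. rho l (fps_nth x))" for S by (rule image_eqI[where x = "Abs_fps (at_fps S)"]) (simp_all add: nth rho_fps)
  then show ?thesis by blast
 qed
 show ?thesis by (rule abpres_transport[OF qE r(2) a1 s a2]) (rule that)
qed

section \<open>Embedding into asymptotic expansions\<close>

definition harm_sum :: "nat => complex" where "harm_sum k = (\<Sum>i<k. 1 / (1 + of_nat i))"

text \<open>From b^k 1 = s^k / k! and b^k Log s = (s^k / k!)(Log s - H_k) with H_k = 1 + 1/2 + ... +
  1/k. Index 1 holds the coefficient of Log s, index 0 the part without logarithm, and alpha = 1
  makes s^(alpha - 1) trivial.\<close>

definition kap :: "jordan2 => nat => complex fps" where
 "kap v j = Abs_fps (%k. if j = 1 then fps_nth (fst v) k / fact k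
  else if j = 0 then (fps_nth (snd v) k - harm_sum k * fps_nth (fst v) k) / fact k else 0)"

lemma harm_sum_Suc: "harm_sum (Suc m) = harm_sum m + 1 / (1 + of_nat m)" by (simp add: harm_sum_def)

lemma one_plus_nat: "(1 + of_nat m :: complex) ~= 0" by (metis of_nat_Suc of_nat_neq_0)

lemma log_identities:
 fixes a F R H P :: complex
 assumes "a ~= 0" "F ~= 0"
 shows "(R - H * P) / F / a - P / F / a ^ 2 = (R - (H + 1 / a) * P) / (a * F)"
  "(a * R + P - (H + 1 / a) * (a * P)) / (a * F) = (R - H * P) / F" "(a * P) / (a * F) = P / F"
proof -
 show "(R - H * P) / F / a - P / F / a ^ 2 = (R - (H + 1 / a) * P) / (a * F)"
  by (simp add: diff_divide_distrib add_divide_distrib distrib_right distrib_left power2_eq_square mult_ac)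
 have "1 / a * a = 1" using assms(1) by simp
 moreover have "(H + 1 / a) * (a * P) = H * (a * P) + (1 / a * a) * P" by (simp only: distrib_right mult.assoc)
 ultimately have "a * R + P - (H + 1 / a) * (a * P) = a * (R - H * P)" by (simp add: algebra_simps)
 then show "(a * R + P - (H + 1 / a) * (a * P)) / (a * F) = (R - H * P) / F" using assms(1) by simp
 show "(a * P) / (a * F) = P / F" using assms(1) by simp
qed

lemma fact_Suc_plus: "fact (Suc m) = (1 + of_nat m) * (fact m :: complex)" by simp

lemma kap_nth: "fps_nth (kap v 0) k = (fps_nth (snd v) k - harm_sum k * fps_nth (fst v) k) / fact k" "fps_nth (kap v 1) k = fps_nth (fst v) k / fact k"
 by (simp_all add: kap_def)

lemma kap_X: "kap (sc fps_X v) = xi_b 1 1 (kap v)"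
proof (rule ext, rule fps_ext)
 fix j k
 show "fps_nth (kap (sc fps_X v) j) k = fps_nth (xi_b 1 1 (kap v) j) k"
 proof (cases k)
  case 0
  then show ?thesis by (simp add: kap_def xi_b_def sc_def)
 next
  case (Suc m)
  have "j = 0 \<or> j = 1 \<or> j > 1" by auto
  then show ?thesis
  proof (elim disjE)
   assume 1: "j = 0"
   have "fps_nth (xi_b 1 1 (kap v) j) k = (\<Sum>l=0..1. (- 1) ^ l * (fact l / fact 0) / (1 + of_nat m) ^ (l + 1) * fps_nth (kap v l) m)"
    unfolding 1 Suc xi_b_def by simp
   also have "\<dots> = fps_nth (kap v 0) m / (1 + of_nat m) - fps_nth (kap v 1) m / (1 + of_nat m) ^ 2"
    by (simp add: power2_eq_square)
   also have "\<dots> = fps_nth (kap (sc fps_X v) j) k"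
    unfolding 1 Suc kap_nth harm_sum_Suc fact_Suc_plus log_identities(1)[OF one_plus_nat fact_nonzero] by (simp add: sc_def)
   finally show ?thesis ..
  next
   assume "j = 1"
   then show ?thesis using one_plus_nat[of m] by (simp add: Suc kap_def sc_def xi_b_def field_simps)
  next
   assume "j > 1"
   then show ?thesis by (simp add: Suc kap_def xi_b_def)
  qed
 qed
qed

lemma kap_a: "kap (aN v) j = fps_X * kap v j"
proof (rule fps_ext)
 fix k
 show "fps_nth (kap (aN v) j) k = fps_nth (fps_X * kap v j) k"
 proof (cases k)
  case 0
  then show ?thesis by (simp add: kap_def aN_def dab_nth)
 next
  case (Suc m)
  have "j = 0 \<or> j = 1 \<or> j > 1" by auto
  then show ?thesis
  proof (elim disjE)
   assume j: "j = 0"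
   have 1: "fps_nth (snd (aN v)) (Suc m) = (1 + of_nat m) * fps_nth (snd v) m + fps_nth (fst v) m" "fps_nth (fst (aN v)) (Suc m) = (1 + of_nat m) * fps_nth (fst v) m"
    by (simp_all add: aN_def dab_nth)
   have "fps_nth (kap (aN v) 0) (Suc m) = fps_nth (kap v 0) m"
    unfolding kap_nth harm_sum_Suc fact_Suc_plus 1 by (rule log_identities(2)[OF one_plus_nat fact_nonzero])
   then show ?thesis by (simp add: j Suc)
  next
   assume j: "j = 1"
   have 1: "fps_nth (fst (aN v)) (Suc m) = (1 + of_nat m) * fps_nth (fst v) m" by (simp add: aN_def dab_nth)
   have "fps_nth (kap (aN v) 1) (Suc m) = fps_nth (kap v 1) m"
    unfolding kap_nth fact_Suc_plus 1 by (rule log_identities(3)[OF one_plus_nat fact_nonzero])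
   then show ?thesis by (simp add: j Suc)
  next
   assume "j > 1"
   then show ?thesis by (simp add: kap_def Suc)
  qed
 qed
qed

lemma kap_add: "kap (v + w) j = kap v j + kap w j"
 by (simp add: kap_def fps_eq_iff add_divide_distrib diff_divide_distrib algebra_simps)

lemma kap_sc: "kap (sc S v) = (%j. Abs_fps (%m. \<Sum>n\<le>m. fps_nth S n * fps_nth ((xi_b 1 1 ^^ n) (kap v) j) m))"
proof (rule ext, rule fps_ext)
 fix j m
 have x: "(xi_b 1 1 ^^ n) (kap v) = kap (sc (fps_X ^ n) v)" for n
  by (induction n) (simp_all add: kap_X sc_mult)
 have t: "fps_nth (kap (sc (fps_X ^ n) v) j) m = (if j = 1 then fps_nth (fst v) (m - n) / fact m
   else if j = 0 then (fps_nth (snd v) (m - n) - harm_sum m * fps_nth (fst v) (m - n)) / fact m else 0)" if "n \<le> m" for n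
  using that by (simp add: kap_def sc_def fps_X_power_mult_nth)
 have "(\<Sum>n\<le>m. fps_nth S n * fps_nth (kap (sc (fps_X ^ n) v) j) m) = (\<Sum>n\<le>m. fps_nth S n * (if j = 1 then fps_nth (fst v) (m - n) / fact m
   else if j = 0 then (fps_nth (snd v) (m - n) - harm_sum m * fps_nth (fst v) (m - n)) / fact m else 0))"
  by (rule sum.cong[OF refl]) (simp only: t atMost_iff)
 also have "\<dots> = fps_nth (kap (sc S v) j) m"
  by (simp add: kap_def sc_def fps_mult_nth atLeast0AtMost sum_divide_distrib sum_distrib_left sum_subtractf[symmetric] right_diff_distrib diff_divide_distrib mult_ac)
 finally show "fps_nth (kap (sc S v) j) m = fps_nth (Abs_fps (%m. \<Sum>n\<le>m. fps_nth S n * fps_nth ((xi_b 1 1 ^^ n) (kap v) j) m)) m"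
  unfolding x by simp
qed

lemma kap_inject: assumes "kap v = kap w" shows "v = w"
proof -
 have 1: "fps_nth (kap v j) k = fps_nth (kap w j) k" for j k using assms by simp
 have f: "fps_nth (fst v) k = fps_nth (fst w) k" for k using 1[of 1 k] by (simp add: kap_def)
 have "fps_nth (snd v) k = fps_nth (snd w) k" for k using 1[of 0 k] f[of k] by (simp add: kap_def)
 with f show ?thesis by (simp add: prod_eq_iff fps_eq_iff)
qed

lemma nice_inv: "nice M A pj ==> v \<in> A ==> inv_into A pj (pj v) = v"
 by (rule inv_into_f_f[OF niceD(2)])

lemma embeds_Xi: assumes M: "nice M A pj" shows "embeds M (Xi 1 1)"
 unfolding embeds_def
proof
 note d = niceD[OF M]
 let ?\<phi> = "%x. kap (inv_into A pj x)"
 have c: "kap v \<in> carrier (Xi 1 1)" for v by (simp add: Xi_def kap_def fps_eq_iff)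
 show "?\<phi> \<in> ab_hom M (Xi 1 1)"
  unfolding ab_hom_def d(7) mem_Collect_eq
 proof (intro conjI ballI allI)
  show "?\<phi> \<in> pj ` A \<rightarrow> carrier (Xi 1 1)" using c by blast
  fix x assume "x \<in> pj ` A"
  then obtain v where v: "x = pj v" "v \<in> A" by blast
  show "?\<phi> (S \<odot>\<^bsub>M\<^esub> x) = S \<odot>\<^bsub>Xi 1 1\<^esub> ?\<phi> x" for S
   unfolding v(1) d(11)[OF v(2)] nice_inv[OF M v(2)] nice_inv[OF M d(10)[OF v(2)]] kap_sc by (simp add: Xi_def)
  show "?\<phi> (aop M x) = aop (Xi 1 1) (?\<phi> x)"
   unfolding v(1) d(13)[OF v(2)] nice_inv[OF M v(2)] nice_inv[OF M d(12)[OF v(2)]] by (simp add: Xi_def kap_a fun_eq_iff)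
  fix y assume "y \<in> pj ` A"
  then obtain w where w: "y = pj w" "w \<in> A" by blast
  show "?\<phi> (x \<oplus>\<^bsub>M\<^esub> y) = ?\<phi> x \<oplus>\<^bsub>Xi 1 1\<^esub> ?\<phi> y"
   unfolding v(1) w(1) d(9)[OF v(2) w(2)] nice_inv[OF M v(2)] nice_inv[OF M w(2)] nice_inv[OF M d(5)[OF v(2) w(2)]] by (simp add: Xi_def kap_add fun_eq_iff)
 qed
 show "inj_on ?\<phi> (carrier M)" unfolding d(7)
 proof (rule inj_onI)
  fix x y assume "x \<in> pj ` A" "y \<in> pj ` A" and e: "?\<phi> x = ?\<phi> y"
  then show "x = y" using kap_inject[OF e] by (metis f_inv_into_f)
 qed
qed

lemma embeds_dsum: assumes "embeds M N" shows "embeds M (ab_dsum [N])"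
proof -
 obtain \<phi> where p: "\<phi> \<in> ab_hom M N" "inj_on \<phi> (carrier M)" using assms by (auto simp: embeds_def)
 have "(%x. [\<phi> x]) \<in> ab_hom M (ab_dsum [N])"
  using p(1) by (auto simp: ab_hom_def ab_dsum_def Pi_iff)
 moreover have "inj_on (%x. [\<phi> x]) (carrier M)" using p(2) by (auto simp: inj_on_def)
 ultimately show ?thesis unfolding embeds_def by blast
qed

context theme2 begin

lemma G_theme: assumes M: "nice M G pj" shows "theme M" "ab_rank M = 2" "ab_module M"
proof -
 show r: "ab_rank M = 2" "ab_module M" using rank2_rank[OF M G_def det_g0_h0] by auto
 have e: "embeds M (Xi 1 1)" by (rule embeds_Xi[OF M])
 \<comment> \<open>A direct sum with one summand is formed twice: for the one-dimensional tensor
   factor and for the outer sum.\<close>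
 have "embeds M (ab_dsum (map (%(\<alpha>, N, d). Xi_tensor \<alpha> N d) [(1, 1, 1)]))"
  using embeds_dsum[OF embeds_dsum[OF e]] by (simp add: Xi_tensor_def)
 moreover have "\<forall>(\<alpha>, N, d)\<in>set [(1 :: rat, 1 :: nat, 1 :: nat)]. 0 < \<alpha> & \<alpha> \<le> 1" by simp
 moreover have "\<exists>x\<in>carrier M. carrier M = at_span M x" using at_span_g0[OF M] g0_G niceD(7)[OF M] by blast
 ultimately have "fresco M" unfolding fresco_def using r(2) by blast
 then have "primitive_theme 1 M" unfolding primitive_theme_def using e by blast
 then show "theme M" unfolding theme_def by (intro exI[of _ 1]) simp
qed

end

section \<open>Bernstein polynomials\<close>

text \<open>The operator b^-1 a, which is defined on the whole model although it need not preserve a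
  given submodule.\<close>

definition th :: "jordan2 => jordan2" where
 "th v = (fps_X * fps_deriv (fst v) + fst v, fps_X * fps_deriv (snd v) + snd v + fst v)"

lemma aN_th: "aN v = sc fps_X (th v)"
 by (simp add: aN_def dab_def sc_def th_def prod_eq_iff algebra_simps power2_eq_square)

lemma th_add: "th (v + w) = th v + th w" and th_sc: "th (sc S v) = sc S (th v) + sc (fps_X * fps_deriv S) v"
 by (simp_all add: th_def sc_def prod_eq_iff algebra_simps)

lemma sc_cancel: "sc (fps_X ^ n) a = sc (fps_X ^ n) b ==> a = b" by (simp add: sc_def prod_eq_iff)

lemma nice_poly_op:
 assumes M: "abpres M A sm am pj" and T: "!!v. v \<in> A ==> tm v \<in> A & T (pj v) = pj (tm v)" and v: "v \<in> A"
 shows "poly_op M T p (pj v) = pj (pop sm tm p v)" "pop sm tm p v \<in> A"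
proof -
 have i: "(tm ^^ i) v \<in> A & (T ^^ i) (pj v) = pj ((tm ^^ i) v)" for i
  by (induction i) (auto simp: v T)
 show "poly_op M T p (pj v) = pj (pop sm tm p v)"
  unfolding poly_op_def pop_def by (rule presents_finsum[OF abpresD(1)[OF M]]) (simp_all add: i csmult_def abpresD[OF M])
 show "pop sm tm p v \<in> A" unfolding pop_def by (rule presents_sum_mem[OF abpresD(1)[OF M]]) (simp add: i abpresD[OF M])
qed

text \<open>\<open>K\<close> models the saturation of \<open>A\<close>. By \<open>K_gen\<close> it
  is reached after one application of b^-1 a, and by \<open>KX\<close> each of its elements is a
  fraction with denominator b.\<close>

locale sharp_model =
 fixes M :: "'m abmod" and A :: "(jordan2) set" and pj and K :: "(jordan2) set"
 assumes M: "nice M A pj" and AK: "A \<subseteq> K" and K_diff: "!!v w. v \<in> K ==> w \<in> K ==> v - w \<in> K" and K_sc: "!!S v. v \<in> K ==> sc S v \<in> K"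
  and K_th: "!!v. v \<in> K ==> th v \<in> K" and KX: "!!v. v \<in> K ==> sc fps_X v \<in> A"
  and K_gen: "!!v. v \<in> K ==> \<exists>x\<in>A. \<exists>y\<in>A. v = x + th y"
begin

lemmas d = niceD[OF M]

lemma K_0: "0 \<in> K" using AK d(4) by blast
lemma K_add: "v \<in> K ==> w \<in> K ==> v + w \<in> K" using K_diff[of v "0 - w"] K_diff[of 0 w] K_0 by simp
lemma K_aN: "v \<in> K ==> aN v \<in> K" unfolding aN_th by (intro K_sc K_th)

definition fr :: "jordan2 => nat => ('m \<times> nat) set" where "fr v n = bfrac M (pj v) n"

lemma bopn: "v \<in> A ==> (bop M ^^ n) (pj v) = pj (sc (fps_X ^ n) v)"
 using abpres_bop_funpow(1)[OF d(1)] by (simp add: sc_funpow)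

lemma fr_mem: assumes "v \<in> A" shows "p \<in> fr v n \<longleftrightarrow> (\<exists>w\<in>A. \<exists>m. p = (pj w, m) & sc (fps_X ^ m) v = sc (fps_X ^ n) w)"
proof -
 have "pj (sc (fps_X ^ m) v) = pj (sc (fps_X ^ n) w) \<longleftrightarrow> sc (fps_X ^ m) v = sc (fps_X ^ n) w" if "w \<in> A" for w m
  using inj_on_eq_iff[OF d(2)] d(10) assms that by blast
 then show ?thesis using assms by (auto simp: fr_def bfrac_def d(7) bopn)
qed

lemma fr_eq: assumes "v \<in> A" "w \<in> A" "sc (fps_X ^ m) v = sc (fps_X ^ n) w" shows "fr v n = fr w m"
proof -
 have *: "sc (fps_X ^ k) v = sc (fps_X ^ n) z \<longleftrightarrow> sc (fps_X ^ k) w = sc (fps_X ^ m) z" for k z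
 proof -
  have "sc (fps_X ^ m) (sc (fps_X ^ k) v) = sc (fps_X ^ n) (sc (fps_X ^ k) w)"
   using arg_cong[OF assms(3), of "sc (fps_X ^ k)"] by (simp add: sc_mult[symmetric] mult.commute)
  moreover have "sc (fps_X ^ m) (sc (fps_X ^ n) z) = sc (fps_X ^ n) (sc (fps_X ^ m) z)" by (simp add: sc_mult[symmetric] mult.commute)
  ultimately show ?thesis by (metis sc_cancel)
 qed
 have "p \<in> fr v n \<longleftrightarrow> p \<in> fr w m" for p unfolding fr_mem[OF assms(1)] fr_mem[OF assms(2)] * by (rule refl)
 then show ?thesis by blast
qed

lemma fr_self: "v \<in> A ==> (pj v, n) \<in> fr v n" by (auto simp: fr_mem)

lemma fr_inj: assumes "v \<in> A" "w \<in> A" "fr v n = fr w m" shows "sc (fps_X ^ m) v = sc (fps_X ^ n) w"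
proof -
 have "(pj w, m) \<in> fr v n" unfolding assms(3) by (rule fr_self[OF assms(2)])
 then obtain w' where "w' \<in> A" "pj w = pj w'" "sc (fps_X ^ m) v = sc (fps_X ^ n) w'" using fr_mem[OF assms(1)] by blast
 then show ?thesis using inj_on_eq_iff[OF d(2)] assms(2) by metis
qed

text \<open>The operations of the localisation are unions over all representatives of a fraction;
  they collapse as soon as every representative gives the same value.\<close>

lemma UN_fr:
 assumes "v \<in> A" and "!!w m. w \<in> A ==> sc (fps_X ^ m) v = sc (fps_X ^ n) w ==> F (pj w, m) = C"
 shows "(\<Union>p\<in>fr v n. F p) = C"
proof -
 have F: "F p = C" if p: "p \<in> fr v n" for p
 proof -
  obtain w m where "w \<in> A" "p = (pj w, m)" "sc (fps_X ^ m) v = sc (fps_X ^ n) w" using p unfolding fr_mem[OF assms(1)] by blast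
  then show ?thesis using assms(2) by simp
 qed
 then have "(\<Union>p\<in>fr v n. F p) = (\<Union>p\<in>fr v n. C)" by (rule SUP_cong[OF refl])
 then show ?thesis using fr_self[OF assms(1), of n] by auto
qed

lemma loc_add:
 assumes v: "v \<in> A" and w: "w \<in> A"
 shows "fr v n \<oplus>\<^bsub>ab_loc M\<^esub> fr w m = fr (sc (fps_X ^ m) v + sc (fps_X ^ n) w) (n + m)"
proof -
 have "(\<Union>p\<in>fr v n. \<Union>q\<in>fr w m. bfrac M ((bop M ^^ snd q) (fst p) \<oplus>\<^bsub>M\<^esub> (bop M ^^ snd p) (fst q)) (snd p + snd q))
  = fr (sc (fps_X ^ m) v + sc (fps_X ^ n) w) (n + m)"
 proof (rule UN_fr[OF v], rule UN_fr[OF w])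
  fix v' n' w' m' assume a: "v' \<in> A" "sc (fps_X ^ n') v = sc (fps_X ^ n) v'" "w' \<in> A" "sc (fps_X ^ m') w = sc (fps_X ^ m) w'"
  have 1: "sc (fps_X ^ (n + m)) (sc (fps_X ^ m') v' + sc (fps_X ^ n') w') = sc (fps_X ^ (m' + m)) (sc (fps_X ^ n) v') + sc (fps_X ^ (n' + n)) (sc (fps_X ^ m) w')"
   by (simp add: sc_def prod_eq_iff power_add algebra_simps)
  have 2: "sc (fps_X ^ (n' + m')) (sc (fps_X ^ m) v + sc (fps_X ^ n) w) = sc (fps_X ^ (m' + m)) (sc (fps_X ^ n') v) + sc (fps_X ^ (n' + n)) (sc (fps_X ^ m') w)"
   by (simp add: sc_def prod_eq_iff power_add algebra_simps)
  have "fr (sc (fps_X ^ m') v' + sc (fps_X ^ n') w') (n' + m') = fr (sc (fps_X ^ m) v + sc (fps_X ^ n) w) (n + m)"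
   by (rule fr_eq) (simp_all only: 1 2 a, simp_all add: d v w a)
  then show "bfrac M ((bop M ^^ snd (pj w', m')) (fst (pj v', n')) \<oplus>\<^bsub>M\<^esub> (bop M ^^ snd (pj v', n')) (fst (pj w', m'))) (snd (pj v', n') + snd (pj w', m'))
    = fr (sc (fps_X ^ m) v + sc (fps_X ^ n) w) (n + m)"
   by (simp add: bopn a d fr_def)
 qed
 then show ?thesis by (simp add: ab_loc_def case_prod_beta)
qed

lemma loc_smult: assumes v: "v \<in> A" shows "S \<odot>\<^bsub>ab_loc M\<^esub> fr v n = fr (sc S v) n"
proof -
 have "(\<Union>p\<in>fr v n. bfrac M (S \<odot>\<^bsub>M\<^esub> fst p) (snd p)) = fr (sc S v) n"
 proof (rule UN_fr[OF v])
  fix w m assume a: "w \<in> A" "sc (fps_X ^ m) v = sc (fps_X ^ n) w"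
  have "fr (sc S w) m = fr (sc S v) n"
  proof (rule fr_eq)
   show "sc (fps_X ^ n) (sc S w) = sc (fps_X ^ m) (sc S v)"
    using arg_cong[OF a(2)[symmetric], of "sc S"] by (simp add: sc_mult[symmetric] mult.commute)
  qed (use a v in \<open>simp_all add: d\<close>)
  then show "bfrac M (S \<odot>\<^bsub>M\<^esub> fst (pj w, m)) (snd (pj w, m)) = fr (sc S v) n" using a by (simp add: fr_def d)
 qed
 then show ?thesis by (simp add: ab_loc_def case_prod_beta)
qed

lemma loc_aop: assumes v: "v \<in> A" shows "aop (ab_loc M) (fr v n) = fr (aN v - sc (of_nat n * fps_X) v) n"
proof -
 have "(\<Union>p\<in>fr v n. bfrac M (aop M (fst p) \<ominus>\<^bsub>M\<^esub> csmult M (of_nat (snd p)) (bop M (fst p))) (snd p)) = fr (aN v - sc (of_nat n * fps_X) v) n"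
 proof (rule UN_fr[OF v])
  fix w m assume a: "w \<in> A" "sc (fps_X ^ m) v = sc (fps_X ^ n) w"
  have e: "sc (fps_X ^ m) (aN v) + sc (fps_X ^ m) (sc (of_nat m * fps_X) v) = sc (fps_X ^ n) (aN w) + sc (fps_X ^ n) (sc (of_nat n * fps_X) w)"
   using arg_cong[OF a(2), of aN] by (simp only: aN_X_power sc_add)
  have f: "sc (fps_X ^ m) (sc S v) = sc (fps_X ^ n) (sc S w)" for S
   using arg_cong[OF a(2), of "sc S"] by (simp add: sc_mult[symmetric] mult.commute)
  have "sc (fps_X ^ n) (aN w - sc (of_nat m * fps_X) w) = sc (fps_X ^ m) (aN v - sc (of_nat n * fps_X) v)"
   using e unfolding sc_diff f by (simp add: algebra_simps)
  then have "fr (aN w - sc (of_nat m * fps_X) w) m = fr (aN v - sc (of_nat n * fps_X) v) n"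
   by (intro fr_eq) (use a v in \<open>simp_all add: d\<close>)
  moreover have "csmult M (of_nat m) (bop M (pj w)) = pj (sc (of_nat m * fps_X) w)"
   using a by (simp add: csmult_def bop_def d sc_mult fps_of_nat)
  ultimately show "bfrac M (aop M (fst (pj w, m)) \<ominus>\<^bsub>M\<^esub> csmult M (of_nat (snd (pj w, m))) (bop M (fst (pj w, m)))) (snd (pj w, m)) = fr (aN v - sc (of_nat n * fps_X) v) n"
   using a by (simp add: fr_def d)
 qed
 then show ?thesis by (simp add: ab_loc_def case_prod_beta)
qed

lemma binv_fr: assumes v: "v \<in> A" shows "binv M (fr v n) = fr v (Suc n)"
proof -
 have "(\<Union>p\<in>fr v n. bfrac M (fst p) (Suc (snd p))) = fr v (Suc n)"
 proof (rule UN_fr[OF v])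
  fix w m assume a: "w \<in> A" "sc (fps_X ^ m) v = sc (fps_X ^ n) w"
  have "fr w (Suc m) = fr v (Suc n)"
   by (rule fr_eq[OF a(1) v]) (use arg_cong[OF a(2), of "sc fps_X"] in \<open>simp add: sc_mult\<close>)
  then show "bfrac M (fst (pj w, m)) (Suc (snd (pj w, m))) = fr v (Suc n)" by (simp add: fr_def)
 qed
 then show ?thesis by (simp add: binv_def case_prod_beta)
qed

lemma loc_monoid: "abelian_monoid (ab_loc M)" and loc_zero: "\<zero>\<^bsub>ab_loc M\<^esub> = fr 0 0" and loc_carrier: "carrier (ab_loc M) = {fr v n | v n. v \<in> A}"
proof -
 show z: "\<zero>\<^bsub>ab_loc M\<^esub> = fr 0 0" by (simp add: ab_loc_def fr_def d)
 show c: "carrier (ab_loc M) = {fr v n | v n. v \<in> A}" by (auto simp: ab_loc_def fr_def d(7))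
 show "abelian_monoid (ab_loc M)"
 proof (rule abelian_monoidI)
  show "\<zero>\<^bsub>ab_loc M\<^esub> \<in> carrier (ab_loc M)" unfolding z c using d(4) by blast
  fix x y z assume "x \<in> carrier (ab_loc M)" "y \<in> carrier (ab_loc M)" "z \<in> carrier (ab_loc M)"
  then obtain u v w n m k where a: "x = fr u n" "u \<in> A" "y = fr v m" "v \<in> A" "z = fr w k" "w \<in> A" unfolding c by blast
  show "x \<oplus>\<^bsub>ab_loc M\<^esub> y \<in> carrier (ab_loc M)"
  proof -
   have "sc (fps_X ^ m) u + sc (fps_X ^ n) v \<in> A" using a by (intro d(5,10))
   then show ?thesis unfolding c a(1,3) loc_add[OF a(2,4)] by blast
  qed
  show "x \<oplus>\<^bsub>ab_loc M\<^esub> y \<oplus>\<^bsub>ab_loc M\<^esub> z = x \<oplus>\<^bsub>ab_loc M\<^esub> (y \<oplus>\<^bsub>ab_loc M\<^esub> z)"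
   using a by (simp add: loc_add d sc_add sc_mult[symmetric] power_add add_ac mult_ac)
  show "x \<oplus>\<^bsub>ab_loc M\<^esub> y = y \<oplus>\<^bsub>ab_loc M\<^esub> x" using a by (simp add: loc_add add.commute)
 next
  fix x assume "x \<in> carrier (ab_loc M)"
  then obtain u n where a: "x = fr u n" "u \<in> A" unfolding c by blast
  then show "\<zero>\<^bsub>ab_loc M\<^esub> \<oplus>\<^bsub>ab_loc M\<^esub> x = x" unfolding z using d(4) by (simp add: loc_add)
 qed
qed

text \<open>An element of \<open>K\<close> as the fraction b^-1 (b v), whose numerator lies in
  \<open>A\<close>.\<close>

definition ps :: "jordan2 => ('m \<times> nat) set" where "ps v = fr (sc fps_X v) 1"

lemma ps_A: "v \<in> A ==> bfrac M (pj v) 0 = ps v"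
 using fr_eq[of v "sc fps_X v" 1 0] by (simp add: ps_def d flip: fr_def)
lemma ps_carrier: "v \<in> K ==> ps v \<in> carrier (ab_loc M)" unfolding loc_carrier ps_def using KX by blast
lemma ps_add: assumes "v \<in> K" "w \<in> K" shows "ps v \<oplus>\<^bsub>ab_loc M\<^esub> ps w = ps (v + w)"
proof -
 have "fr (sc (fps_X ^ 1) (sc fps_X v) + sc (fps_X ^ 1) (sc fps_X w)) (1 + 1) = fr (sc fps_X (v + w)) 1"
  by (rule fr_eq) (use assms in \<open>simp_all add: KX K_add d sc_add sc_mult power2_eq_square numeral_2_eq_2\<close>)
 then show ?thesis unfolding ps_def using assms by (simp add: loc_add KX)
qed
lemma ps_smult: "v \<in> K ==> S \<odot>\<^bsub>ab_loc M\<^esub> ps v = ps (sc S v)"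
 unfolding ps_def by (simp add: loc_smult KX sc_mult[symmetric] mult.commute)
lemma ps_aop: "v \<in> K ==> aop (ab_loc M) (ps v) = ps (aN v)"
 unfolding ps_def by (simp add: loc_aop KX aN_sc sc_mult power2_eq_square)
lemma ps_binv_a: assumes "v \<in> K" shows "binv_a M (ps v) = ps (th v)"
proof -
 have "fr (sc fps_X (aN v)) (Suc 1) = fr (sc fps_X (th v)) 1"
  by (rule fr_eq) (use assms in \<open>simp_all add: KX K_aN K_th d aN_th sc_mult\<close>)
 then show ?thesis using assms unfolding binv_a_def ps_aop[OF assms] by (simp add: ps_def binv_fr KX K_aN)
qed
lemma ps_inj: "inj_on ps K"
proof (rule inj_onI)
 fix v w assume a: "v \<in> K" "w \<in> K" "ps v = ps w"
 then have "sc (fps_X ^ 1) (sc fps_X v) = sc (fps_X ^ 1) (sc fps_X w)" unfolding ps_def by (intro fr_inj KX)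
 then have "sc (fps_X ^ 2) v = sc (fps_X ^ 2) w" by (simp add: sc_mult power2_eq_square)
 then show "v = w" by (rule sc_cancel)
qed

lemma ps_finsum: "(!!j. j < k ==> u j \<in> K) ==> (!!j. j < k ==> g j = ps (u j)) ==> finsum (ab_loc M) g {..<k} = ps (\<Sum>j<k. u j) & (\<Sum>j<k. u j) \<in> K"
 for k :: nat
proof (induction k)
 case 0
 interpret abelian_monoid "ab_loc M" by (rule loc_monoid)
 have "fr 0 0 = ps 0" using ps_A[OF d(4)] by (simp add: fr_def)
 then show ?case using loc_zero K_0 by simp
next
 case (Suc k)
 interpret abelian_monoid "ab_loc M" by (rule loc_monoid)
 have IH: "finsum (ab_loc M) g {..<k} = ps (\<Sum>j<k. u j)" "(\<Sum>j<k. u j) \<in> K" using Suc by auto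
 have "finsum (ab_loc M) g (insert k {..<k}) = g k \<oplus>\<^bsub>ab_loc M\<^esub> finsum (ab_loc M) g {..<k}"
  by (rule finsum_insert) (use Suc.prems in \<open>auto simp: ps_carrier\<close>)
 then show ?case using Suc.prems IH by (simp add: lessThan_Suc ps_add K_add add.commute)
qed

lemma sharp_carrier: "carrier (sharp M) = ps ` K"
proof -
 have t: "(th ^^ j) v \<in> K & (binv_a M ^^ j) (ps v) = ps ((th ^^ j) v)" if "v \<in> K" for v j
  by (induction j) (auto simp: that K_th ps_binv_a)
 have f: "finsum (ab_loc M) (%j. (binv_a M ^^ j) (bfrac M (pj (y j)) 0)) {..<k} = ps (\<Sum>j<k. (th ^^ j) (y j)) & (\<Sum>j<k. (th ^^ j) (y j)) \<in> K"
  if y: "!!j. y j \<in> A" for y and k :: nat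
 proof (rule ps_finsum)
  have yK: "y j \<in> K" for j using y AK by blast
  show "(th ^^ j) (y j) \<in> K" for j using t[OF yK] by blast
  show "(binv_a M ^^ j) (bfrac M (pj (y j)) 0) = ps ((th ^^ j) (y j))" for j unfolding ps_A[OF y] using t[OF yK] by blast
 qed
 have "carrier (sharp M) = {finsum (ab_loc M) (%j. (binv_a M ^^ j) (bfrac M (x j) 0)) {..<k} | x k. \<forall>j. x j \<in> carrier M}"
  by (simp add: sharp_def ab_sub_def)
 also have "\<dots> = ps ` K"
 proof
  show "{finsum (ab_loc M) (%j. (binv_a M ^^ j) (bfrac M (x j) 0)) {..<k} | x k. \<forall>j. x j \<in> carrier M} \<subseteq> ps ` K"
  proof
   fix c assume "c \<in> {finsum (ab_loc M) (%j. (binv_a M ^^ j) (bfrac M (x j) 0)) {..<k} | x k. \<forall>j. x j \<in> carrier M}"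
   then obtain x k where c: "c = finsum (ab_loc M) (%j. (binv_a M ^^ j) (bfrac M (x j) 0)) {..<k}" "!!j. x j \<in> carrier M" by blast
   then have "\<forall>j. \<exists>y. y \<in> A & x j = pj y" unfolding d(7) by blast
   then obtain y where y: "!!j. y j \<in> A" "!!j. x j = pj (y j)" by metis
   show "c \<in> ps ` K" unfolding c(1) y(2) using f[where y = y and k = k, OF y(1)] by simp
  qed
  show "ps ` K \<subseteq> {finsum (ab_loc M) (%j. (binv_a M ^^ j) (bfrac M (x j) 0)) {..<k} | x k. \<forall>j. x j \<in> carrier M}"
  proof
   fix c assume "c \<in> ps ` K"
   then obtain v where v: "c = ps v" "v \<in> K" by blast
   obtain x y where xy: "x \<in> A" "y \<in> A" "v = x + th y" using K_gen[OF v(2)] by blast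
   \<comment> \<open>Two terms of the sum defining the saturation suffice; the sequence must have
     values in \<open>A\<close> everywhere, so it is continued by \<open>y\<close>.\<close>
   define z where "z j = (if j = (0 :: nat) then x else y)" for j
   have zA: "z j \<in> A" for j using xy by (simp add: z_def)
   have "(\<Sum>j<2. (th ^^ j) (z j)) = v" by (simp add: z_def xy(3) numeral_2_eq_2)
   then have "c = finsum (ab_loc M) (%j. (binv_a M ^^ j) (bfrac M (pj (z j)) 0)) {..<2}" using f[where y = z and k = 2, OF zA] v(1) by simp
   moreover have "\<forall>j. pj (z j) \<in> carrier M" using zA d(7) by blast
   ultimately show "c \<in> {finsum (ab_loc M) (%j. (binv_a M ^^ j) (bfrac M (x j) 0)) {..<k} | x k. \<forall>j. x j \<in> carrier M}"
    by (intro CollectI exI[of _ "%j. pj (z j)"] exI[of _ 2]) simp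
  qed
 qed
 finally show ?thesis .
qed

lemma sharp_ops: "\<zero>\<^bsub>sharp M\<^esub> = \<zero>\<^bsub>ab_loc M\<^esub>" "x \<oplus>\<^bsub>sharp M\<^esub> y = x \<oplus>\<^bsub>ab_loc M\<^esub> y" "S \<odot>\<^bsub>sharp M\<^esub> x = S \<odot>\<^bsub>ab_loc M\<^esub> x" "aop (sharp M) x = aop (ab_loc M) x"
 by (simp_all add: sharp_def ab_sub_def)

lemma sharp_nice: "nice (sharp M) K ps"
proof -
 have "fr 0 0 = ps 0" using ps_A[OF d(4)] by (simp add: fr_def)
 then have "presents (sharp M) K ps"
  unfolding presents_def sharp_carrier sharp_ops loc_zero using K_0 K_add K_diff[OF K_0] by (auto simp: ps_add)
 then have "abpres (sharp M) K sc aN ps" unfolding abpres_def sharp_ops by (auto simp: K_sc K_aN ps_smult ps_aop)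
 then show ?thesis unfolding nice_def using ps_inj by blast
qed

definition XK :: "(jordan2) set" where "XK = sc fps_X ` K"

text \<open>The functionals \<open>c mu\<close> diagonalise b^-1 a on K/bK: each is an eigenvector
  for its own mu, none vanishes, and together they separate points. So a polynomial in -b^-1 a is
  zero exactly when it vanishes at all -mu, and distinctness of the mu gives the minimal
  degree.\<close>

lemma bernstein_eq:
 fixes c :: "complex => jordan2 => complex"
 assumes I: "finite I" and c_add: "!!mu v w. c mu (v + w) = c mu v + c mu w" and c_sc: "!!mu z v. c mu (sc (fps_const z) v) = z * c mu v"
  and c_th: "!!mu v. mu \<in> I ==> v \<in> K ==> c mu (th v) = mu * c mu v" and c_nz: "!!mu. mu \<in> I ==> \<exists>v\<in>K. c mu v ~= 0"
  and c_ker: "!!v. v \<in> K ==> v \<in> XK \<longleftrightarrow> (\<forall>mu\<in>I. c mu v = 0)"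
 shows "bernstein M = (\<Prod>mu\<in>I. [:mu, 1:])"
proof -
 let ?F = "sharp M"
 define bF where "bF = bop ?F ` carrier ?F"
 note F = niceD[OF sharp_nice]
 have bop: "bop ?F (ps v) = ps (sc fps_X v)" if "v \<in> K" for v using that by (simp add: bop_def F)
 have bF: "bF = ps ` XK" unfolding bF_def F(7) XK_def image_image by (rule image_cong[OF refl]) (rule bop)
 have XK: "XK \<subseteq> K" using K_sc by (auto simp: XK_def)
 have X1: "sc S v \<in> XK" if "v \<in> XK" for S v using that K_sc unfolding XK_def by (auto simp: sc_mult[symmetric] mult.commute) (metis image_eqI sc_mult mult.commute)
 have X2: "v - w \<in> XK" if vw: "v \<in> XK" "w \<in> XK" for v w
 proof -
  obtain v' w' where "v = sc fps_X v'" "w = sc fps_X w'" "v' \<in> K" "w' \<in> K" using vw by (auto simp: XK_def)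
  then show ?thesis unfolding XK_def by (intro image_eqI[where x = "v' - w'"]) (simp_all add: sc_diff K_diff)
 qed
 have X0: "0 \<in> XK" unfolding XK_def using K_0 by (metis image_eqI sc_zero(2))
 have Xth: "th v \<in> XK" if v: "v \<in> XK" for v
 proof -
  obtain z where z: "v = sc fps_X z" "z \<in> K" using v by (auto simp: XK_def)
  have "th v = sc fps_X (th z + z)" unfolding z by (simp add: th_sc sc_add)
  then show ?thesis unfolding XK_def using K_add[OF K_th[OF z(2)] z(2)] by blast
 qed
 have XaN: "aN v \<in> XK" if "v \<in> XK" for v unfolding aN_th using X1[OF Xth[OF that]] .
 define Q where "Q = ab_quot ?F bF"
 define pjQ where "pjQ v = bF +>\<^bsub>?F\<^esub> ps v" for v
 have k0: "pker K ps {0}" using inj_on_eq_iff[OF F(2)] by (simp add: pker_def)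
 have h3: "sc S x - sc S y \<in> XK" if "x \<in> K" "y \<in> K" "x - y \<in> XK" for S x y using X1[OF that(3), of S] by (simp add: sc_diff)
 have h4: "aN x - aN y \<in> XK" if "x \<in> K" "y \<in> K" "x - y \<in> XK" for x y using XaN[OF that(3)] by (simp add: aN_diff)
 have h1: "{0} \<subseteq> XK" using X0 by simp
 note q = abpres_quotient[OF F(1) k0 h1 XK X0 X2 h3 h4 bF]
 have Q1: "abpres Q K sc aN pjQ" unfolding Q_def pjQ_def[abs_def] by (rule q(1))
 have Q2: "pker K pjQ XK" unfolding pjQ_def[abs_def] by (rule q(2))
 note Q = Q1 Q2
 define T where "T = (%C. \<Union>w\<in>C. bF +>\<^bsub>?F\<^esub> csmult ?F (- 1) (binv_a M w))"
 define tm where "tm v = sc (fps_const (- 1)) (th v)" for v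
 have T: "tm v \<in> K & T (pjQ v) = pjQ (tm v)" if v: "v \<in> K" for v
 proof
  show tmK: "tm v \<in> K" using v by (simp add: tm_def K_sc K_th)
  have m: "pjQ v = (%y. ps (y + v)) ` XK"
  proof -
   have "pjQ v = (%y. ps y \<oplus>\<^bsub>?F\<^esub> ps v) ` XK" unfolding pjQ_def a_r_coset_def' bF by auto
   also have "\<dots> = (%y. ps (y + v)) ` XK" by (rule image_cong[OF refl]) (use v XK F(9) in blast)
   finally show ?thesis .
  qed
  have "bF +>\<^bsub>?F\<^esub> csmult ?F (- 1) (binv_a M (ps (y + v))) = pjQ (tm v)" if y: "y \<in> XK" for y
  proof -
   have yv: "y + v \<in> K" using y XK v K_add by blast
   have "csmult ?F (- 1) (binv_a M (ps (y + v))) = ps (tm (y + v))"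
    unfolding csmult_def ps_binv_a[OF yv] tm_def by (rule F(11)[OF K_th[OF yv]])
   then have "bF +>\<^bsub>?F\<^esub> csmult ?F (- 1) (binv_a M (ps (y + v))) = pjQ (tm (y + v))" by (simp add: pjQ_def)
   also have "\<dots> = pjQ (tm v)"
   proof -
    have "tm (y + v) - tm v = sc (fps_const (- 1)) (th y)" by (simp add: tm_def th_add sc_add)
    then have "tm (y + v) - tm v \<in> XK" using X1[OF Xth[OF y]] by simp
    moreover have "tm (y + v) \<in> K" using yv by (simp add: tm_def K_sc K_th)
    ultimately show ?thesis using Q(2) tmK by (simp add: pker_def)
   qed
   finally show ?thesis .
  qed
  then show "T (pjQ v) = pjQ (tm v)" unfolding T_def m using X0 by auto
 qed
 have c0: "c mu 0 = 0" for mu using c_add[of mu 0 0] by simp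
 have ci: "(tm ^^ i) v \<in> K & c mu ((tm ^^ i) v) = (- mu) ^ i * c mu v" if "v \<in> K" "mu \<in> I" for v mu i
  using T by (induction i) (simp_all add: that tm_def K_sc K_th c_sc c_th)
 have xs: "c mu (sum g B) = (\<Sum>i\<in>B. c mu (g i))" for mu g and B :: "nat set"
  by (induction B rule: infinite_finite_induct) (auto simp: c0 c_add)
 have cp: "c mu (pop sc tm p v) = poly p (- mu) * c mu v" if "v \<in> K" "mu \<in> I" for v mu p
  using ci[OF that] by (simp add: pop_def xs c_sc poly_altdef sum_distrib_right mult.assoc)
 have po1: "poly_op Q T p (pjQ v) = pjQ (pop sc tm p v)" if v: "v \<in> K" for p v by (rule nice_poly_op(1)[OF Q(1) _ v]) (rule T)
 have po2: "pop sc tm p v \<in> K" if v: "v \<in> K" for p v by (rule nice_poly_op(2)[OF Q(1) _ v]) (rule T)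
 note po = po1 po2
 have z: "\<zero>\<^bsub>Q\<^esub> = pjQ 0" and cQ: "carrier Q = pjQ ` K" using presentsD(4,5)[OF abpresD(1)[OF Q(1)]] by simp_all
 have kill: "(\<forall>x\<in>carrier Q. poly_op Q T p x = \<zero>\<^bsub>Q\<^esub>) \<longleftrightarrow> (\<forall>mu\<in>I. poly p (- mu) = 0)" for p
 proof -
  have eq: "poly_op Q T p (pjQ v) = \<zero>\<^bsub>Q\<^esub> \<longleftrightarrow> (\<forall>mu\<in>I. poly p (- mu) * c mu v = 0)" if v: "v \<in> K" for v
  proof -
   have "poly_op Q T p (pjQ v) = \<zero>\<^bsub>Q\<^esub> \<longleftrightarrow> pop sc tm p v \<in> XK"
    unfolding po(1)[OF v] z using Q(2) po(2)[OF v, of p] K_0 by (simp add: pker_def)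
   also have "\<dots> \<longleftrightarrow> (\<forall>mu\<in>I. poly p (- mu) * c mu v = 0)" using c_ker[OF po(2)[OF v, of p]] cp[OF v] by simp
   finally show ?thesis .
  qed
  show ?thesis
  proof
   assume a: "\<forall>x\<in>carrier Q. poly_op Q T p x = \<zero>\<^bsub>Q\<^esub>"
   show "\<forall>mu\<in>I. poly p (- mu) = 0"
   proof
    fix mu assume m: "mu \<in> I"
    obtain v where v: "v \<in> K" "c mu v ~= 0" using c_nz[OF m] by blast
    have "poly_op Q T p (pjQ v) = \<zero>\<^bsub>Q\<^esub>" using a v(1) unfolding cQ by blast
    then have "poly p (- mu) * c mu v = 0" using eq[OF v(1)] m by blast
    then show "poly p (- mu) = 0" using v(2) by simp
   qed
  next
   assume b: "\<forall>mu\<in>I. poly p (- mu) = 0"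
   show "\<forall>x\<in>carrier Q. poly_op Q T p x = \<zero>\<^bsub>Q\<^esub>"
   proof
    fix x assume "x \<in> carrier Q"
    then obtain v where v: "x = pjQ v" "v \<in> K" unfolding cQ by blast
    show "poly_op Q T p x = \<zero>\<^bsub>Q\<^esub>" unfolding v(1) eq[OF v(2)] using b by simp
   qed
  qed
 qed
 define m where "m = (\<Prod>mu\<in>I. [:mu, 1 :: complex:])"
 have md: "Polynomial.coeff m (Polynomial.degree m) = 1 & Polynomial.degree m = card I"
  unfolding m_def using I
 proof (induction I)
  case empty
  show ?case by simp
 next
  case (insert x F)
  define P where "P = (\<Prod>mu\<in>F. [:mu, 1 :: complex:])"
  have P1: "Polynomial.coeff P (Polynomial.degree P) = 1" and P2: "Polynomial.degree P = card F" using insert.IH unfolding P_def by blast+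
  have ne: "P ~= 0" using P1 by auto
  have nx: "[:x, 1 :: complex:] ~= 0" by simp
  have d: "Polynomial.degree ([:x, 1:] * P) = Suc (card F)" unfolding degree_mult_eq[OF nx ne] P2 by simp
  have l: "Polynomial.coeff ([:x, 1:] * P) (Polynomial.degree ([:x, 1:] * P)) = 1" unfolding lead_coeff_mult P1 by simp
  show ?case
   unfolding prod.insert[OF insert.hyps(1) insert.hyps(2)] card_insert_disjoint[OF insert.hyps(1) insert.hyps(2)] P_def[symmetric] using l d by blast
 qed
 then have mne: "m ~= 0" by auto
 have mk: "poly m (- mu) = 0" if "mu \<in> I" for mu
  unfolding m_def poly_prod using I that by (auto intro!: prod_zero)
 have low: "card I \<le> Polynomial.degree p" if "p ~= 0" "\<forall>mu\<in>I. poly p (- mu) = 0" for p :: "complex poly"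
 proof -
  have "card I = card (uminus ` I)" by (rule card_image[symmetric]) simp
  also have "\<dots> \<le> card {x. poly p x = 0}" using that by (intro card_mono poly_roots_finite) auto
  also have "\<dots> \<le> Polynomial.degree p" by (rule card_poly_roots_bound[OF that(1)])
  finally show ?thesis .
 qed
 have "(THE p. is_min_poly Q T p) = m"
 proof (rule the_equality)
  show "is_min_poly Q T m" unfolding is_min_poly_def kill using md mk low by auto
  fix p assume p: "is_min_poly Q T p"
  then have p1: "Polynomial.coeff p (Polynomial.degree p) = 1" "\<forall>mu\<in>I. poly p (- mu) = 0" "Polynomial.degree p \<le> Polynomial.degree m"
   unfolding is_min_poly_def kill using mne mk by auto
  then have "p ~= 0" by auto
  then have dp: "Polynomial.degree p = card I" using low[of p] p1 md by auto
  show "p = m"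
  proof (rule ccontr)
   assume "p ~= m"
   then have n: "p - m ~= 0" by simp
   have "Polynomial.degree (p - m) \<le> card I" using degree_diff_le[of p "card I" m] dp md by simp
   moreover have "card I \<le> Polynomial.degree (p - m)" by (rule low[OF n]) (use p1 mk in simp)
   ultimately have dg: "Polynomial.degree (p - m) = card I" by simp
   have dm: "Polynomial.degree m = card I" and lm: "Polynomial.coeff m (Polynomial.degree m) = 1" using md by blast+
   have cp: "Polynomial.coeff p (card I) = 1" using p1(1) unfolding dp .
   have cm: "Polynomial.coeff m (card I) = 1" using lm unfolding dm .
   have "Polynomial.coeff (p - m) (Polynomial.degree (p - m)) = 0" unfolding dg coeff_diff cp cm by (rule diff_self)
   then show False using n unfolding leading_coeff_0_iff by blast
  qed
 qed
 then show ?thesis unfolding bernstein_def Let_def bF_def[symmetric] Q_def[symmetric] T_def[symmetric] m_def .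
qed

end

section \<open>Semi-simple parts\<close>

lemma nonzero_factor: assumes "F ~= (0 :: complex fps)" obtains m U where "F = fps_X ^ m * U" "fps_nth U 0 ~= 0"
proof (rule that)
 show "F = fps_X ^ subdegree F * fps_shift (subdegree F) F" using subdegree_decompose[of F] by (simp add: mult.commute)
 show "fps_nth (fps_shift (subdegree F) F) 0 ~= 0" using assms by (simp add: nth_subdegree_nonzero)
qed

lemma dab_0: "dab 0 = 0" by (simp add: dab_def)
lemma fst_sc: "fst (sc S v) = S * fst v" by (simp add: sc_def)
lemma fst_aN: "fst (aN v) = dab (fst v)" by (simp add: aN_def)

lemma dab_power: "dab (fps_X ^ n) = of_nat (Suc n) * fps_X * fps_X ^ n"
 using dab_X_power[of n 1] by (simp add: mult.commute)

text \<open>Normalise x to (X^m, R) and apply a - (m + 1) b. The result is (0, D), where in degree m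
  + 1 the two contributions of R cancel and the logarithmic term leaves 1. Dividing D by a unit
  gives (0, X^k), from which y = (X^(m+k), 0) and z = (0, X^(m+k)) are obtained.\<close>

lemma nilpotent_pair:
 assumes M: "nice M A pj" and x: "x \<in> A" "fst x ~= 0"
 obtains K y z where "y \<in> A" "z \<in> A" "z ~= 0" "aN y = sc (of_nat (Suc K) * fps_X) y + sc fps_X z" "aN z = sc (of_nat (Suc K) * fps_X) z"
proof -
 note d = niceD[OF M]
 obtain m U where U: "fst x = fps_X ^ m * U" "fps_nth U 0 ~= 0" using nonzero_factor[OF x(2)] .
 have iU: "inverse U * U = 1" by (rule inverse_mult_eq_1[OF U(2)])
 define R where "R = inverse U * snd x"
 define x1 where "x1 = sc (inverse U) x"
 have "inverse U * (fps_X ^ m * U) = fps_X ^ m * (inverse U * U)" by (simp only: mult_ac)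
 then have x1: "x1 = (fps_X ^ m, R)" unfolding x1_def sc_def U(1) R_def iU by simp
 have x1A: "x1 \<in> A" unfolding x1_def by (rule d(10)[OF x(1)])
 define D where "D = dab R + fps_X * fps_X ^ m - of_nat (Suc m) * fps_X * R"
 have e: "aN x1 - sc (of_nat (Suc m) * fps_X) x1 = (0, D)" unfolding x1 aN_def sc_def D_def by (simp add: dab_power)
 have DA: "(0, D) \<in> A" unfolding e[symmetric] using x1A by (intro d(6,10,12))
 have "fps_nth (of_nat (Suc m) * fps_X * R) (Suc m) = of_nat (Suc m) * fps_nth R m"
  by (simp add: mult.assoc fps_of_nat[symmetric] del: of_nat_Suc)
 then have "fps_nth D (Suc m) = 1" by (simp add: D_def dab_nth fps_X_power_nth del: of_nat_Suc)
 then have "D ~= 0" by auto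
 then obtain k V where V: "D = fps_X ^ k * V" "fps_nth V 0 ~= 0" using nonzero_factor by metis
 have iV: "inverse V * V = 1" by (rule inverse_mult_eq_1[OF V(2)])
 have "inverse V * (fps_X ^ k * V) = fps_X ^ k * (inverse V * V)" by (simp only: mult_ac)
 then have "sc (inverse V) (0, D) = (0, fps_X ^ k)" unfolding sc_def V(1) iV by simp
 then have kA: "(0, fps_X ^ k) \<in> A" using d(10)[OF DA, of "inverse V"] by simp
 define z where "z = sc (fps_X ^ m) (0 :: complex fps, fps_X ^ k :: complex fps)"
 define y where "y = sc (fps_X ^ k) x1 - sc R (0, fps_X ^ k)"
 have zA: "z \<in> A" unfolding z_def by (rule d(10)[OF kA])
 have yA: "y \<in> A" unfolding y_def by (rule d(6)[OF d(10)[OF x1A] d(10)[OF kA]])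
 have z: "z = (0, fps_X ^ (m + k))" by (simp add: z_def sc_def power_add)
 have y: "y = (fps_X ^ (m + k), 0)" by (simp add: y_def x1 sc_def power_add mult.commute)
 show ?thesis
 proof (rule that[OF yA zA, of "m + k"])
  show "z ~= 0" unfolding z by (simp add: zero_prod_def)
  show "aN y = sc (of_nat (Suc (m + k)) * fps_X) y + sc fps_X z" unfolding y z aN_def sc_def fst_conv snd_conv dab_power by (simp add: dab_def)
  show "aN z = sc (of_nat (Suc (m + k)) * fps_X) z" unfolding z aN_def sc_def fst_conv snd_conv dab_power by (simp add: dab_def)
 qed
qed

text \<open>In a summand E_l = C[[b]] the pair satisfies c y_n = z_n and c z_n = 0 with c = n + l -
  (K + 1). Either case for c gives z_n = 0, so z is sent to 0, against injectivity.\<close>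

lemma not_semi_simple:
 assumes M: "nice M A pj" and x: "x \<in> A" "fst x ~= 0"
 shows "\<not> semi_simple M"
proof
 note d = niceD[OF M]
 assume "semi_simple M"
 then obtain ls :: "rat list" and \<phi> where p: "\<phi> \<in> ab_hom M (ab_dsum (map (%l. E_mod (of_rat l)) ls))" "inj_on \<phi> (carrier M)"
  unfolding semi_simple_def embeds_def by blast
 obtain K y z where yz: "y \<in> A" "z \<in> A" "z ~= 0" "aN y = sc (of_nat (Suc K) * fps_X) y + sc fps_X z" "aN z = sc (of_nat (Suc K) * fps_X) z"
  using nilpotent_pair[OF M x] .
 have len: "length (\<phi> (pj v)) = length ls" if "v \<in> A" for v
  using p(1) that d(7) by (fastforce simp: ab_hom_def ab_dsum_def Pi_iff)
 have "\<phi> (pj z) ! i = \<phi> (pj 0) ! i" if i: "i < length ls" for i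
 proof -
  obtain pjE where E: "abpres (E_mod (of_rat (ls ! i))) UNIV (*) (dabl (of_rat (ls ! i))) pjE" "inj pjE" using E_mod_presentation .
  have cE: "carrier (E_mod (of_rat (ls ! i))) = range pjE" by (rule presentsD(4)[OF abpresD(1)[OF E(1)]])
  define ps0 where "ps0 v = inv_into UNIV pjE (\<phi> (pj v) ! i)" for v
  have P: "pjE (ps0 v) = \<phi> (pj v) ! i" if "v \<in> A" for v
  proof -
   have "\<phi> (pj v) ! i \<in> range pjE" using p(1) that d(7) i unfolding cE[symmetric] by (fastforce simp: ab_hom_def ab_dsum_def Pi_iff)
   then show ?thesis unfolding ps0_def by (rule f_inv_into_f)
  qed
  have inj: "a = b" if "pjE a = pjE b" for a b using injD[OF E(2) that] .
  have add: "ps0 (v + w) = ps0 v + ps0 w" if vw: "v \<in> A" "w \<in> A" for v w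
  proof (rule inj)
   have "\<phi> (pj v \<oplus>\<^bsub>M\<^esub> pj w) = \<phi> (pj v) \<oplus>\<^bsub>ab_dsum (map (%l. E_mod (of_rat l)) ls)\<^esub> \<phi> (pj w)"
    using p(1) vw d(7) unfolding ab_hom_def by blast
   then have "\<phi> (pj (v + w)) ! i = \<phi> (pj v) ! i \<oplus>\<^bsub>E_mod (of_rat (ls ! i))\<^esub> \<phi> (pj w) ! i" using i vw by (simp add: d ab_dsum_def)
   then show "pjE (ps0 (v + w)) = pjE (ps0 v + ps0 w)"
    unfolding P[OF vw(1), symmetric] P[OF vw(2), symmetric] P[OF d(5)[OF vw], symmetric] presentsD(6)[OF abpresD(1)[OF E(1)] UNIV_I UNIV_I] .
  qed
  have smul: "ps0 (sc S v) = S * ps0 v" if v: "v \<in> A" for S v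
  proof (rule inj)
   have "\<phi> (S \<odot>\<^bsub>M\<^esub> pj v) = S \<odot>\<^bsub>ab_dsum (map (%l. E_mod (of_rat l)) ls)\<^esub> \<phi> (pj v)" using p(1) v d(7) unfolding ab_hom_def by blast
   then have "\<phi> (pj (sc S v)) ! i = S \<odot>\<^bsub>E_mod (of_rat (ls ! i))\<^esub> (\<phi> (pj v) ! i)" using i v by (simp add: d ab_dsum_def)
   then show "pjE (ps0 (sc S v)) = pjE (S * ps0 v)"
    unfolding P[OF v, symmetric] P[OF d(10)[OF v], symmetric] abpresD(3)[OF E(1) UNIV_I] .
  qed
  have aop: "ps0 (aN v) = dabl (of_rat (ls ! i)) (ps0 v)" if v: "v \<in> A" for v
  proof (rule inj)
   have "\<phi> (aop M (pj v)) = aop (ab_dsum (map (%l. E_mod (of_rat l)) ls)) (\<phi> (pj v))" using p(1) v d(7) unfolding ab_hom_def by blast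
   then have "\<phi> (pj (aN v)) ! i = aop (E_mod (of_rat (ls ! i))) (\<phi> (pj v) ! i)" using i v by (simp add: d ab_dsum_def)
   then show "pjE (ps0 (aN v)) = pjE (dabl (of_rat (ls ! i)) (ps0 v))"
    unfolding P[OF v, symmetric] P[OF d(12)[OF v], symmetric] abpresD(5)[OF E(1) UNIV_I] .
  qed
  have 1: "dabl (of_rat (ls ! i)) (ps0 y) = of_nat (Suc K) * fps_X * ps0 y + fps_X * ps0 z"
   unfolding aop[OF yz(1), symmetric] yz(4) add[OF d(10)[OF yz(1)] d(10)[OF yz(2)]] smul[OF yz(1)] smul[OF yz(2)] ..
  have 2: "dabl (of_rat (ls ! i)) (ps0 z) = of_nat (Suc K) * fps_X * ps0 z"
   unfolding aop[OF yz(2), symmetric] yz(5) smul[OF yz(2)] ..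
  have "fps_nth (ps0 z) n = 0" for n
  proof -
   define c where "c = of_nat n + of_rat (ls ! i) - (of_nat (Suc K) :: complex)"
   have X: "fps_nth (of_nat (Suc K) * fps_X * F) (Suc n) = of_nat (Suc K) * fps_nth F n" for F :: "complex fps"
    by (simp add: mult.assoc fps_of_nat[symmetric] del: of_nat_Suc)
   have "(of_nat n + of_rat (ls ! i)) * fps_nth (ps0 y) n = of_nat (Suc K) * fps_nth (ps0 y) n + fps_nth (ps0 z) n"
    using arg_cong[OF 1, of "%F. fps_nth F (Suc n)"] unfolding fps_add_nth X by (simp add: dabl_nth del: of_nat_Suc)
   then have a: "fps_nth (ps0 z) n = c * fps_nth (ps0 y) n" by (simp add: c_def algebra_simps)
   have "(of_nat n + of_rat (ls ! i)) * fps_nth (ps0 z) n = of_nat (Suc K) * fps_nth (ps0 z) n"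
    using arg_cong[OF 2, of "%F. fps_nth F (Suc n)"] unfolding X by (simp add: dabl_nth del: of_nat_Suc)
   then have b: "c * fps_nth (ps0 z) n = 0" by (simp add: c_def algebra_simps)
   show ?thesis using a b by (cases "c = 0") auto
  qed
  then have "ps0 z = 0" by (simp add: fps_eq_iff)
  moreover have "ps0 0 = 0" using smul[OF d(4), of 0] by simp
  ultimately show ?thesis using P[OF yz(2)] P[OF d(4)] by simp
 qed
 then have "\<phi> (pj z) = \<phi> (pj 0)" by (intro nth_equalityI) (simp_all add: len yz d(4))
 then have "pj z = pj 0" using p(2) yz(2) d(4,7) by (metis imageI inj_on_def)
 then have "z = 0" using inj_on_eq_iff[OF d(2) yz(2) d(4)] by simp
 then show False using yz(3) by simp
qed

definition R1 :: "nat => (jordan2) set" where "R1 n = {(0, fps_X ^ n * T) | T. True}"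

lemma R1_0: "0 \<in> R1 n" unfolding R1_def by (rule CollectI, rule exI[of _ 0]) (simp add: zero_prod_def)
lemma R1_diff: "v \<in> R1 n ==> w \<in> R1 n ==> v - w \<in> R1 n"
 unfolding R1_def by (auto simp: right_diff_distrib[symmetric])
lemma R1_sc: "v \<in> R1 n ==> sc S v \<in> R1 n"
 unfolding R1_def sc_def by (auto simp: mult.left_commute[of S])
lemma R1_th: "v \<in> R1 n ==> th v \<in> R1 n"
proof -
 assume "v \<in> R1 n"
 then obtain T where v: "v = (0, fps_X ^ n * T)" by (auto simp: R1_def)
 have "fps_X * fps_deriv (fps_X ^ n * T) = (fps_X * fps_deriv (fps_X ^ n)) * T + fps_X ^ n * (fps_X * fps_deriv T)" by (simp add: algebra_simps)
 then have "th v = (0, fps_X ^ n * (of_nat n * T + fps_X * fps_deriv T + T))" unfolding v th_def fst_conv snd_conv X_deriv_power by (simp add: algebra_simps)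
 then show ?thesis unfolding R1_def by blast
qed

lemma fps_X_deriv_nth: "fps_nth (fps_X * fps_deriv P) n = of_nat n * fps_nth P n" for P :: "complex fps" by (cases n) simp_all

lemma fps_X_factor: "fps_nth T 0 = 0 ==> T = fps_X * fps_shift 1 T" for T :: "complex fps"
proof (rule fps_ext)
 fix n assume "fps_nth T 0 = 0" then show "fps_nth T n = fps_nth (fps_X * fps_shift 1 T) n" by (cases n) simp_all
qed

lemma R1_bernstein: assumes M: "nice M (R1 n) pj" shows "bernstein M = [:of_nat (Suc n), 1:]"
proof -
 have th0: "th 0 = 0" by (simp add: th_def zero_prod_def)
 interpret sharp_model M "R1 n" pj "R1 n"
 proof
  show "\<exists>x\<in>R1 n. \<exists>y\<in>R1 n. v = x + th y" if "v \<in> R1 n" for v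
   by (rule bexI[OF _ that], rule bexI[OF _ R1_0]) (simp add: th0)
 qed (use M R1_diff R1_sc R1_th in auto)
 have "bernstein M = (\<Prod>mu\<in>{of_nat (Suc n)}. [:mu, 1:])"
 proof (rule bernstein_eq[where c = "%mu v. fps_nth (snd v) n"])
  fix mu :: complex and v
  assume "mu \<in> {of_nat (Suc n)}" "v \<in> R1 n"
  then show "fps_nth (snd (th v)) n = mu * fps_nth (snd v) n" by (auto simp: R1_def th_def fps_X_deriv_nth algebra_simps)
 next
  show "\<exists>v\<in>R1 n. fps_nth (snd v) n ~= 0" by (rule bexI[of _ "(0, fps_X ^ n * 1)"]) (auto simp: R1_def fps_X_power_mult_nth simp del: mult_1_right)
 next
  fix v assume "v \<in> R1 n"
  then obtain T where v: "v = (0, fps_X ^ n * T)" by (auto simp: R1_def)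
  have n: "fps_nth (fps_X ^ n * T) n = fps_nth T 0" by (simp add: fps_X_power_mult_nth)
  have "v \<in> XK \<longleftrightarrow> fps_nth T 0 = 0"
  proof
   assume "v \<in> XK"
   then obtain T' where "fps_X ^ n * T = fps_X * (fps_X ^ n * T')" unfolding XK_def v by (auto simp: R1_def sc_def)
   then have "fps_X ^ n * T = fps_X ^ Suc n * T'" by (simp add: mult_ac)
   from arg_cong[OF this, of "%F. fps_nth F n"] show "fps_nth T 0 = 0" unfolding n by (simp add: fps_X_power_mult_nth del: power_Suc)
  next
   assume "fps_nth T 0 = 0"
   then have "T = fps_X * fps_shift 1 T" by (rule fps_X_factor)
   then have "v = sc fps_X (0, fps_X ^ n * fps_shift 1 T)" unfolding v sc_def by (metis fst_conv mult.left_commute mult_zero_right snd_conv)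
   moreover have "(0, fps_X ^ n * fps_shift 1 T) \<in> R1 n" unfolding R1_def by blast
   ultimately show "v \<in> XK" unfolding XK_def by blast
  qed
  then show "v \<in> XK \<longleftrightarrow> (\<forall>mu\<in>{of_nat (Suc n)}. fps_nth (snd v) n = 0)" unfolding v snd_conv n by simp
 qed (simp_all add: sc_def)
 then show ?thesis by simp
qed

lemma R1_ab_module: assumes M: "nice M (R1 n) pj" shows "ab_module M"
proof (rule nice_ab_module[OF M, of "[(0, fps_X ^ n)]"])
 have "(0, fps_X ^ n * 1) \<in> R1 n" unfolding R1_def by blast
 then show "set [(0, fps_X ^ n)] \<subseteq> R1 n" by simp
 fix v assume "v \<in> R1 n"
 then obtain T where v: "v = (0, fps_X ^ n * T)" by (auto simp: R1_def)
 show "\<exists>!xs. length xs = length [(0 :: complex fps, fps_X ^ n :: complex fps)] & v = lc xs [(0, fps_X ^ n)]"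
 proof (rule ex1I[of _ "[T]"])
  fix xs assume "length xs = length [(0 :: complex fps, fps_X ^ n :: complex fps)] & v = lc xs [(0, fps_X ^ n)]"
  then show "xs = [T]" by (auto simp: length_Suc_conv v sc_def mult.commute)
 qed (simp add: v sc_def mult.commute)
qed

text \<open>The second component embeds it into C[[b]] with a = \<open>dabl 1\<close>, whatever n
  is: the factor X^n only describes the image inside E_1.\<close>

lemma R1_semi_simple: assumes M: "nice M (R1 n) pj" shows "semi_simple M"
 unfolding semi_simple_def
proof
 show "ab_module M" by (rule R1_ab_module[OF M])
 note d = niceD[OF M]
 obtain pjE where E: "abpres (E_mod 1) UNIV (*) (dabl 1) pjE" "inj pjE" using E_mod_presentation .
 note e = presentsD[OF abpresD(1)[OF E(1)]]
 have z: "fst v = 0" if "v \<in> R1 n" for v using that by (auto simp: R1_def)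
 let ?\<phi> = "%x. pjE (snd (inv_into (R1 n) pj x))"
 have "embeds M (E_mod 1)"
  unfolding embeds_def
 proof
  have zs: "(0, snd v) = v" if "v \<in> R1 n" for v using z[OF that] by (simp add: prod_eq_iff)
  have sn: "snd (sc S v) = S * snd v" for S v by (simp add: sc_def)
  have an: "snd (aN v) = dabl 1 (snd v)" if "v \<in> R1 n" for v using z[OF that] by (simp add: aN_def dabl_one)
  show "?\<phi> \<in> ab_hom M (E_mod 1)"
   unfolding ab_hom_def d(7) mem_Collect_eq
  proof (intro conjI ballI allI)
   show "?\<phi> \<in> pj ` R1 n \<rightarrow> carrier (E_mod 1)" unfolding e(4) by blast
   fix x assume "x \<in> pj ` R1 n"
   then obtain v where v: "x = pj v" "v \<in> R1 n" by blast
   show "?\<phi> (S \<odot>\<^bsub>M\<^esub> x) = S \<odot>\<^bsub>E_mod 1\<^esub> ?\<phi> x" for S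
    unfolding v(1) d(11)[OF v(2)] nice_inv[OF M v(2)] nice_inv[OF M d(10)[OF v(2)]] abpresD(3)[OF E(1) UNIV_I] sn ..
   show "?\<phi> (aop M x) = aop (E_mod 1) (?\<phi> x)"
    unfolding v(1) d(13)[OF v(2)] nice_inv[OF M v(2)] nice_inv[OF M d(12)[OF v(2)]] abpresD(5)[OF E(1) UNIV_I] an[OF v(2)] ..
   fix y assume "y \<in> pj ` R1 n"
   then obtain w where w: "y = pj w" "w \<in> R1 n" by blast
   show "?\<phi> (x \<oplus>\<^bsub>M\<^esub> y) = ?\<phi> x \<oplus>\<^bsub>E_mod 1\<^esub> ?\<phi> y"
    unfolding v(1) w(1) d(9)[OF v(2) w(2)] nice_inv[OF M v(2)] nice_inv[OF M w(2)] nice_inv[OF M d(5)[OF v(2) w(2)]] e(6)[OF UNIV_I UNIV_I] snd_add ..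
  qed
  show "inj_on ?\<phi> (carrier M)" unfolding d(7)
  proof (rule inj_onI)
   fix x y assume "x \<in> pj ` R1 n" "y \<in> pj ` R1 n" and h: "?\<phi> x = ?\<phi> y"
   then obtain v w where vw: "x = pj v" "v \<in> R1 n" "y = pj w" "w \<in> R1 n" by blast
   have "snd v = snd w" using injD[OF E(2) h] unfolding vw(1,3) nice_inv[OF M vw(2)] nice_inv[OF M vw(4)] .
   then have "v = w" using zs[OF vw(2)] zs[OF vw(4)] by metis
   then show "x = y" using vw by simp
  qed
 qed
 from embeds_dsum[OF this] show "\<exists>ls :: rat list. (\<forall>l\<in>set ls. 0 < l) & embeds M (ab_dsum (map (%l. E_mod (of_rat l)) ls))"
  by (intro exI[of _ "[1]"]) simp
qed

lemma nice_submodule: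
 assumes M: "nice M A pj" and m: "ab_module M" and B: "B \<subseteq> A" "0 \<in> B" "!!x y. x \<in> B ==> y \<in> B ==> x - y \<in> B" "!!S x. x \<in> B ==> sc S x \<in> B" "!!x. x \<in> B ==> aN x \<in> B"
 shows "ab_submodule M (pj ` B)"
proof -
 note d = niceD[OF M]
 interpret Module.module fps_ring M using m by (simp add: ab_module_def)
 have BA: "v \<in> A" if "v \<in> B" for v using that B(1) by blast
 have neg: "\<ominus>\<^bsub>M\<^esub> pj v = pj (0 - v)" if v: "v \<in> B" for v
 proof -
  have c: "pj v \<in> carrier M" using d(7) BA[OF v] by blast
  have "\<zero>\<^bsub>M\<^esub> \<ominus>\<^bsub>M\<^esub> pj v = pj (0 - v)" unfolding d(8) by (rule d(14)[OF d(4) BA[OF v]])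
  then show ?thesis using c by (simp add: M.minus_eq)
 qed
 have Badd: "x + y \<in> B" if "x \<in> B" "y \<in> B" for x y using B(3)[OF that(1) B(3)[OF B(2) that(2)]] by simp
 have "submodule (pj ` B) fps_ring M"
 proof (rule submoduleI)
  show "pj ` B \<subseteq> carrier M" using d(7) B(1) by blast
  show "\<zero>\<^bsub>M\<^esub> \<in> pj ` B" unfolding d(8) using B(2) by blast
  show "\<ominus>\<^bsub>M\<^esub> a \<in> pj ` B" if "a \<in> pj ` B" for a using that neg B(3)[OF B(2)] by blast
  show "a \<oplus>\<^bsub>M\<^esub> b \<in> pj ` B" if "a \<in> pj ` B" "b \<in> pj ` B" for a b using that d(9) BA Badd by (auto intro!: imageI)
  show "a \<odot>\<^bsub>M\<^esub> x \<in> pj ` B" if "x \<in> pj ` B" for a x using that d(11) BA B(4) by (auto intro!: imageI)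
 qed
 then show ?thesis unfolding ab_submodule_def using d(13) BA B(5) by auto
qed

lemma submodule_nice:
 assumes M: "nice M A pj" and m: "ab_module M" and S: "ab_submodule M S"
 defines "B \<equiv> {v \<in> A. pj v \<in> S}"
 shows "S = pj ` B" "nice (ab_sub M S) B pj"
proof -
 note d = niceD[OF M]
 interpret Module.module fps_ring M using m by (simp add: ab_module_def)
 have s: "submodule S fps_ring M" and a: "aop M ` S \<subseteq> S" using S by (simp_all add: ab_submodule_def)
 note e = submoduleE[OF s]
 show SB: "S = pj ` B" using e(1) d(7) by (auto simp: B_def)
 have R: "(S' :: complex fps) \<in> carrier fps_ring" for S' by (simp add: ring_of_type_algebra_def)
 have diff: "x - y \<in> B" if "x \<in> B" "y \<in> B" for x y
 proof -
  have "pj (x - y) = pj x \<oplus>\<^bsub>M\<^esub> (\<ominus>\<^bsub>M\<^esub> pj y)" using that d(14)[of x y] by (simp add: B_def M.minus_eq)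
  then show ?thesis using that e(3,5) d(6) by (simp add: B_def)
 qed
 have "B ~= {}" using SB e(2) by blast
 then have z: "0 \<in> B" using diff by fastforce
 have "nice (ab_sub M (pj ` B)) B pj"
 proof (rule nice_sub[OF M _ z diff])
  show "sc S' x \<in> B" if "x \<in> B" for S' x using that e(4)[OF R] d(10,11) by (auto simp: B_def) (metis d(11))
  show "aN x \<in> B" if "x \<in> B" for x using that a d(12,13) by (auto simp: B_def) (metis d(13) image_subset_iff)
 qed (auto simp: B_def)
 then show "nice (ab_sub M S) B pj" using SB by simp
qed

text \<open>A submodule containing a vector with nonzero first component is not semi-simple by
  \<open>not_semi_simple\<close>. So the vectors with zero first component contain every semi-simple
  submodule, and they form one by hypothesis.\<close>

lemma ss_part_eq:
 assumes M: "nice M A pj" and m: "ab_module M" and B: "B = {v \<in> A. fst v = 0}" and ss: "semi_simple (ab_sub M (pj ` B))"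
 shows "ss_part M = pj ` B"
 unfolding ss_part_def
proof (rule the_equality)
 note d = niceD[OF M]
 have sub: "ab_submodule M (pj ` B)"
 proof (rule nice_submodule[OF M m])
  show "B \<subseteq> A" unfolding B by blast
  show "0 \<in> B" using d(4) by (simp add: B)
  show "x - y \<in> B" if "x \<in> B" "y \<in> B" for x y using that d(6) by (simp add: B)
  show "sc S x \<in> B" if "x \<in> B" for S x using that d(10) by (simp add: B fst_sc)
  show "aN x \<in> B" if "x \<in> B" for x using that d(12) by (simp add: B fst_aN dab_0)
 qed
 have max: "S \<subseteq> pj ` B" if S: "ab_submodule M S" "semi_simple (ab_sub M S)" for S
 proof -
  note n = submodule_nice[OF M m S(1)]
  have "fst v = 0" if "v \<in> A" "pj v \<in> S" for v using not_semi_simple[OF n(2), of v] S(2) that by auto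
  then show ?thesis using n(1) unfolding B by blast
 qed
 show "ab_submodule M (pj ` B) & semi_simple (ab_sub M (pj ` B)) & (\<forall>S'. ab_submodule M S' & semi_simple (ab_sub M S') \<longrightarrow> S' \<subseteq> pj ` B)"
  using sub ss max by blast
 fix S assume "ab_submodule M S & semi_simple (ab_sub M S) & (\<forall>S'. ab_submodule M S' & semi_simple (ab_sub M S') \<longrightarrow> S' \<subseteq> S)"
 then show "S = pj ` B" using sub ss max by (intro equalityI) blast+
qed

lemma ab_sub_carrier: "ab_sub M (carrier M) = M" by (simp add: ab_sub_def)

lemma nice_quotient:
 assumes M: "nice M A pj" and B: "B \<subseteq> A" "0 \<in> B" "!!x y. x \<in> B ==> y \<in> B ==> x - y \<in> B" "!!S x. x \<in> B ==> sc S x \<in> B" "!!x. x \<in> B ==> aN x \<in> B"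
 shows "abpres (ab_quot M (pj ` B)) A sc aN (%x. pj ` B +>\<^bsub>M\<^esub> pj x)" "pker A (%x. pj ` B +>\<^bsub>M\<^esub> pj x) B"
proof -
 note d = niceD[OF M]
 have k: "pker A pj {0}" using inj_on_eq_iff[OF d(2)] by (simp add: pker_def)
 have h1: "{0} \<subseteq> B" using B(2) by simp
 have h3: "sc S x - sc S y \<in> B" if "x \<in> A" "y \<in> A" "x - y \<in> B" for S x y using B(4)[OF that(3), of S] by (simp add: sc_diff)
 have h4: "aN x - aN y \<in> B" if "x \<in> A" "y \<in> A" "x - y \<in> B" for x y using B(5)[OF that(3)] by (simp add: aN_diff)
 note q = abpres_quotient[OF d(1) k h1 B(1,2,3) h3 h4 refl]
 show "abpres (ab_quot M (pj ` B)) A sc aN (%x. pj ` B +>\<^bsub>M\<^esub> pj x)" by (rule q(1))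
 show "pker A (%x. pj ` B +>\<^bsub>M\<^esub> pj x) B" by (rule q(2))
qed

context theme2 begin

lemma G_fst: "{v \<in> G. fst v = 0} = R1 (Suc r)"
proof
 show "{v \<in> G. fst v = 0} \<subseteq> R1 (Suc r)"
 proof
  fix v assume v: "v \<in> {v \<in> G. fst v = 0}"
  then obtain S T where ST: "v = sc S g0 + sc T h0" by (auto simp: G_def)
  have "p ~= 0" using p0 by auto
  then have "S = 0" using v by (simp add: ST sc_def g0_def h0_def)
  then have "v = (0, fps_X ^ Suc r * T)" by (simp add: ST sc_def h0_def mult.commute)
  then show "v \<in> R1 (Suc r)" unfolding R1_def by blast
 qed
 show "R1 (Suc r) \<subseteq> {v \<in> G. fst v = 0}"
 proof
  fix v assume "v \<in> R1 (Suc r)"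
  then obtain T where "v = (0, fps_X ^ Suc r * T)" by (auto simp: R1_def)
  then have "v = sc T h0" by (simp add: sc_def h0_def mult.commute)
  then show "v \<in> {v \<in> G. fst v = 0}" using G_sc[OF h0_G, of T] by (simp add: sc_def h0_def)
 qed
qed

lemma G_image: "(%v. (0 :: complex fps, fst v)) ` G = R1 q"
proof
 show "(%v. (0 :: complex fps, fst v)) ` G \<subseteq> R1 q"
 proof
  fix w assume "w \<in> (%v. (0 :: complex fps, fst v)) ` G"
  then obtain S T where "w = (0, fst (sc S g0 + sc T h0))" by (auto simp: G_def)
  then have "w = (0, fps_X ^ q * (S * p))" by (simp add: sc_def g0_def h0_def mult_ac)
  then show "w \<in> R1 q" unfolding R1_def by blast
 qed
 show "R1 q \<subseteq> (%v. (0 :: complex fps, fst v)) ` G"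
 proof
  fix w assume "w \<in> R1 q"
  then obtain T where w: "w = (0, fps_X ^ q * T)" by (auto simp: R1_def)
  have "T * inverse p * (fps_X ^ q * p) = fps_X ^ q * T * (p * inverse p)" by (simp only: mult_ac)
  then have "w = (0, fst (sc (T * inverse p) g0))" unfolding w p_inv by (simp add: sc_def g0_def)
  then show "w \<in> (%v. (0 :: complex fps, fst v)) ` G" using G_sc[OF g0_G] by blast
 qed
qed

text \<open>The socle is the kernel of the first component, and the quotient is its image X^q
  C[[b]], which is semi-simple of rank one. So the filtration stops at the second step, the
  remaining rank is 0, and no shift of the variable occurs.\<close>

lemma G_ss_filt:
 assumes M: "nice M G pj"
 shows "ss_filt M 1 = pj ` R1 (Suc r)" "ss_filt M 2 = carrier M"
  "bernstein_j M 2 = [:of_nat (Suc q), 1:]"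
proof -
 note d = niceD[OF M]
 have mM: "ab_module M" by (rule G_theme(3)[OF M])
 define B where "B = R1 (Suc r)"
 have B: "B = {v \<in> G. fst v = 0}" using G_fst by (simp add: B_def)
 have b1: "B \<subseteq> G" unfolding B by blast
 have b2: "0 \<in> B" by (simp add: B G_0)
 have b3: "x - y \<in> B" if "x \<in> B" "y \<in> B" for x y using that by (simp add: B G_diff)
 have b4: "sc S x \<in> B" if "x \<in> B" for S x using that by (simp add: B G_sc fst_sc)
 have b5: "aN x \<in> B" if "x \<in> B" for x using that by (simp add: B G_aN fst_aN dab_0)
 note Bc = b1 b2 b3 b4 b5
 have z: "pj ` {0} = {\<zero>\<^bsub>M\<^esub>}" by (simp add: d(8))
 \<comment> \<open>The filtration starts with the quotient by the zero submodule, whose elements are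
   singleton cosets.\<close>
 define M0 where "M0 = ab_quot M {\<zero>\<^bsub>M\<^esub>}"
 define pj0 where "pj0 x = {\<zero>\<^bsub>M\<^esub>} +>\<^bsub>M\<^esub> pj x" for x
 have aN0: "aN 0 = 0" using aN_diff[of 0 0] by simp
 have s0: "{0} \<subseteq> G" "0 \<in> {0 :: jordan2}" using d(4) by auto
 have s1: "x - y \<in> {0}" if "x \<in> {0}" "y \<in> {0}" for x y :: "jordan2" using that by simp
 have s2: "sc S x \<in> {0}" if "x \<in> {0}" for S x using that by simp
 have s3: "aN x \<in> {0}" if "x \<in> {0}" for x using that by (simp add: aN0)
 note q0 = nice_quotient[OF M s0 s1 s2 s3, unfolded z]
 have M0: "nice M0 G pj0"
  unfolding nice_def M0_def pj0_def[abs_def] using q0 by (auto simp: pker_def inj_on_def)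
 have "ss_part M0 = pj0 ` B"
 proof (rule ss_part_eq[OF M0 G_theme(3)[OF M0] B])
  have "nice (ab_sub M0 (pj0 ` B)) B pj0" by (rule nice_sub[OF M0 Bc])
  then show "semi_simple (ab_sub M0 (pj0 ` B))" unfolding B_def by (rule R1_semi_simple)
 qed
 then have "ss_filt M 1 = {x \<in> carrier M. {\<zero>\<^bsub>M\<^esub>} +>\<^bsub>M\<^esub> x \<in> pj0 ` B}" by (simp add: M0_def)
 also have "\<dots> = pj ` B"
 proof -
  have "pj0 v \<in> pj0 ` B \<longleftrightarrow> v \<in> B" if "v \<in> G" for v using inj_on_image_mem_iff[OF niceD(2)[OF M0] that Bc(1)] .
  then show ?thesis unfolding d(7) pj0_def[symmetric] using Bc(1) by (auto simp: pj0_def)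
 qed
 finally have f1: "ss_filt M 1 = pj ` B" .
 then show "ss_filt M 1 = pj ` R1 (Suc r)" by (simp add: B_def)
 define M1 where "M1 = ab_quot M (pj ` B)"
 define pj1 where "pj1 x = pj ` B +>\<^bsub>M\<^esub> pj x" for x
 note nq = nice_quotient[OF M Bc]
 have q11: "abpres M1 G sc aN pj1" unfolding M1_def pj1_def[abs_def] by (rule nq(1))
 have q12: "pker G pj1 B" unfolding pj1_def[abs_def] by (rule nq(2))
 note q1 = q11 q12
 define \<phi> where "\<phi> w = (0 :: complex fps, fst w)" for w :: "jordan2"
 have f1a: "\<phi> (x + y) = \<phi> x + \<phi> y" for x y by (simp add: \<phi>_def)
 have f2a: "\<phi> (sc S x) = sc S (\<phi> x)" for S x by (simp add: \<phi>_def sc_def)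
 have f3a: "\<phi> (aN x) = aN (\<phi> x)" for x by (simp add: \<phi>_def aN_def dab_0)
 have f4a: "\<phi> x = \<phi> y \<longleftrightarrow> pj1 x = pj1 y" if "x \<in> G" "y \<in> G" for x y
  using q1(2) that d(6)[OF that] by (simp add: pker_def B \<phi>_def)
 have f5a: "\<phi> ` G = R1 q" using G_image by (simp add: \<phi>_def[abs_def])
 obtain pj' where "abpres M1 (R1 q) sc aN pj'" "inj_on pj' (R1 q)"
  by (rule abpres_transport[OF q1(1) f1a f4a f2a f3a f5a])
 then have n1: "nice M1 (R1 q) pj'" by (simp add: nice_def)
 note d1 = niceD[OF n1]
 have "ss_part M1 = pj' ` R1 q"
 proof (rule ss_part_eq[OF n1 R1_ab_module[OF n1]])
  show "R1 q = {v \<in> R1 q. fst v = 0}" by (auto simp: R1_def)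
  show "semi_simple (ab_sub M1 (pj' ` R1 q))" unfolding d1(7)[symmetric] ab_sub_carrier by (rule R1_semi_simple[OF n1])
 qed
 then have s: "ss_part M1 = carrier M1" by (simp add: d1(7))
 have "ss_filt M (Suc 1) = {x \<in> carrier M. pj ` B +>\<^bsub>M\<^esub> x \<in> ss_part M1}" unfolding ss_filt.simps(2)[of M 1] f1 M1_def ..
 also have "\<dots> = carrier M"
  unfolding s presentsD(4)[OF abpresD(1)[OF q1(1)]] d(7) by (auto simp: pj1_def)
 finally show f2: "ss_filt M 2 = carrier M" by (simp only: Suc_1)
 have "pj g0 \<notin> pj ` B"
 proof
  assume "pj g0 \<in> pj ` B"
  then have "g0 \<in> B" using inj_on_image_mem_iff[OF d(2) g0_G Bc(1)] by blast
  then show False using p0 by (auto simp: B g0_def)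
 qed
 then have ne: "ss_filt M 2 ~= ss_filt M (2 - 1)" using f1 f2 d(7) g0_G by auto
 have rk: "ab_rank (ab_quot M (carrier M)) = 0"
 proof -
  note q2 = nice_quotient[OF M subset_refl d(4) d(6) d(10) d(12)]
  define pj2 where "pj2 x = pj ` G +>\<^bsub>M\<^esub> pj x" for x
  have q31: "abpres (ab_quot M (pj ` G)) G sc aN pj2" unfolding pj2_def[abs_def] by (rule q2(1))
  have q32: "pker G pj2 G" unfolding pj2_def[abs_def] by (rule q2(2))
  note q3 = q31 q32
  note p2 = presentsD[OF abpresD(1)[OF q3(1)]]
  have e: "pj2 x = pj2 0" if "x \<in> G" for x using q3(2) that d(4) by (simp add: pker_def)
  show ?thesis unfolding d(7)
  proof (rule rank0[OF abpresD(1)[OF q3(1)]])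
   show "carrier (ab_quot M (pj ` G)) = {\<zero>\<^bsub>ab_quot M (pj ` G)\<^esub>}" unfolding p2(4,5) using e d(4) by blast
   show "S \<odot>\<^bsub>ab_quot M (pj ` G)\<^esub> \<zero>\<^bsub>ab_quot M (pj ` G)\<^esub> = \<zero>\<^bsub>ab_quot M (pj ` G)\<^esub>" for S
    unfolding p2(5) using abpresD(3)[OF q3(1) d(4), of S] by simp
  qed
 qed
 have "bernstein_j M 2 = pcompose (bernstein M1) [:- of_nat 0, 1:]"
  unfolding bernstein_j_def using ne f1 by (simp add: f2 rk ab_sub_carrier M1_def)
 also have "\<dots> = bernstein M1" by (simp add: pcompose_idR)
 also have "\<dots> = [:of_nat (Suc q), 1:]" by (rule R1_bernstein[OF n1])
 finally show "bernstein_j M 2 = [:of_nat (Suc q), 1:]" .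
qed

text \<open>The vector b^-1 \<open>h0\<close>. Since b^-1 a g0 = \<open>t1\<close> g0 +
  \<open>w0\<close> k0 with a unit \<open>w0\<close>, adjoining it gives the saturation.\<close>

definition k0 :: "jordan2" where "k0 = (0, fps_X ^ r)"
definition K0 :: "(jordan2) set" where "K0 = {sc S g0 + sc T k0 | S T. True}"
definition t1 :: "complex fps" where "t1 = of_nat (Suc q) + fps_X * fps_deriv p * inverse p"

lemma h0_k0: "h0 = sc fps_X k0" by (simp add: h0_def k0_def sc_def)

lemma th_g0: "th g0 = sc t1 g0 + sc w0 k0"
proof (rule sc_cancel[of 1])
 have "tt = fps_X * t1" by (simp add: tt_def t1_def algebra_simps power2_eq_square)
 then have "sc tt g0 + sc w0 h0 = sc fps_X (sc t1 g0 + sc w0 k0)" unfolding h0_k0 by (simp add: sc_add sc_mult[symmetric] mult.commute)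
 then show "sc (fps_X ^ 1) (th g0) = sc (fps_X ^ 1) (sc t1 g0 + sc w0 k0)" using aN_g0 aN_th[of g0] by simp
qed

lemma th_k0: "th k0 = sc (of_nat (Suc r)) k0"
proof -
 show ?thesis unfolding th_def k0_def sc_def fst_conv snd_conv X_deriv_power by (simp add: algebra_simps)
qed

lemma K0_I: "sc S g0 + sc T k0 \<in> K0" unfolding K0_def by blast

text \<open>The coefficient of X^q in the first component and that of X^r in the second are
  eigenfunctionals for q + 1 and r + 1. The second one is so because the first component starts at
  X^q with q > r, so the logarithmic term does not reach degree r.\<close>

lemma G_bernstein:
 assumes M: "nice M G pj" and rq: "r < q"
 shows "bernstein M = [:of_nat (Suc q), 1:] * [:of_nat (Suc r), 1:]"
proof -
 interpret sharp_model M G pj K0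
 proof
  show "nice M G pj" by (rule M)
  show "G \<subseteq> K0"
  proof
   fix v assume "v \<in> G"
   then obtain S T where "v = sc S g0 + sc T h0" by (auto simp: G_def)
   then have "v = sc S g0 + sc (T * fps_X) k0" by (simp add: h0_k0 sc_mult)
   then show "v \<in> K0" using K0_I by simp
  qed
  fix v assume "v \<in> K0"
  then obtain S T where v: "v = sc S g0 + sc T k0" by (auto simp: K0_def)
  show "sc S' v \<in> K0" for S' using K0_I[of "S' * S" "S' * T"] by (simp add: v sc_add sc_mult)
  have "th v = sc (S * t1 + fps_X * fps_deriv S) g0 + sc (S * w0 + T * of_nat (Suc r) + fps_X * fps_deriv T) k0"
   unfolding v th_add th_sc th_g0 th_k0 by (simp add: sc_add sc_mult sc_add_left add_ac)
  then show "th v \<in> K0" using K0_I by simp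
  have "sc fps_X v = sc (fps_X * S) g0 + sc T h0" by (simp add: v h0_k0 sc_add sc_mult[symmetric] mult.commute)
  then show "sc fps_X v \<in> G" unfolding G_def by blast
  define C where "C = T * inverse w0"
  have C: "C * w0 = T" using inverse_mult_eq_1[OF w0_0] by (simp add: C_def mult.assoc)
  have "th (sc C g0) = sc (C * t1) g0 + sc T k0 + sc (fps_X * fps_deriv C) g0"
   unfolding th_sc th_g0 sc_add sc_mult[symmetric] C ..
  then have "v = sc (S - C * t1 - fps_X * fps_deriv C) g0 + th (sc C g0)" by (simp add: v sc_diff_left)
  then show "\<exists>x\<in>G. \<exists>y\<in>G. v = x + th y" using G_sc[OF g0_G] by blast
  fix w assume "w \<in> K0"
  then obtain S' T' where w: "w = sc S' g0 + sc T' k0" by (auto simp: K0_def)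
  have "v - w = sc (S - S') g0 + sc (T - T') k0" by (simp add: v w sc_diff_left)
  then show "v - w \<in> K0" using K0_I by simp
 qed
 have n: "(of_nat (Suc q) :: complex) ~= of_nat (Suc r)" using rq by (simp only: of_nat_eq_iff)
 define c where "c mu w = (if mu = of_nat (Suc q) then fps_nth (fst w) q else fps_nth (snd w) r)" for mu :: complex and w :: "jordan2"
 have form: "fst (sc S g0 + sc T k0) = fps_X ^ q * (S * p)" "snd (sc S g0 + sc T k0) = fps_X ^ r * (S * v + T)" for S T
  by (simp_all add: sc_def g0_def k0_def algebra_simps)
 have "bernstein M = (\<Prod>mu\<in>{of_nat (Suc q), of_nat (Suc r)}. [:mu, 1:])"
 proof (rule bernstein_eq[where c = c])
  fix mu :: complex and w assume m: "mu \<in> {of_nat (Suc q), of_nat (Suc r)}" "w \<in> K0"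
  then obtain S T where w: "w = sc S g0 + sc T k0" by (auto simp: K0_def)
  have "fps_nth (fst w) r = 0" unfolding w form using rq by (simp add: fps_X_power_mult_nth)
  then show "c mu (th w) = mu * c mu w" using m(1) n by (auto simp: c_def th_def fps_X_deriv_nth algebra_simps simp del: of_nat_Suc) (simp_all add: algebra_simps)
 next
  fix mu :: complex assume "mu \<in> {of_nat (Suc q), of_nat (Suc r)}"
  moreover have "c (of_nat (Suc q)) (sc 1 g0 + sc 0 k0) ~= 0" unfolding c_def form using p0 by (simp add: fps_X_power_mult_nth)
  moreover have "c (of_nat (Suc r)) (sc 0 g0 + sc 1 k0) ~= 0" unfolding c_def form using n by (simp add: fps_X_power_mult_nth del: of_nat_Suc)
  ultimately show "\<exists>v\<in>K0. c mu v ~= 0" using K0_I by blast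
 next
  fix w assume "w \<in> K0"
  then obtain S T where w: "w = sc S g0 + sc T k0" by (auto simp: K0_def)
  have "(\<forall>mu\<in>{of_nat (Suc q), of_nat (Suc r)}. c mu w = 0) \<longleftrightarrow> fps_nth (fst w) q = 0 & fps_nth (snd w) r = 0"
   using n by (auto simp: c_def simp del: of_nat_Suc)
  also have "\<dots> \<longleftrightarrow> fps_nth S 0 = 0 & fps_nth T 0 = 0"
   unfolding w form using p0 by (auto simp: fps_X_power_mult_nth)
  also have "\<dots> \<longleftrightarrow> w \<in> XK"
  proof
   assume a: "fps_nth S 0 = 0 & fps_nth T 0 = 0"
   have "w = sc (fps_X * fps_shift 1 S) g0 + sc (fps_X * fps_shift 1 T) k0"
    unfolding w using fps_X_factor[of S] fps_X_factor[of T] a by metis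
   then have "w = sc fps_X (sc (fps_shift 1 S) g0 + sc (fps_shift 1 T) k0)" by (simp add: sc_add sc_mult)
   then show "w \<in> XK" unfolding XK_def using K0_I by blast
  next
   assume "w \<in> XK"
   then obtain u where u: "w = sc fps_X u" "u \<in> K0" unfolding XK_def by blast
   obtain S' T' where "u = sc S' g0 + sc T' k0" using u(2) unfolding K0_def by blast
   then have "w = sc fps_X (sc S' g0 + sc T' k0)" using u(1) by simp
   then have w': "w = sc (fps_X * S') g0 + sc (fps_X * T') k0" by (simp add: sc_add sc_mult)
   have f: "fst w = fps_X ^ q * (fps_X * S' * p)" "snd w = fps_X ^ r * (fps_X * S' * v + fps_X * T')" unfolding w' form by simp_all
   have "fps_nth (fst w) q = 0" "fps_nth (snd w) r = 0" unfolding f by (simp_all add: fps_X_power_mult_nth mult.assoc)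
   then show "fps_nth S 0 = 0 & fps_nth T 0 = 0" unfolding w form using p0 by (auto simp: fps_X_power_mult_nth)
  qed
  finally show "w \<in> XK \<longleftrightarrow> (\<forall>mu\<in>{of_nat (Suc q), of_nat (Suc r)}. c mu w = 0)" by blast
 qed (simp_all add: c_def sc_def)
 also have "\<dots> = [:of_nat (Suc q), 1:] * [:of_nat (Suc r), 1:]" using n by (simp del: of_nat_Suc)
 finally show ?thesis .
qed

lemma G_rsquarefree: assumes M: "nice M G pj" and rq: "r < q" shows "rsquarefree (bernstein M)"
proof -
 define a b :: complex where "a = of_nat (Suc q)" and "b = of_nat (Suc r)"
 have n: "a ~= b" unfolding a_def b_def using rq by (simp only: of_nat_eq_iff)
 have "\<not> (poly ([:a, 1:] * [:b, 1:]) x = 0 & poly (pderiv ([:a, 1:] * [:b, 1:])) x = 0)" for x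
 proof
  assume h: "poly ([:a, 1:] * [:b, 1:]) x = 0 & poly (pderiv ([:a, 1:] * [:b, 1:])) x = 0"
  have e: "poly [:a, 1:] x = a + x" "poly [:b, 1:] x = b + x" by simp_all
  have dd: "pderiv [:a, 1:] = 1" "pderiv [:b, 1:] = 1" by (simp_all add: pderiv_pCons)
  have h1: "(a + x) * (b + x) = 0" using h unfolding poly_mult e by blast
  have h2: "(a + x) + (b + x) = 0" using h unfolding pderiv_mult dd poly_add poly_mult e by (simp only: poly_1 mult_1_right simp_thms)
  have "a + x = 0 \<or> b + x = 0" using h1 by (simp only: mult_eq_0_iff)
  then have "a + x = 0 & b + x = 0"
  proof
   assume z: "a + x = 0"
   show ?thesis using z h2[unfolded z add_0_left] by (rule conjI)
  next
   assume z: "b + x = 0"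
   show ?thesis using h2[unfolded z add_0_right] z by (rule conjI)
  qed
  then have "a + x = b + x" by simp
  then show False using n by simp
 qed
 then show ?thesis unfolding G_bernstein[OF M rq] a_def[symmetric] b_def[symmetric] rsquarefree_roots by blast
qed

end

section \<open>The four frescos\<close>

context klein begin

lemma inv7_fp: assumes "inv7 P" shows "inv7 (fp * P)"
proof -
 have e: "fp * P = cX * (cY * (cY * (cY * P))) + cY * (cZ * (cZ * (cZ * P))) + cX * (cX * (cX * (cZ * P))) + cc lam * (cX * (cY * (cZ * P)))"
  by (simp add: fp_def power2_eq_square power3_eq_cube algebra_simps)
 have 7: "pz 7 P = P" using pz_7[of 0 P] assms by (simp add: inv7_def)
 have 14: "pz 14 P = P" using pz_7[of 7 P] 7 by simp
 have n: "0 + 1 + 2 + 2 + 2 = (7 :: nat)" "0 + 2 + 4 + 4 + 4 = (14 :: nat)" "0 + 1 + 1 + 1 + 4 = (7 :: nat)" "0 + 1 + 2 + 4 = (7 :: nat)" by simp_all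
 show ?thesis unfolding inv7_def e by (simp only: pz_add pz_cc pz_var n 7 14)
qed

lemma inv7_beta: assumes "inv7 P" shows "inv7 (beta P)"
proof -
 define E where "E = Einv P"
 have E: "inv7 E" unfolding E_def Einv_def by (rule inv7_dg[OF assms])
 have 7: "pz 7 E = E" using pz_7[of 0 E] E by (simp add: inv7_def)
 have m: "inv7 (cX * (cY * (cZ * E)))" unfolding inv7_def by (simp add: pz_var 7)
 have e: "beta P = cc 4 * (fp * E) - cc lam * (cX * (cY * (cZ * E)))"
  unfolding beta_def E_def[symmetric] by (simp add: cc_numeral algebra_simps)
 show ?thesis unfolding e by (intro inv7_diff inv7_cc inv7_fp E m)
qed

lemma inv7_beta_funpow: "inv7 P ==> inv7 ((beta ^^ n) P)" by (induction n) (auto simp: inv7_beta)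

lemma fp_funpow: "((*) fp ^^ i) v = fp ^ i * v" by (induction i) (simp_all add: mult.assoc)

lemma pop_smp: "pop smp ((*) fp) p v = (\<Sum>i\<le>Polynomial.degree p. cc (Polynomial.coeff p i) * (fp ^ i * v))"
 by (simp add: pop_def fp_funpow smp_const)

lemma smp_X_fun: "smp fps_X = beta" by (rule ext) (rule smp_X)

lemma inv7_fp_power: "inv7 P ==> inv7 (fp ^ i * P)" by (induction i) (simp_all add: inv7_fp mult.assoc)

text \<open>For every L the difference agrees up to order L with a finite sum of elements of
  \<open>Dhat\<close>, and \<open>Dhat\<close> is closed. So an infinite sum of multiples of b^nu,
  nu >= N, is one multiple of b^N.\<close>

lemma fsum_tail_Dhat:
 assumes o: "!!nu. ordge nu (t nu)" and Q: "!!nu. t nu - (beta ^^ nu) (Q nu) \<in> Dhat"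
 shows "fsum t - (\<Sum>nu<N. t nu) - (beta ^^ N) (fsum (%m. (beta ^^ m) (Q (m + N)))) \<in> Dhat"
proof (rule cl3_limit[OF Dhat_closed[symmetric]])
 fix L
 define Z where "Z = fsum (%m. (beta ^^ m) (Q (m + N)))"
 have S: "(\<Sum>nu<N + L. t nu) = (\<Sum>nu<N. t nu) + (\<Sum>m<L. t (m + N))" by (induction L) (simp_all add: add_ac)
 have 1: "ordge L (fsum t - (\<Sum>nu<N + L. t nu))" by (rule ordge_mono[OF ordge_fsum[OF o]]) simp
 have 2: "ordge L ((beta ^^ N) (Z - (\<Sum>m<L. (beta ^^ m) (Q (m + N)))))"
  unfolding Z_def by (rule beta_funpow_ordge[OF ordge_fsum]) (rule ordge_beta_funpow)
 define D where "D = (\<Sum>m<L. t (m + N) - (beta ^^ (m + N)) (Q (m + N)))"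
 have D: "D \<in> Dhat" unfolding D_def by (rule sub3_sum[OF sub3_Dhat]) (rule Q)
 have b: "(beta ^^ N) (\<Sum>m<L. (beta ^^ m) (Q (m + N))) = (\<Sum>m<L. (beta ^^ (m + N)) (Q (m + N)))"
  unfolding beta_funpow_sum by (rule sum.cong[OF refl]) (simp only: funpow_add o_apply add.commute[of _ N])
 have eq: "fsum t - (\<Sum>nu<N. t nu) - (beta ^^ N) Z - D = (fsum t - (\<Sum>nu<N + L. t nu)) - (beta ^^ N) (Z - (\<Sum>m<L. (beta ^^ m) (Q (m + N))))"
  unfolding S D_def beta_funpow_diff b sum_subtractf by simp
 have "ordge L (fsum t - (\<Sum>nu<N. t nu) - (beta ^^ N) Z - D)" unfolding eq by (rule ordge_diff[OF 1 2])
 with D show "\<exists>Q'\<in>Dhat. ordge L (fsum t - (\<Sum>nu<N. t nu) - (beta ^^ N) (fsum (%m. (beta ^^ m) (Q (m + N)))) - Q')" unfolding Z_def by blast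
qed

text \<open>The action of a series in a and b lifted to formal series; its terms have growing order
  and are summed there. \<open>act_part\<close> identifies the remainder after N terms as a multiple
  of b^N modulo torsion.\<close>

definition act :: "atilde => ps3 => ps3" where "act u P = fsum (%nu. pop smp ((*) fp) (u nu) ((beta ^^ nu) P))"

lemma act_inv7: "inv7 P ==> inv7 (act u P)"
 unfolding act_def pop_smp by (intro inv7_fsum inv7_sum inv7_cc inv7_fp_power inv7_beta_funpow)

lemma act_part: "\<exists>Z. act u P - (part smp ((*) fp) u N P + (beta ^^ N) Z) \<in> KK"
proof -
 define t where "t nu = pop smp ((*) fp) (u nu) ((beta ^^ nu) P)" for nu
 have o: "ordge nu (t nu)" for nu
  unfolding t_def pop_smp
 proof (intro ordge_sum ordge_cc)
  fix i show "ordge nu (fp ^ i * (beta ^^ nu) P)" by (rule ordge_mono[OF ordge_fp_power[OF ordge_beta_funpow]]) simp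
 qed
 have "\<exists>Q. t nu - (beta ^^ nu) Q \<in> Dhat" for nu
 proof -
  have "\<forall>i. \<exists>Q. fp ^ i * (beta ^^ nu) P - (beta ^^ nu) Q \<in> Dhat" using beta_fp_power_funpow by blast
  from choice[OF this] obtain Q where Q: "!!i. fp ^ i * (beta ^^ nu) P - (beta ^^ nu) (Q i) \<in> Dhat" by blast
  let ?c = "%i. cc (Polynomial.coeff (u nu) i)"
  have "t nu - (beta ^^ nu) (\<Sum>i\<le>Polynomial.degree (u nu). ?c i * Q i) = (\<Sum>i\<le>Polynomial.degree (u nu). ?c i * (fp ^ i * (beta ^^ nu) P - (beta ^^ nu) (Q i)))"
   unfolding t_def pop_smp beta_funpow_sum beta_funpow_cc right_diff_distrib sum_subtractf ..
  also have "\<dots> \<in> Dhat" by (intro sub3_sum[OF sub3_Dhat] sub3_cc[OF sub3_Dhat] Q)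
  finally show ?thesis by blast
 qed
 then obtain Q where Q: "!!nu. t nu - (beta ^^ nu) (Q nu) \<in> Dhat" by metis
 have p: "part smp ((*) fp) u N P = (\<Sum>nu<N. t nu)" by (simp add: part_def t_def smp_X_fun)
 have a: "act u P = fsum t" by (simp add: act_def t_def[abs_def])
 have "act u P - (part smp ((*) fp) u N P + (beta ^^ N) (fsum (%m. (beta ^^ m) (Q (m + N))))) \<in> Dhat"
  using fsum_tail_Dhat[of t Q N, OF o Q] unfolding a p diff_diff_eq .
 then show ?thesis using Dhat_Khat Khat_KK by blast
qed

lemma LL_sum: "LL (sum g B) = (\<Sum>b\<in>B. LL (g b))"
proof (induction B rule: infinite_finite_induct)
 case empty
 show ?case using LL_diff[of 0 0] by simp
next
 case (infinite B)
 then show ?case using LL_diff[of 0 0] by simp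
qed (simp add: LL_add)

lemma LL_part: "LL (part smp ((*) fp) u N P) = part sc aN u N (LL P)"
proof -
 have f: "LL (fp ^ i * v) = (aN ^^ i) (LL v)" for i v by (induction i) (simp_all add: mult.assoc LL_fp)
 have "LL (pop smp ((*) fp) p v) = pop sc aN p (LL v)" for p v
  unfolding pop_smp LL_sum LL_cc f by (simp only: pop_def)
 then show ?thesis by (simp add: part_def LL_sum smp_X_fun sc_funpow LL_beta_funpow)
qed

lemma LL_act: "\<exists>z. LL (act u P) = part sc aN u N (LL P) + sc (fps_X ^ N) z"
proof -
 obtain Z where Z: "act u P - (part smp ((*) fp) u N P + (beta ^^ N) Z) \<in> KK" using act_part by blast
 have "LL (act u P) - (part sc aN u N (LL P) + sc (fps_X ^ N) (LL Z)) = 0"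
  using LL_KK[OF Z] by (simp only: LL_diff LL_add LL_part LL_beta_funpow)
 then show ?thesis by (intro exI[of _ "LL Z"]) simp
qed

end

context klein_germ begin

lemma H_at_act: "at_act (H_mod f) u (piH P) = piH (act u P)"
proof (rule abpres_at_act[OF H_abpres H_pker UNIV_I UNIV_I])
 show "v - w \<in> KK" if "v \<in> KK" "w \<in> KK" for v w by (rule sub3_diff[OF sub3_KK that])
 show "(smp fps_X ^^ N) (v - w) = (smp fps_X ^^ N) v - (smp fps_X ^^ N) w" for N v w unfolding smp_X_fun by (rule beta_funpow_diff)
 show "w \<in> KK" if "!!N. \<exists>z\<in>UNIV. w - (smp fps_X ^^ N) z \<in> KK" for w
  by (rule separated) (use that in \<open>simp add: smp_X_fun\<close>)
 show "\<exists>z\<in>UNIV. act u P - (part smp ((*) fp) u N P + (smp fps_X ^^ N) z) \<in> KK" for N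
  using act_part[of u P N] by (simp add: smp_X_fun)
qed

text \<open>The orbit of P consists of invariant series, on which \<open>piH\<close> and
  \<open>LL\<close> have the same fibres by \<open>LL_injective\<close>. Under \<open>LL\<close> the
  orbit becomes that of \<open>g0\<close>, which is all of G, so the fresco is isomorphic to
  G.\<close>

lemma fresco_nice:
 assumes \<omega>: "has_ps \<omega> P" "inv7 P" and t: "theme2 q r p v" and L: "LL P = theme2.g0 q r p v"
 obtains pj where "nice (F_fresco f \<omega>) (theme2.G q r p v) pj"
proof -
 interpret theme2 q r p v by (rule t)
 define W where "W = {Q. inv7 Q & LL Q \<in> G}"
 have LG: "LL (act u P) \<in> G" and LA: "!!y. (!!N. \<exists>z\<in>G. y = part sc aN u N g0 + sc (fps_X ^ N) z) ==> LL (act u P) = y" for u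
 proof -
  show 1: "LL (act u P) = y" if y: "!!N. \<exists>z\<in>G. y = part sc aN u N g0 + sc (fps_X ^ N) z" for y
  proof -
   have "LL (act u P) - y = 0"
   proof (rule N2_separated)
    fix N
    obtain z where z: "y = part sc aN u N g0 + sc (fps_X ^ N) z" using y by blast
    obtain z' where z': "LL (act u P) = part sc aN u N (LL P) + sc (fps_X ^ N) z'" using LL_act by blast
    have "LL (act u P) - y = sc (fps_X ^ N) (z' - z)" unfolding z z' L sc_diff by simp
    then show "\<exists>z. LL (act u P) - y = sc (fps_X ^ N) z" by blast
   qed
   then show ?thesis by simp
  qed
  obtain y where y: "y \<in> G" "!!N. \<exists>z\<in>G. y = part sc aN u N g0 + sc (fps_X ^ N) z" using action_exists[of u] by blast
  show "LL (act u P) \<in> G" using 1[OF y(2)] y(1) by simp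
 qed
 have surj: "\<exists>u. LL (act u P) = y" if "y \<in> G" for y using action_surj[OF that] LA by blast
 have ker: "piH Q = piH R \<longleftrightarrow> LL Q = LL R" if QR: "inv7 Q" "inv7 R" for Q R
 proof -
  have "piH Q = piH R \<longleftrightarrow> Q - R \<in> KK" using H_pker by (simp add: pker_def)
  also have "\<dots> \<longleftrightarrow> LL (Q - R) = 0" using LL_KK LL_injective[OF inv7_diff[OF QR]] by blast
  finally show ?thesis by (simp add: LL_diff)
 qed
 have "at_span (H_mod f) (piH P) = piH ` W"
 proof
  show "at_span (H_mod f) (piH P) \<subseteq> piH ` W"
   unfolding at_span_def H_at_act W_def using act_inv7[OF \<omega>(2)] LG by blast
  show "piH ` W \<subseteq> at_span (H_mod f) (piH P)"
  proof
   fix x assume "x \<in> piH ` W"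
   then obtain Q where Q: "x = piH Q" "inv7 Q" "LL Q \<in> G" by (auto simp: W_def)
   obtain u where "LL (act u P) = LL Q" using surj[OF Q(3)] by blast
   then have "x = at_act (H_mod f) u (piH P)" unfolding H_at_act Q(1) using ker[OF Q(2) act_inv7[OF \<omega>(2)]] by simp
   then show "x \<in> at_span (H_mod f) (piH P)" unfolding at_span_def by blast
  qed
 qed
 then have F: "F_fresco f \<omega> = ab_sub (H_mod f) (piH ` W)" unfolding F_fresco_def H_class_eq[OF \<omega>(1)] by simp
 have L0: "LL 0 = 0" using LL_diff[of 0 0] by simp
 have i_smp: "inv7 (smp S Q)" if "inv7 Q" for S Q
  unfolding smp_def by (intro inv7_fsum inv7_cc inv7_beta_funpow that)
 have A: "abpres (F_fresco f \<omega>) W smp ((*) fp) piH"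
  unfolding F
 proof (rule abpres_sub[OF H_abpres])
  show "0 \<in> W" by (simp add: W_def inv7_0 L0 G_0)
  show "x - y \<in> W" if "x \<in> W" "y \<in> W" for x y using that by (simp add: W_def inv7_diff LL_diff G_diff)
  show "smp S x \<in> W" if "x \<in> W" for S x using that by (simp add: W_def i_smp LL_smp G_sc)
  show "fp * x \<in> W" if "x \<in> W" for x using that by (simp add: W_def inv7_fp LL_fp G_aN)
 qed simp
 have k: "LL x = LL y \<longleftrightarrow> piH x = piH y" if "x \<in> W" "y \<in> W" for x y using ker that by (auto simp: W_def)
 have im: "LL ` W = G"
 proof
  show "LL ` W \<subseteq> G" by (auto simp: W_def)
  show "G \<subseteq> LL ` W"
  proof
   fix y assume y: "y \<in> G"
   obtain u where "LL (act u P) = y" using surj[OF y] by blast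
   then show "y \<in> LL ` W" using act_inv7[OF \<omega>(2), of u] y by (intro image_eqI[where x = "act u P"]) (simp_all add: W_def)
  qed
 qed
 obtain pj' where "abpres (F_fresco f \<omega>) G sc aN pj'" "inj_on pj' G"
  by (rule abpres_transport[OF A LL_add k LL_smp LL_fp im])
 then show ?thesis using that by (simp add: nice_def)
qed

lemma fresco_results:
 assumes "has_ps \<omega> P" "inv7 P" and t: "theme2 q r p v" and "LL P = theme2.g0 q r p v"
 shows "theme (F_fresco f \<omega>)" "ab_rank (F_fresco f \<omega>) = 2" "bernstein_j (F_fresco f \<omega>) 2 = [:of_nat (Suc q), 1:]"
  "r < q ==> rsquarefree (bernstein (F_fresco f \<omega>))"
proof -
 obtain pj where n: "nice (F_fresco f \<omega>) (theme2.G q r p v) pj" using fresco_nice[OF assms] .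
 show "theme (F_fresco f \<omega>)" by (rule theme2.G_theme(1)[OF t n])
 show "ab_rank (F_fresco f \<omega>) = 2" by (rule theme2.G_theme(2)[OF t n])
 show "bernstein_j (F_fresco f \<omega>) 2 = [:of_nat (Suc q), 1:]" by (rule theme2.G_ss_filt(3)[OF t n])
 show "r < q ==> rsquarefree (bernstein (F_fresco f \<omega>))" by (rule theme2.G_rsquarefree[OF t n])
qed

end

lemma has_ps_power:
 assumes "has_ps g P"
 shows "has_ps (%p. vec_nth p 2 ^ n * g p) (cY ^ n * P)" "has_ps (%p. vec_nth p 3 ^ n * g p) (cZ ^ n * P)"
proof -
 show "has_ps (%p. vec_nth p 2 ^ n * g p) (cY ^ n * P)"
  by (induction n) (simp_all add: assms has_ps_var(2) mult.assoc)
 show "has_ps (%p. vec_nth p 3 ^ n * g p) (cZ ^ n * P)"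
  by (induction n) (simp_all add: assms has_ps_var(3) mult.assoc)
qed

theorem proposition4p0p1:
  fixes lam :: complex and f \<omega>1 \<omega>2 \<omega>3 \<omega>4 :: "complex ^ 3 \<Rightarrow> complex"
  assumes "lam \<noteq> 0"
    and "f = (\<lambda>p. let x = p $ 1; y = p $ 2; z = p $ 3 in
               x * y ^ 3 + y * z ^ 3 + z * x ^ 3 + lam * x * y * z)"
    and "\<omega>1 = (\<lambda>p. 1)"
    and "\<omega>2 = (\<lambda>p. (p $ 2) ^ 3 * (p $ 3) ^ 2)"
    and "\<omega>3 = (\<lambda>p. (p $ 2) ^ 7)"
    and "\<omega>4 = (\<lambda>p. p $ 1 * (p $ 2) ^ 3)"
  shows "(\<forall>\<omega>\<in>{\<omega>1, \<omega>2, \<omega>3, \<omega>4}. theme (F_fresco f \<omega>) \<and> ab_rank (F_fresco f \<omega>) = 2)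
    \<and> bernstein_j (F_fresco f \<omega>1) 2 = [:1, 1:]
    \<and> bernstein_j (F_fresco f \<omega>2) 2 = [:3, 1:]
    \<and> bernstein_j (F_fresco f \<omega>3) 2 = [:5, 1:]
    \<and> bernstein_j (F_fresco f \<omega>4) 2 = [:3, 1:]
    \<and> rsquarefree (bernstein (F_fresco f \<omega>3))
    \<and> rsquarefree (bernstein (F_fresco f \<omega>4))"
proof -
 interpret klein_germ lam f by unfold_locales (rule assms(1), rule assms(2))
 have p: "has_ps \<omega>1 1" "has_ps \<omega>2 (cY ^ 3 * cZ ^ 2)" "has_ps \<omega>3 (cY ^ 7)" "has_ps \<omega>4 (cX * cY ^ 3)"
  using has_ps_one has_ps_power(1)[OF has_ps_power(2)[OF has_ps_one, of 2], of 3] has_ps_power(1)[OF has_ps_one, of 7]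
   has_ps_var(1)[OF has_ps_power(1)[OF has_ps_one, of 3]] by (simp_all add: assms(3-6))
 have i: "inv7 1" "inv7 (cY ^ 3 * cZ ^ 2)" "inv7 (cY ^ 7)" "inv7 (cX * cY ^ 3)"
  using inv7_mon[of 0 0 0] inv7_mon[of 0 3 2] inv7_mon[of 0 7 0] inv7_mon[of 1 3 0] by (simp_all add: mon_def)
 \<comment> \<open>Here q = r = 0, so no information on the second component of \<open>LL 1\<close>
   enters.\<close>
 have t1: "theme2 0 0 (fst (LL 1)) (snd (LL 1))" using LL_one by (metis theme2.intro)
 obtain U2 V2 where w2: "LL (cY ^ 3 * cZ ^ 2) = (fps_X ^ 2 * U2, fps_X * V2)" "fps_nth U2 0 ~= 0" "fps_nth V2 0 ~= 0" using LL_w2 .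
 obtain U3 V3 where w3: "LL (cY ^ 7) = (fps_X ^ 4 * U3, fps_X * V3)" "fps_nth U3 0 ~= 0" "fps_nth V3 0 ~= 0" using LL_w3 .
 obtain U4 V4 where w4: "LL (cX * cY ^ 3) = (fps_X ^ 2 * U4, fps_X * V4)" "fps_nth U4 0 ~= 0" "fps_nth V4 0 ~= 0" using LL_w4 .
 have t2: "theme2 2 1 U2 V2" and t3: "theme2 4 1 U3 V3" and t4: "theme2 2 1 U4 V4" using w2 w3 w4 by (simp_all add: theme2_def)
 have l1: "LL 1 = theme2.g0 0 0 (fst (LL 1)) (snd (LL 1))" by (simp add: theme2.g0_def[OF t1])
 have l2: "LL (cY ^ 3 * cZ ^ 2) = theme2.g0 2 1 U2 V2" unfolding theme2.g0_def[OF t2] w2(1) by simp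
 have l3: "LL (cY ^ 7) = theme2.g0 4 1 U3 V3" unfolding theme2.g0_def[OF t3] w3(1) by simp
 have l4: "LL (cX * cY ^ 3) = theme2.g0 2 1 U4 V4" unfolding theme2.g0_def[OF t4] w4(1) by simp
 note r1 = fresco_results[OF p(1) i(1) t1 l1] and r2 = fresco_results[OF p(2) i(2) t2 l2]
  and r3 = fresco_results[OF p(3) i(3) t3 l3] and r4 = fresco_results[OF p(4) i(4) t4 l4]
 have q: "bernstein_j (F_fresco f \<omega>1) 2 = [:1, 1:]" "bernstein_j (F_fresco f \<omega>2) 2 = [:3, 1:]" "bernstein_j (F_fresco f \<omega>3) 2 = [:5, 1:]" "bernstein_j (F_fresco f \<omega>4) 2 = [:3, 1:]"
  using r1(3) r2(3) r3(3) r4(3) by simp_all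
 have "rsquarefree (bernstein (F_fresco f \<omega>3))" "rsquarefree (bernstein (F_fresco f \<omega>4))" by (rule r3(4), simp) (rule r4(4), simp)
 then show ?thesis using r1(1,2) r2(1,2) r3(1,2) r4(1,2) q by simp
qed

end
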